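(* Let $H$ be a weak Hopf algebra over a commutative ring $k$ with bijective antipode, which is finitely generated and projective as a $k$-module. Then the Drinfeld double $D(H)$ is a weak Hopf algebra, with comultiplication, counit and antipode given by $$\Delta[h\bowtie h^*]=[h_{(2)}\bowtie h^*_{(1)}]\otimes[h_{(1)}\bowtie h^*_{(2)}],\qquad \varepsilon[h\bowtie h^*]=\langle h^*,1_{(2)}\rangle\langle\varepsilon,h1_{(1)}\rangle,$$ $$S[h\bowtie h^*]=[S^{-1}(h_{(2)})\bowtie S(h^*_{(2)})]\,\langle h^*_{(1)},S^{-1}(h_{(3)})\rangle\langle h^*_{(3)},h_{(1)}\rangle .$$ As a weak Hopf algebra, $D(H)$ is isomorphic to $D'(H)^{\rm op}$.
   Context: $\otimes=\otimes_k$. A weak $k$-bialgebra is a $k$-module $H$ with a unital associative algebra structure and a coassociative counital coalgebra structure $(\Delta,\varepsilon)$, $\Delta(h)=h_{(1)}\otimes h_{(2)}$, such that $\Delta(hk)=\Delta(h)\Delta(k)$, $(\Delta\otimes H)\Delta(1)=1_{(1)}\otimes 1_{(2)}1_{(1')}\otimes 1_{(2')}=1_{(1)}\otimes 1_{(1')}1_{(2)}\otimes 1_{(2')}$, $\varepsilon(hkl)=\varepsilon(hk_{(1)})\varepsilon(k_{(2)}l)=\varepsilon(hk_{(2)})\varepsilon(k_{(1)}l)$. Put $\varepsilon_t(h)=\varepsilon(1_{(1)}h)1_{(2)}$, $\varepsilon_s(h)=1_{(1)}\varepsilon(h1_{(2)})$, $H_t=\mathrm{Im}(\varepsilon_t)$,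 $H_s=\mathrm{Im}(\varepsilon_s)$. A weak Hopf algebra is a weak bialgebra with a $k$-linear antipode $S$ such that $S(h_{(1)})h_{(2)}=\varepsilon_s(h)$, $h_{(1)}S(h_{(2)})=\varepsilon_t(h)$, $S(h_{(1)})h_{(2)}S(h_{(3)})=S(h)$. $H^*=\mathrm{Hom}_k(H,k)$ is a weak Hopf algebra: convolution product $\langle h^**k^*,h\rangle=\langle h^*,h_{(1)}\rangle\langle k^*,h_{(2)}\rangle$, unit $\varepsilon$, comultiplication $\langle\Delta(h^* ),h\otimes k\rangle=\langle h^*,hk\rangle$ (written $h^*_{(1)}\otimes h^*_{(2)}$), counit evaluation at $1$, antipode the transpose of $S$ (also denoted $S$). It is an $H$-bimodule by $\langle h\rightharpoonup h^*\leftharpoonup k,l\rangle=\langle h^*,klh\rangle$. $H\bowtie H^*$ is $H\otimes H^*$ with the associative multiplication $(h\bowtie h^* )(k\bowtie k^* )=hk_{(2)}\bowtie(S^{-1}(k_{(1)})\rightharpoonup h^*\leftharpoonup k_{(3)})*k^*$. The element $1\bowtie\varepsilon$ is a preunit ($ex=xe=xe^2$ for $e=1\bowtie\varepsilon$ and all $x$); with $p(x)=x(1\bowtie\varepsilon)$, the Drinfeld double is $D(H)=(H\bowtie H^* )/\mathrm{Ker}(p)$, a $k$-algebra with unit $[1\bowtie\varepsilon]$; $[\cdot]$ denotes classes. $D'(H)$ is the quotient of $H^*\otimes H$, with associative multiplication $(h^*\otimes h)(k^*\otimes k)=(h_{(3)}\rightharpoonup k^*\leftharpoonup S(h_{(1)}))*h^*\otimes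 h_{(2)}k$, by the two-sided ideal $I$ spanned by the elements $h^*\otimes zh-(\varepsilon\leftharpoonup z)*h^*\otimes h$ and $h^*\otimes yh-(y\rightharpoonup\varepsilon)*h^*\otimes h$ ($h\in H$, $h^*\in H^*$, $z\in H_t$, $y\in H_s$). It is known to be a weak Hopf algebra with unit $[\varepsilon\otimes 1]$, $\Delta[h^*\otimes h]=[h^*_{(1)}\otimes h_{(1)}]\otimes[h^*_{(2)}\otimes h_{(2)}]$, $\varepsilon[h^*\otimes h]=\langle h^*,\varepsilon_t(h)\rangle$, $S[h^*\otimes h]=[S^{-1}(h^*_{(2)})\otimes S(h_{(2)})]\langle h^*_{(1)},h_{(1)}\rangle\langle h^*_{(3)},S(h_{(3)})\rangle$. $D'(H)^{\rm op}$ has the opposite multiplication, the same coalgebra structure and the inverse antipode. *)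

theory Defs
  imports "HOL-Algebra.Module" "HOL-Algebra.QuotRing"
begin

section \<open>Linear maps and modules\<close>

definition linear_map ::
  "('a, 'r) ring_scheme \<Rightarrow> ('a, 'm, 'x) module_scheme \<Rightarrow> ('a, 'n, 'y) module_scheme \<Rightarrow> ('m \<Rightarrow> 'n) set"
  where "linear_map R M N =
    {f \<in> carrier M \<rightarrow> carrier N.
      (\<forall>x\<in>carrier M. \<forall>y\<in>carrier M. f (x \<oplus>\<^bsub>M\<^esub> y) = f x \<oplus>\<^bsub>N\<^esub> f y) \<and>
      (\<forall>a\<in>carrier R. \<forall>x\<in>carrier M. f (a \<odot>\<^bsub>M\<^esub> x) = a \<odot>\<^bsub>N\<^esub> f x)}"

definition regular_module :: "('a, 'r) ring_scheme \<Rightarrow> ('a, 'a) module"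
  where "regular_module R =
    \<lparr>carrier = carrier R, mult = mult R, one = one R, zero = zero R, add = add R, smult = mult R\<rparr>"

definition module_span :: "('a, 'r) ring_scheme \<Rightarrow> ('a, 'm, 'x) module_scheme \<Rightarrow> 'm set \<Rightarrow> 'm set"
  where "module_span R M X = \<Inter>{N. submodule N R M \<and> X \<subseteq> N}"

definition finitely_generated_module :: "('a, 'r) ring_scheme \<Rightarrow> ('a, 'm, 'x) module_scheme \<Rightarrow> bool"
  where "finitely_generated_module R M \<longleftrightarrow>
    (\<exists>X. finite X \<and> X \<subseteq> carrier M \<and> module_span R M X = carrier M)"

text \<open>
  The record type \<^typ>\<open>('a, 'm) module\<close> has multiplicative fields that are meaningless
  for a bare module; for free modules they are left undefined.  Elements are the finitely
  supported functions on \<open>X\<close>, extended by zero.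
\<close>

definition free_module :: "('a, 'r) ring_scheme \<Rightarrow> 'x set \<Rightarrow> ('a, 'x \<Rightarrow> 'a) module"
  where "free_module R X =
    \<lparr>carrier = {\<phi> \<in> X \<rightarrow> carrier R. (\<forall>x. x \<notin> X \<longrightarrow> \<phi> x = \<zero>\<^bsub>R\<^esub>) \<and> finite {x. \<phi> x \<noteq> \<zero>\<^bsub>R\<^esub>}},
     mult = undefined, one = undefined,
     zero = (\<lambda>x. \<zero>\<^bsub>R\<^esub>), add = (\<lambda>\<phi> \<psi> x. \<phi> x \<oplus>\<^bsub>R\<^esub> \<psi> x),
     smult = (\<lambda>a \<phi> x. a \<otimes>\<^bsub>R\<^esub> \<phi> x)\<rparr>"

definition free_basis :: "('a, 'r) ring_scheme \<Rightarrow> 'x \<Rightarrow> 'x \<Rightarrow> 'a"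
  where "free_basis R p = (\<lambda>x. if x = p then \<one>\<^bsub>R\<^esub> else \<zero>\<^bsub>R\<^esub>)"

text \<open>
  Projective means direct summand of a free module.  Taking the index set \<open>X\<close> in the type of
  \<open>M\<close> is no restriction: a projective module \<open>M\<close> is a summand of the free module on the set
  \<open>carrier M\<close>.
\<close>

definition projective_module :: "('a, 'r) ring_scheme \<Rightarrow> ('a, 'm, 'x) module_scheme \<Rightarrow> bool"
  where "projective_module R M \<longleftrightarrow>
    (\<exists>(X :: 'm set) i p. i \<in> linear_map R M (free_module R X) \<and>
       p \<in> linear_map R (free_module R X) M \<and> (\<forall>m\<in>carrier M. p (i m) = m))"


section \<open>Quotients\<close>

text \<open>
  The library quotient (elements are additive cosets of \<open>I\<close>), equipped with its scalar
  multiplication.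
\<close>

definition quotient_algebra :: "('a, 'm, 'x) module_scheme \<Rightarrow> 'm set \<Rightarrow> ('a, 'm set) module"
  where "quotient_algebra A I =
    \<lparr>carrier = carrier (A Quot I), mult = mult (A Quot I), one = one (A Quot I),
     zero = zero (A Quot I), add = add (A Quot I),
     smult = (\<lambda>a X. \<Union>x\<in>X. I +>\<^bsub>A\<^esub> (a \<odot>\<^bsub>A\<^esub> x))\<rparr>"

text \<open>The common value of \<open>g\<close> on a class, for \<open>g\<close> constant on classes.\<close>

definition on_class :: "('m \<Rightarrow> 'b) \<Rightarrow> 'm set \<Rightarrow> 'b"
  where "on_class g X = the_elem (g ` X)"


section \<open>Tensor products over a commutative ring\<close>

definition tensor_relations ::
  "('a, 'r) ring_scheme \<Rightarrow> ('a, 'm, 'x) module_scheme \<Rightarrow> ('a, 'n, 'y) module_scheme \<Rightarrow> ('m \<times> 'n \<Rightarrow> 'a) set"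
  where "tensor_relations R M N =
    (let F = free_module R (carrier M \<times> carrier N); e = (\<lambda>m n. free_basis R (m, n)) in
     module_span R F
       ({e (m \<oplus>\<^bsub>M\<^esub> m') n \<ominus>\<^bsub>F\<^esub> (e m n \<oplus>\<^bsub>F\<^esub> e m' n) | m m' n.
           m \<in> carrier M \<and> m' \<in> carrier M \<and> n \<in> carrier N} \<union>
        {e m (n \<oplus>\<^bsub>N\<^esub> n') \<ominus>\<^bsub>F\<^esub> (e m n \<oplus>\<^bsub>F\<^esub> e m n') | m n n'.
           m \<in> carrier M \<and> n \<in> carrier N \<and> n' \<in> carrier N} \<union>
        {e (a \<odot>\<^bsub>M\<^esub> m) n \<ominus>\<^bsub>F\<^esub> a \<odot>\<^bsub>F\<^esub> e m n | a m n.
           a \<in> carrier R \<and> m \<in> carrier M \<and> n \<in> carrier N} \<union>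
        {e m (a \<odot>\<^bsub>N\<^esub> n) \<ominus>\<^bsub>F\<^esub> a \<odot>\<^bsub>F\<^esub> e m n | a m n.
           a \<in> carrier R \<and> m \<in> carrier M \<and> n \<in> carrier N}))"

definition tensor_module ::
  "('a, 'r) ring_scheme \<Rightarrow> ('a, 'm, 'x) module_scheme \<Rightarrow> ('a, 'n, 'y) module_scheme \<Rightarrow>
   ('a, ('m \<times> 'n \<Rightarrow> 'a) set) module"
  where "tensor_module R M N =
    quotient_algebra (free_module R (carrier M \<times> carrier N)) (tensor_relations R M N)"

definition tens ::
  "('a, 'r) ring_scheme \<Rightarrow> ('a, 'm, 'x) module_scheme \<Rightarrow> ('a, 'n, 'y) module_scheme \<Rightarrow>
   'm \<Rightarrow> 'n \<Rightarrow> ('m \<times> 'n \<Rightarrow> 'a) set"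
  where "tens R M N m n =
    tensor_relations R M N +>\<^bsub>free_module R (carrier M \<times> carrier N)\<^esub> free_basis R (m, n)"

text \<open>
  For bilinear \<open>F\<close> with values in the module \<open>P\<close>: the induced linear map on the tensor product,
  sending \<open>tens R M N m n\<close> to \<open>F m n\<close>.
\<close>

definition tensor_lift ::
  "('a, 'r) ring_scheme \<Rightarrow> ('a, 'p, 'z) module_scheme \<Rightarrow>
   ('m \<times> 'n \<Rightarrow> 'a) set \<Rightarrow> ('m \<Rightarrow> 'n \<Rightarrow> 'p) \<Rightarrow> 'p"
  where "tensor_lift R P t F =
    on_class (\<lambda>\<phi>. \<Oplus>\<^bsub>P\<^esub>p\<in>{p. \<phi> p \<noteq> \<zero>\<^bsub>R\<^esub>}. \<phi> p \<odot>\<^bsub>P\<^esub> F (fst p) (snd p)) t"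

text \<open>
  If \<open>M\<close> and \<open>N\<close> are algebras, their tensor product is an algebra with the componentwise
  product; for bare modules the multiplicative fields are not used.
\<close>

definition tensor ::
  "('a, 'r) ring_scheme \<Rightarrow> ('a, 'm, 'x) module_scheme \<Rightarrow> ('a, 'n, 'y) module_scheme \<Rightarrow>
   ('a, ('m \<times> 'n \<Rightarrow> 'a) set) module"
  where "tensor R M N = (tensor_module R M N)
    \<lparr>mult := (\<lambda>s t. tensor_lift R (tensor_module R M N) s (\<lambda>m n.
                    tensor_lift R (tensor_module R M N) t (\<lambda>m' n'.
                      tens R M N (m \<otimes>\<^bsub>M\<^esub> m') (n \<otimes>\<^bsub>N\<^esub> n')))),
     one := tens R M N \<one>\<^bsub>M\<^esub> \<one>\<^bsub>N\<^esub>\<rparr>"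


section \<open>Weak bialgebras and weak Hopf algebras\<close>

record ('a, 'h) bialg = "('a, 'h) module" +
  comult :: "'h \<Rightarrow> ('h \<times> 'h \<Rightarrow> 'a) set"
  counit :: "'h \<Rightarrow> 'a"

record ('a, 'h) hopf = "('a, 'h) bialg" +
  antipode :: "'h \<Rightarrow> 'h"

text \<open>
  \<open>sweedler R H P h (\<lambda>h1 h2. F h1 h2)\<close> is the Sweedler sum of \<open>F\<close> over the comultiplication
  of \<open>h\<close>, and \<open>sweedler3\<close> the one over the iterated comultiplication, both with values in \<open>P\<close>.
\<close>

definition sweedler ::
  "('a, 'r) ring_scheme \<Rightarrow> ('a, 'h, 'x) bialg_scheme \<Rightarrow> ('a, 'p, 'z) module_scheme \<Rightarrow>
   'h \<Rightarrow> ('h \<Rightarrow> 'h \<Rightarrow> 'p) \<Rightarrow> 'p"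
  where "sweedler R H P h F = tensor_lift R P (comult H h) F"

definition sweedler3 ::
  "('a, 'r) ring_scheme \<Rightarrow> ('a, 'h, 'x) bialg_scheme \<Rightarrow> ('a, 'p, 'z) module_scheme \<Rightarrow>
   'h \<Rightarrow> ('h \<Rightarrow> 'h \<Rightarrow> 'h \<Rightarrow> 'p) \<Rightarrow> 'p"
  where "sweedler3 R H P h F = sweedler R H P h (\<lambda>x c. sweedler R H P x (\<lambda>a b. F a b c))"

locale unital_algebra = module + ring M +
  assumes smult_mult_left:
      "\<lbrakk>a \<in> carrier R; x \<in> carrier M; y \<in> carrier M\<rbrakk> \<Longrightarrow>
        (a \<odot>\<^bsub>M\<^esub> x) \<otimes>\<^bsub>M\<^esub> y = a \<odot>\<^bsub>M\<^esub> (x \<otimes>\<^bsub>M\<^esub> y)"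
    and smult_mult_right:
      "\<lbrakk>a \<in> carrier R; x \<in> carrier M; y \<in> carrier M\<rbrakk> \<Longrightarrow>
        x \<otimes>\<^bsub>M\<^esub> (a \<odot>\<^bsub>M\<^esub> y) = a \<odot>\<^bsub>M\<^esub> (x \<otimes>\<^bsub>M\<^esub> y)"

text \<open>The triple tensor product is bracketed to the right.\<close>

abbreviation tensor3 where "tensor3 R H \<equiv> tensor R H (tensor R H H)"
abbreviation tens3 where "tens3 R H a b c \<equiv> tens R H (tensor R H H) a (tens R H H b c)"

locale coalgebra = module R H
  for R :: "('a, 'r) ring_scheme" (structure) and H :: "('a, 'h, 'x) bialg_scheme" (structure) +
  assumes comult_linear: "comult H \<in> linear_map R H (tensor R H H)"
    and counit_linear: "counit H \<in> linear_map R H (regular_module R)"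
    and coassociative: "h \<in> carrier H \<Longrightarrow>
      sweedler3 R H (tensor3 R H) h (\<lambda>h1 h2 h3. tens3 R H h1 h2 h3) =
      sweedler R H (tensor3 R H) h (\<lambda>h1 h2. tens R H (tensor R H H) h1 (comult H h2))"
    and counit_left: "h \<in> carrier H \<Longrightarrow> sweedler R H H h (\<lambda>h1 h2. counit H h1 \<odot>\<^bsub>H\<^esub> h2) = h"
    and counit_right: "h \<in> carrier H \<Longrightarrow> sweedler R H H h (\<lambda>h1 h2. counit H h2 \<odot>\<^bsub>H\<^esub> h1) = h"

locale weak_bialgebra = unital_algebra R H + coalgebra R H
  for R :: "('a, 'r) ring_scheme" (structure) and H :: "('a, 'h, 'x) bialg_scheme" (structure) +
  assumes comult_mult: "\<lbrakk>h \<in> carrier H; k \<in> carrier H\<rbrakk> \<Longrightarrow>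
      comult H (h \<otimes>\<^bsub>H\<^esub> k) = comult H h \<otimes>\<^bsub>tensor R H H\<^esub> comult H k"
    and comult_one:
      "sweedler3 R H (tensor3 R H) \<one>\<^bsub>H\<^esub> (\<lambda>a b c. tens3 R H a b c) =
       sweedler R H (tensor3 R H) \<one>\<^bsub>H\<^esub> (\<lambda>a b.
         sweedler R H (tensor3 R H) \<one>\<^bsub>H\<^esub> (\<lambda>a' b'. tens3 R H a (b \<otimes>\<^bsub>H\<^esub> a') b'))"
      "sweedler3 R H (tensor3 R H) \<one>\<^bsub>H\<^esub> (\<lambda>a b c. tens3 R H a b c) =
       sweedler R H (tensor3 R H) \<one>\<^bsub>H\<^esub> (\<lambda>a b.
         sweedler R H (tensor3 R H) \<one>\<^bsub>H\<^esub> (\<lambda>a' b'. tens3 R H a (a' \<otimes>\<^bsub>H\<^esub> b) b'))"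
    and counit_mult:
      "\<lbrakk>h \<in> carrier H; k \<in> carrier H; l \<in> carrier H\<rbrakk> \<Longrightarrow>
       counit H (h \<otimes>\<^bsub>H\<^esub> k \<otimes>\<^bsub>H\<^esub> l) =
       sweedler R H (regular_module R) k (\<lambda>k1 k2. counit H (h \<otimes>\<^bsub>H\<^esub> k1) \<otimes>\<^bsub>R\<^esub> counit H (k2 \<otimes>\<^bsub>H\<^esub> l))"
      "\<lbrakk>h \<in> carrier H; k \<in> carrier H; l \<in> carrier H\<rbrakk> \<Longrightarrow>
       counit H (h \<otimes>\<^bsub>H\<^esub> k \<otimes>\<^bsub>H\<^esub> l) =
       sweedler R H (regular_module R) k (\<lambda>k1 k2. counit H (h \<otimes>\<^bsub>H\<^esub> k2) \<otimes>\<^bsub>R\<^esub> counit H (k1 \<otimes>\<^bsub>H\<^esub> l))"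

definition target_counit :: "('a, 'r) ring_scheme \<Rightarrow> ('a, 'h, 'x) bialg_scheme \<Rightarrow> 'h \<Rightarrow> 'h"
  where "target_counit R H h =
    sweedler R H H \<one>\<^bsub>H\<^esub> (\<lambda>a b. counit H (a \<otimes>\<^bsub>H\<^esub> h) \<odot>\<^bsub>H\<^esub> b)"

definition source_counit :: "('a, 'r) ring_scheme \<Rightarrow> ('a, 'h, 'x) bialg_scheme \<Rightarrow> 'h \<Rightarrow> 'h"
  where "source_counit R H h =
    sweedler R H H \<one>\<^bsub>H\<^esub> (\<lambda>a b. counit H (h \<otimes>\<^bsub>H\<^esub> b) \<odot>\<^bsub>H\<^esub> a)"

locale weak_hopf_algebra = weak_bialgebra R H
  for R :: "('a, 'r) ring_scheme" (structure) and H :: "('a, 'h, 'x) hopf_scheme" (structure) +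
  assumes antipode_linear: "antipode H \<in> linear_map R H H"
    and antipode_source: "h \<in> carrier H \<Longrightarrow>
      sweedler R H H h (\<lambda>h1 h2. antipode H h1 \<otimes>\<^bsub>H\<^esub> h2) = source_counit R H h"
    and antipode_target: "h \<in> carrier H \<Longrightarrow>
      sweedler R H H h (\<lambda>h1 h2. h1 \<otimes>\<^bsub>H\<^esub> antipode H h2) = target_counit R H h"
    and antipode_antipode: "h \<in> carrier H \<Longrightarrow>
      sweedler3 R H H h (\<lambda>h1 h2 h3. antipode H h1 \<otimes>\<^bsub>H\<^esub> h2 \<otimes>\<^bsub>H\<^esub> antipode H h3) = antipode H h"

abbreviation antipode_inv :: "('a, 'h, 'x) hopf_scheme \<Rightarrow> 'h \<Rightarrow> 'h"
  where "antipode_inv H \<equiv> inv_into (carrier H) (antipode H)"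

text \<open>Opposite multiplication, same coalgebra, inverse antipode.\<close>

definition hopf_op :: "('a, 'h, 'x) hopf_scheme \<Rightarrow> ('a, 'h, 'x) hopf_scheme"
  where "hopf_op H = H\<lparr>mult := (\<lambda>x y. y \<otimes>\<^bsub>H\<^esub> x), antipode := antipode_inv H\<rparr>"

definition weak_hopf_iso ::
  "('a, 'r) ring_scheme \<Rightarrow> ('a, 'h, 'x) hopf_scheme \<Rightarrow> ('a, 'l, 'y) hopf_scheme \<Rightarrow> ('h \<Rightarrow> 'l) set"
  where "weak_hopf_iso R H L =
    {\<phi> \<in> ring_iso H L \<inter> linear_map R H L.
      weak_hopf_algebra R H \<and> weak_hopf_algebra R L \<and>
      (\<forall>h\<in>carrier H. comult L (\<phi> h) =
         sweedler R H (tensor R L L) h (\<lambda>h1 h2. tens R L L (\<phi> h1) (\<phi> h2))) \<and>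
      (\<forall>h\<in>carrier H. counit L (\<phi> h) = counit H h) \<and>
      (\<forall>h\<in>carrier H. antipode L (\<phi> h) = \<phi> (antipode H h))}"


section \<open>The dual\<close>

text \<open>
  The comultiplication of \<open>f\<close> is the tensor whose pairing with \<open>h\<close> and \<open>k\<close> is \<open>f (h k)\<close>; it
  exists uniquely when \<open>H\<close> is finitely generated projective.
\<close>

definition dual :: "('a, 'r) ring_scheme \<Rightarrow> ('a, 'h, 'x) hopf_scheme \<Rightarrow> ('a, 'h \<Rightarrow> 'a) hopf"
  where "dual R H =
    (let B = \<lparr>carrier = linear_map R H (regular_module R) \<inter> extensional (carrier H),
              mult = (\<lambda>f g. \<lambda>h\<in>carrier H. sweedler R H (regular_module R) h (\<lambda>h1 h2. f h1 \<otimes>\<^bsub>R\<^esub> g h2)),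
              one = restrict (counit H) (carrier H),
              zero = (\<lambda>h\<in>carrier H. \<zero>\<^bsub>R\<^esub>),
              add = (\<lambda>f g. \<lambda>h\<in>carrier H. f h \<oplus>\<^bsub>R\<^esub> g h),
              smult = (\<lambda>a f. \<lambda>h\<in>carrier H. a \<otimes>\<^bsub>R\<^esub> f h)\<rparr>
     in module.extend B \<lparr>
       comult = (\<lambda>f. THE t. t \<in> carrier (tensor R B B) \<and>
         (\<forall>h\<in>carrier H. \<forall>k\<in>carrier H.
            tensor_lift R (regular_module R) t (\<lambda>f1 f2. f1 h \<otimes>\<^bsub>R\<^esub> f2 k) = f (h \<otimes>\<^bsub>H\<^esub> k))),
       counit = (\<lambda>f. f \<one>\<^bsub>H\<^esub>),
       antipode = (\<lambda>f. \<lambda>h\<in>carrier H. f (antipode H h))\<rparr>)"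

definition act_left :: "('a, 'h, 'x) hopf_scheme \<Rightarrow> 'h \<Rightarrow> ('h \<Rightarrow> 'a) \<Rightarrow> ('h \<Rightarrow> 'a)"
  where "act_left H h f = (\<lambda>l\<in>carrier H. f (l \<otimes>\<^bsub>H\<^esub> h))"

definition act_right :: "('a, 'h, 'x) hopf_scheme \<Rightarrow> ('h \<Rightarrow> 'a) \<Rightarrow> 'h \<Rightarrow> ('h \<Rightarrow> 'a)"
  where "act_right H f k = (\<lambda>l\<in>carrier H. f (k \<otimes>\<^bsub>H\<^esub> l))"


section \<open>The Drinfeld double\<close>

text \<open>\<open>H \<bowtie> H\<^sup>*\<close>; the unit slot of the record holds the preunit, which need not be a unit.\<close>

definition double_product ::
  "('a, 'r) ring_scheme \<Rightarrow> ('a, 'h, 'x) hopf_scheme \<Rightarrow> ('a, ('h \<times> ('h \<Rightarrow> 'a) \<Rightarrow> 'a) set) module"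
  where "double_product R H =
    (let Hs = dual R H; T = tensor R H Hs in
     T\<lparr>mult := (\<lambda>x y.
         tensor_lift R T x (\<lambda>h f. tensor_lift R T y (\<lambda>k g.
           sweedler3 R H T k (\<lambda>k1 k2 k3.
             tens R H Hs (h \<otimes>\<^bsub>H\<^esub> k2)
               (act_right H (act_left H (antipode_inv H k1) f) k3 \<otimes>\<^bsub>Hs\<^esub> g))))),
       one := tens R H Hs \<one>\<^bsub>H\<^esub> \<one>\<^bsub>Hs\<^esub>\<rparr>)"

definition double_kernel ::
  "('a, 'r) ring_scheme \<Rightarrow> ('a, 'h, 'x) hopf_scheme \<Rightarrow> ('h \<times> ('h \<Rightarrow> 'a) \<Rightarrow> 'a) set set"
  where "double_kernel R H =
    a_kernel (double_product R H) (double_product R H)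
      (\<lambda>x. x \<otimes>\<^bsub>double_product R H\<^esub> \<one>\<^bsub>double_product R H\<^esub>)"

definition drinfeld_double ::
  "('a, 'r) ring_scheme \<Rightarrow> ('a, 'h, 'x) hopf_scheme \<Rightarrow> ('a, ('h \<times> ('h \<Rightarrow> 'a) \<Rightarrow> 'a) set set) module"
  where "drinfeld_double R H = quotient_algebra (double_product R H) (double_kernel R H)"

definition double_class ::
  "('a, 'r) ring_scheme \<Rightarrow> ('a, 'h, 'x) hopf_scheme \<Rightarrow> 'h \<Rightarrow> ('h \<Rightarrow> 'a) \<Rightarrow> ('h \<times> ('h \<Rightarrow> 'a) \<Rightarrow> 'a) set set"
  where "double_class R H h f =
    double_kernel R H +>\<^bsub>double_product R H\<^esub> tens R H (dual R H) h f"


section \<open>The double as a quotient of \<open>H\<^sup>* \<otimes> H\<close>\<close>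

text \<open>Again the unit slot need not hold a unit before passing to the quotient.\<close>

definition double'_product ::
  "('a, 'r) ring_scheme \<Rightarrow> ('a, 'h, 'x) hopf_scheme \<Rightarrow> ('a, (('h \<Rightarrow> 'a) \<times> 'h \<Rightarrow> 'a) set) module"
  where "double'_product R H =
    (let Hs = dual R H; T = tensor R Hs H in
     T\<lparr>mult := (\<lambda>x y.
         tensor_lift R T x (\<lambda>f h. tensor_lift R T y (\<lambda>g k.
           sweedler3 R H T h (\<lambda>h1 h2 h3.
             tens R Hs H
               (act_right H (act_left H h3 g) (antipode H h1) \<otimes>\<^bsub>Hs\<^esub> f) (h2 \<otimes>\<^bsub>H\<^esub> k))))),
       one := tens R Hs H \<one>\<^bsub>Hs\<^esub> \<one>\<^bsub>H\<^esub>\<rparr>)"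

definition double'_ideal ::
  "('a, 'r) ring_scheme \<Rightarrow> ('a, 'h, 'x) hopf_scheme \<Rightarrow> (('h \<Rightarrow> 'a) \<times> 'h \<Rightarrow> 'a) set set"
  where "double'_ideal R H =
    (let Hs = dual R H; A = double'_product R H in
     module_span R A
       ({tens R Hs H f (z \<otimes>\<^bsub>H\<^esub> h) \<ominus>\<^bsub>A\<^esub> tens R Hs H (act_right H \<one>\<^bsub>Hs\<^esub> z \<otimes>\<^bsub>Hs\<^esub> f) h | f h z.
           f \<in> carrier Hs \<and> h \<in> carrier H \<and> z \<in> target_counit R H ` carrier H} \<union>
        {tens R Hs H f (y \<otimes>\<^bsub>H\<^esub> h) \<ominus>\<^bsub>A\<^esub> tens R Hs H (act_left H y \<one>\<^bsub>Hs\<^esub> \<otimes>\<^bsub>Hs\<^esub> f) h | f h y.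
           f \<in> carrier Hs \<and> h \<in> carrier H \<and> y \<in> source_counit R H ` carrier H}))"

definition double'_class ::
  "('a, 'r) ring_scheme \<Rightarrow> ('a, 'h, 'x) hopf_scheme \<Rightarrow> ('h \<Rightarrow> 'a) \<Rightarrow> 'h \<Rightarrow> (('h \<Rightarrow> 'a) \<times> 'h \<Rightarrow> 'a) set set"
  where "double'_class R H f h =
    double'_ideal R H +>\<^bsub>double'_product R H\<^esub> tens R (dual R H) H f h"

definition drinfeld_double' ::
  "('a, 'r) ring_scheme \<Rightarrow> ('a, 'h, 'x) hopf_scheme \<Rightarrow> ('a, (('h \<Rightarrow> 'a) \<times> 'h \<Rightarrow> 'a) set set) hopf"
  where "drinfeld_double' R H =
    (let Hs = dual R H; D = quotient_algebra (double'_product R H) (double'_ideal R H);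
         cls = double'_class R H; k = regular_module R
     in module.extend D \<lparr>
       comult = on_class (\<lambda>t. tensor_lift R (tensor R D D) t (\<lambda>f h.
         sweedler R Hs (tensor R D D) f (\<lambda>f1 f2.
           sweedler R H (tensor R D D) h (\<lambda>h1 h2. tens R D D (cls f1 h1) (cls f2 h2))))),
       counit = on_class (\<lambda>t. tensor_lift R k t (\<lambda>f h. f (target_counit R H h))),
       antipode = on_class (\<lambda>t. tensor_lift R D t (\<lambda>f h.
         sweedler3 R Hs D f (\<lambda>f1 f2 f3. sweedler3 R H D h (\<lambda>h1 h2 h3.
           (f1 h1 \<otimes>\<^bsub>R\<^esub> f3 (antipode H h3)) \<odot>\<^bsub>D\<^esub> cls (antipode_inv Hs f2) (antipode H h2)))))\<rparr>)"

end

(*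
Functionals on the double correspond to endomorphisms t of H with t(zh) = z t(h) for z in H_t
and t(yh) = t(h) S(y) for y in H_s, through [f, h] |-> f(t(h)). Since H is finitely generated
projective, so is the double, and its functionals separate points of all tensor powers. Each axiom
of a weak Hopf algebra for the double thereby becomes an identity between scalar Sweedler sums in H.
The ideal I consists of the x with [eps (x) 1] x = 0, and h |><| f |-> f (x) S^-1(h) is an
anti-homomorphism carrying Ker(p) onto I. Hence D(H) is D'(H)^op as an algebra, and the coalgebra
structure and the antipode are transported.
*)
theory Submission
 imports Defs
begin

text \<open>The obstacle is that projectivity does not pass to quotients by itself, so at first no
  functionals are known to separate classes. It is overcome by the preunit u = \<epsilon> \<otimes>
  1: in the product on H^* \<otimes> H one has x i = 0 for i in I, while u x and x have the same
  class. Left multiplication by u is therefore an idempotent linear map with kernel I. It splits the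
  projection, yields a dual basis of the quotient, and describes I as an annihilator, which is the
  form in which Ker(p) is given. The equality of the classes of u x and x has to be proved with
  values in the quotient itself, not in scalars. To treat both doubles alike, the weak Hopf axioms
  are deduced from a list of values of functionals on classes; what is transported to D(H) is this
  list, not the axioms one by one.\<close>

text \<open>
  Besides ASCII forms and subscripted structure arguments (\<open>\<otimes>\<^sub>H\<close>), this notation writes a
  Sweedler sum \<open>\<Sum> F h\<^sub>1 h\<^sub>2\<close> of a scalar form \<open>F\<close> as \<open>h$.a b. F a b\<close>, and the
  threefold sum \<open>\<Sum> F h\<^sub>1 h\<^sub>2 h\<^sub>3\<close> as \<open>h$$.a b c. F a b c\<close>.
\<close>

abbreviation (input) iff_ascii (infixr "<->" 25) where "P <-> Q == (P = Q)"
syntax (input) "_lam2" :: "[pttrn, pttrn, 'a] => 'b" ("._ _./ _" [0, 0, 52] 1000)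
syntax (input) "_lam3" :: "[pttrn, pttrn, pttrn, 'a] => 'b" ("._ _ _./ _" [0, 0, 0, 52] 1000)
translations "_lam2 a b t" => "%a b. t"
translations "_lam3 a b c t" => "%a b c. t"
syntax (input) "_index" :: "logic => index" ("\<^sub>_" [1000] 1000)
abbreviation (input) Lin where "Lin == linear_map"
abbreviation (input) mem_carrier (infix ":." 50) where "x:.M == x : carrier M"

section \<open>Linear algebra over a commutative ring: maps, quotients, tensor products, dual
  bases\<close>

section \<open>Linear and bilinear maps\<close>

lemma (in abelian_group) minus_eq_zero_iff: assumes "x:.G" "y:.G"
 shows "x \<ominus> y = \<zero> <-> x = y"
proof
 assume "x \<ominus> y = \<zero>"
 then have "(x \<ominus> y) \<oplus> y = y" using assms by simp
 then show "x = y" using assms by (simp add: a_minus_def a_assoc l_neg)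
qed (use assms in \<open>simp add: a_minus_def r_neg\<close>)

lemma lmI: assumes "!!x. x:.M ==> f x:.N"
  and "!!x y. [|x:.M; y:.M|] ==> f (x \<oplus>\<^sub>M y) = f x \<oplus>\<^sub>N f y"
  and "!!a x. [|a:.R; x:.M|] ==> f (a \<odot>\<^sub>M x) = a \<odot>\<^sub>N f x" shows "f : Lin R M N"
 using assms unfolding linear_map_def by simp

lemma lmD: assumes "f : Lin R M N" shows "!!x. x:.M ==> f x:.N"
  and "!!x y. [|x:.M; y:.M|] ==> f (x \<oplus>\<^sub>M y) = f x \<oplus>\<^sub>N f y"
  and "!!a x. [|a:.R; x:.M|] ==> f (a \<odot>\<^sub>M x) = a \<odot>\<^sub>N f x"
 using assms unfolding linear_map_def by auto

lemma lm_cong: assumes "module R M" "!!x. x:.M ==> f x = g x"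
 shows "f : Lin R M N <-> g : Lin R M N"
proof -
 interpret M: module R M by fact
 have "f : carrier M \<rightarrow> carrier N <-> g : carrier M \<rightarrow> carrier N"
  using assms(2) by (auto simp: Pi_def)
 then show ?thesis unfolding linear_map_def using assms(2) by auto
qed

lemma lm_comp: assumes "f : Lin R M N" "g : Lin R N P" shows "(%x. g (f x)) : Lin R M P"
 by (rule lmI) (simp_all add: lmD[OF assms(1)] lmD[OF assms(2)])

lemma lm_id: "(%x. x) : Lin R M M" by (rule lmI) (assumption | rule refl)+

lemma regular_module_sel [simp]: "carrier (regular_module R) = carrier R" "add (regular_module R) = add R"
 "smult (regular_module R) = mult R" "zero (regular_module R) = zero R" by (auto simp: regular_module_def)

lemma finsum_regular_module: "finsum (regular_module R) = finsum R"
 by (intro ext) (simp add: finsum_def finprod_def regular_module_def)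

lemma (in cring) regular_module: "module R (regular_module R)"
proof (rule moduleI)
 show "abelian_group (regular_module R)" by (rule abelian_groupI) (auto simp: a_assoc intro: add.l_inv_ex a_comm)
qed (auto simp: is_cring l_distr r_distr m_assoc)

lemma lm_zero: assumes "module R M" "module R N" "f : Lin R M N" shows "f \<zero>\<^sub>M = \<zero>\<^sub>N"
proof -
 interpret M: module R M by fact
 interpret N: module R N by fact
 have "f \<zero>\<^sub>M = f (\<zero>\<^sub>R \<odot>\<^sub>M \<zero>\<^sub>M)" by simp
 also have "... = \<zero>\<^sub>R \<odot>\<^sub>N f \<zero>\<^sub>M" by (rule lmD(3)[OF assms(3)]) auto
 also have "... = \<zero>\<^sub>N" using lmD(1)[OF assms(3)] by auto
 finally show ?thesis .
qed

lemma linear_map_neg: assumes "module R M" "module R N" "f : Lin R M N" "x:.M"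
 shows "f (\<ominus>\<^sub>M x) = \<ominus>\<^sub>N f x"
proof -
 interpret M: module R M by fact
 interpret N: module R N by fact
 have "f (\<ominus>\<^sub>M x) \<oplus>\<^sub>N f x = \<zero>\<^sub>N"
  using lmD(2)[OF assms(3), symmetric] assms(4) lm_zero[OF assms(1-3)] by (simp add: M.M.l_neg)
 then show ?thesis using lmD(1)[OF assms(3)] assms(4) by (metis M.M.a_inv_closed N.M.minus_equality)
qed

lemma linear_map_minus: assumes "module R M" "module R N" "f : Lin R M N" "x:.M" "y:.M"
 shows "f (x \<ominus>\<^sub>M y) = f x \<ominus>\<^sub>N f y"
proof -
 interpret M: module R M by fact
 show ?thesis using assms lmD(2)[OF assms(3)] linear_map_neg[OF assms(1-3)] by (simp add: a_minus_def)
qed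

lemma lm_sum: assumes "module R M" "module R N" "f : Lin R M N" "finite I" "!!i. i \<in> I ==> g i:.M"
 shows "f (finsum M g I) = finsum N (%i. f (g i)) I"
proof -
 interpret M: module R M by fact
 interpret N: module R N by fact
 show ?thesis using assms(4,5)
 proof (induction I rule: finite_induct)
  case empty then show ?case using lm_zero[OF assms(1-3)] by simp
 next
  case (insert x F)
  have c: "g \<in> F \<rightarrow> carrier M" "g x:.M" using insert by auto
  have c': "(%i. f (g i)) \<in> F \<rightarrow> carrier N" "f (g x):.N" using c lmD(1)[OF assms(3)] by auto
  show ?case using insert c c' lmD(2)[OF assms(3)] by simp
 qed
qed

lemma lm_add: assumes "module R M" "module R N" "f : Lin R M N" "g : Lin R M N"
 shows "(%x. f x \<oplus>\<^sub>N g x) : Lin R M N"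
proof -
 interpret M: module R M by fact
 interpret N: module R N by fact
 note D = lmD[OF assms(3)] lmD[OF assms(4)]
 show ?thesis by (rule lmI) (simp_all add: D N.smult_r_distr N.M.a_assoc N.M.a_comm N.M.a_lcomm)
qed

lemma lm_smult: assumes "module R M" "module R N" "f : Lin R M N" "a:.R"
 shows "(%x. a \<odot>\<^sub>N f x) : Lin R M N"
proof -
 interpret M: module R M by fact
 interpret N: module R N by fact
 note D = lmD[OF assms(3)]
 show ?thesis using assms(4) by (intro lmI) (simp_all add: D N.smult_r_distr N.smult_assoc1[symmetric] M.R.m_comm)
qed

lemma lm_const_smult: assumes "module R M" "module R N" "f : Lin R M (regular_module R)" "x:.N"
 shows "(%m. f m \<odot>\<^sub>N x) : Lin R M N"
proof -
 interpret M: module R M by fact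
 interpret N: module R N by fact
 note D = lmD[OF assms(3), simplified]
 show ?thesis using assms(4) by (intro lmI) (simp_all add: D N.smult_l_distr N.smult_assoc1)
qed

lemma linear_map_finsum_fun: assumes "module R M" "module R N" "finite I" "!!i. i \<in> I ==> f i : Lin R M N"
 shows "(%x. finsum N (%i. f i x) I) : Lin R M N"
proof -
 interpret M: module R M by fact
 interpret N: module R N by fact
 show ?thesis using assms(3,4)
 proof (induction I rule: finite_induct)
  case empty then show ?case by (simp add: lmI)
 next
  case (insert i F)
  then have "(%x. f i x \<oplus>\<^sub>N finsum N (%i. f i x) F) : Lin R M N" by (intro lm_add assms(1,2)) auto
  moreover have "finsum N (%i. f i x) (insert i F) = f i x \<oplus>\<^sub>N finsum N (%i. f i x) F"
   if "x:.M" for x using insert that lmD(1)[of "f _" R M N] by (subst N.M.finsum_insert) auto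
  ultimately show ?case by (subst lm_cong[OF assms(1)]) auto
 qed
qed

lemma restrict_linear_map: assumes "module R M"
 shows "restrict f (carrier M) : Lin R M N <-> f : Lin R M N" by (rule lm_cong[OF assms]) auto

definition bilinear :: "('a, 'r) ring_scheme => ('a, 'm, 'x) module_scheme => ('a, 'n, 'y) module_scheme =>
 ('a, 'p, 'z) module_scheme => ('m => 'n => 'p) => bool" where "bilinear R M N P F \<longleftrightarrow>
  (\<forall>m\<in>carrier M. (%n. F m n) : Lin R N P) \<and> (\<forall>n\<in>carrier N. (%m. F m n) : Lin R M P)"

lemma bilI: assumes "!!m. m:.M ==> (%n. F m n) : Lin R N P" and "!!n. n:.N ==> (%m. F m n) : Lin R M P"
 shows "bilinear R M N P F" using assms unfolding bilinear_def by auto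

lemma bilD: assumes "bilinear R M N P F" shows "!!m. m:.M ==> (%n. F m n) : Lin R N P"
  and "!!n. n:.N ==> (%m. F m n) : Lin R M P" and "!!m n. [|m:.M; n:.N|] ==> F m n:.P"
 using assms unfolding bilinear_def linear_map_def by auto

lemma bilinear_cong: assumes "module R M" "module R N" "!!m n. [|m:.M; n:.N|] ==> F m n = G m n"
 shows "bilinear R M N P F <-> bilinear R M N P G"
proof -
 have "(%n. F m n) : Lin R N P <-> (%n. G m n) : Lin R N P" if "m:.M" for m
  by (rule lm_cong[OF assms(2)]) (use assms(3) that in auto)
 moreover have "(%m. F m n) : Lin R M P <-> (%m. G m n) : Lin R M P" if "n:.N" for n
  by (rule lm_cong[OF assms(1)]) (use assms(3) that in auto)
 ultimately show ?thesis unfolding bilinear_def by auto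
qed

section \<open>Quotient modules\<close>

lemma module_span_submodule: assumes "module R M" "X \<subseteq> carrier M" shows "submodule (module_span R M X) R M"
proof -
 interpret M: module R M by fact
 have c: "submodule (carrier M) R M" by (rule M.carrier_is_submodule)
 note E = M.submoduleE
 show ?thesis
 proof (rule M.submoduleI)
  show "module_span R M X \<subseteq> carrier M" using c assms(2) by (auto simp: module_span_def)
  show "\<zero>\<^sub>M \<in> module_span R M X"
   by (auto simp: module_span_def dest!: submodule.axioms(1) subgroup.one_closed)
 qed (auto simp: module_span_def E)
qed

lemma module_span_incl: "X \<subseteq> module_span R M X" by (auto simp: module_span_def)

lemma module_span_least: assumes "submodule N R M" "X \<subseteq> N" shows "module_span R M X \<subseteq> N"
 using assms by (auto simp: module_span_def)

lemma linear_map_kernel_submodule: assumes "module R M" "module R N" "f : Lin R M N"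
 shows "submodule {x \<in> carrier M. f x = \<zero>\<^sub>N} R M"
proof -
 interpret M: module R M by fact
 interpret N: module R N by fact
 show ?thesis by (rule M.submoduleI) (auto simp: lmD[OF assms(3)] lm_zero[OF assms] linear_map_neg[OF assms])
qed

lemma linear_map_span_zero: assumes "module R M" "module R N" "f : Lin R M N" "X \<subseteq> carrier M"
  and "!!x. x \<in> X ==> f x = \<zero>\<^sub>N" and "x \<in> module_span R M X" shows "f x = \<zero>\<^sub>N"
 using module_span_least[OF linear_map_kernel_submodule[OF assms(1-3)], of X] assms(4-6) by auto

lemma linear_map_eq_on_span:
 assumes "module R M" "module R N" "f : Lin R M N" "g : Lin R M N" "X \<subseteq> carrier M"
  and "!!x. x \<in> X ==> f x = g x" and "x \<in> module_span R M X" shows "f x = g x"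
proof -
 interpret M: module R M by fact
 interpret N: module R N by fact
 have "submodule {x \<in> carrier M. f x = g x} R M" by (rule M.submoduleI)
   (auto simp: lmD[OF assms(3)] lm_zero[OF assms(1-3)] linear_map_neg[OF assms(1-3)]
    lmD[OF assms(4)] lm_zero[OF assms(1,2,4)] linear_map_neg[OF assms(1,2,4)])
 then show ?thesis using module_span_least[of "{x \<in> carrier M. f x = g x}" R M X] assms(5-7) by auto
qed

locale quotient_by = module R A for R :: "('a, 'r) ring_scheme" (structure) and A :: "('a, 'm, 'x) module_scheme" +
 fixes I assumes sub: "submodule I R A"
begin

abbreviation "Q \<equiv> quotient_algebra A I"
abbreviation cls where "cls x \<equiv> I +>\<^sub>A x"

lemma I_subset: "I \<subseteq> carrier A" using submoduleE(1)[OF sub] .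

lemma abelian_subgroup: "abelian_subgroup I A" using submodule.axioms(1)[OF sub]
 by (intro abelian_subgroupI3 additive_subgroupI) (auto simp: M.abelian_group_axioms)

lemmas a_rcos_sum = abelian_subgroup.a_rcos_sum[OF abelian_subgroup]
lemmas a_rcos_module = abelian_subgroup.a_rcos_module[OF abelian_subgroup]
lemmas a_elemrcos_carrier = abelian_subgroup.a_elemrcos_carrier[OF abelian_subgroup]
lemmas a_rcos_self = abelian_subgroup.a_rcos_self[OF abelian_subgroup]
lemmas a_subgroup_in_rcosets = abelian_subgroup.a_subgroup_in_rcosets[OF abelian_subgroup]
lemmas a_repr_independence' = abelian_subgroup.a_repr_independence'[OF abelian_subgroup]

lemma quotient_sel: "carrier Q = a_rcosets\<^bsub>A\<^esub> I" "add Q = set_add A" "zero Q = I"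
 "mult Q = rcoset_mult A I" "one Q = cls \<one>\<^sub>A" by (simp_all add: quotient_algebra_def FactRing_def)

lemma cls_closed: "x:.A ==> cls x:.Q" by (simp add: quotient_sel M.a_rcosetsI[OF I_subset])

lemma quotient_cases: "X:.Q ==> \<exists>x\<in>carrier A. X = cls x" by (auto simp: quotient_sel A_RCOSETS_def')

lemma cls_add: "[|x:.A; y:.A|] ==> cls (x \<oplus>\<^sub>A y) = cls x \<oplus>\<^sub>Q cls y"
 by (simp add: quotient_sel a_rcos_sum)

lemma cls_eq_iff: "[|x:.A; y:.A|] ==> cls x = cls y <-> x \<ominus>\<^sub>A y \<in> I"
 using a_rcos_module[of y x] a_rcos_self[of x] a_repr_independence'[of x y] unfolding a_minus_def by auto

lemma mem_cls: "x:.A ==> y \<in> cls x <-> y:.A \<and> y \<ominus>\<^sub>A x \<in> I"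
 using a_rcos_module[of x y] a_elemrcos_carrier[of x y] unfolding a_minus_def by auto

text \<open>Two representatives differ by an element of \<open>I\<close>, which is stable under
  scalars, so each of them contributes the same coset to the union that defines the scalar
  multiple.\<close>

lemma cls_smult: assumes "a:.R" "x:.A" shows "cls (a \<odot>\<^sub>A x) = a \<odot>\<^sub>Q cls x"
proof -
 have eq: "cls (a \<odot>\<^sub>A y) = cls (a \<odot>\<^sub>A x)" if "y \<in> cls x" for y
 proof -
  have y: "y:.A" "y \<ominus>\<^sub>A x \<in> I" using that mem_cls[OF assms(2)] by auto
  then have "a \<odot>\<^sub>A (y \<ominus>\<^sub>A x) \<in> I" using submoduleE(4)[OF sub] assms(1) by auto
  moreover have "a \<odot>\<^sub>A (y \<ominus>\<^sub>A x) = a \<odot>\<^sub>A y \<ominus>\<^sub>A a \<odot>\<^sub>A x"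
   using assms y by (simp add: a_minus_def smult_r_distr smult_r_minus)
  ultimately show ?thesis using assms y by (simp add: cls_eq_iff)
 qed
 have "a \<odot>\<^sub>Q cls x = (\<Union>y\<in>cls x. cls (a \<odot>\<^sub>A y))" by (simp only: quotient_algebra_def module.select_convs)
 also have "... = (\<Union>y\<in>cls x. cls (a \<odot>\<^sub>A x))" by (rule SUP_cong[OF refl eq])
 also have "... = cls (a \<odot>\<^sub>A x)" using a_rcos_self[OF assms(2)] by blast
 finally show ?thesis by (rule sym)
qed

lemma quotient_module: "module R Q"
proof (rule moduleI)
 show "abelian_group Q"
 proof (rule abelian_groupI)
  fix X Y Z assume "X:.Q" "Y:.Q" "Z:.Q"
  then obtain x y z where *: "x:.A" "y:.A" "z:.A"
   "X = cls x" "Y = cls y" "Z = cls z" using quotient_cases by meson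
  then show "X \<oplus>\<^sub>Q Y:.Q" "X \<oplus>\<^sub>Q Y = Y \<oplus>\<^sub>Q X"
   "X \<oplus>\<^sub>Q Y \<oplus>\<^sub>Q Z = X \<oplus>\<^sub>Q (Y \<oplus>\<^sub>Q Z)"
   by (simp_all add: cls_add[symmetric] cls_closed M.a_ac)
 next
  fix X assume "X:.Q"
  then obtain x where x: "x:.A" "X = cls x" using quotient_cases by meson
  have z: "\<zero>\<^sub>Q = cls \<zero>\<^sub>A" using M.a_coset_add_zero[OF I_subset] by (simp add: quotient_sel)
  show "\<zero>\<^sub>Q \<oplus>\<^sub>Q X = X" using x by (simp add: z cls_add[symmetric])
  show "\<exists>Y\<in>carrier Q. Y \<oplus>\<^sub>Q X = \<zero>\<^sub>Q"
   using x by (intro bexI[of _ "cls (\<ominus>\<^sub>A x)"]) (simp_all add: z cls_add[symmetric] cls_closed M.l_neg)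
 next
  show "\<zero>\<^sub>Q:.Q" by (simp add: quotient_sel a_subgroup_in_rcosets)
 qed
next
 fix a X assume a: "a:.R" and "X:.Q"
 then obtain x where x: "x:.A" "X = cls x" using quotient_cases by meson
 show "a \<odot>\<^sub>Q X:.Q" using a x by (simp add: cls_smult[symmetric] cls_closed)
next
 fix X assume "X:.Q"
 then obtain x where x: "x:.A" "X = cls x" using quotient_cases by meson
 show "\<one> \<odot>\<^sub>Q X = X" using x by (simp add: cls_smult[symmetric])
next
 fix a X Y assume a: "a:.R" and "X:.Q" "Y:.Q"
 then obtain x y where x: "x:.A" "X = cls x" "y:.A" "Y = cls y" using quotient_cases by meson
 show "a \<odot>\<^sub>Q (X \<oplus>\<^sub>Q Y) = a \<odot>\<^sub>Q X \<oplus>\<^sub>Q a \<odot>\<^sub>Q Y"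
  using a x by (simp add: cls_smult[symmetric] cls_add[symmetric] smult_r_distr)
next
 fix a b X assume a: "a:.R" "b:.R" and "X:.Q"
 then obtain x where x: "x:.A" "X = cls x" using quotient_cases by meson
 show "(a \<oplus> b) \<odot>\<^sub>Q X = a \<odot>\<^sub>Q X \<oplus>\<^sub>Q b \<odot>\<^sub>Q X"
  using a x by (simp add: cls_smult[symmetric] cls_add[symmetric] smult_l_distr)
 show "(a \<otimes> b) \<odot>\<^sub>Q X = a \<odot>\<^sub>Q (b \<odot>\<^sub>Q X)"
  using a x by (simp add: cls_smult[symmetric] smult_assoc1)
qed (rule R.is_cring)

lemma cls_linear: "cls : Lin R A Q" by (rule lmI[OF cls_closed cls_add cls_smult])

lemma on_class_cls: assumes "module R P" "g : Lin R A P" "!!i. i \<in> I ==> g i = \<zero>\<^sub>P" "x:.A"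
 shows "on_class g (cls x) = g x"
proof -
 have eq: "g y = g x" if "y \<in> cls x" for y
 proof -
  have y: "y:.A" and yx: "y \<ominus>\<^sub>A x \<in> I" using that mem_cls[OF assms(4)] by auto
  have "g y \<ominus>\<^sub>P g x = g (y \<ominus>\<^sub>A x)"
   by (rule linear_map_minus[OF module_axioms assms(1,2) y assms(4), symmetric])
  also have "... = \<zero>\<^sub>P" by (rule assms(3)[OF yx])
  finally show ?thesis
   using abelian_group.minus_eq_zero_iff[OF module.axioms(2)[OF assms(1)] lmD(1)[OF assms(2) y] lmD(1)[OF assms(2) assms(4)]] by blast
 qed
 have "g ` cls x = {g x}" using a_rcos_self[OF assms(4)] eq by blast
 then show ?thesis by (simp add: on_class_def)
qed

lemma on_class_linear: assumes "module R P" "g : Lin R A P" "!!i. i \<in> I ==> g i = \<zero>\<^sub>P"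
 shows "on_class g : Lin R Q P"
proof (rule lmI)
 fix X assume "X:.Q"
 then obtain x where x: "x:.A" "X = cls x" using quotient_cases by meson
 show "on_class g X:.P" using x by (simp add: on_class_cls[OF assms] lmD[OF assms(2)])
 show "on_class g (a \<odot>\<^sub>Q X) = a \<odot>\<^sub>P on_class g X" if a: "a:.R" for a
  using x a by (simp add: on_class_cls[OF assms] cls_smult[symmetric] lmD[OF assms(2)])
 show "on_class g (X \<oplus>\<^sub>Q Y) = on_class g X \<oplus>\<^sub>P on_class g Y" if "Y:.Q" for Y
 proof -
  from that obtain y where y: "y:.A" "Y = cls y" using quotient_cases by meson
  then show ?thesis using x by (simp add: on_class_cls[OF assms] cls_add[symmetric] lmD[OF assms(2)])
 qed
qed

end

section \<open>Free modules and tensor products\<close>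

lemma free_module_sel [simp]:
 "zero (free_module R X) = (%x. \<zero>\<^sub>R)" "add (free_module R X) = (%ph ps x. ph x \<oplus>\<^sub>R ps x)"
 "smult (free_module R X) = (%a ph x. a \<otimes>\<^sub>R ph x)" by (simp_all add: free_module_def)

lemma free_carrier: "ph:.(free_module R X) \<longleftrightarrow>
  (\<forall>x\<in>X. ph x:.R) \<and> (\<forall>x. x \<notin> X --> ph x = \<zero>\<^sub>R) \<and> finite {x. ph x ~= \<zero>\<^sub>R}"
 by (auto simp: free_module_def)

context cring begin

lemma free_module_closed: "ph:.(free_module R X) ==> ph x:.R" by (cases "x \<in> X") (auto simp: free_carrier)

lemma free_module_module: "module R (free_module R X)"
proof (rule moduleI)
 let ?F = "free_module R X"
 note c = free_module_closed
 show "abelian_group ?F"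
 proof (rule abelian_groupI)
  fix x y assume xy: "x:.?F" "y:.?F"
  have "{p. x p \<oplus> y p ~= \<zero>} \<subseteq> {p. x p ~= \<zero>} \<union> {p. y p ~= \<zero>}" by auto
  then show "x \<oplus>\<^sub>?F y:.?F" using xy by (auto simp: free_carrier intro: finite_subset)
  show "x \<oplus>\<^sub>?F y = y \<oplus>\<^sub>?F x" using c[OF xy(1)] c[OF xy(2)] by (simp add: a_comm)
 next
  fix x y z assume "x:.?F" "y:.?F" "z:.?F"
  then show "x \<oplus>\<^sub>?F y \<oplus>\<^sub>?F z = x \<oplus>\<^sub>?F (y \<oplus>\<^sub>?F z)" by (simp add: a_assoc c)
 next
  fix x assume x: "x:.?F"
  have fin: "finite {p. x p ~= \<zero>}" using x by (simp add: free_carrier)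
  have "{p. \<ominus> x p ~= \<zero>} \<subseteq> {p. x p ~= \<zero>}" by auto
  then have "finite {p. \<ominus> x p ~= \<zero>}" using fin by (rule finite_subset)
  then have "(%p. \<ominus> x p):.?F" using x c[OF x] by (auto simp: free_carrier)
  moreover have "(%p. \<ominus> x p) \<oplus>\<^sub>?F x = \<zero>\<^sub>?F" using c[OF x] by (simp add: l_neg)
  ultimately show "\<exists>y\<in>carrier ?F. y \<oplus>\<^sub>?F x = \<zero>\<^sub>?F" by blast
 qed (auto simp: free_carrier c)
 fix a x assume a: "a:.R" and x: "x:.?F"
 have fin: "finite {p. x p ~= \<zero>}" using x by (simp add: free_carrier)
 have "{p. a \<otimes> x p ~= \<zero>} \<subseteq> {p. x p ~= \<zero>}" using a by auto
 then have "finite {p. a \<otimes> x p ~= \<zero>}" using fin by (rule finite_subset)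
 then show "a \<odot>\<^sub>?F x:.?F" using x c[OF x] a by (auto simp: free_carrier)
qed (simp_all add: free_module_closed l_distr r_distr m_assoc is_cring)

lemma free_basis_closed: "x \<in> X ==> free_basis R x:.(free_module R X)"
 by (auto simp: free_basis_def free_carrier)

text \<open>Induction on the size of the support: one value is set to zero and restored as a
  multiple of its basis vector.\<close>

lemma free_module_span: "module_span R (free_module R X) (free_basis R ` X) = carrier (free_module R X)"
proof
 let ?F = "free_module R X"
 interpret F: module R ?F by (rule free_module_module)
 have sub: "free_basis R ` X \<subseteq> carrier ?F" by (auto simp: free_basis_closed)
 have N: "submodule (module_span R ?F (free_basis R ` X)) R ?F"
  by (rule module_span_submodule[OF free_module_module sub])
 show "module_span R ?F (free_basis R ` X) \<subseteq> carrier ?F" by (rule F.submoduleE(1)[OF N])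
 show "carrier ?F \<subseteq> module_span R ?F (free_basis R ` X)"
 proof
  fix ph assume "ph:.?F"
  then show "ph \<in> module_span R ?F (free_basis R ` X)"
  proof (induction "card {x. ph x ~= \<zero>}" arbitrary: ph)
   case 0
   then have "ph = (%x. \<zero>)" by (auto simp: free_carrier)
   then show ?case using subgroup.one_closed[OF submodule.axioms(1)[OF N]] by simp
  next
   case (Suc n)
   have fin: "finite {x. ph x ~= \<zero>}" using Suc by (simp add: free_carrier)
   then obtain p where p: "ph p ~= \<zero>" using Suc(2) by (metis (mono_tags, lifting) Collect_empty_eq card.empty nat.distinct(1))
   let ?ps = "ph(p := \<zero>)"
   have pX: "p \<in> X" using p Suc(3) by (auto simp: free_carrier)
   have s: "{x. ?ps x ~= \<zero>} = {x. ph x ~= \<zero>} - {p}" by auto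
   have "?ps:.?F" unfolding free_carrier s using Suc(3) fin by (auto simp: free_carrier)
   moreover have "card {x. ?ps x ~= \<zero>} = n" unfolding s using Suc(2) p by (simp add: fin)
   ultimately have "?ps \<in> module_span R ?F (free_basis R ` X)" using Suc(1) by simp
   moreover have "ph p \<odot>\<^sub>?F free_basis R p \<in> module_span R ?F (free_basis R ` X)"
    using F.submoduleE(4)[OF N] module_span_incl pX free_module_closed[OF Suc(3)] by (metis image_subset_iff)
   ultimately have "?ps \<oplus>\<^sub>?F ph p \<odot>\<^sub>?F free_basis R p \<in> module_span R ?F (free_basis R ` X)"
    by (rule F.submoduleE(5)[OF N])
   moreover have "?ps \<oplus>\<^sub>?F ph p \<odot>\<^sub>?F free_basis R p = ph"
    using free_module_closed[OF Suc(3)] by (auto simp: free_basis_def)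
   ultimately show ?case by simp
  qed
 qed
qed

end

definition free_lift :: "('a, 'r) ring_scheme => ('a, 'p, 'z) module_scheme => ('x => 'p) => ('x => 'a) => 'p"
 where "free_lift R P G ph = (\<Oplus>\<^sub>P p\<in>{p. ph p ~= \<zero>\<^sub>R}. ph p \<odot>\<^sub>P G p)"

text \<open>The index set in \<open>free_lift\<close> depends on the argument. Additivity compares
  three different supports, so the sum must be available over any common finite set containing
  them.\<close>

lemma free_lift_superset: assumes "module R P" "ph:.(free_module R X)" "!!x. x \<in> X ==> G x:.P"
  "finite A" "{p. ph p ~= \<zero>\<^sub>R} \<subseteq> A" "A \<subseteq> X"
 shows "free_lift R P G ph = (\<Oplus>\<^sub>P p\<in>A. ph p \<odot>\<^sub>P G p)"
proof -
 interpret P: module R P by fact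
 show ?thesis unfolding free_lift_def by (rule P.M.add.finprod_mono_neutral_cong_left)
   (use assms in \<open>auto simp: subset_iff free_carrier\<close>)
qed

lemma free_lift_linear: assumes "module R P" "!!x. x \<in> X ==> G x:.P"
 shows "free_lift R P G : Lin R (free_module R X) P"
proof -
 interpret P: module R P by fact
 let ?F = "free_module R X"
 interpret F: module R ?F by (rule P.R.free_module_module)
 note c = P.R.free_module_closed
 have sub: "{p. ph p ~= \<zero>\<^sub>R} \<subseteq> X" "finite {p. ph p ~= \<zero>\<^sub>R}" if "ph:.?F" for ph
  using that by (auto simp: free_carrier)
 have GX: "G p:.P" if "p \<in> A" "A \<subseteq> X" for p A using that assms(2) by auto
 show ?thesis
 proof (rule lmI)
  fix x assume x: "x:.?F"
  show "free_lift R P G x:.P" unfolding free_lift_def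
   by (rule P.M.finsum_closed) (use sub[OF x] c[OF x] assms(2) in auto)
  fix a assume a: "a:.R"
  let ?A = "{p. x p ~= \<zero>\<^sub>R}"
  have "free_lift R P G (a \<odot>\<^sub>?F x) = (\<Oplus>\<^sub>P p\<in>?A. (a \<odot>\<^sub>?F x) p \<odot>\<^sub>P G p)"
   by (rule free_lift_superset[OF assms(1) F.smult_closed[OF a x] assms(2)]) (use sub[OF x] a in auto)
  also have "... = (\<Oplus>\<^sub>P p\<in>?A. a \<odot>\<^sub>P (x p \<odot>\<^sub>P G p))"
   by (rule P.M.finsum_cong') (use sub[OF x] a c[OF x] assms(2) in \<open>auto simp: P.smult_assoc1\<close>)
  also have "... = a \<odot>\<^sub>P free_lift R P G x" unfolding free_lift_def
   by (rule P.finsum_smult_ldistr[symmetric]) (use sub[OF x] a c[OF x] assms(2) in auto)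
  finally show "free_lift R P G (a \<odot>\<^sub>?F x) = a \<odot>\<^sub>P free_lift R P G x" .
 next
  fix x y assume x: "x:.?F" and y: "y:.?F"
  let ?A = "{p. x p ~= \<zero>\<^sub>R} \<union> {p. y p ~= \<zero>\<^sub>R}"
  have A: "finite ?A" "?A \<subseteq> X" using sub[OF x] sub[OF y] by auto
  have "free_lift R P G (x \<oplus>\<^sub>?F y) = (\<Oplus>\<^sub>P p\<in>?A. (x \<oplus>\<^sub>?F y) p \<odot>\<^sub>P G p)"
   by (rule free_lift_superset[OF assms(1) F.M.add.m_closed[OF x y] assms(2)]) (use A in auto)
  also have "... = (\<Oplus>\<^sub>P p\<in>?A. x p \<odot>\<^sub>P G p \<oplus>\<^sub>P y p \<odot>\<^sub>P G p)"
   by (rule P.M.finsum_cong') (use GX[OF _ A(2)] c[OF x] c[OF y] in \<open>auto simp: P.smult_l_distr\<close>)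
  also have "... = (\<Oplus>\<^sub>P p\<in>?A. x p \<odot>\<^sub>P G p) \<oplus>\<^sub>P (\<Oplus>\<^sub>P p\<in>?A. y p \<odot>\<^sub>P G p)"
   by (rule P.M.finsum_addf) (use GX[OF _ A(2)] c[OF x] c[OF y] in auto)
  also have "(\<Oplus>\<^sub>P p\<in>?A. x p \<odot>\<^sub>P G p) = free_lift R P G x"
   by (rule free_lift_superset[OF assms(1) x assms(2), symmetric]) (use A in auto)
  also have "(\<Oplus>\<^sub>P p\<in>?A. y p \<odot>\<^sub>P G p) = free_lift R P G y"
   by (rule free_lift_superset[OF assms(1) y assms(2), symmetric]) (use A in auto)
  finally show "free_lift R P G (x \<oplus>\<^sub>?F y) = free_lift R P G x \<oplus>\<^sub>P free_lift R P G y" .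
 qed
qed

lemma free_lift_basis: assumes "module R P" "x \<in> X" "G x:.P" shows "free_lift R P G (free_basis R x) = G x"
proof -
 interpret P: module R P by fact
 show ?thesis
 proof (cases "\<one>\<^sub>R = \<zero>\<^sub>R")
  \<comment> \<open>Over the zero ring a basis vector has empty support and its lift is an empty
    sum; every module over this ring is trivial, so the value is still right.\<close>
  case True
  then have "G x = \<zero>\<^sub>P" using P.smult_one[OF assms(3)] P.smult_l_null[OF assms(3)] by simp
  then show ?thesis using True by (simp add: free_lift_def free_basis_def)
 next
  case False
  then have "{p. free_basis R x p ~= \<zero>\<^sub>R} = {x}" by (auto simp: free_basis_def)
  then show ?thesis using assms(3) by (simp add: free_lift_def) (simp add: free_basis_def)
 qed
qed

lemma tensor_lift_def': "tensor_lift R P t F = on_class (free_lift R P (%p. F (fst p) (snd p))) t"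
 by (simp add: tensor_lift_def free_lift_def[abs_def])

abbreviation free_on_pairs where "free_on_pairs R M N \<equiv> free_module R (carrier M \<times> carrier N)"

text \<open>The generators of \<open>tensor_relations\<close> are isolated so that a linear map can
  be shown to kill the relations by looking at the four families only.\<close>

definition tensor_generators where "tensor_generators R M N =
  (let F = free_module R (carrier M \<times> carrier N); e = (%m n. free_basis R (m, n)) in
   ({e (m \<oplus>\<^sub>M m') n \<ominus>\<^sub>F (e m n \<oplus>\<^sub>F e m' n) | m m' n.
     m:.M \<and> m':.M \<and> n : carrier N} \<union>
    {e m (n \<oplus>\<^sub>N n') \<ominus>\<^sub>F (e m n \<oplus>\<^sub>F e m n') | m n n'.
     m:.M \<and> n:.N \<and> n' : carrier N} \<union>
    {e (a \<odot>\<^sub>M m) n \<ominus>\<^sub>F a \<odot>\<^sub>F e m n | a m n.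
     a:.R \<and> m:.M \<and> n : carrier N} \<union>
    {e m (a \<odot>\<^sub>N n) \<ominus>\<^sub>F a \<odot>\<^sub>F e m n | a m n.
     a:.R \<and> m:.M \<and> n:.N}))"

lemma tensor_relations_span: "tensor_relations R M N = module_span R (free_on_pairs R M N) (tensor_generators R M N)"
 by (simp only: tensor_relations_def tensor_generators_def Let_def)

locale two_modules =
 fixes R :: "('a, 'r) ring_scheme" and M :: "('a, 'm, 'x) module_scheme" and N :: "('a, 'n, 'y) module_scheme"
 assumes mod_M: "module R M" and mod_N: "module R N"
begin

sublocale M: module R M by (rule mod_M)
sublocale N: module R N by (rule mod_N)

abbreviation "FP \<equiv> free_on_pairs R M N"
abbreviation "T \<equiv> tensor_module R M N"

lemma FP_module: "module R FP" by (rule M.R.free_module_module)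

lemma FP_basis: "m:.M ==> n:.N ==> free_basis R (m, n):.FP" by (rule M.R.free_basis_closed) simp

lemma tensor_generators_closed: "tensor_generators R M N \<subseteq> carrier FP"
proof -
 interpret F: module R FP by (rule FP_module)
 have "x \<oplus>\<^bsub>FP\<^esub> y:.FP" "x \<ominus>\<^bsub>FP\<^esub> y:.FP" if "x:.FP" "y:.FP" for x y
  using that F.M.minus_closed F.M.add.m_closed by blast+
 moreover have "a \<odot>\<^bsub>FP\<^esub> x:.FP" if "x:.FP" "a:.R" for x a using that F.smult_closed by blast
 ultimately show ?thesis unfolding tensor_generators_def Let_def using FP_basis by (auto simp del: free_module_sel)
qed

lemma quotient_by_relations: "quotient_by R FP (tensor_relations R M N)"
 unfolding quotient_by_def quotient_by_axioms_def tensor_relations_span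
 by (intro conjI FP_module module_span_submodule tensor_generators_closed)

lemma T_def': "T = quotient_algebra FP (tensor_relations R M N)" by (simp add: tensor_module_def)

lemma tensor_mod: "module R T" unfolding T_def' by (rule quotient_by.quotient_module[OF quotient_by_relations])

lemma tens_closed: "m:.M ==> n:.N ==> tens R M N m n:.T"
 unfolding T_def' tens_def by (intro quotient_by.cls_closed[OF quotient_by_relations] FP_basis)

lemma tensor_relations_mem: "x \<in> tensor_generators R M N ==> x \<in> tensor_relations R M N"
 unfolding tensor_relations_span using module_span_incl by (rule subsetD)

lemma tens_add_left: assumes "m:.M" "m':.M" "n:.N"
 shows "tens R M N (m \<oplus>\<^sub>M m') n = tens R M N m n \<oplus>\<^sub>T tens R M N m' n"
proof -
 interpret Q: quotient_by R FP "tensor_relations R M N" by (rule quotient_by_relations)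
 have "free_basis R (m \<oplus>\<^sub>M m', n) \<ominus>\<^bsub>FP\<^esub> (free_basis R (m, n) \<oplus>\<^bsub>FP\<^esub> free_basis R (m', n))
   \<in> tensor_relations R M N"
  by (rule tensor_relations_mem) (use assms in \<open>unfold tensor_generators_def Let_def, blast\<close>)
 then show ?thesis unfolding tens_def T_def'
  using assms by (subst Q.cls_add[symmetric]) (auto simp: Q.cls_eq_iff FP_basis Q.M.add.m_closed simp del: free_module_sel)
qed

lemma tens_add_right: assumes "m:.M" "n:.N" "n':.N"
 shows "tens R M N m (n \<oplus>\<^sub>N n') = tens R M N m n \<oplus>\<^sub>T tens R M N m n'"
proof -
 interpret Q: quotient_by R FP "tensor_relations R M N" by (rule quotient_by_relations)
 have "free_basis R (m, n \<oplus>\<^sub>N n') \<ominus>\<^bsub>FP\<^esub> (free_basis R (m, n) \<oplus>\<^bsub>FP\<^esub> free_basis R (m, n'))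
   \<in> tensor_relations R M N"
  by (rule tensor_relations_mem) (use assms in \<open>unfold tensor_generators_def Let_def, blast\<close>)
 then show ?thesis unfolding tens_def T_def'
  using assms by (subst Q.cls_add[symmetric]) (auto simp: Q.cls_eq_iff FP_basis Q.M.add.m_closed simp del: free_module_sel)
qed

lemma tens_smult_left: assumes "a:.R" "m:.M" "n:.N"
 shows "tens R M N (a \<odot>\<^sub>M m) n = a \<odot>\<^sub>T tens R M N m n"
proof -
 interpret Q: quotient_by R FP "tensor_relations R M N" by (rule quotient_by_relations)
 have "free_basis R (a \<odot>\<^sub>M m, n) \<ominus>\<^bsub>FP\<^esub> a \<odot>\<^bsub>FP\<^esub> free_basis R (m, n) \<in> tensor_relations R M N"
  by (rule tensor_relations_mem) (use assms in \<open>unfold tensor_generators_def Let_def, blast\<close>)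
 then show ?thesis unfolding tens_def T_def'
  using assms by (subst Q.cls_smult[symmetric]) (auto simp: Q.cls_eq_iff FP_basis Q.smult_closed simp del: free_module_sel)
qed

lemma tens_smult_right: assumes "a:.R" "m:.M" "n:.N"
 shows "tens R M N m (a \<odot>\<^sub>N n) = a \<odot>\<^sub>T tens R M N m n"
proof -
 interpret Q: quotient_by R FP "tensor_relations R M N" by (rule quotient_by_relations)
 have "free_basis R (m, a \<odot>\<^sub>N n) \<ominus>\<^bsub>FP\<^esub> a \<odot>\<^bsub>FP\<^esub> free_basis R (m, n) \<in> tensor_relations R M N"
  by (rule tensor_relations_mem) (use assms in \<open>unfold tensor_generators_def Let_def, blast\<close>)
 then show ?thesis unfolding tens_def T_def'
  using assms by (subst Q.cls_smult[symmetric]) (auto simp: Q.cls_eq_iff FP_basis Q.smult_closed simp del: free_module_sel)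
qed

lemma tens_bilinear: "bilinear R M N T (tens R M N)"
 by (intro bilI lmI tens_closed tens_add_left tens_add_right tens_smult_left tens_smult_right)

lemma tensor_generators_lift_zero: assumes "module R P" "bilinear R M N P F" "x \<in> tensor_generators R M N"
 shows "free_lift R P (%p. F (fst p) (snd p)) x = \<zero>\<^sub>P"
proof -
 interpret P: module R P by fact
 interpret F: module R FP by (rule FP_module)
 let ?g = "free_lift R P (%p. F (fst p) (snd p))"
 note c = bilD(3)[OF assms(2)]
 have lin: "?g : Lin R FP P" by (rule free_lift_linear[OF assms(1)]) (auto simp: c)
 have b: "?g (free_basis R (m, n)) = F m n" if "m:.M" "n:.N" for m n
  using free_lift_basis[OF assms(1), of "(m, n)" "carrier M \<times> carrier N" "%p. F (fst p) (snd p)"] that c by auto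
 have mi: "?g (x \<ominus>\<^bsub>FP\<^esub> y) = ?g x \<ominus>\<^sub>P ?g y" if "x:.FP" "y:.FP" for x y
  by (rule linear_map_minus[OF FP_module assms(1) lin that])
 have ad: "?g (x \<oplus>\<^bsub>FP\<^esub> y) = ?g x \<oplus>\<^sub>P ?g y" if "x:.FP" "y:.FP" for x y
  by (rule lmD(2)[OF lin that])
 have sm: "?g (a \<odot>\<^bsub>FP\<^esub> x) = a \<odot>\<^sub>P ?g x" if "a:.R" "x:.FP" for x a
  by (rule lmD(3)[OF lin that])
 note cl = FP_basis F.M.add.m_closed F.smult_closed
 have z: "x:.P ==> x \<ominus>\<^sub>P x = \<zero>\<^sub>P" for x by (simp add: P.M.minus_eq_zero_iff)
 note D = lmD[OF bilD(1)[OF assms(2)]] lmD[OF bilD(2)[OF assms(2)]]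
 show ?thesis using assms(3) unfolding tensor_generators_def Let_def
  by (elim UnE CollectE exE conjE) (simp_all add: mi ad sm cl b D z del: free_module_sel)
qed

lemma tensor_lift_tens: assumes "module R P" "bilinear R M N P F" "m:.M" "n:.N"
 shows "tensor_lift R P (tens R M N m n) F = F m n"
proof -
 interpret Q: quotient_by R FP "tensor_relations R M N" by (rule quotient_by_relations)
 let ?g = "free_lift R P (%p. F (fst p) (snd p))"
 have lin: "?g : Lin R FP P" by (rule free_lift_linear[OF assms(1)]) (auto simp: bilD(3)[OF assms(2)])
 have "on_class ?g (Q.cls (free_basis R (m, n))) = ?g (free_basis R (m, n))"
  by (rule Q.on_class_cls[OF assms(1) lin]) (auto simp: FP_basis assms tensor_relations_span
    intro: linear_map_span_zero[OF FP_module assms(1) lin tensor_generators_closed tensor_generators_lift_zero[OF assms(1,2)]])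
 then show ?thesis unfolding tensor_lift_def' tens_def
  using free_lift_basis[OF assms(1), of "(m, n)" "carrier M \<times> carrier N" "%p. F (fst p) (snd p)"]
   bilD(3)[OF assms(2)] assms by simp
qed

lemma tensor_lift_linear: assumes "module R P" "bilinear R M N P F" shows "(%t. tensor_lift R P t F) : Lin R T P"
proof -
 interpret Q: quotient_by R FP "tensor_relations R M N" by (rule quotient_by_relations)
 let ?g = "free_lift R P (%p. F (fst p) (snd p))"
 have lin: "?g : Lin R FP P" by (rule free_lift_linear[OF assms(1)]) (auto simp: bilD(3)[OF assms(2)])
 show ?thesis unfolding tensor_lift_def' T_def' by (rule Q.on_class_linear[OF assms(1) lin])
   (auto simp: tensor_relations_span
    intro: linear_map_span_zero[OF FP_module assms(1) lin tensor_generators_closed tensor_generators_lift_zero[OF assms(1,2)]])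
qed

lemmas tensor_lift_closed = lmD(1)[OF tensor_lift_linear]

text \<open>Both maps are pulled back along the class map to the free module on pairs, which the
  basis vectors span.\<close>

lemma tensor_eqI: assumes "module R P" "f : Lin R T P" "g : Lin R T P"
  "!!m n. [|m:.M; n:.N|] ==> f (tens R M N m n) = g (tens R M N m n)" "t:.T" shows "f t = g t"
proof -
 interpret Q: quotient_by R FP "tensor_relations R M N" by (rule quotient_by_relations)
 obtain ph where ph: "ph:.FP" "t = Q.cls ph" using Q.quotient_cases assms(5) by (auto simp: T_def')
 have cl: "Q.cls : Lin R FP T" unfolding T_def' by (rule Q.cls_linear)
 have "f (Q.cls ph) = g (Q.cls ph)"
 proof (rule linear_map_eq_on_span[OF FP_module assms(1)])
  show "(%x. f (Q.cls x)) : Lin R FP P" by (rule lm_comp[OF cl assms(2)])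
  show "(%x. g (Q.cls x)) : Lin R FP P" by (rule lm_comp[OF cl assms(3)])
  show "free_basis R ` (carrier M \<times> carrier N) \<subseteq> carrier FP" by (auto intro: M.R.free_basis_closed)
  show "ph \<in> module_span R FP (free_basis R ` (carrier M \<times> carrier N))"
   unfolding M.R.free_module_span by (rule ph)
 qed (use assms(4) in \<open>auto simp: tens_def\<close>)
 then show ?thesis by (simp add: ph)
qed

lemma tensor_lift_cong: assumes "module R P" "bilinear R M N P F"
  "!!m n. [|m:.M; n:.N|] ==> F m n = G m n" "t:.T" shows "tensor_lift R P t F = tensor_lift R P t G"
proof -
 have G: "bilinear R M N P G" using assms(2) bilinear_cong[OF mod_M mod_N, of F G P] assms(3) by blast
 show ?thesis
  by (rule tensor_eqI[OF assms(1) tensor_lift_linear[OF assms(1,2)] tensor_lift_linear[OF assms(1) G] _ assms(4)])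
   (simp add: tensor_lift_tens[OF assms(1)] assms(2,3) G)
qed

lemma bilinear_comp: assumes "bilinear R M N P F" "f : Lin R P Q" shows "bilinear R M N Q (%m n. f (F m n))"
 by (rule bilI; rule lm_comp[OF bilD(1)[OF assms(1)] assms(2)]
  lm_comp[OF bilD(2)[OF assms(1)] assms(2)]; assumption)

lemma tensor_lift_comp: assumes "module R P" "module R Q" "bilinear R M N P F" "f : Lin R P Q" "t:.T"
 shows "f (tensor_lift R P t F) = tensor_lift R Q t (%m n. f (F m n))"
proof (rule tensor_eqI[OF assms(2) _ _ _ assms(5)])
 show "(%t. f (tensor_lift R P t F)) : Lin R T Q" by (rule lm_comp[OF tensor_lift_linear[OF assms(1,3)] assms(4)])
 have b: "bilinear R M N Q (%m n. f (F m n))" by (rule bilinear_comp[OF assms(3,4)])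
 show "(%t. tensor_lift R Q t (%m n. f (F m n))) : Lin R T Q" by (rule tensor_lift_linear[OF assms(2) b])
qed (simp add: tensor_lift_tens[OF assms(1,3)] tensor_lift_tens[OF assms(2) bilinear_comp[OF assms(3,4)]])

lemma bilinear_smult: assumes "module R P" "bilinear R M N P F" "a:.R"
 shows "bilinear R M N P (%m n. a \<odot>\<^sub>P F m n)" by (rule bilI)
  (rule lm_smult[OF mod_N assms(1) bilD(1)[OF assms(2)] assms(3)]
  lm_smult[OF mod_M assms(1) bilD(2)[OF assms(2)] assms(3)]; assumption)+

text \<open>Linearity in a parameter cannot be read off a representative of \<open>t\<close>.
  Instead both sides of each law are seen as linear in \<open>t\<close> and compared on pure
  tensors.\<close>

lemma tensor_lift_fun_linear: assumes "module R P" "module R X" "!!x. x:.X ==> bilinear R M N P (F x)"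
  "!!m n. [|m:.M; n:.N|] ==> (%x. F x m n) : Lin R X P" "t:.T"
 shows "(%x. tensor_lift R P t (F x)) : Lin R X P"
proof (rule lmI)
 interpret P: module R P by fact
 interpret X: module R X by fact
 note L = tensor_lift_linear[OF assms(1)]
 note D = lmD[OF assms(4)]
 fix x assume x: "x:.X"
 show "tensor_lift R P t (F x):.P" by (rule tensor_lift_closed[OF assms(1,3)]) (use x assms in auto)
 show "tensor_lift R P t (F (x \<oplus>\<^sub>X y)) = tensor_lift R P t (F x) \<oplus>\<^sub>P tensor_lift R P t (F y)"
  if y: "y:.X" for y
  by (rule tensor_eqI[OF assms(1) L[OF assms(3)] lm_add[OF tensor_mod assms(1) L[OF assms(3)] L[OF assms(3)]] _ assms(5)])
   (use x y in \<open>simp_all add: tensor_lift_tens[OF assms(1)] assms(3) D\<close>)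
 show "tensor_lift R P t (F (a \<odot>\<^sub>X x)) = a \<odot>\<^sub>P tensor_lift R P t (F x)" if a: "a:.R" for a
  by (rule tensor_eqI[OF assms(1) L[OF assms(3)] lm_smult[OF tensor_mod assms(1) L[OF assms(3)]] _ assms(5)])
   (use x a in \<open>simp_all add: tensor_lift_tens[OF assms(1)] assms(3) D\<close>)
qed

end

lemma tensor_sel [simp]:
 "carrier (tensor R M N) = carrier (tensor_module R M N)" "add (tensor R M N) = add (tensor_module R M N)"
 "zero (tensor R M N) = zero (tensor_module R M N)" "smult (tensor R M N) = smult (tensor_module R M N)"
 by (simp_all add: tensor_def)

lemma (in abelian_monoid) finsum_Times:
 assumes "finite A" "finite B" "!!a b. [|a \<in> A; b \<in> B|] ==> g (a, b):.G"
 shows "finsum G g (A \<times> B) = (\<Oplus>a\<in>A. \<Oplus>b\<in>B. g (a, b))" using assms(1,3)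
proof (induction A rule: finite_induct)
 case (insert x F)
 have g: "g \<in> Pair x ` B \<rightarrow> carrier G" "g \<in> F \<times> B \<rightarrow> carrier G" using insert(4) by auto
 have "insert x F \<times> B = Pair x ` B \<union> F \<times> B" by auto
 then have "finsum G g (insert x F \<times> B) = finsum G g (Pair x ` B) \<oplus> finsum G g (F \<times> B)"
  using insert(1,2) assms(2) g by (simp, subst finsum_Un_disjoint) auto
 also have "finsum G g (Pair x ` B) = (\<Oplus>b\<in>B. g (x, b))"
  by (rule finsum_reindex) (use g in \<open>auto simp: inj_on_def\<close>)
 also have "finsum G g (F \<times> B) = (\<Oplus>a\<in>F. \<Oplus>b\<in>B. g (a, b))" using insert by auto
 finally show ?case using insert(1,2,4) by (subst finsum_insert) auto
qed simp

lemma (in cring) product_bilinear: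
 assumes "module R M" "module R N" "f : Lin R M (regular_module R)" "g : Lin R N (regular_module R)"
 shows "bilinear R M N (regular_module R) (%m n. f m \<otimes> g n)"
proof (rule bilI)
 note f = lmD[OF assms(3), simplified] and g = lmD[OF assms(4), simplified]
 show "(%n. f m \<otimes> g n) : Lin R N (regular_module R)" if m: "m:.M" for m
  by (rule lmI) (simp_all add: m f g r_distr m_lcomm)
 show "(%m. f m \<otimes> g n) : Lin R M (regular_module R)" if n: "n:.N" for n
  by (rule lmI) (simp_all add: n f g l_distr m_assoc)
qed

lemma lm_tensor [simp]: "Lin R (tensor R M N) P = Lin R (tensor_module R M N) P"
 "Lin R P (tensor R M N) = Lin R P (tensor_module R M N)" by (simp_all add: linear_map_def)

lemma module_cong: assumes "module R M" "carrier N = carrier M" "add N = add M" "zero N = zero M" "smult N = smult M"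
 shows "module R N"
proof -
 interpret M: module R M by fact
 show ?thesis
 proof (rule moduleI)
  show "abelian_group N" by (rule abelian_groupI) (use assms M.M.a_assoc M.M.a_comm M.M.add.l_inv_ex in auto)
 qed (use assms M.R.is_cring M.smult_l_distr M.smult_r_distr M.smult_assoc1 in auto)
qed

lemma finsum_cong_record: assumes "carrier N = carrier M" "add N = add M" "zero N = zero M"
 shows "finsum N = finsum M" by (intro ext) (simp add: finsum_def finprod_def assms)

context two_modules begin

lemma tensor_module': "module R (tensor R M N)" by (rule module_cong[OF tensor_mod]) simp_all

text \<open>The records \<open>tensor\<close> and \<open>tensor_module\<close> differ only in their
  multiplicative fields, which finite sums do not touch.\<close>

lemma tensor_lift_codomain: "tensor_lift R (tensor R M N) = tensor_lift R T"
 unfolding tensor_lift_def by (simp add: finsum_cong_record[of "tensor R M N" T])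

text \<open>A pattern for products on M \<otimes> N prescribed on pure tensors by a four-argument
  \<open>Z\<close>. It serves the componentwise product as well as the twisted products of the two
  doubles.\<close>

lemma tensor_product_bilinear: assumes P: "module R P"
  and Z: "!!m n. [|m:.M; n:.N|] ==> bilinear R M N P (Z m n)"
   "!!m n. [|m:.M; n:.N|] ==> bilinear R M N P (%m' n'. Z m' n' m n)"
 shows "t:.T ==> bilinear R M N P (%m n. tensor_lift R P t (Z m n))" "bilinear R T T P (%s t. tensor_lift R P s (%m n. tensor_lift R P t (Z m n)))" (is ?A)
  "[|m:.M; n:.N; m':.M; n':.N|] ==>
   tensor_lift R P (tens R M N m n) (%m n. tensor_lift R P (tens R M N m' n') (Z m n)) = Z m n m' n'"
proof -
 show inner: "bilinear R M N P (%m n. tensor_lift R P t (Z m n))" if t: "t:.T" for t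
 proof (rule bilI)
  show "(%n. tensor_lift R P t (Z m n)) : Lin R N P" if m: "m:.M" for m
   by (rule tensor_lift_fun_linear[OF P mod_N Z(1)[OF m] bilD(1)[OF Z(2) m] t])
  show "(%m. tensor_lift R P t (Z m n)) : Lin R M P" if n: "n:.N" for n
   by (rule tensor_lift_fun_linear[OF P mod_M Z(1)[OF _ n] bilD(2)[OF Z(2) n] t])
 qed
 show ?A
 proof (rule bilI)
  show "(%t. tensor_lift R P s (%m n. tensor_lift R P t (Z m n))) : Lin R T P" if "s:.T" for s
   by (rule tensor_lift_fun_linear[OF P tensor_mod inner tensor_lift_linear[OF P Z(1)] that])
  show "(%s. tensor_lift R P s (%m n. tensor_lift R P t (Z m n))) : Lin R T P" if "t:.T" for t
   by (rule tensor_lift_linear[OF P inner[OF that]])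
 qed
 show "tensor_lift R P (tens R M N m n) (%m n. tensor_lift R P (tens R M N m' n') (Z m n)) = Z m n m' n'"
  if "m:.M" "n:.N" "m':.M" "n':.N"
  by (simp add: tensor_lift_tens[OF P inner] tensor_lift_tens[OF P Z(1)] tens_closed that)
qed

definition pair_form :: "('m => 'a) => ('n => 'a) => ('m \<times> 'n => 'a) set => 'a"
 where "pair_form f g t = tensor_lift R (regular_module R) t (%m n. f m \<otimes>\<^sub>R g n)"

lemma pair_form_linear: assumes "f : Lin R M (regular_module R)" "g : Lin R N (regular_module R)"
 shows "pair_form f g : Lin R T (regular_module R)" unfolding pair_form_def[abs_def]
 by (rule tensor_lift_linear[OF M.R.regular_module M.R.product_bilinear[OF mod_M mod_N assms]])

lemma pair_form_tens: assumes "f : Lin R M (regular_module R)" "g : Lin R N (regular_module R)" "m:.M" "n:.N"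
 shows "pair_form f g (tens R M N m n) = f m \<otimes>\<^sub>R g n" unfolding pair_form_def
 by (rule tensor_lift_tens[OF M.R.regular_module M.R.product_bilinear[OF mod_M mod_N assms(1,2)] assms(3,4)])

end

section \<open>Dual bases\<close>

text \<open>The vectors \<open>e i\<close> may be dependent; a finite system of this kind exists
  precisely for finitely generated projective modules.\<close>

definition dual_basis ::
 "('a, 'r) ring_scheme => ('a, 'm, 'x) module_scheme => 'i set => ('i => 'm) => ('i => 'm => 'a) => bool"
 where "dual_basis R M I e d <-> finite I \<and> e \<in> I \<rightarrow> carrier M \<and>
  (\<forall>i\<in>I. d i : Lin R M (regular_module R)) \<and>
  (\<forall>x\<in>carrier M. (\<Oplus>\<^sub>M i\<in>I. d i x \<odot>\<^sub>M e i) = x)"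

lemma dual_basisD: assumes "dual_basis R M I e d" shows "finite I" "!!i. i \<in> I ==> e i:.M"
  "!!i. i \<in> I ==> d i : Lin R M (regular_module R)"
  "!!x. x:.M ==> (\<Oplus>\<^sub>M i\<in>I. d i x \<odot>\<^sub>M e i) = x"
  "!!i x. [|i \<in> I; x:.M|] ==> d i x:.R"
 using assms lmD(1)[of "d _" R M "regular_module R"] unfolding dual_basis_def by auto

lemma dual_basis_separates: assumes "module R M" "dual_basis R M I e d" "x:.M" "y:.M"
  "!!f. f : Lin R M (regular_module R) ==> f x = f y" shows "x = y"
proof -
 interpret M: module R M by fact
 note D = dual_basisD[OF assms(2)]
 have "(\<Oplus>\<^sub>M i\<in>I. d i x \<odot>\<^sub>M e i) = (\<Oplus>\<^sub>M i\<in>I. d i y \<odot>\<^sub>M e i)"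
  by (rule M.M.finsum_cong'[OF refl]) (simp_all add: assms(5)[OF D(3)] D(2,5) assms(3,4) Pi_def)
 then show ?thesis using D(4) assms by simp
qed

lemma dual_basis_expand: assumes "module R M" "module R P" "dual_basis R M I e d" "f : Lin R M P" "x:.M"
 shows "f x = (\<Oplus>\<^sub>P i\<in>I. d i x \<odot>\<^sub>P f (e i))" (is "_ = ?R")
proof -
 interpret M: module R M by fact
 interpret P: module R P by fact
 note D = dual_basisD[OF assms(3)]
 have "f x = f (\<Oplus>\<^sub>M i\<in>I. d i x \<odot>\<^sub>M e i)" using D(4) assms by simp
 also have "... = (\<Oplus>\<^sub>P i\<in>I. f (d i x \<odot>\<^sub>M e i))"
  by (rule lm_sum[OF assms(1,2,4) D(1)]) (use D assms in auto)
 also have "... = ?R"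
  by (rule P.M.finsum_cong') (use D assms lmD[OF assms(4)] in auto)
 finally show ?thesis .
qed

text \<open>Finite generation bounds the supports of the coordinates of a projective module.\<close>

lemma projective_dual_basis: assumes "module R M" "finitely_generated_module R M" "projective_module R M"
 shows "\<exists>(I :: 'm set) e d. dual_basis R (M :: ('a, 'm, 'x) module_scheme) I e d"
proof -
 interpret M: module R M by fact
 obtain G where G: "finite G" "G \<subseteq> carrier M" "module_span R M G = carrier M"
  using assms(2) by (auto simp: finitely_generated_module_def)
 obtain X :: "'m set" and i p where ip: "i : Lin R M (free_module R X)"
  "p : Lin R (free_module R X) M" "!!m. m:.M ==> p (i m) = m"
  using assms(3) unfolding projective_module_def by blast
 let ?F = "free_module R X"
 interpret F: module R ?F by (rule M.R.free_module_module)
 note iD = lmD[OF ip(1)]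
 define I where "I = (\<Union>g\<in>G. {x. i g x ~= \<zero>\<^sub>R})"
 have fin: "finite I" unfolding I_def using G iD(1) by (auto simp: free_carrier)
 have IX: "I \<subseteq> X"
 proof
  fix x assume "x \<in> I"
  then obtain g where "g \<in> G" "i g x ~= \<zero>\<^sub>R" unfolding I_def by blast
  then show "x \<in> X" using G(2) iD(1)[of g] unfolding free_carrier by blast
 qed
 \<comment> \<open>Elements whose coordinates vanish outside \<open>I\<close> form a submodule; it
   contains the finite generating set and is therefore everything.\<close>
 have "submodule {m \<in> carrier M. \<forall>x. x \<notin> I --> i m x = \<zero>\<^sub>R} R M"
 proof (rule M.submoduleI)
  have ni: "i (\<ominus>\<^sub>M m) x = \<zero>\<^sub>R" if "m:.M" "i m x = \<zero>\<^sub>R" for m x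
  proof -
   have "i m \<oplus>\<^sub>?F i (\<ominus>\<^sub>M m) = \<zero>\<^sub>?F"
    using iD(2)[of m "\<ominus>\<^sub>M m"] that lm_zero[OF assms(1) M.R.free_module_module ip(1)]
    by (simp add: M.M.r_neg del: free_module_sel)
   then have "i m x \<oplus>\<^sub>R i (\<ominus>\<^sub>M m) x = \<zero>\<^sub>R" by (auto dest: fun_cong)
   then show ?thesis using that M.R.free_module_closed[OF iD(1)] by simp
  qed
  show "\<zero>\<^sub>M \<in> {m \<in> carrier M. \<forall>x. x \<notin> I --> i m x = \<zero>\<^sub>R}"
   using lm_zero[OF assms(1) M.R.free_module_module ip(1)] by simp
  show "\<ominus>\<^sub>M m \<in> {m \<in> carrier M. \<forall>x. x \<notin> I --> i m x = \<zero>\<^sub>R}"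
   if "m \<in> {m \<in> carrier M. \<forall>x. x \<notin> I --> i m x = \<zero>\<^sub>R}" for m using that ni by auto
 qed (auto simp: iD)
 then have "module_span R M G \<subseteq> {m \<in> carrier M. \<forall>x. x \<notin> I --> i m x = \<zero>\<^sub>R}"
  by (rule module_span_least) (use G in \<open>auto simp: I_def\<close>)
 then have supp: "i m x = \<zero>\<^sub>R" if "m:.M" "x \<notin> I" for m x using that G(3) by auto
 have "dual_basis R M I (%x. p (free_basis R x)) (%x m. i m x)" unfolding dual_basis_def
 proof (intro conjI ballI fin funcsetI)
  show pc: "p (free_basis R x):.M" if "x \<in> I" for x
   by (rule lmD(1)[OF ip(2) M.R.free_basis_closed[OF subsetD[OF IX that]]])
  show "(%m. i m x) : Lin R M (regular_module R)" if "x \<in> I" for x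
   by (rule lmI) (simp_all add: iD M.R.free_module_closed[OF iD(1)])
  fix m assume m: "m:.M"
  have lift: "free_lift R M (%x. p (free_basis R x)) : Lin R ?F M"
   by (rule free_lift_linear[OF assms(1)]) (rule lmD(1)[OF ip(2) M.R.free_basis_closed])
  have "p (i m) = free_lift R M (%x. p (free_basis R x)) (i m)"
  proof (rule linear_map_eq_on_span[OF M.R.free_module_module assms(1) ip(2) lift])
   show "free_basis R ` X \<subseteq> carrier ?F" by (auto intro: M.R.free_basis_closed)
   show "i m \<in> module_span R ?F (free_basis R ` X)" unfolding M.R.free_module_span by (rule iD(1)[OF m])
   fix y assume "y \<in> free_basis R ` X"
   then obtain x where x: "x \<in> X" "y = free_basis R x" by blast
   show "p y = free_lift R M (%x. p (free_basis R x)) y" unfolding x(2)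
    by (rule free_lift_basis[OF assms(1) x(1), symmetric]) (rule lmD(1)[OF ip(2) M.R.free_basis_closed[OF x(1)]])
  qed
  also have "... = (\<Oplus>\<^sub>M x\<in>I. i m x \<odot>\<^sub>M p (free_basis R x))"
  proof (rule free_lift_superset[OF assms(1) iD(1)[OF m] _ fin _ IX])
   show "p (free_basis R x):.M" if "x \<in> X" for x by (rule lmD(1)[OF ip(2) M.R.free_basis_closed[OF that]])
   show "{x. i m x ~= \<zero>\<^sub>R} \<subseteq> I" using supp[OF m] by blast
  qed
  finally show "(\<Oplus>\<^sub>M x\<in>I. i m x \<odot>\<^sub>M p (free_basis R x)) = m" using ip(3)[OF m] by simp
 qed
 then show ?thesis by blast
qed

text \<open>By linearity only pure tensors have to be expanded: first the left leg, then the right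
  one.\<close>

lemma (in two_modules) tensor_dual_basis: assumes "dual_basis R M I e d" "dual_basis R N J e' d'"
 shows "dual_basis R T (I \<times> J) (%p. tens R M N (e (fst p)) (e' (snd p)))
  (%p. pair_form (d (fst p)) (d' (snd p)))" unfolding dual_basis_def
proof (intro conjI ballI)
 note D = dual_basisD[OF assms(1)] and D' = dual_basisD[OF assms(2)]
 interpret T: module R T by (rule tensor_mod)
 show fin: "finite (I \<times> J)" using D(1) D'(1) by simp
 show "(%p. tens R M N (e (fst p)) (e' (snd p))) \<in> I \<times> J \<rightarrow> carrier T"
  by (auto intro!: tens_closed D D')
 show pf: "pair_form (d (fst p)) (d' (snd p)) : Lin R T (regular_module R)" if "p \<in> I \<times> J" for p
  using that by (auto intro!: pair_form_linear D D')
 fix t assume t: "t:.T"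
 show "(\<Oplus>\<^sub>T p\<in>I \<times> J. pair_form (d (fst p)) (d' (snd p)) t \<odot>\<^sub>T tens R M N (e (fst p)) (e' (snd p))) = t"
 proof (rule tensor_eqI[OF tensor_mod _ lm_id _ t])
  show "(%t. \<Oplus>\<^sub>T p\<in>I \<times> J. pair_form (d (fst p)) (d' (snd p)) t \<odot>\<^sub>T tens R M N (e (fst p)) (e' (snd p)))
    : Lin R T T" by (intro linear_map_finsum_fun tensor_mod fin lm_const_smult pf) (auto intro!: tens_closed D D')
  fix m n assume mn: "m:.M" "n:.N"
  note Dm = D(5)[OF _ mn(1)] and Dn = D'(5)[OF _ mn(2)]
  have "tens R M N m n = (\<Oplus>\<^sub>T i\<in>I. d i m \<odot>\<^sub>T tens R M N (e i) n)"
   by (rule dual_basis_expand[OF mod_M tensor_mod assms(1) bilD(2)[OF tens_bilinear mn(2)] mn(1)])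
  also have "... = (\<Oplus>\<^sub>T i\<in>I. \<Oplus>\<^sub>T j\<in>J. (d i m \<otimes>\<^sub>R d' j n) \<odot>\<^sub>T tens R M N (e i) (e' j))"
  proof (rule T.M.finsum_cong'[OF refl])
   fix i assume i: "i \<in> I"
   have "tens R M N (e i) n = (\<Oplus>\<^sub>T j\<in>J. d' j n \<odot>\<^sub>T tens R M N (e i) (e' j))"
    by (rule dual_basis_expand[OF mod_N tensor_mod assms(2) bilD(1)[OF tens_bilinear D(2)[OF i]] mn(2)])
   then have "d i m \<odot>\<^sub>T tens R M N (e i) n =
     (\<Oplus>\<^sub>T j\<in>J. d i m \<odot>\<^sub>T (d' j n \<odot>\<^sub>T tens R M N (e i) (e' j)))"
    using T.finsum_smult_ldistr[OF D'(1) Dm[OF i], of "%j. d' j n \<odot>\<^sub>T tens R M N (e i) (e' j)"]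
     i Dn D D' by (simp add: Pi_def tens_closed)
   also have "... = (\<Oplus>\<^sub>T j\<in>J. (d i m \<otimes>\<^sub>R d' j n) \<odot>\<^sub>T tens R M N (e i) (e' j))"
    by (rule T.M.finsum_cong') (use i Dm Dn D D' in \<open>auto simp: T.smult_assoc1 tens_closed\<close>)
   finally show "d i m \<odot>\<^sub>T tens R M N (e i) n = ..." .
  qed (use Dm Dn D D' tens_closed in auto)
  also have "... = (\<Oplus>\<^sub>T p\<in>I \<times> J. (d (fst p) m \<otimes>\<^sub>R d' (snd p) n) \<odot>\<^sub>T tens R M N (e (fst p)) (e' (snd p)))"
   by (subst T.M.finsum_Times[OF D(1) D'(1)]) (use Dm Dn D D' tens_closed in auto)
  also have "... = (\<Oplus>\<^sub>T p\<in>I \<times> J. pair_form (d (fst p)) (d' (snd p)) (tens R M N m n) \<odot>\<^sub>T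
    tens R M N (e (fst p)) (e' (snd p)))"
   by (rule T.M.finsum_cong') (use mn Dm Dn D D' in \<open>auto simp: pair_form_tens tens_closed\<close>)
  finally show "(\<Oplus>\<^sub>T p\<in>I \<times> J. pair_form (d (fst p)) (d' (snd p)) (tens R M N m n) \<odot>\<^sub>T
    tens R M N (e (fst p)) (e' (snd p))) = tens R M N m n" by (rule sym) qed
qed

text \<open>The coordinates of the product dual basis are themselves of the form f \<otimes> g, so
  functionals of this form already separate points. This allows identities in tensor powers to be
  tested leg by leg.\<close>

lemma (in two_modules) tensor_separates: assumes "dual_basis R M I e d" "dual_basis R N J e' d'" "s:.T" "t:.T"
  "!!f g. [|f : Lin R M (regular_module R); g : Lin R N (regular_module R)|] ==> pair_form f g s = pair_form f g t"
 shows "s = t"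
proof -
 note TD = tensor_dual_basis[OF assms(1,2)]
 note D = dual_basisD[OF assms(1)] and D' = dual_basisD[OF assms(2)]
 interpret T: module R T by (rule tensor_mod)
 have "(\<Oplus>\<^sub>T p\<in>I \<times> J. pair_form (d (fst p)) (d' (snd p)) s \<odot>\<^sub>T tens R M N (e (fst p)) (e' (snd p))) =
  (\<Oplus>\<^sub>T p\<in>I \<times> J. pair_form (d (fst p)) (d' (snd p)) t \<odot>\<^sub>T tens R M N (e (fst p)) (e' (snd p)))"
  by (rule T.M.finsum_cong')
   (use dual_basisD[OF TD] assms(3,4) in \<open>auto intro!: arg_cong2[where f = "smult T"] assms(5) D D'\<close>)
 then show ?thesis using dual_basisD(4)[OF TD] assms(3,4) by simp
qed

section \<open>Algebra structure on tensor products\<close>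

text \<open>Only bilinearity of the products is assumed: the product on the tensor square of the
  double is needed before the double is known to be an associative algebra.\<close>

locale two_algebras = two_modules R M N for R :: "('a, 'r) ring_scheme"
  and M :: "('a, 'm, 'x) module_scheme" and N :: "('a, 'n, 'y) module_scheme" +
 assumes mult_M: "bilinear R M M M (mult M)" and mult_N: "bilinear R N N N (mult N)"
begin

lemma mult_tens_bilinear: assumes "m:.M" "n:.N"
 shows "bilinear R M N T (%m' n'. tens R M N (m \<otimes>\<^sub>M m') (n \<otimes>\<^sub>N n'))"
  "bilinear R M N T (%m' n'. tens R M N (m' \<otimes>\<^sub>M m) (n' \<otimes>\<^sub>N n))"
 by (rule bilI; (rule lm_comp[OF bilD(1)[OF mult_N assms(2)] bilD(1)[OF tens_bilinear bilD(3)[OF mult_M]]] |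
  rule lm_comp[OF bilD(1)[OF mult_M assms(1)] bilD(2)[OF tens_bilinear bilD(3)[OF mult_N]]] |
  rule lm_comp[OF bilD(2)[OF mult_N assms(2)] bilD(1)[OF tens_bilinear bilD(3)[OF mult_M]]] |
  rule lm_comp[OF bilD(2)[OF mult_M assms(1)] bilD(2)[OF tens_bilinear bilD(3)[OF mult_N]]]); (rule assms | assumption))+

lemma mult_tens_bilinear': assumes "t:.T"
 shows "bilinear R M N T (%m n. tensor_lift R T t (%m' n'. tens R M N (m \<otimes>\<^sub>M m') (n \<otimes>\<^sub>N n')))"
 by (rule tensor_product_bilinear(1)[OF tensor_mod mult_tens_bilinear assms])

lemma tensor_mult: "s \<otimes>\<^bsub>tensor R M N\<^esub> t = tensor_lift R T s (%m n. tensor_lift R T t (%m' n'.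
  tens R M N (m \<otimes>\<^sub>M m') (n \<otimes>\<^sub>N n')))" by (simp add: tensor_def)

lemma tensor_mult_bilinear: "bilinear R T T T (mult (tensor R M N))"
 unfolding tensor_mult[abs_def] by (rule tensor_product_bilinear(2)[OF tensor_mod mult_tens_bilinear])

lemma tensor_mult_closed: assumes "s:.T" "t:.T" shows "s \<otimes>\<^bsub>tensor R M N\<^esub> t:.T"
 unfolding tensor_mult by (rule tensor_lift_closed[OF tensor_mod mult_tens_bilinear'[OF assms(2)] assms(1)])

lemma tensor_mult_form: assumes "module R P" "ph : Lin R T P" "s:.T" "t:.T"
 shows "ph (s \<otimes>\<^bsub>tensor R M N\<^esub> t) = tensor_lift R P s (%m n. tensor_lift R P t (%m' n'.
  ph (tens R M N (m \<otimes>\<^sub>M m') (n \<otimes>\<^sub>N n'))))" (is "?L = ?R")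
proof -
 have "?L = tensor_lift R P s (%m n. ph (tensor_lift R T t (%m' n'.
   tens R M N (m \<otimes>\<^sub>M m') (n \<otimes>\<^sub>N n'))))" unfolding tensor_mult
  by (rule tensor_lift_comp[OF tensor_mod assms(1) mult_tens_bilinear'[OF assms(4)] assms(2,3)])
 also have "... = ?R"
  by (rule tensor_lift_cong[OF assms(1) bilinear_comp[OF mult_tens_bilinear'[OF assms(4)] assms(2)] _ assms(3)])
   (rule tensor_lift_comp[OF tensor_mod assms(1) mult_tens_bilinear(1) assms(2,4)])
 finally show ?thesis .
qed

end

section \<open>Sweedler sums, with values in modules and then for scalar forms\<close>

section \<open>Sweedler sums\<close>

text \<open>A linear coproduct is all that Sweedler sums require. The locale is applied to H, to its
  dual, and to the double while the coalgebra axioms of the latter are still to be proved.\<close>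

locale comultiplication = module R C for R :: "('a, 'r) ring_scheme" (structure)
  and C :: "('a, 'c, 'x) bialg_scheme" (structure) + assumes comult_lin: "comult C : Lin R C (tensor R C C)"
begin

lemma two_modules_self: "two_modules R C C" by (rule two_modules.intro) (rule module_axioms)+

lemma comult_closed: "h:.C ==> comult C h:.(tensor_module R C C)" using lmD(1)[OF comult_lin] by simp

lemma sweedler_linear: assumes "module R P" "bilinear R C C P F" shows "(%h. sweedler R C P h F) : Lin R C P"
 unfolding sweedler_def
 using lm_comp[OF comult_lin[simplified] two_modules.tensor_lift_linear[OF two_modules_self assms]] .

lemmas sweedler_closed = lmD(1)[OF sweedler_linear]

lemma sweedler_comp: assumes "module R P" "module R Q" "bilinear R C C P F" "f : Lin R P Q" "h:.C"
 shows "f (sweedler R C P h F) = sweedler R C Q h (%a b. f (F a b))" unfolding sweedler_def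
 by (rule two_modules.tensor_lift_comp[OF two_modules_self assms(1-4) comult_closed[OF assms(5)]])

lemma sweedler_cong: assumes "module R P" "bilinear R C C P F" "h:.C" "!!a b. [|a:.C; b:.C|] ==> F a b = G a b"
 shows "sweedler R C P h F = sweedler R C P h G" unfolding sweedler_def
 by (rule two_modules.tensor_lift_cong[OF two_modules_self assms(1,2,4) comult_closed[OF assms(3)]])

lemma sweedler_fun_linear: assumes "module R P" "module R X" "!!x. x:.X ==> bilinear R C C P (F x)"
  "!!a b. [|a:.C; b:.C|] ==> (%x. F x a b) : Lin R X P" "h:.C"
 shows "(%x. sweedler R C P h (F x)) : Lin R X P" unfolding sweedler_def
 by (rule two_modules.tensor_lift_fun_linear[OF two_modules_self assms(1-4) comult_closed[OF assms(5)]])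

lemma sweedler3_inner_bilinear: assumes "module R P" "!!c. c:.C ==> bilinear R C C P (%a b. F a b c)"
  "!!a b. [|a:.C; b:.C|] ==> F a b : Lin R C P"
 shows "bilinear R C C P (%x c. sweedler R C P x (%a b. F a b c))" by (rule bilI)
  (rule sweedler_fun_linear[OF assms(1) module_axioms] sweedler_linear[OF assms(1)] assms(2,3); assumption?)+

lemma sweedler3_linear: assumes "module R P" "!!c. c:.C ==> bilinear R C C P (%a b. F a b c)"
  "!!a b. [|a:.C; b:.C|] ==> F a b : Lin R C P" shows "(%h. sweedler3 R C P h F) : Lin R C P"
 unfolding sweedler3_def by (rule sweedler_linear[OF assms(1) sweedler3_inner_bilinear[OF assms]])

lemma sweedler3_comp: assumes "module R P" "module R Q" "!!c. c:.C ==> bilinear R C C P (%a b. F a b c)"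
  "!!a b. [|a:.C; b:.C|] ==> F a b : Lin R C P" "f : Lin R P Q" "h:.C"
 shows "f (sweedler3 R C P h F) = sweedler3 R C Q h (%a b c. f (F a b c))" (is "?L = ?R")
proof -
 have b: "bilinear R C C P (%x c. sweedler R C P x (%a b. F a b c))"
  by (rule sweedler3_inner_bilinear[OF assms(1,3,4)])
 have "?L = sweedler R C Q h (%x c. f (sweedler R C P x (%a b. F a b c)))"
  unfolding sweedler3_def by (rule sweedler_comp[OF assms(1,2) b assms(5,6)])
 also have "... = ?R" unfolding sweedler3_def
  by (rule sweedler_cong[OF assms(2) two_modules.bilinear_comp[OF two_modules_self b assms(5)] assms(6)])
   (rule sweedler_comp[OF assms(1,2) assms(3) assms(5)])
 finally show ?thesis .
qed

lemma sweedler3_cong: assumes "module R P" "!!c. c:.C ==> bilinear R C C P (%a b. F a b c)"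
  "!!a b. [|a:.C; b:.C|] ==> F a b : Lin R C P" "h:.C"
  "!!a b c. [|a:.C; b:.C; c:.C|] ==> F a b c = G a b c" shows "sweedler3 R C P h F = sweedler3 R C P h G"
 unfolding sweedler3_def
proof (rule sweedler_cong[OF assms(1) sweedler3_inner_bilinear[OF assms(1-3)] assms(4)])
 fix x c assume "x:.C" and c: "c:.C"
 then show "sweedler R C P x (%a b. F a b c) = sweedler R C P x (%a b. G a b c)"
  by (intro sweedler_cong[OF assms(1) assms(2)[OF c]] assms(5)[OF _ _ c])
qed

end

section \<open>A total Sweedler calculus for scalar-valued multilinear forms\<close>

text \<open>
  All operations are made total by replacing arguments outside the carrier by zero, and the
  Sweedler sum of a form is defined through a dual basis of \<open>H\<close>.  Equations between Sweedler
  sums then hold without carrier conditions, and interchanging sums needs no linearity.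
\<close>

locale weak_hopf_basis = weak_hopf_algebra R H
 for R :: "('a, 'r) ring_scheme" (structure) and H :: "('a, 'h, 'x) hopf_scheme" +
 fixes I :: "'i set" and e :: "'i => 'h" and d :: "'i => 'h => 'a"
 assumes antipode_bij: "bij_betw (antipode H) (carrier H) (carrier H)" and basis: "dual_basis R H I e d"
begin

lemma mod_H: "module R H" by (rule module_axioms)
lemma mod_K: "module R (regular_module R)" by (rule R.regular_module)

sublocale HH: two_modules R H H by (rule two_modules.intro) (rule mod_H)+

lemma comultiplication_H: "comultiplication R H"
 using comult_linear by (simp add: comultiplication_def comultiplication_axioms_def mod_H)

sublocale CH: comultiplication R H by (rule comultiplication_H)

abbreviation K where "K \<equiv> regular_module R"

definition cl :: "'h => 'h" where "cl x = (if x:.H then x else \<zero>\<^sub>H)"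
definition sc :: "'a => 'a" where "sc r = (if r:.R then r else \<zero>)"
definition smul :: "'a => 'a => 'a" (infixl "*:" 70) where "r*:s = sc r \<otimes> sc s"
definition hmul :: "'h => 'h => 'h" (infixl "**" 75) where "x**y = cl x \<otimes>\<^sub>H cl y"
definition uu :: 'h where "uu = \<one>\<^sub>H"
definition ep :: "'h => 'a" where "ep x = counit H (cl x)"
definition St :: "'h => 'h" where "St x = antipode H (cl x)"
definition Si :: "'h => 'h" where "Si x = antipode_inv H (cl x)"
definition et :: "'h => 'h" where "et x = target_counit R H (cl x)"
definition es :: "'h => 'h" where "es x = source_counit R H (cl x)"

definition lin :: "('h => 'a) => bool"
 where "lin F <-> F : Lin R H K \<and> (\<forall>x. F (cl x) = F x)"
text \<open>Linearity is demanded only after \<open>cl\<close>, so that the identity and composites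
  qualify although their values may lie outside the carrier.\<close>

definition hlin :: "('h => 'h) => bool"
 where "hlin g <-> (%x. cl (g x)) : Lin R H H \<and> (\<forall>x. cl (g (cl x)) = cl (g x))"
definition lin2 where "lin2 F <-> (\<forall>b. lin (%a. F a b)) \<and> (\<forall>a. lin (%b. F a b))"
definition lin3 where "lin3 F <-> (\<forall>b c. lin (%a. F a b c)) \<and> (\<forall>a c. lin (%b. F a b c)) \<and> (\<forall>a b. lin (%c. F a b c))"

definition sw :: "'h => ('h => 'h => 'a) => 'a" ("_$_" [1000, 1000] 52)
 where "sw h F = (\<Oplus>p\<in>I \<times> I. HH.pair_form (d (fst p)) (d (snd p)) (comult H (cl h)) \<otimes>
  sc (F (e (fst p)) (e (snd p))))"

abbreviation (input) sw3 ("_$$_" [1000, 1000] 52) where "h$$F == sw h (%a w. sw w (F a))"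

lemma cl_closed [simp]: "cl x:.H" by (simp add: cl_def)
lemma cl_id: "x:.H ==> cl x = x" by (simp add: cl_def)
lemma sc_closed [simp]: "sc r:.R" by (simp add: sc_def)
lemma sc_id: "r:.R ==> sc r = r" by (simp add: sc_def)
lemma smul_closed [simp]: "r*:s:.R" by (simp add: smul_def)
lemma hmul_closed [simp]: "x**y:.H" by (simp add: hmul_def)
lemma uu_closed [simp]: "uu:.H" by (simp add: uu_def)
lemma ep_closed [simp]: "ep x:.R" using lmD(1)[OF counit_linear] by (simp add: ep_def)
lemma St_closed [simp]: "St x:.H" using lmD(1)[OF antipode_linear] by (simp add: St_def)
lemma Si_closed [simp]: "Si x:.H"
 unfolding Si_def using antipode_bij by (metis bij_betw_def cl_closed inv_into_into)

lemma cl_cl [simp]: "cl (cl x) = cl x" by (simp add: cl_id)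
lemma sc_sc [simp]: "sc (sc x) = sc x" by (simp add: sc_id)
lemma cl_hmul [simp]: "cl (x**y) = x**y" "cl x**y = x**y" "x**cl y = x**y"
 by (simp_all add: cl_id) (simp_all add: hmul_def)
lemma sc_smul [simp]: "sc (x*:y) = x*:y" "sc x*:y = x*:y" "x*:sc y = x*:y"
 by (simp_all add: sc_id) (simp_all add: smul_def)
lemma cl_uu [simp]: "cl uu = uu" by (simp add: cl_id)
lemma ep_cl [simp]: "ep (cl x) = ep x" "sc (ep x) = ep x" by (simp_all add: ep_def sc_id[OF ep_closed[unfolded ep_def]])
lemma St_cl [simp]: "St (cl x) = St x" "cl (St x) = St x" by (simp_all add: cl_id) (simp_all add: St_def)
lemma Si_cl [simp]: "Si (cl x) = Si x" "cl (Si x) = Si x" by (simp_all add: cl_id) (simp_all add: Si_def)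

lemma smul_comm: "x*:y = y*:x" by (simp add: smul_def R.m_comm)
lemma smul_assoc: "x*:y*:z = x*:(y*:z)" by (simp add: smul_def sc_id R.m_assoc)
lemma smul_left_comm: "x*:(y*:z) = y*:(x*:z)" by (metis smul_assoc smul_comm)
lemma hassoc: "x**y**z = x**(y**z)" by (simp add: hmul_def cl_id m_assoc)
lemma hmul_uu [simp]: "uu**x = cl x" "x**uu = cl x" by (simp_all add: hmul_def uu_def cl_id)

lemma St_Si [simp]: "St (Si x) = cl x"
proof -
 have "St (Si x) = antipode H (Si x)" by (simp add: St_def cl_id)
 then show ?thesis using antipode_bij by (simp add: Si_def bij_betw_def f_inv_into_f)
qed
lemma Si_St [simp]: "Si (St x) = cl x"
proof -
 have "Si (St x) = antipode_inv H (antipode H (cl x))" by (simp add: Si_def St_def cl_id[OF St_closed[unfolded St_def]])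
 then show ?thesis using antipode_bij by (simp add: bij_betw_def)
qed

lemma linI: assumes "!!x. F x:.R" "!!x. F (cl x) = F x"
  "!!x y. [|x:.H; y:.H|] ==> F (x \<oplus>\<^sub>H y) = F x \<oplus> F y"
  "!!a x. [|a:.R; x:.H|] ==> F (a \<odot>\<^sub>H x) = a \<otimes> F x" shows "lin F"
 unfolding lin_def using assms by (auto intro!: lmI)

lemma linD: assumes "lin F" shows "F x:.R" "F (cl x) = F x" "sc (F x) = F x"
  "!!x y. [|x:.H; y:.H|] ==> F (x \<oplus>\<^sub>H y) = F x \<oplus> F y"
  "!!a x. [|a:.R; x:.H|] ==> F (a \<odot>\<^sub>H x) = a \<otimes> F x" "F : Lin R H K"
proof -
 have c: "!!x. F (cl x) = F x" and l: "F : Lin R H K" using assms by (auto simp: lin_def)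
 show "F x:.R" using lmD(1)[OF l cl_closed, of x] c by simp
 then show "sc (F x) = F x" by (rule sc_id)
qed (use assms lmD[of F R H K] in \<open>auto simp: lin_def\<close>)

lemma hlinD: assumes "hlin g" shows "cl (g (cl x)) = cl (g x)"
  "!!x y. [|x:.H; y:.H|] ==> cl (g (x \<oplus>\<^sub>H y)) = cl (g x) \<oplus>\<^sub>H cl (g y)"
  "!!a x. [|a:.R; x:.H|] ==> cl (g (a \<odot>\<^sub>H x)) = a \<odot>\<^sub>H cl (g x)"
 using assms lmD[of "%x. cl (g x)" R H H] by (auto simp: hlin_def)

lemma hlinI: assumes "!!x. cl (g (cl x)) = cl (g x)"
  "!!x y. [|x:.H; y:.H|] ==> cl (g (x \<oplus>\<^sub>H y)) = cl (g x) \<oplus>\<^sub>H cl (g y)"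
  "!!a x. [|a:.R; x:.H|] ==> cl (g (a \<odot>\<^sub>H x)) = a \<odot>\<^sub>H cl (g x)" shows "hlin g"
 unfolding hlin_def using assms by (auto intro!: lmI)

lemma lin_comp: assumes "lin F" "hlin g" shows "lin (%x. F (g x))"
proof (rule linI)
 note F = linD[OF assms(1)] and g = hlinD[OF assms(2)]
 have c: "F (g x) = F (cl (g x))" for x using F(2) by simp
 show "F (g (cl x)) = F (g x)" for x using F(2)[of "g (cl x)"] F(2)[of "g x"] g(1) by simp
 show "F (g (x \<oplus>\<^sub>H y)) = F (g x) \<oplus> F (g y)" if "x:.H" "y:.H" for x y
  unfolding c[of "g _"] c[of "x \<oplus>\<^sub>H y"] c[of x] c[of y] using that by (simp add: g F)
 show "F (g (a \<odot>\<^sub>H x)) = a \<otimes> F (g x)" if "a:.R" "x:.H" for a x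
  unfolding c[of "a \<odot>\<^sub>H x"] c[of x] using that by (simp add: g F)
qed (rule linD[OF assms(1)])

lemma hlin_comp: assumes "hlin f" "hlin g" shows "hlin (%x. f (g x))"
proof (rule hlinI)
 note f = hlinD[OF assms(1)] and g = hlinD[OF assms(2)]
 have c: "cl (f (g x)) = cl (f (cl (g x)))" for x using f(1) by simp
 show "cl (f (g (cl x))) = cl (f (g x))" for x unfolding c by (simp add: g)
 show "cl (f (g (x \<oplus>\<^sub>H y))) = cl (f (g x)) \<oplus>\<^sub>H cl (f (g y))" if "x:.H" "y:.H" for x y
  unfolding c using that by (simp add: g f)
 show "cl (f (g (a \<odot>\<^sub>H x))) = a \<odot>\<^sub>H cl (f (g x))" if "a:.R" "x:.H" for a x
  unfolding c using that by (simp add: g f)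
qed

lemma hlin_id: "hlin (%x. x)" by (rule hlinI) (simp_all add: cl_id)

lemma hlin_linear_map: assumes "f : Lin R H H" shows "hlin (%x. f (cl x))"
 by (rule hlinI) (simp_all add: cl_id lmD[OF assms])

lemma lin_linear_map: assumes "f : Lin R H K" shows "lin (%x. f (cl x))"
 using lmD[OF assms] by (intro linI) (simp_all add: cl_id)

lemma linear_map_St_inv: "antipode_inv H : Lin R H H"
proof (rule lmI)
 note S = lmD[OF antipode_linear]
 have inv: "antipode_inv H x:.H" "antipode H (antipode_inv H x) = x" if "x:.H" for x
  using Si_closed[of x] St_Si[of x] that by (simp_all add: Si_def St_def cl_id)
 have inj: "x = y" if "antipode H x = antipode H y" "x:.H" "y:.H" for x y
  using antipode_bij that by (auto simp: bij_betw_def dest: inj_onD)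
 fix x assume x: "x:.H"
 show "antipode_inv H x:.H" by (rule inv(1)[OF x])
 show "antipode_inv H (x \<oplus>\<^sub>H y) = antipode_inv H x \<oplus>\<^sub>H antipode_inv H y" if "y:.H" for y
  by (rule inj) (use x that in \<open>simp_all add: inv S\<close>)
 show "antipode_inv H (a \<odot>\<^sub>H x) = a \<odot>\<^sub>H antipode_inv H x" if "a:.R" for a
  by (rule inj) (use x that in \<open>simp_all add: inv S\<close>)
qed

lemma hlin_St: "hlin g ==> hlin (%x. St (g x))"
 by (rule hlin_comp) (use hlin_linear_map[OF antipode_linear] in \<open>simp_all add: St_def[abs_def]\<close>)
lemma hlin_Si: "hlin g ==> hlin (%x. Si (g x))"
 by (rule hlin_comp) (use hlin_linear_map[OF linear_map_St_inv] in \<open>simp_all add: Si_def[abs_def]\<close>)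
lemma lin_ep: "hlin g ==> lin (%x. ep (g x))"
 by (rule lin_comp) (use lin_linear_map[OF counit_linear] in \<open>simp_all add: ep_def[abs_def]\<close>)

lemma hlin_hmul_left: "hlin g ==> hlin (%x. g x**c)" by (rule hlin_comp[of "%x. x**c"])
  (auto intro!: hlinI simp: hmul_def cl_id l_distr smult_mult_left)
lemma hlin_hmul_right: "hlin g ==> hlin (%x. c**g x)" by (rule hlin_comp[of "%x. c**x"])
  (auto intro!: hlinI simp: hmul_def cl_id r_distr smult_mult_right)

lemma lin_smul_left: "lin f ==> lin (%x. f x*:c)"
 by (rule linI) (simp_all add: smul_def linD sc_id R.l_distr R.m_assoc)
lemma lin_smul_right: "lin f ==> lin (%x. c*:f x)" using lin_smul_left[of f c] by (simp add: smul_comm)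

lemma lin2I: "[|!!b. lin (%a. F a b); !!a. lin (%b. F a b)|] ==> lin2 F" by (simp add: lin2_def)
lemma lin3I: "[|!!b c. lin (%a. F a b c); !!a c. lin (%b. F a b c); !!a b. lin (%c. F a b c)|] ==> lin3 F"
 by (simp add: lin3_def)
lemma lin2D: assumes "lin2 F" "hlin g" shows "lin (%x. F (g x) b)" "lin (%x. F a (g x))"
 using assms lin_comp[OF _ assms(2), of "%a. F a b"] lin_comp[OF _ assms(2), of "F a"] by (auto simp: lin2_def)
lemma lin3D: assumes "lin3 F" "hlin g" shows "lin (%x. F (g x) b c)" "lin (%x. F a (g x) c)" "lin (%x. F a b (g x))"
 using assms lin_comp[OF _ assms(2), of "%a. F a b c"] lin_comp[OF _ assms(2), of "%b. F a b c"]
  lin_comp[OF _ assms(2), of "%c. F a b c"] by (auto simp: lin3_def)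

lemma lin2_bilinear: "lin2 F ==> bilinear R H H K F" by (auto simp: lin2_def lin_def bilinear_def)

subsection \<open>Sweedler sums as finite sums\<close>

lemma finite_II: "finite (I \<times> I)" using dual_basisD(1)[OF basis] by simp

lemma coord_linear: assumes "p \<in> I \<times> I"
 shows "(%h. HH.pair_form (d (fst p)) (d (snd p)) (comult H h)) : Lin R H K"
 by (rule lm_comp[OF comult_linear[simplified] HH.pair_form_linear]) (use assms dual_basisD(3)[OF basis] in auto)

lemma coord_closed [simp]: "p \<in> I \<times> I ==> HH.pair_form (d (fst p)) (d (snd p)) (comult H (cl h)):.R"
 using lmD(1)[OF coord_linear] by simp

lemma coord_closed' [simp]: "[|i \<in> I; j \<in> I|] ==> HH.pair_form (d i) (d j) (comult H (cl h)):.R"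
 using coord_closed[of "(i, j)"] by simp

lemma sw_closed [simp]: "sw h F:.R" unfolding sw_def by (rule R.finsum_closed) auto
lemma sw_sc [simp]: "sc (sw h F) = sw h F" by (simp add: sc_id)
lemma sw_cl [simp]: "sw (cl h) F = sw h F" by (simp add: sw_def)

lemma lin_sw_arg: assumes "hlin g" shows "lin (%x. sw (g x) F)"
proof (rule lin_comp[OF _ assms])
 have "(%h. \<Oplus>\<^sub>K p\<in>I \<times> I. sc (F (e (fst p)) (e (snd p))) \<odot>\<^sub>K HH.pair_form (d (fst p)) (d (snd p)) (comult H h))
   : Lin R H K" by (intro linear_map_finsum_fun mod_H mod_K finite_II lm_smult coord_linear) auto
 from lin_linear_map[OF this] show "lin (%x. sw x F)"
 proof (rule back_subst[of lin], intro ext)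
  fix x
  show "(\<Oplus>\<^sub>K p\<in>I \<times> I. sc (F (e (fst p)) (e (snd p))) \<odot>\<^sub>K HH.pair_form (d (fst p)) (d (snd p)) (comult H (cl x))) = sw x F"
   unfolding sw_def finsum_regular_module
   by (rule R.finsum_cong'[OF refl]) (auto simp: R.m_comm simp del: coord_closed intro!: R.m_closed R.m_comm coord_closed)
 qed
qed

lemma lin_sw_fun: assumes "!!a b. lin (%x. F x a b)" shows "lin (%x. sw h (F x))"
proof -
 note F = linD[OF assms]
 let ?c = "%p. HH.pair_form (d (fst p)) (d (snd p)) (comult H (cl h))"
 have "(%x. \<Oplus>\<^sub>K p\<in>I \<times> I. ?c p \<odot>\<^sub>K F x (e (fst p)) (e (snd p))) : Lin R H K"
  by (intro linear_map_finsum_fun mod_H mod_K finite_II lm_smult coord_closed F(6))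
 from lin_linear_map[OF this] show ?thesis
  by (rule back_subst[of lin]) (auto simp: sw_def finsum_regular_module F(2,3))
qed

lemma finsum_swap: assumes "finite A" "finite B" "!!a b. [|a \<in> A; b \<in> B|] ==> g a b:.R"
 shows "(\<Oplus>a\<in>A. \<Oplus>b\<in>B. g a b) = (\<Oplus>b\<in>B. \<Oplus>a\<in>A. g a b)" using assms(1,3)
proof (induction A rule: finite_induct)
 case (insert x A)
 then have "(\<Oplus>a\<in>insert x A. \<Oplus>b\<in>B. g a b) = (\<Oplus>b\<in>B. g x b) \<oplus> (\<Oplus>b\<in>B. \<Oplus>a\<in>A. g a b)"
  by (subst R.finsum_insert) (auto intro!: R.finsum_closed)
 also have "... = (\<Oplus>b\<in>B. g x b \<oplus> (\<Oplus>a\<in>A. g a b))"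
  by (rule R.finsum_addf[symmetric]) (use insert in \<open>auto intro!: R.finsum_closed\<close>)
 also have "... = (\<Oplus>b\<in>B. \<Oplus>a\<in>insert x A. g a b)"
  by (rule R.finsum_cong'[OF refl]) (use insert in \<open>auto intro!: R.finsum_closed\<close>)
 finally show ?case .
qed simp

lemma sw_swap: "h$.a b. k$.c d. F a b c d = k$.c d. h$.a b. F a b c d" (is "?L = ?R")
proof -
 let ?c = "%h p. HH.pair_form (d (fst p)) (d (snd p)) (comult H (cl h))"
 let ?F = "%p q. sc (F (e (fst p)) (e (snd p)) (e (fst q)) (e (snd q)))"
 have "?L = (\<Oplus>p\<in>I \<times> I. \<Oplus>q\<in>I \<times> I. ?c h p \<otimes> (?c k q \<otimes> ?F p q))"
  unfolding sw_def[of h] sw_sc unfolding sw_def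
  by (rule R.finsum_cong'[OF refl]) (auto simp: R.finsum_rdistr[OF finite_II] intro!: R.finsum_closed)
 also have "... = (\<Oplus>q\<in>I \<times> I. \<Oplus>p\<in>I \<times> I. ?c h p \<otimes> (?c k q \<otimes> ?F p q))"
  by (rule finsum_swap[OF finite_II finite_II]) auto
 also have "... = (\<Oplus>q\<in>I \<times> I. ?c k q \<otimes> (\<Oplus>p\<in>I \<times> I. ?c h p \<otimes> ?F p q))"
  by (rule R.finsum_cong'[OF refl])
   (auto simp: R.finsum_rdistr[OF finite_II] R.m_lcomm intro!: R.finsum_closed R.finsum_cong' R.m_lcomm)
 also have "... = ?R" unfolding sw_def[of k] sw_sc unfolding sw_def ..
 finally show ?thesis .
qed

lemma sw_smul: "c*:sw h F = h$.a b. c*:F a b" (is "?L = ?R") "sw h F*:c = h$.a b. F a b*:c"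
proof -
 let ?c = "%h p. HH.pair_form (d (fst p)) (d (snd p)) (comult H (cl h))"
 have "?L = sc c \<otimes> sw h F" by (simp add: smul_def)
 also have "... = (\<Oplus>p\<in>I \<times> I. sc c \<otimes> (?c h p \<otimes> sc (F (e (fst p)) (e (snd p)))))"
  unfolding sw_def by (rule R.finsum_rdistr[OF finite_II]) auto
 also have "... = ?R"
  unfolding sw_def by (rule R.finsum_cong'[OF refl]) (auto simp: smul_def sc_id R.m_lcomm)
 finally show 1: "?L = ?R" .
 then show "sw h F*:c = h$.a b. F a b*:c" by (simp add: smul_comm)
qed

text \<open>Expanding the coproduct in the product dual basis gives the finite sum. This is the
  bridge to the sums of the statement, and the place where bilinearity of \<open>F\<close>
  enters.\<close>

lemma sw_sweedler: assumes "lin2 F" shows "sw h F = sweedler R H K (cl h) F"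
proof -
 note b = lin2_bilinear[OF assms] and D = dual_basisD[OF basis]
 have c: "comult H (cl h):.HH.T" using lmD(1)[OF comult_linear] by simp
 have "sweedler R H K (cl h) F = (\<Oplus>\<^sub>K p\<in>I \<times> I. HH.pair_form (d (fst p)) (d (snd p)) (comult H (cl h)) \<odot>\<^sub>K
   tensor_lift R K (tens R H H (e (fst p)) (e (snd p))) F)" unfolding sweedler_def
  by (rule dual_basis_expand[OF HH.tensor_mod mod_K HH.tensor_dual_basis[OF basis basis] HH.tensor_lift_linear[OF mod_K b] c])
 also have "... = sw h F" unfolding sw_def finsum_regular_module by (rule R.finsum_cong'[OF refl])
   (auto simp: HH.tensor_lift_tens[OF mod_K b] D sc_id[OF bilD(3)[OF b, simplified]])
 finally show ?thesis by simp
qed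

lemma hlin_cl: "hlin g ==> hlin (%x. cl (g x))" by (rule hlin_comp[of cl]) (auto intro!: hlinI simp: cl_id)

subsection \<open>The axioms as rules for Sweedler sums\<close>

lemma sweedler_sw: assumes "lin2 X" "h:.H" "!!a b. [|a:.H; b:.H|] ==> G a b = X a b"
 shows "sweedler R H K h G = sw h X" unfolding sw_sweedler[OF assms(1)] cl_id[OF assms(2)]
 by (rule CH.sweedler_cong[OF mod_K lin2_bilinear[OF assms(1)] assms(2), symmetric]) (simp add: assms(3))

definition trilinear :: "('a, 'p, 'z) module_scheme => ('h => 'h => 'h => 'p) => bool"
 where "trilinear P F <-> (\<forall>a\<in>carrier H. bilinear R H H P (F a)) \<and> (\<forall>c\<in>carrier H. bilinear R H H P (%a b. F a b c))"

lemma trilinearD: assumes "trilinear P F" shows "!!a. a:.H ==> bilinear R H H P (F a)"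
  "!!c. c:.H ==> bilinear R H H P (%a b. F a b c)" "!!a b. [|a:.H; b:.H|] ==> F a b : Lin R H P"
  "!!a c. [|a:.H; c:.H|] ==> (%b. F a b c) : Lin R H P"
  "!!b c. [|b:.H; c:.H|] ==> (%a. F a b c) : Lin R H P"
proof -
 show 1: "bilinear R H H P (F a)" if "a:.H" for a using assms that by (simp add: trilinear_def)
 show 2: "bilinear R H H P (%a b. F a b c)" if "c:.H" for c using assms that by (simp add: trilinear_def)
 show "F a b : Lin R H P" if "a:.H" "b:.H" for a b by (rule bilD(1)[OF 1[OF that(1)] that(2)])
 show "(%b. F a b c) : Lin R H P" if "a:.H" "c:.H" for a c by (rule bilD(2)[OF 1[OF that(1)] that(2)])
 show "(%a. F a b c) : Lin R H P" if "b:.H" "c:.H" for b c by (rule bilD(2)[OF 2[OF that(2)] that(1)])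
qed

lemma trilinearI: assumes "!!a b. [|a:.H; b:.H|] ==> (%c. F a b c) : Lin R H P"
  "!!a c. [|a:.H; c:.H|] ==> (%b. F a b c) : Lin R H P"
  "!!b c. [|b:.H; c:.H|] ==> (%a. F a b c) : Lin R H P" shows "trilinear P F"
 using assms by (simp add: trilinear_def bilinear_def)

lemma lin3_trilinear: "lin3 F ==> trilinear K F" by (rule trilinearI) (simp_all add: lin3_def lin_def)

lemma two_modules_H_HH: "two_modules R H (tensor R H H)" by (rule two_modules.intro[OF mod_H HH.tensor_module'])

text \<open>The map that a trilinear \<open>F\<close> induces on the right-bracketed triple tensor
  product. Applying it turns axioms stated in \<open>tensor3\<close> into equations of Sweedler sums
  with values in any module.\<close>

definition tri :: "('a, 'p, 'z) module_scheme => ('h => 'h => 'h => 'p) => ('h \<times> ('h \<times> 'h => 'a) set => 'a) set => 'p"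
 where "tri P F t = tensor_lift R P t (%a s. tensor_lift R P s (%b c. F a b c))"

lemma tri_bilinear: assumes "module R P" "trilinear P F"
 shows "bilinear R H (tensor R H H) P (%a s. tensor_lift R P s (%b c. F a b c))"
proof (rule bilI)
 note T = trilinearD[OF assms(2)]
 show "(%s. tensor_lift R P s (%b c. F a b c)) : Lin R (tensor R H H) P" if "a:.H" for a
  using HH.tensor_lift_linear[OF assms(1) T(1)[OF that]] by simp
 show "(%a. tensor_lift R P s (%b c. F a b c)) : Lin R H P" if s: "s:.(tensor R H H)" for s
  by (rule HH.tensor_lift_fun_linear[OF assms(1) mod_H T(1)]) (use s in \<open>simp_all add: T(5)\<close>)
qed

lemma tri_linear: assumes "module R P" "trilinear P F" shows "tri P F : Lin R (tensor3 R H) P"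
 unfolding tri_def[abs_def] lm_tensor
 using two_modules.tensor_lift_linear[OF two_modules_H_HH assms(1) tri_bilinear[OF assms]] .

lemma tri_tens: assumes "module R P" "trilinear P F" "a:.H" "s:.HH.T"
 shows "tri P F (tens R H (tensor R H H) a s) = tensor_lift R P s (F a)" unfolding tri_def using assms
 by (subst two_modules.tensor_lift_tens[OF two_modules_H_HH assms(1) tri_bilinear[OF assms(1,2)]]) simp_all

lemma tri_tens3: assumes "module R P" "trilinear P F" "a:.H" "b:.H" "c:.H"
 shows "tri P F (tens3 R H a b c) = F a b c" by (subst tri_tens[OF assms(1-3)])
  (use assms in \<open>simp_all add: HH.tens_closed HH.tensor_lift_tens[OF assms(1) trilinearD(1)[OF assms(2,3)]]\<close>)

lemma mod_HHH: "module R (tensor3 R H)" by (rule two_modules.tensor_module'[OF two_modules_H_HH])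

lemma tens3_trilinear: "trilinear (tensor3 R H) (%a b c. tens3 R H a b c)"
proof (rule trilinearI)
 note B = two_modules.tens_bilinear[OF two_modules_H_HH] and B' = HH.tens_bilinear
 show "(%a. tens3 R H a b c) : Lin R H (tensor3 R H)" if "b:.H" "c:.H" for b c
  using bilD(2)[OF B, of "tens R H H b c"] that by (simp add: HH.tens_closed)
 fix a assume a: "a:.H"
 have "(%s. tens R H (tensor R H H) a s) : Lin R HH.T (tensor3 R H)" using bilD(1)[OF B, of a] a by simp
 from lm_comp[OF _ this]
 show "b:.H ==> (%c. tens3 R H a b c) : Lin R H (tensor3 R H)"
  "c:.H ==> (%b. tens3 R H a b c) : Lin R H (tensor3 R H)" for b c using bilD(1,2)[OF B'] by blast+
qed

lemma tri_sweedler3: assumes "module R P" "trilinear P F" "h:.H"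
 shows "tri P F (sweedler3 R H (tensor3 R H) h (%a b c. tens3 R H a b c)) = sweedler3 R H P h F"
proof -
 note T = trilinearD[OF assms(2)] and T' = trilinearD[OF tens3_trilinear]
 have "tri P F (sweedler3 R H (tensor3 R H) h (%a b c. tens3 R H a b c)) =
   sweedler3 R H P h (%a b c. tri P F (tens3 R H a b c))"
  by (rule CH.sweedler3_comp[OF mod_HHH assms(1) T'(2,3) tri_linear[OF assms(1,2)] assms(3)])
 also have "... = sweedler3 R H P h F" by (rule CH.sweedler3_cong[OF assms(1) T(2,3) assms(3), symmetric])
   (simp_all add: tri_tens3[OF assms(1,2)])
 finally show ?thesis .
qed

lemma sweedler3_coassoc: assumes "module R P" "trilinear P F" "h:.H"
 shows "sweedler3 R H P h F = sweedler R H P h (%a b. sweedler R H P b (F a))" (is "?L = ?R")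
proof -
 have cc: "comult H b:.HH.T" if "b:.H" for b using lmD(1)[OF comult_linear that] by simp
 have b: "bilinear R H H (tensor3 R H) (%a b. tens R H (tensor R H H) a (comult H b))"
 proof (rule bilI)
  note B = two_modules.tens_bilinear[OF two_modules_H_HH]
  show "(%b. tens R H (tensor R H H) a (comult H b)) : Lin R H (tensor3 R H)" if "a:.H" for a
   using lm_comp[OF comult_linear bilD(1)[OF B that]] by simp
  show "(%a. tens R H (tensor R H H) a (comult H b)) : Lin R H (tensor3 R H)" if "b:.H" for b
   using bilD(2)[OF B, of "comult H b"] cc[OF that] by simp
 qed
 note tl = tri_linear[OF assms(1,2)]
 have "?L = tri P F (sweedler R H (tensor3 R H) h (%h1 h2. tens R H (tensor R H H) h1 (comult H h2)))"
  using tri_sweedler3[OF assms] coassociative[OF assms(3)] by simp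
 also have "... = sweedler R H P h (%a b. tri P F (tens R H (tensor R H H) a (comult H b)))"
  by (rule CH.sweedler_comp[OF mod_HHH assms(1) b tl assms(3)])
 also have "... = ?R"
  by (rule CH.sweedler_cong[OF assms(1) HH.bilinear_comp[OF b tl] assms(3)])
   (simp add: tri_tens[OF assms(1,2) _ cc] sweedler_def)
 finally show ?thesis .
qed

text \<open>\<open>f\<close> stands for the product or its opposite, so that both halves of
  \<open>comult_one\<close> are evaluated by one computation.\<close>

lemma sweedler3_one_aux: assumes "module R P" "trilinear P F" and f: "bilinear R H H H f"
 shows "tri P F (sweedler R H (tensor3 R H) \<one>\<^sub>H (%a b. sweedler R H (tensor3 R H) \<one>\<^sub>H (%c d. tens3 R H a (f b c) d))) =
  sweedler R H P \<one>\<^sub>H (%a b. sweedler R H P \<one>\<^sub>H (%c d. F a (f b c) d))" (is "_ = ?R")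
proof -
 note tl = tri_linear[OF assms(1,2)] and T = trilinearD[OF tens3_trilinear]
 have one: "\<one>\<^sub>H:.H" by simp
 have T3: "bilinear R H H (tensor3 R H) (%c d. tens3 R H a (f b c) d)" if "a:.H" "b:.H" for a b
  by (rule bilI; (rule T(3)[OF that(1) bilD(3)[OF f that(2)]] |
   rule lm_comp[OF bilD(1)[OF f that(2)] T(4)[OF that(1)]]); assumption)
 have b2: "bilinear R H H (tensor3 R H) (%a b. sweedler R H (tensor3 R H) \<one>\<^sub>H (%c d. tens3 R H a (f b c) d))"
 proof (rule bilI; rule CH.sweedler_fun_linear[OF mod_HHH mod_H T3 _ one])
  fix a b c d assume *: "b:.H" "c:.H" "d:.H" "a:.H"
  show "(%a. tens3 R H a (f b c) d) : Lin R H (tensor3 R H)" by (rule T(5)[OF bilD(3)[OF f *(1,2)] *(3)])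
  show "(%b. tens3 R H a (f b c) d) : Lin R H (tensor3 R H)"
   by (rule lm_comp[OF bilD(2)[OF f *(2)] T(4)[OF *(4,3)]])
 qed
 have "tri P F (sweedler R H (tensor3 R H) \<one>\<^sub>H (%a b. sweedler R H (tensor3 R H) \<one>\<^sub>H (%c d. tens3 R H a (f b c) d))) =
  sweedler R H P \<one>\<^sub>H (%a b. tri P F (sweedler R H (tensor3 R H) \<one>\<^sub>H (%c d. tens3 R H a (f b c) d)))"
  by (rule CH.sweedler_comp[OF mod_HHH assms(1) b2 tl one])
 also have "... = ?R"
 proof (rule CH.sweedler_cong[OF assms(1) HH.bilinear_comp[OF b2 tl] one])
  fix a b assume ab: "a:.H" "b:.H"
  have "tri P F (sweedler R H (tensor3 R H) \<one>\<^sub>H (%c d. tens3 R H a (f b c) d)) =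
   sweedler R H P \<one>\<^sub>H (%c d. tri P F (tens3 R H a (f b c) d))"
   by (rule CH.sweedler_comp[OF mod_HHH assms(1) T3[OF ab] tl one])
  also have "... = sweedler R H P \<one>\<^sub>H (%c d. F a (f b c) d)"
   by (rule CH.sweedler_cong[OF assms(1) HH.bilinear_comp[OF T3[OF ab] tl] one])
    (use ab bilD(3)[OF f] in \<open>simp add: tri_tens3[OF assms(1,2)]\<close>)
  finally show "tri P F (sweedler R H (tensor3 R H) \<one>\<^sub>H (%c d. tens3 R H a (f b c) d)) =
   sweedler R H P \<one>\<^sub>H (%c d. F a (f b c) d)" . qed finally show ?thesis .
qed

lemma mult_bilinear: "bilinear R H H H (mult H)" and mult_op_bilinear: "bilinear R H H H (%b c. c \<otimes>\<^sub>H b)"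
 by (rule bilI; rule lmI; simp add: l_distr r_distr smult_mult_left smult_mult_right)+

lemma sweedler3_one: assumes "module R P" "trilinear P F"
 shows "sweedler3 R H P \<one>\<^sub>H F = sweedler R H P \<one>\<^sub>H (%a b. sweedler R H P \<one>\<^sub>H (%c d. F a (b \<otimes>\<^sub>H c) d))"
  "sweedler3 R H P \<one>\<^sub>H F = sweedler R H P \<one>\<^sub>H (%a b. sweedler R H P \<one>\<^sub>H (%c d. F a (c \<otimes>\<^sub>H b) d))"
 using tri_sweedler3[OF assms, of "\<one>\<^sub>H"] sweedler3_one_aux[OF assms mult_bilinear]
  sweedler3_one_aux[OF assms mult_op_bilinear] by (simp_all only: comult_one one_closed[simplified])
  (simp_all only: comult_one[symmetric] tri_sweedler3[OF assms one_closed])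

lemma sweedler3_sw: assumes "lin3 F" "h:.H" shows "sweedler3 R H K h F = h$.a b. a$.c d. F c d b"
 unfolding sweedler3_def by (rule sweedler_sw[OF _ assms(2) sweedler_sw])
  (use assms in \<open>auto intro!: lin2I lin_sw_fun lin_sw_arg hlin_id simp: lin3_def lin2_def\<close>)

lemma sw_coassoc: assumes "lin3 F" shows "h$.a b. a$.c d. F c d b = h$$.a c d. F a c d"
proof -
 have "sweedler R H K (cl h) (%a b. sweedler R H K b (F a)) = (cl h)$$.a c d. F a c d"
  by (rule sweedler_sw[OF _ cl_closed sweedler_sw])
   (use assms in \<open>auto intro!: lin2I lin_sw_fun lin_sw_arg hlin_id simp: lin3_def lin2_def\<close>)
 then show ?thesis
  using sweedler3_sw[OF assms cl_closed, of h] sweedler3_coassoc[OF mod_K lin3_trilinear[OF assms] cl_closed, of h] by simp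
qed

lemma sweedler3_sw': assumes "lin3 F" "h:.H" shows "sweedler3 R H K h F = h$$.a b c. F a b c"
 using sweedler3_sw[OF assms] sw_coassoc[OF assms(1)] by simp

lemma sw_counit: assumes "lin F" shows "h$.a b. ep a*:F b = F h" "h$.a b. ep b*:F a = F h"
proof -
 note F = linD[OF assms] and cD = lmD[OF counit_linear, simplified]
 have 1: "bilinear R H H H (%a b. counit H a \<odot>\<^sub>H b)" "bilinear R H H H (%a b. counit H b \<odot>\<^sub>H a)"
  by (rule bilI;
   rule lm_smult[OF mod_H mod_H lm_id cD(1)] lm_const_smult[OF mod_H mod_H counit_linear]; assumption)+
 have "F h = F (sweedler R H H (cl h) (%a b. counit H a \<odot>\<^sub>H b))" using counit_left[OF cl_closed, of h] F(2) by simp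
 also have "... = sweedler R H K (cl h) (%a b. F (counit H a \<odot>\<^sub>H b))"
  by (rule CH.sweedler_comp[OF mod_H mod_K 1(1) F(6) cl_closed])
 also have "... = sweedler R H K (cl h) (%a b. ep a*:F b)"
  by (rule CH.sweedler_cong[OF mod_K HH.bilinear_comp[OF 1(1) F(6)] cl_closed])
   (simp add: F cD smul_def ep_def cl_id sc_id)
 also have "... = h$.a b. ep a*:F b"
  by (rule sw_sweedler[symmetric]) (intro lin2I lin_smul_left lin_smul_right lin_ep hlin_id assms)
 finally show "h$.a b. ep a*:F b = F h" by (rule sym)
 have "F h = F (sweedler R H H (cl h) (%a b. counit H b \<odot>\<^sub>H a))" using counit_right[OF cl_closed, of h] F(2) by simp
 also have "... = sweedler R H K (cl h) (%a b. F (counit H b \<odot>\<^sub>H a))"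
  by (rule CH.sweedler_comp[OF mod_H mod_K 1(2) F(6) cl_closed])
 also have "... = sweedler R H K (cl h) (%a b. ep b*:F a)"
  by (rule CH.sweedler_cong[OF mod_K HH.bilinear_comp[OF 1(2) F(6)] cl_closed])
   (simp add: F cD smul_def ep_def cl_id sc_id)
 also have "... = h$.a b. ep b*:F a"
  by (rule sw_sweedler[symmetric]) (intro lin2I lin_smul_left lin_smul_right lin_ep hlin_id assms)
 finally show "h$.a b. ep b*:F a = F h" by (rule sym)
qed

sublocale HHa: two_algebras R H H by unfold_locales (rule mult_bilinear)+

lemma sw_mul: assumes "lin2 F" shows "sw (h**k) F = h$.a b. k$.c d. F (a**c) (b**d)" (is "?L = ?R")
proof -
 note b = lin2_bilinear[OF assms]
 have cc: "comult H (cl b):.HH.T" for b using lmD(1)[OF comult_linear cl_closed] by simp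
 have l: "(%t. tensor_lift R K t F) : Lin R HH.T K" by (rule HH.tensor_lift_linear[OF mod_K b])
 have L: "lin2 (%a b. k$.c d. F (a**c) (b**d))" "!!a b. lin2 (%c d. F (a**c) (b**d))" for k
  by (intro lin2I lin_sw_fun lin2D[OF assms] hlin_hmul_left hlin_hmul_right hlin_id)+
 have "?L = tensor_lift R K (comult H (cl h) \<otimes>\<^bsub>tensor R H H\<^esub> comult H (cl k)) F"
  by (subst sw_sweedler[OF assms]) (simp add: sweedler_def, simp add: hmul_def comult_mult)
 also have "... = tensor_lift R K (comult H (cl h)) (%a b. tensor_lift R K (comult H (cl k)) (%c d.
   tensor_lift R K (tens R H H (a \<otimes>\<^sub>H c) (b \<otimes>\<^sub>H d)) F))"
  by (rule HHa.tensor_mult_form[OF mod_K l cc cc])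
 also have "... = tensor_lift R K (comult H (cl h)) (%a b. k$.c d. F (a**c) (b**d))"
 proof (rule HH.tensor_lift_cong[OF mod_K lin2_bilinear[OF L(1)] _ cc, symmetric])
  fix a b assume ab: "a:.H" "b:.H"
  show "k$.c d. F (a**c) (b**d) = tensor_lift R K (comult H (cl k)) (%c d.
   tensor_lift R K (tens R H H (a \<otimes>\<^sub>H c) (b \<otimes>\<^sub>H d)) F)"
   unfolding sw_sweedler[OF L(2)] sweedler_def by (rule HH.tensor_lift_cong[OF mod_K lin2_bilinear[OF L(2)] _ cc])
    (use ab in \<open>simp add: HH.tensor_lift_tens[OF mod_K b] hmul_def cl_id\<close>)
 qed
 also have "... = ?R" by (simp add: sw_sweedler[OF L(1)] sweedler_def)
 finally show ?thesis .
qed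

lemma sw_one: assumes "lin3 F" shows "uu$$.a c d. F a c d = uu$.a b. uu$.c d. F a (b**c) d" (is "?L = ?R")
  and "uu$$.a c d. F a c d = uu$.a b. uu$.c d. F a (c**b) d"
proof -
 have one: "\<one>\<^sub>H:.H" by simp
 note S = sweedler3_one[OF mod_K lin3_trilinear[OF assms]] sweedler3_sw'[OF assms one]
 have L: "lin2 (%c d. F a (b**c) d)" "lin2 (%a b. uu$.c d. F a (b**c) d)"
  "lin2 (%c d. F a (c**b) d)" "lin2 (%a b. uu$.c d. F a (c**b) d)" for a b
  by (intro lin2I lin_sw_fun lin3D[OF assms] hlin_hmul_left hlin_hmul_right hlin_id)+
 have "sweedler R H K \<one>\<^sub>H (%a b. sweedler R H K \<one>\<^sub>H (%c d. F a (b \<otimes>\<^sub>H c) d)) = sw \<one>\<^sub>H (%a b. sw \<one>\<^sub>H (%c d. F a (b**c) d))"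
  by (rule sweedler_sw[OF L(2)[unfolded uu_def] one sweedler_sw[OF L(1) one]]) (simp add: hmul_def cl_id)
 then show "?L = ?R" using S by (simp add: uu_def)
 have "sweedler R H K \<one>\<^sub>H (%a b. sweedler R H K \<one>\<^sub>H (%c d. F a (c \<otimes>\<^sub>H b) d)) = sw \<one>\<^sub>H (%a b. sw \<one>\<^sub>H (%c d. F a (c**b) d))"
  by (rule sweedler_sw[OF L(4)[unfolded uu_def] one sweedler_sw[OF L(3) one]]) (simp add: hmul_def cl_id)
 then show "?L = uu$.a b. uu$.c d. F a (c**b) d" using S by (simp add: uu_def)
qed

lemma ep_mul: "ep (h**k**l) = k$.a b. ep (h**a)*:ep (b**l)" (is "?L = ?R") "ep (h**k**l) = k$.a b. ep (h**b)*:ep (a**l)"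
proof -
 have L: "lin2 (%a b. ep (h**a)*:ep (b**l))" "lin2 (%a b. ep (h**b)*:ep (a**l))"
  by (intro lin2I lin_smul_left lin_smul_right lin_ep hlin_hmul_left hlin_hmul_right hlin_id)+
 have e: "?L = counit H (cl h \<otimes>\<^sub>H cl k \<otimes>\<^sub>H cl l)" by (simp add: ep_def hmul_def cl_id)
 have "k$.a b. ep (h**a)*:ep (b**l) = sweedler R H K (cl k) (%a b. counit H (cl h \<otimes>\<^sub>H a) \<otimes> counit H (b \<otimes>\<^sub>H cl l))"
  unfolding sw_sweedler[OF L(1)] by (rule CH.sweedler_cong[OF mod_K lin2_bilinear[OF L(1)] cl_closed])
   (simp add: ep_def hmul_def cl_id smul_def sc_id lmD(1)[OF counit_linear, simplified])
 then show "?L = ?R" using e counit_mult(1)[OF cl_closed cl_closed cl_closed, of h k l] by simp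
 have "k$.a b. ep (h**b)*:ep (a**l) = sweedler R H K (cl k) (%a b. counit H (cl h \<otimes>\<^sub>H b) \<otimes> counit H (a \<otimes>\<^sub>H cl l))"
  unfolding sw_sweedler[OF L(2)] by (rule CH.sweedler_cong[OF mod_K lin2_bilinear[OF L(2)] cl_closed])
   (simp add: ep_def hmul_def cl_id smul_def sc_id lmD(1)[OF counit_linear, simplified])
 then show "?L = k$.a b. ep (h**b)*:ep (a**l)" using e counit_mult(2)[OF cl_closed cl_closed cl_closed, of h k l] by simp
qed

lemma counit_mult_linear:
 "(%h. counit H (a \<otimes>\<^sub>H h)) : Lin R H K" "(%h. counit H (h \<otimes>\<^sub>H a)) : Lin R H K" if "a:.H"
 using lm_comp[OF bilD(1)[OF mult_bilinear that] counit_linear]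
  lm_comp[OF bilD(2)[OF mult_bilinear that] counit_linear] by auto

lemma et_summand_bilinear: assumes "h:.H"
 shows "bilinear R H H H (%a b. counit H (a \<otimes>\<^sub>H h) \<odot>\<^sub>H b)" (is ?A) "bilinear R H H H (%a b. counit H (h \<otimes>\<^sub>H b) \<odot>\<^sub>H a)"
proof -
 note c = lmD(1)[OF counit_mult_linear(1), simplified] lmD(1)[OF counit_mult_linear(2), simplified]
 note L = lm_const_smult[OF mod_H mod_H counit_mult_linear(1)] lm_const_smult[OF mod_H mod_H counit_mult_linear(2)]
  lm_smult[OF mod_H mod_H lm_id]
 show ?A "bilinear R H H H (%a b. counit H (h \<otimes>\<^sub>H b) \<odot>\<^sub>H a)"
  by (rule bilI; (rule L(3)[OF c(1)[OF _ assms]] L(3)[OF c(1)[OF assms]] L(1)[OF assms] L(2)[OF assms]); assumption)+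
qed

lemma target_source_linear: "target_counit R H : Lin R H H" "source_counit R H : Lin R H H"
proof -
 note L = lm_const_smult[OF mod_H mod_H counit_mult_linear(1)] lm_const_smult[OF mod_H mod_H counit_mult_linear(2)]
 show "target_counit R H : Lin R H H" unfolding target_counit_def[abs_def]
  by (rule CH.sweedler_fun_linear[OF mod_H mod_H et_summand_bilinear(1)]) (use L in auto)
 show "source_counit R H : Lin R H H" unfolding source_counit_def[abs_def]
  by (rule CH.sweedler_fun_linear[OF mod_H mod_H et_summand_bilinear(2)]) (use L in auto)
qed

lemma et_closed [simp]: "et x:.H" and es_closed [simp]: "es x:.H"
 by (simp_all add: et_def es_def lmD(1)[OF target_source_linear(1)] lmD(1)[OF target_source_linear(2)])
lemma et_cl [simp]: "et (cl x) = et x" "cl (et x) = et x" by (simp_all add: cl_id) (simp_all add: et_def)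
lemma es_cl [simp]: "es (cl x) = es x" "cl (es x) = es x" by (simp_all add: cl_id) (simp_all add: es_def)
lemma hlin_et: "hlin g ==> hlin (%x. et (g x))"
 by (rule hlin_comp) (use hlin_linear_map[OF target_source_linear(1)] in \<open>simp_all add: et_def[abs_def]\<close>)
lemma hlin_es: "hlin g ==> hlin (%x. es (g x))"
 by (rule hlin_comp) (use hlin_linear_map[OF target_source_linear(2)] in \<open>simp_all add: es_def[abs_def]\<close>)

text \<open>Introduction rules for linearity. Nearly every rewriting step below has to show that its
  form is multilinear; the proofs extend this list, usually under the name \<open>L\<close>, by
  rules for their own functionals.\<close>

lemmas lins = lin2I lin3I lin_sw_arg lin_sw_fun lin_ep lin_smul_left lin_smul_right
 hlin_hmul_left hlin_hmul_right hlin_St hlin_Si hlin_et hlin_es hlin_id hlin_cl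

lemma sw_et_def: assumes "lin F" shows "F (et h) = uu$.a b. ep (a**h)*:F b" and "F (es h) = uu$.a b. ep (h**b)*:F a"
proof -
 note F = linD[OF assms]
 note c = lmD(1)[OF counit_mult_linear(1), simplified] lmD(1)[OF counit_mult_linear(2), simplified]
 have L: "lin2 (%a b. ep (a**h)*:F b)" "lin2 (%a b. ep (h**b)*:F a)" by (intro lins assms)+
 have one: "\<one>\<^sub>H:.H" by simp
 have "F (et h) = sweedler R H K \<one>\<^sub>H (%a b. F (counit H (a \<otimes>\<^sub>H cl h) \<odot>\<^sub>H b))"
  unfolding et_def target_counit_def by (rule CH.sweedler_comp[OF mod_H mod_K et_summand_bilinear(1) F(6) one]) simp
 also have "... = sweedler R H K \<one>\<^sub>H (%a b. ep (a**h)*:F b)"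
  by (rule CH.sweedler_cong[OF mod_K lin2_bilinear[OF L(1)] one, symmetric])
   (simp add: F c smul_def ep_def hmul_def cl_id sc_id)
 finally show "F (et h) = uu$.a b. ep (a**h)*:F b" by (subst sw_sweedler[OF L(1)]) (simp add: uu_def cl_id)
 have "F (es h) = sweedler R H K \<one>\<^sub>H (%a b. F (counit H (cl h \<otimes>\<^sub>H b) \<odot>\<^sub>H a))"
  unfolding es_def source_counit_def by (rule CH.sweedler_comp[OF mod_H mod_K et_summand_bilinear(2) F(6) one]) simp
 also have "... = sweedler R H K \<one>\<^sub>H (%a b. ep (h**b)*:F a)"
  by (rule CH.sweedler_cong[OF mod_K lin2_bilinear[OF L(2)] one, symmetric])
   (simp add: F c smul_def ep_def hmul_def cl_id sc_id)
 finally show "F (es h) = uu$.a b. ep (h**b)*:F a" by (subst sw_sweedler[OF L(2)]) (simp add: uu_def cl_id)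
qed

text \<open>The common shape of the antipode axioms: a product of linear images of the two legs of a
  coproduct, tested by a functional.\<close>

lemma sw_product: assumes "lin F" "f : Lin R H H" "g : Lin R H H"
 shows "F (sweedler R H H (cl h) (%a b. f a \<otimes>\<^sub>H g b)) = h$.a b. F (f (cl a)**g (cl b))" (is "?L = _")
proof -
 note F = linD[OF assms(1)] and f = lmD[OF assms(2)] and g = lmD[OF assms(3)]
 have b: "bilinear R H H H (%a b. f a \<otimes>\<^sub>H g b)" by (rule bilI)
  (rule lm_comp[OF assms(3) bilD(1)[OF mult_bilinear f(1)]]
   lm_comp[OF assms(2) bilD(2)[OF mult_bilinear g(1)]]; assumption)+
 have L: "lin2 (%a b. F (f (cl a)**g (cl b)))"
  by (intro lin2I lin_comp[OF assms(1)] hlin_hmul_left hlin_hmul_right hlin_linear_map assms)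
 have "?L = sweedler R H K (cl h) (%a b. F (f a \<otimes>\<^sub>H g b))"
  by (rule CH.sweedler_comp[OF mod_H mod_K b F(6) cl_closed])
 also have "... = sweedler R H K (cl h) (%a b. F (f (cl a)**g (cl b)))"
  by (rule CH.sweedler_cong[OF mod_K lin2_bilinear[OF L] cl_closed, symmetric]) (simp add: f g hmul_def cl_id)
 finally show ?thesis by (simp add: sw_sweedler[OF L])
qed

lemma sw_antipode: assumes "lin F" shows "h$.a b. F (St a**b) = F (es h)" (is "?L = _") "h$.a b. F (a**St b) = F (et h)"
  "h$.a b. a$.c d. F (St c**d**St b) = F (St h)" (is ?A)
proof -
 note F = linD[OF assms] and A = antipode_linear and Ac = lmD(1)[OF antipode_linear]
 have "?L = h$.a b. F (antipode H (cl a)**cl b)" by (simp add: St_def)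
 also have "... = F (sweedler R H H (cl h) (%a b. antipode H a \<otimes>\<^sub>H b))"
  by (rule sw_product[OF assms A lm_id, symmetric])
 finally show "?L = F (es h)" by (simp add: antipode_source es_def)
 have "h$.a b. F (a**St b) = h$.a b. F (cl a**antipode H (cl b))" by (simp add: St_def)
 also have "... = F (sweedler R H H (cl h) (%a b. a \<otimes>\<^sub>H antipode H b))"
  by (rule sw_product[OF assms lm_id A, symmetric])
 finally show "h$.a b. F (a**St b) = F (et h)" by (simp add: antipode_target et_def)
 have c: "sweedler R H H x (%a b. antipode H a \<otimes>\<^sub>H b \<otimes>\<^sub>H antipode H c) =
   source_counit R H x \<otimes>\<^sub>H antipode H c" if "x:.H" "c:.H" for x c proof -
  have b: "bilinear R H H H (%a b. antipode H a \<otimes>\<^sub>H b)"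
  proof (rule bilI)
   show "(%b. antipode H a \<otimes>\<^sub>H b) : Lin R H H" if "a:.H" for a
    by (rule bilD(1)[OF mult_bilinear Ac[OF that]])
   show "(%a. antipode H a \<otimes>\<^sub>H b) : Lin R H H" if "b:.H" for b
    by (rule lm_comp[OF A bilD(2)[OF mult_bilinear that]])
  qed
  show ?thesis using CH.sweedler_comp[OF mod_H mod_H b bilD(2)[OF mult_bilinear Ac[OF that(2)]] that(1), symmetric]
   by (simp add: antipode_source that)
 qed
 have "sweedler3 R H H (cl h) (%a b c. antipode H a \<otimes>\<^sub>H b \<otimes>\<^sub>H antipode H c) =
  sweedler R H H (cl h) (%x c. source_counit R H x \<otimes>\<^sub>H antipode H c)" proof -
  note sl = target_source_linear(2)
  have b: "bilinear R H H H (%x c. source_counit R H x \<otimes>\<^sub>H antipode H c)"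
  proof (rule bilI)
   show "(%c. source_counit R H a \<otimes>\<^sub>H antipode H c) : Lin R H H" if "a:.H" for a
    by (rule lm_comp[OF A bilD(1)[OF mult_bilinear lmD(1)[OF sl that]]])
   show "(%a. source_counit R H a \<otimes>\<^sub>H antipode H b) : Lin R H H" if "b:.H" for b
    by (rule lm_comp[OF sl bilD(2)[OF mult_bilinear Ac[OF that]]])
  qed
  show ?thesis unfolding sweedler3_def by (rule CH.sweedler_cong[OF mod_H b cl_closed, symmetric]) (simp add: c)
 qed
 then have "F (St h) = F (sweedler R H H (cl h) (%x c. source_counit R H x \<otimes>\<^sub>H antipode H c))"
  using antipode_antipode[OF cl_closed, of h] by (simp add: St_def)
 also have "... = h$.a b. F (source_counit R H (cl a)**antipode H (cl b))"
  by (rule sw_product[OF assms target_source_linear(2) A])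
 also have "... = h$.a b. F (es a**St b)" by (simp add: es_def St_def)
 also have "... = h$.a b. a$.c d. F (St c**d**St b)"
 proof -
  have *: "a$.c d. F (St c**d) = F (es a)" if "lin F" for F a
  proof -
   have "a$.c d. F (St c**d) = a$.c d. F (antipode H (cl c)**cl d)" by (simp add: St_def)
   also have "... = F (sweedler R H H (cl a) (%a b. antipode H a \<otimes>\<^sub>H b))"
    by (rule sw_product[OF that A lm_id, symmetric])
   finally show ?thesis by (simp add: antipode_source es_def)
  qed
  have "a$.c d. F (St c**d**St b) = F (es a**St b)" for a b by (rule *) (intro lin_comp[OF assms] lins)
  then show ?thesis by simp
 qed
 finally show ?A by (rule sym)
qed

section \<open>The counital subalgebras and the antipode of H\<close>

section \<open>Weak Hopf algebra identities\<close>

lemma sw_cong: "(!!a b. F a b = G a b) ==> sw h F = sw h G" by presburger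

text \<open>Congruence below two, three or four nested sums, so that a rule can be applied deep
  inside a Sweedler expression.\<close>

lemma sw_cong2: "(!!a b c d. F a b c d = G a b c d) ==> sw h (%a b. sw (k a b) (F a b)) = sw h (%a b. sw (k a b) (G a b))"
 and sw_cong3: "(!!a b c d x y. F' a b c d x y = G' a b c d x y) ==> sw h (%a b. sw (k a b) (%c d. sw (l a b c d) (F' a b c d))) =
  sw h (%a b. sw (k a b) (%c d. sw (l a b c d) (G' a b c d)))"
 and sw_cong4: "(!!a b c d x y z w. F'' a b c d x y z w = G'' a b c d x y z w) ==>
  sw h (%a b. sw (k a b) (%c d. sw (l a b c d) (%x y. sw (m a b c d x y) (F'' a b c d x y)))) =
  sw h (%a b. sw (k a b) (%c d. sw (l a b c d) (%x y. sw (m a b c d x y) (G'' a b c d x y))))" by presburger+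

lemma lin2_cl: "lin2 F ==> F (cl a) b = F a b" "lin2 F ==> F a (cl b) = F a b"
 using linD(2)[of "%a. F a b"] linD(2)[of "F a"] by (auto simp: lin2_def)

lemma H_eqI: "(!!F. lin F ==> F x = F y) ==> cl x = cl y"
 by (rule dual_basis_separates[OF mod_H basis cl_closed cl_closed]) (use lin_linear_map in blast)

text \<open>A counit is inserted behind the second leg of \<Delta>(1_1 h). Writing the middle leg of
  \<Delta>^2(1) as 1'_1 1_2 then detaches the copy of \<Delta>(1) from which \<open>et\<close> is
  made.\<close>

lemma sw_et_right: assumes F: "lin2 F" shows "h$.a b. F a (et b) = uu$.u v. F (u**h) v"
proof -
 note L = lins lin2D[OF F]
 have "uu$.u v. F (u**h) v = uu$.u v. (u**h)$.p q. ep q*:F p v"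
  by ((rule sw_counit(2)[symmetric] | rule sw_cong)+; (intro L)+)
 also have "... = uu$.u v. u$.a b. h$.c d. ep (b**d)*:F (a**c) v" by ((rule sw_mul | rule sw_cong)+; (intro L)+)
 also have "... = uu$$.u b v. h$.c d. ep (b**d)*:F (u**c) v" by (rule sw_coassoc; (intro L)+)
 also have "... = uu$.u b. uu$.u' v. h$.c d. ep (u'**b**d)*:F (u**c) v" by (rule sw_one(2); (intro L)+)
 also have "... = uu$.u' v. uu$.u b. h$.c d. ep (u'**(b**d))*:F (u**c) v" unfolding hassoc by (rule sw_swap)
 also have "... = uu$.u' v. (uu**h)$.p q. ep (u'**q)*:F p v"
  by ((rule sw_mul[symmetric] | rule sw_cong)+; (intro L)+)
 also have "... = h$.p q. uu$.u' v. ep (u'**q)*:F p v" by (simp only: hmul_uu sw_cl) (rule sw_swap)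
 also have "... = h$.a b. F a (et b)" by ((rule sw_et_def[symmetric] | rule sw_cong)+; (intro L)+)
 finally show ?thesis by (rule sym)
qed

text \<open>Mirror image of \<open>sw_et_right\<close>, with the counit inserted before the first
  leg of \<Delta>(h 1_2).\<close>

lemma sw_es_left: assumes F: "lin2 F" shows "h$.a b. F (es a) b = uu$.u v. F u (h**v)"
proof -
 note L = lins lin2D[OF F]
 have "uu$.u v. F u (h**v) = uu$.u v. (h**v)$.p q. ep p*:F u q"
  by ((rule sw_counit(1)[symmetric] | rule sw_cong)+; (intro L)+)
 also have "... = uu$.u v. h$.c d. v$.a b. ep (c**a)*:F u (d**b)" by ((rule sw_mul | rule sw_cong)+; (intro L)+)
 also have "... = uu$$.u a b. h$.c d. ep (c**a)*:F u (d**b)" by (rule sw_cong, rule sw_swap)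
 also have "... = uu$.u w. uu$.a b. h$.c d. ep (c**(a**w))*:F u (d**b)" by (rule sw_one(2); (intro L)+)
 also have "... = uu$.u w. h$.c d. uu$.a b. ep (c**a**w)*:F u (d**b)"
  unfolding hassoc by (rule sw_cong, rule sw_swap)
 also have "... = uu$.u w. (h**uu)$.p q. ep (p**w)*:F u q" by ((rule sw_mul[symmetric] | rule sw_cong)+; (intro L)+)
 also have "... = h$.p q. uu$.u w. ep (p**w)*:F u q" by (simp only: hmul_uu sw_cl) (rule sw_swap)
 also have "... = h$.a b. F (es a) b" by ((rule sw_et_def(2)[symmetric] | rule sw_cong)+; (intro L)+)
 finally show ?thesis by (rule sym)
qed

lemma sw_uu_es: "lin2 F ==> sw uu (%u v. F (es u) v) = uu$.u v. F u v"
 by (simp add: sw_es_left) (rule sw_cong, simp add: lin2_cl)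
lemma sw_uu_et: "lin2 F ==> sw uu (%u v. F u (et v)) = uu$.u v. F u v"
 by (simp add: sw_et_right) (rule sw_cong, simp add: lin2_cl)

text \<open>Expanding \<open>et\<close> leaves \<Delta>(1) between two counits, where the second
  form of weak multiplicativity, with middle argument 1, contracts it.\<close>

lemma ep_et: "ep (h**et k) = ep (h**k)"
proof -
 have "ep (h**et k) = uu$.a b. ep (a**k)*:ep (h**b)" by (rule sw_et_def; (intro lins)+)
 also have "... = ep (h**uu**k)" unfolding ep_mul(2) by (simp add: smul_comm)
 finally show ?thesis by simp
qed

lemma ep_es: "ep (es h**k) = ep (h**k)"
proof -
 have "ep (es h**k) = uu$.a b. ep (h**b)*:ep (a**k)" by (rule sw_et_def; (intro lins)+)
 also have "... = ep (h**uu**k)" unfolding ep_mul(2) ..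
 finally show ?thesis by simp
qed

text \<open>The two expressions for \<Delta>^2(1) place the factor from H_t to the left or to the
  right of 1_1. Comparing them lets such a factor change sides next to \<Delta>(1).\<close>

lemma sw_et: assumes F: "lin2 F" shows "sw (et w) F = uu$.u v. F (et w**u) v" (is "?L = ?R") "sw (et w) F = uu$.u v. F (u**et w) v"
proof -
 note L = lins lin2D[OF F]
 have 0: "?L = uu$$.a p q. ep (a**w)*:F p q" unfolding sw_smul(1)[symmetric] by (rule sw_et_def; (intro L)+)
 also have "... = uu$.a b. uu$.c d. ep (a**w)*:F (b**c) d" by (rule sw_one(1); (intro L)+)
 also have "... = uu$.c d. uu$.a b. ep (a**w)*:F (b**c) d" by (rule sw_swap)
 also have "... = ?R" by ((rule sw_et_def[symmetric] | rule sw_cong)+; (intro L)+)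
 finally show "?L = ?R" .
 have "uu$$.a p q. ep (a**w)*:F p q = uu$.a b. uu$.c d. ep (a**w)*:F (c**b) d" by (rule sw_one(2); (intro L)+)
 also have "... = uu$.c d. uu$.a b. ep (a**w)*:F (c**b) d" by (rule sw_swap)
 also have "... = uu$.u v. F (u**et w) v" by ((rule sw_et_def[symmetric] | rule sw_cong)+; (intro L)+)
 finally show "?L = uu$.u v. F (u**et w) v" using 0 by simp
qed

lemma sw_es: assumes F: "lin2 F" shows "sw (es w) F = uu$.u v. F u (es w**v)" (is "?L = ?R") "sw (es w) F = uu$.u v. F u (v**es w)"
proof -
 note L = lins lin2D[OF F]
 have "?L = uu$.a b. a$.p q. ep (w**b)*:F p q"
  unfolding sw_smul(1)[symmetric] by (rule sw_et_def(2); (intro L)+)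
 also have "... = uu$$.p q b. ep (w**b)*:F p q" by (rule sw_coassoc; (intro L)+)
 finally have 0: "?L = ..." .
 have "uu$$.p q b. ep (w**b)*:F p q = uu$.p y. uu$.q b. ep (w**b)*:F p (y**q)" by (rule sw_one(1); (intro L)+)
 also have "... = uu$.u v. F u (v**es w)" by ((rule sw_et_def(2)[symmetric] | rule sw_cong)+; (intro L)+)
 finally show "?L = uu$.u v. F u (v**es w)" using 0 by simp
 have "uu$$.p q b. ep (w**b)*:F p q = uu$.p y. uu$.q b. ep (w**b)*:F p (q**y)" by (rule sw_one(2); (intro L)+)
 also have "... = ?R" by ((rule sw_et_def(2)[symmetric] | rule sw_cong)+; (intro L)+)
 finally show "?L = ?R" using 0 by simp
qed

text \<open>Applying the counit to both outer legs of \<Delta>^2(1) leaves its middle leg, which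
  factors in the two orders by the two axioms for \<Delta>^2(1).\<close>

lemma et_es_commute: "et w**es k = es k**et w"
proof -
 have "cl (et w**es k) = cl (es k**et w)"
 proof (rule H_eqI)
  fix F assume F: "lin F"
  note L = lins lin_comp[OF F]
  have "F (et w**es k) = uu$.a b. ep (a**w)*:F (b**es k)" by (rule sw_et_def; (intro L)+)
  also have "... = uu$.a b. ep (a**w)*:sw uu (%c d. ep (k**d)*:F (b**c))"
   by (subst sw_et_def(2)[where F = "%c. F (_**c)"]; (intro L)?) (rule refl)
  also have "... = uu$.a b. uu$.c d. ep (a**w)*:(ep (k**d)*:F (b**c))" by (simp only: sw_smul)
  also have "... = uu$$.a c d. ep (a**w)*:(ep (k**d)*:F c)" by (rule sw_one(1)[symmetric]; (intro L)+)
  also have "... = uu$.a b. uu$.c d. ep (a**w)*:(ep (k**d)*:F (c**b))" by (rule sw_one(2); (intro L)+)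
  also have "... = uu$.a b. ep (a**w)*:sw uu (%c d. ep (k**d)*:F (c**b))" by (simp only: sw_smul)
  also have "... = uu$.a b. ep (a**w)*:F (es k**b)"
   by (subst sw_et_def(2)[where F = "%c. F (c**_)"]; (intro L)?) (rule refl)
  also have "... = F (es k**et w)" by (rule sw_et_def[symmetric]; (intro L)+)
  finally show "F (et w**es k) = F (es k**et w)" .
 qed
 then show ?thesis by simp
qed

lemma et_es_commute': "et w**(es k**x) = es k**(et w**x)" by (simp only: hassoc[symmetric] et_es_commute)

text \<open>Multiply the formula for \<Delta>(et w) by \<Delta>(h); the remaining \<Delta>(1) is
  absorbed because \<Delta>(1 h) = \<Delta>(h) = \<Delta>(h 1).\<close>

lemma sw_et_mul: assumes F: "lin2 F"
 shows "sw (et w**h) F = h$.a b. F (et w**a) b" (is "?L = ?R") "sw (h**et w) F = h$.a b. F (a**et w) b" (is ?A)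
proof -
 note L = lins lin2D[OF F]
 have "?L = (et w)$.a b. h$.c d. F (a**c) (b**d)" by (rule sw_mul[OF F])
 also have "... = uu$.a b. h$.c d. F (et w**(a**c)) (b**d)" by (subst sw_et(1); (intro L)?) (simp only: hassoc)
 also have "... = (uu**h)$.a b. F (et w**a) b" by (rule sw_mul[symmetric]; (intro L)+)
 finally show "?L = ?R" by simp
 have "sw (h**et w) F = (et w)$.c d. h$.a b. F (a**c) (b**d)" unfolding sw_mul[OF F] by (rule sw_swap)
 also have "... = uu$.c d. h$.a b. F (a**c**et w) (b**d)" by (subst sw_et(2); (intro L)?) (simp only: hassoc)
 also have "... = h$.a b. uu$.c d. F (a**c**et w) (b**d)" by (rule sw_swap)
 also have "... = (h**uu)$.a b. F (a**et w) b" by (rule sw_mul[symmetric]; (intro L)+)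
 finally show ?A by simp
qed

lemma sw_es_mul: assumes F: "lin2 F"
 shows "sw (es w**h) F = h$.a b. F a (es w**b)" (is "?L = ?R") "sw (h**es w) F = h$.a b. F a (b**es w)" (is ?A)
proof -
 note L = lins lin2D[OF F]
 have "?L = (es w)$.a b. h$.c d. F (a**c) (b**d)" by (rule sw_mul[OF F])
 also have "... = uu$.a b. h$.c d. F (a**c) (es w**(b**d))" by (subst sw_es(1); (intro L)?) (simp only: hassoc)
 also have "... = (uu**h)$.a b. F a (es w**b)" by (rule sw_mul[symmetric]; (intro L)+)
 finally show "?L = ?R" by simp
 have "sw (h**es w) F = (es w)$.c d. h$.a b. F (a**c) (b**d)" unfolding sw_mul[OF F] by (rule sw_swap)
 also have "... = uu$.c d. h$.a b. F (a**c) (b**d**es w)" by (subst sw_es(2); (intro L)?) (simp only: hassoc)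
 also have "... = h$.a b. uu$.c d. F (a**c) (b**d**es w)" by (rule sw_swap)
 also have "... = (h**uu)$.a b. F a (b**es w)" by (rule sw_mul[symmetric]; (intro L)+)
 finally show ?A by simp
qed

lemma et_mul_et: "et (h**et k) = et (h**k)"
proof -
 have "cl (et (h**et k)) = cl (et (h**k))" by (rule H_eqI) (simp add: sw_et_def(1) hassoc[symmetric] ep_et)
 then show ?thesis by simp
qed

lemma es_es_mul: "es (es h**k) = es (h**k)"
proof -
 have "cl (es (es h**k)) = cl (es (h**k))" by (rule H_eqI) (simp add: sw_et_def(2) hassoc ep_es)
 then show ?thesis by simp
qed

lemma et_uu [simp]: "et uu = uu" and es_uu [simp]: "es uu = uu"
proof -
 have "cl (et uu) = cl uu" by (rule H_eqI) (simp add: sw_et_def(1) sw_counit)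
 then show "et uu = uu" by simp
 have "cl (es uu) = cl uu" by (rule H_eqI) (simp add: sw_et_def(2) sw_counit)
 then show "es uu = uu" by simp
qed

lemma et_et [simp]: "et (et h) = et h" using et_mul_et[of uu h] by simp
lemma es_es [simp]: "es (es h) = es h" using es_es_mul[of h uu] by simp

text \<open>Expanding the product by the counit moves \<open>et w\<close> inside \<epsilon>. There
  the two forms of \<open>sw_et\<close> carry it across 1_1, where the definition of
  \<open>et\<close> picks it up.\<close>

lemma et_et_mul: "et (et w**k) = et w**et k"
proof -
 have "cl (et w**et k) = cl (et (et w**k))"
 proof (rule H_eqI)
  fix F assume F: "lin F"
  note L = lins lin_comp[OF F]
  have "F (et w**et k) = (et w**et k)$.p q. ep p*:F q" by (rule sw_counit(1)[symmetric, OF F])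
  also have "... = (et k)$.p q. ep (et w**p)*:F q" by (rule sw_et_mul(1); (intro L F)+)
  also have "... = uu$.u v. ep (et w**u**k)*:F v"
   by (subst sw_et(2); (intro L F)?) (simp add: hassoc[symmetric] ep_et)
  also have "... = uu$.u v. ep (u**et w**k)*:F v" using sw_et[of "%u v. ep (u**k)*:F v" w] by (simp add: L F)
  also have "... = F (et (et w**k))" using sw_et_def(1)[OF F, of "et w**k"] by (simp add: hassoc)
  finally show "F (et w**et k) = F (et (et w**k))" .
 qed
 then show ?thesis by simp
qed

lemma es_mul_es: "es (h**es w) = es h**es w"
proof -
 have "cl (es h**es w) = cl (es (h**es w))"
 proof (rule H_eqI)
  fix F assume F: "lin F"
  note L = lins lin_comp[OF F]
  have "F (es h**es w) = (es h**es w)$.p q. ep q*:F p" by (rule sw_counit(2)[symmetric, OF F])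
  also have "... = (es h)$.p q. ep (q**es w)*:F p" by (rule sw_es_mul(2); (intro L F)+)
  also have "... = uu$.u v. ep (h**(v**es w))*:F u" by (subst sw_es(1); (intro L F)?) (simp add: hassoc ep_es)
  also have "... = uu$.u v. ep (h**(es w**v))*:F u" using sw_es[of "%u v. ep (h**v)*:F u" w] by (simp add: L F)
  also have "... = F (es (h**es w))" using sw_et_def(2)[OF F, of "h**es w"] by (simp add: hassoc)
  finally show "F (es h**es w) = F (es (h**es w))" .
 qed
 then show ?thesis by simp
qed

subsection \<open>The antipode\<close>

lemma sw_St_left: "lin2 F ==> sw h (%a b. b$.c d. F (St a**c) d) = h$.a b. F (es a) b"
proof -
 assume F: "lin2 F"
 note L = lins lin2D[OF F]
 have "h$$.a c d. F (St a**c) d = h$.a b. a$.c d. F (St c**d) b" by (rule sw_coassoc[symmetric]; (intro L)+)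
 also have "... = h$.a b. F (es a) b" by ((rule sw_antipode(1) | rule sw_cong)+; (intro L)+)
 finally show ?thesis .
qed

lemma sw_St_right: "lin2 F ==> sw h (%a b. b$.c d. F (a**St c) d) = h$.a b. F (et a) b"
proof -
 assume F: "lin2 F"
 note L = lins lin2D[OF F]
 have "h$$.a c d. F (a**St c) d = h$.a b. a$.c d. F (c**St d) b" by (rule sw_coassoc[symmetric]; (intro L)+)
 also have "... = h$.a b. F (et a) b" by ((rule sw_antipode(2) | rule sw_cong)+; (intro L)+)
 finally show ?thesis .
qed

lemma sw_et_mid: assumes F: "lin3 F" shows "h$$.a c d. F a (et c) d = h$.a b. uu$.u v. F (u**a) v b" (is "?L = ?R")
proof -
 note L = lins lin3D[OF F]
 have "?L = h$.a b. a$.c d. F c (et d) b" by (rule sw_coassoc[symmetric]; (intro L)+)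
 also have "... = ?R" by ((rule sw_et_right | rule sw_cong)+; (intro L)+)
 finally show ?thesis .
qed

lemma sw_St: assumes F: "lin F" shows "h$.a b. F (es a**St b) = F (St h)" "h$.a b. F (St a**et b) = F (St h)"
proof -
 note L = lins lin_comp[OF F]
 have "h$.a b. a$.c d. F (St c**d**St b) = h$.a b. F (es a**St b)"
  by ((rule sw_antipode(1) | rule sw_cong)+; (intro L)+)
 then show "h$.a b. F (es a**St b) = F (St h)" using sw_antipode(3)[OF F] by simp
 have "h$.a b. a$.c d. F (St c**d**St b) = h$$.a c d. F (St a**(c**St d))"
  unfolding hassoc by (rule sw_coassoc; (intro L)+)
 also have "... = h$.a b. F (St a**et b)" by ((rule sw_antipode(2) | rule sw_cong)+; (intro L)+)
 finally show "h$.a b. F (St a**et b) = F (St h)" using sw_antipode(3)[OF F] by simp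
qed

text \<open>\<Delta>(h z) = h_1 z \<otimes> h_2 for z in H_t, so the target antipode axiom for h z
  is a conjugation of z by h.\<close>

lemma sw_et_conj: assumes F: "lin F" shows "h$.a b. F (a**(et k**St b)) = F (et (h**k))"
proof -
 note L = lins lin_comp[OF F]
 have "F (et (h**k)) = (h**et k)$.a b. F (a**St b)" by (subst sw_antipode(2)[OF F]) (simp only: et_mul_et)
 also have "... = h$.a b. F (a**et k**St b)" by (rule sw_et_mul(2); (intro L)+)
 finally show ?thesis by (simp only: hassoc)
qed

lemma sw_es_conj: assumes F: "lin F" shows "k$.a b. F (St a**(es h**b)) = F (es (h**k))"
proof -
 note L = lins lin_comp[OF F]
 have "F (es (h**k)) = (es h**k)$.a b. F (St a**b)" by (subst sw_antipode(1)[OF F]) (simp only: es_es_mul)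
 also have "... = k$.a b. F (St a**(es h**b))" by (rule sw_es_mul(1); (intro L)+)
 finally show ?thesis by simp
qed

text \<open>The usual convolution argument meets es(h_1 k_1) where an ordinary Hopf algebra has a
  scalar. It is rewritten as S(k_1) es(h_1) k_2; since H_s and H_t commute, the k-part then closes
  to S(k) and the h-part to S(h) independently.\<close>

lemma St_mul: "St (h**k) = St k**St h"
proof -
 have "cl (St (h**k)) = cl (St k**St h)"
 proof (rule H_eqI)
  fix F assume F: "lin F"
  note L = lins lin_comp[OF F]
  have "F (St (h**k)) = (h**k)$.x y. F (St x**et y)" by (rule sw_St(2)[OF F, symmetric])
  also have "... = h$.a b. k$.c d. F (St (a**c)**et (b**d))" by (rule sw_mul; (intro L)+)
  also have "... = h$.a b. k$.c d. b$.p q. F (St (a**c)**(p**(et d**St q)))"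
   by ((rule sw_et_conj[symmetric] | rule sw_cong)+; (intro L)+)
  also have "... = h$.a b. k$.c d. b$.p q. d$.r s. F (St (a**c)**(p**(r**St s**St q)))"
   by ((rule sw_antipode(2)[symmetric] | rule sw_cong)+; (intro L)+)
  also have "... = h$.a b. k$.c d. b$.p q. d$.r s. F (St (a**c)**(p**(r**(St s**St q))))" by (simp only: hassoc)
  also have "... = h$$.a p q. k$$.c r s. F (St (a**c)**(p**(r**(St s**St q))))" by (rule sw_cong, rule sw_swap)
  also have "... = h$$.a p q. k$.y s. y$.c r. F (St (a**c)**(p**(r**(St s**St q))))"
   by (rule sw_cong2, rule sw_coassoc[symmetric]; (intro L)+)
  also have "... = h$.x q. x$.a p. k$.y s. y$.c r. F (St (a**c)**(p**(r**(St s**St q))))"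
   by (rule sw_coassoc[symmetric]; (intro L)+)
  also have "... = h$.x q. k$.y s. x$.a p. y$.c r. F (St (a**c)**(p**r**(St s**St q)))"
   unfolding hassoc by (rule sw_cong, rule sw_swap)
  also have "... = h$.x q. k$.y s. (x**y)$.m n. F (St m**(n**(St s**St q)))"
   by (rule sw_cong2, rule sw_mul[symmetric]; (intro L)+)
  also have "... = h$.x q. k$.y s. F (es (x**y)**(St s**St q))"
   unfolding hassoc[symmetric, of "St _"] by (rule sw_cong2, rule sw_antipode(1); (intro L)+)
  also have "... = h$.x q. k$.y s. y$.c r. F (St c**(es x**r)**(St s**St q))"
   by (rule sw_cong2, rule sw_es_conj[symmetric]; (intro L)+)
  also have "... = h$.x q. k$$.c r s. F (St c**(es x**r)**(St s**St q))"
   by (rule sw_cong, rule sw_coassoc; (intro L)+)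
  also have "... = h$.x q. k$$.c r s. F (St c**(es x**(r**St s**St q)))" by (simp only: hassoc)
  also have "... = h$.x q. k$.c w. F (St c**(es x**(et w**St q)))"
   by (rule sw_cong2, rule sw_antipode(2); (intro L)+)
  also have "... = h$.x q. k$.c w. F (St c**et w**(es x**St q))" by (simp only: hassoc et_es_commute')
  also have "... = h$.x q. F (St k**(es x**St q))" by (rule sw_cong, rule sw_St(2); (intro L)+)
  also have "... = F (St k**St h)" by (rule sw_St(1); (intro L)+)
  finally show "F (St (h**k)) = F (St k**St h)" .
 qed
 then show ?thesis by simp
qed

lemma St_uu [simp]: "St uu = uu"
proof -
 have "cl (St uu) = cl uu"
 proof (rule H_eqI)
  fix F assume F: "lin F"
  note L = lins lin_comp[OF F]
  have "F (St uu) = uu$.a b. F (St a**et b)" by (rule sw_St(2)[OF F, symmetric])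
  also have "... = uu$.a b. F (St a**b)" by (rule sw_uu_et; (intro L)+)
  also have "... = F uu" by (simp add: sw_antipode(1)[OF F])
  finally show "F (St uu) = F uu" .
 qed
 then show ?thesis by simp
qed

text \<open>For y in H_s the coproduct 1_1 \<otimes> y 1_2 carries y in one leg only, so y_1 S(y_2)
  = 1_1 S(1_2) S(y) = S(y). The case of H_t is symmetric.\<close>

lemma St_es_et: "St (es w) = et (es w)" and St_et_es: "St (et w) = es (et w)"
proof -
 have "cl (et (es w)) = cl (St (es w))"
 proof (rule H_eqI)
  fix F assume F: "lin F"
  note L = lins lin_comp[OF F]
  have "F (et (es w)) = (es w)$.a b. F (a**St b)" by (rule sw_antipode(2)[OF F, symmetric])
  also have "... = uu$.u v. F (u**St v**St (es w))" by (subst sw_es(1); (intro L)?) (simp only: St_mul hassoc)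
  also have "... = F (et uu**St (es w))" by (rule sw_antipode(2); (intro L)+)
  finally show "F (et (es w)) = F (St (es w))" by simp
 qed
 then show "St (es w) = et (es w)" by simp
 have "cl (es (et w)) = cl (St (et w))"
 proof (rule H_eqI)
  fix F assume F: "lin F"
  note L = lins lin_comp[OF F]
  have "F (es (et w)) = (et w)$.a b. F (St a**b)" by (rule sw_antipode(1)[OF F, symmetric])
  also have "... = uu$.u v. F (St (et w)**(St u**v))" by (subst sw_et(2); (intro L)?) (simp only: St_mul hassoc)
  also have "... = F (St (et w)**es uu)" by (rule sw_antipode(1); (intro L)+)
  finally show "F (es (et w)) = F (St (et w))" by simp
 qed
 then show "St (et w) = es (et w)" by simp
qed

text \<open>\<Delta>(1) lies in H_s \<otimes> H_t, and there S agrees with \<open>et\<close> and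
  with \<open>es\<close> respectively.\<close>

lemma sw_uu_St: assumes F: "lin2 F"
 shows "uu$.u v. F (St u) v = uu$.u v. F (et u) v" (is "?L = ?R") "uu$.u v. F u (St v) = uu$.u v. F u (es v)" (is ?A)
proof -
 note L = lins lin2D[OF F]
 have "?L = uu$.u v. F (St (es u)) v" by (rule sw_uu_es[symmetric]; (intro L)+)
 also have "... = ?R" unfolding St_es_et by (rule sw_uu_es; (intro L)+)
 finally show "?L = ?R" .
 have "uu$.u v. F u (St v) = uu$.u v. F u (St (et v))" by (rule sw_uu_et[symmetric]; (intro L)+)
 also have "... = uu$.u v. F u (es v)" unfolding St_et_es by (rule sw_uu_et; (intro L)+)
 finally show ?A .
qed

text \<open>Inserting the definition of \<open>et\<close> puts \<Delta>(1) between two counits, and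
  weak multiplicativity of the counit contracts it.\<close>

lemma sw_uu_ep: assumes F: "lin F"
 shows "uu$.u v. ep (v**h)*:F (et u) = F (et h)" (is "?L = _") "uu$.u v. ep (h**u)*:F (es v) = F (es h)" (is ?A)
proof -
 note L = lins lin_comp[OF F]
 have "?L = uu$.u v. uu$.a b. ep (a**u)*:ep (v**h)*:F b"
  unfolding sw_et_def(1)[OF F] sw_smul by (simp only: smul_assoc smul_left_comm[of _ "ep (_**h)"])
 also have "... = uu$.a b. uu$.u v. ep (a**u)*:ep (v**h)*:F b" by (rule sw_swap)
 also have "... = uu$.a b. ep (a**h)*:F b" by (simp only: sw_smul(2)[symmetric] ep_mul(1)[symmetric] hmul_uu cl_hmul)
 finally show "?L = F (et h)" by (simp only: sw_et_def(1)[OF F])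
 have "uu$.u v. ep (h**u)*:F (es v) = uu$.u v. uu$.a b. ep (h**u)*:ep (v**b)*:F a"
  by (simp only: sw_et_def(2)[OF F] sw_smul smul_assoc)
 also have "... = uu$.a b. uu$.u v. ep (h**u)*:ep (v**b)*:F a" by (rule sw_swap)
 also have "... = uu$.a b. ep (h**b)*:F a" by (simp only: sw_smul(2)[symmetric] ep_mul(1)[symmetric] hmul_uu cl_hmul)
 finally show ?A by (simp only: sw_et_def(2)[OF F])
qed

text \<open>After S is replaced by \<open>es\<close> and \<open>et\<close> on the two legs, one of
  them is expanded and \<open>sw_uu_ep\<close> removes the original copy of \<Delta>(1). This is the
  case h = 1 of \<open>sw_St_anti\<close>.\<close>

lemma sw_uu_flip: assumes F: "lin2 F" shows "uu$.u v. F (St v) (St u) = uu$.u v. F u v" (is "?L = ?R")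
proof -
 note L = lins lin2D[OF F]
 have "?L = uu$.u v. F (St v) (et u)" by (rule sw_uu_St; (intro L)+)
 also have "... = uu$.u v. F (es v) (et u)" by (rule sw_uu_St; (intro L)+)
 also have "... = uu$.u v. uu$.a b. ep (v**b)*:F a (et u)" by ((rule sw_et_def(2) | rule sw_cong)+; (intro L)+)
 also have "... = uu$.a b. uu$.u v. ep (v**b)*:F a (et u)" by (rule sw_swap)
 also have "... = uu$.a b. F a (et b)" by ((rule sw_uu_ep | rule sw_cong)+; (intro L)+)
 also have "... = ?R" by (rule sw_uu_et[OF F])
 finally show ?thesis .
qed

text \<open>The right-hand side is \<Delta>(h_1 S(h_2)) computed as if S already reversed
  coproducts. It is proved independently because it is an ingredient of that very fact.\<close>

lemma sw_et_split: assumes F: "lin2 F" shows "sw (et h) F = h$$.a b x. x$.c d. F (a**St d) (b**St c)"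
proof -
 note L = lins lin2D[OF F]
 have "h$$.a b x. x$.c d. F (a**St d) (b**St c) = h$$.a b d. F (a**St d) (et b)"
  by (rule sw_cong, rule sw_St_right; (intro L)+)
 also have "... = h$.a d. uu$.u v. F (u**a**St d) v" by (rule sw_et_mid; (intro L)+)
 also have "... = uu$.u v. h$.a d. F (u**(a**St d)) v" unfolding hassoc by (rule sw_swap)
 also have "... = uu$.u v. F (u**et h) v" by (rule sw_cong, rule sw_antipode(2); (intro L)+)
 finally show ?thesis by (simp only: sw_et(2)[OF F])
qed

lemma sw_es_split: assumes F: "lin2 F" shows "sw (es h) F = h$$.a b x. x$.c d. F (St b**c) (St a**d)"
proof -
 note L = lins lin2D[OF F]
 have "h$$.a b x. x$.c d. F (St b**c) (St a**d) = h$$.a b d. F (es b) (St a**d)"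
  by (rule sw_cong, rule sw_St_left; (intro L)+)
 also have "... = h$.a w. uu$.u v. F u (St a**(w**v))" by (rule sw_cong, rule sw_es_left; (intro L)+)
 also have "... = uu$.u v. h$.a w. F u (St a**w**v)" unfolding hassoc by (rule sw_swap)
 also have "... = uu$.u v. F u (es h**v)" by (rule sw_cong, rule sw_antipode(1); (intro L)+)
 finally show ?thesis by (simp only: sw_es(1)[OF F])
qed

text \<open>In \<Delta>(S(h_1) et(h_2)) the factor \<Delta>(et(h_2)) is split so that
  \<Delta>(S(h_1)) meets \<Delta>(h_2) and becomes \<Delta>(es(h_1)), which is known as well. A
  factor \<Delta>(1) survives; \<open>sw_St_anti\<close> removes it.\<close>

lemma sw_St_aux: assumes F: "lin2 F" shows "sw (St h) F = h$.a b. uu$.u v. F (St b**u) (St a**v)" (is "?L = ?R")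
proof -
 note L = lins lin2D[OF F]
 have "?L = h$.a b. sw (St a**et b) F" by (rule sw_St(2)[symmetric]; (intro L)+)
 also have "... = h$.a b. (St a)$.p q. (et b)$.r s. F (p**r) (q**s)" by (rule sw_cong, rule sw_mul[OF F])
 also have "... = h$.a b. (St a)$.p q. b$$.b1 b2 x. x$.c d. F (p**(b1**St d)) (q**(b2**St c))"
  by (rule sw_cong2, rule sw_et_split; (intro L)+)
 also have "... = h$$.a b1 w. (St a)$.p q. w$$.b2 c d. F (p**(b1**St d)) (q**(b2**St c))"
  by (rule sw_cong, rule sw_swap)
 also have "... = h$$.a b1 w. w$.b2 x. (St a)$.p q. x$.c d. F (p**(b1**St d)) (q**(b2**St c))"
  by (rule sw_cong2, rule sw_swap)
 also have "... = h$$.a y x. y$.b1 b2. (St a)$.p q. x$.c d. F (p**(b1**St d)) (q**(b2**St c))"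
  by (rule sw_cong, rule sw_coassoc[symmetric]; (intro L)+)
 also have "... = h$$.a y x. (St a)$.p q. y$.b1 b2. x$.c d. F (p**b1**St d) (q**b2**St c)"
  unfolding hassoc by (rule sw_cong2, rule sw_swap)
 also have "... = h$$.a y x. (St a**y)$.m n. x$.c d. F (m**St d) (n**St c)"
  by (rule sw_cong2, rule sw_mul[symmetric]; (intro L)+)
 also have "... = h$.w x. w$.a y. (St a**y)$.m n. x$.c d. F (m**St d) (n**St c)"
  by (rule sw_coassoc[symmetric]; (intro L)+)
 also have "... = h$.w x. (es w)$.m n. x$.c d. F (m**St d) (n**St c)"
  by (rule sw_cong, rule sw_antipode(1); (intro L)+)
 also have "... = h$.w x. w$$.a b y. y$.c' d'. x$.c d. F (St b**c'**St d) (St a**d'**St c)"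
  by (rule sw_cong, rule sw_es_split; (intro L)+)
 also have "... = h$$.a w' x. w'$$.b c' d'. x$.c d. F (St b**c'**St d) (St a**d'**St c)"
  by (rule sw_coassoc; (intro L)+)
 also have "... = h$$.a b v'. v'$.y x. y$.c' d'. x$.c d. F (St b**c'**St d) (St a**d'**St c)"
  by (rule sw_cong, rule sw_coassoc; (intro L)+)
 also have "... = h$$.a b v'. v'$$.c' d' x. x$.c d. F (St b**c'**St d) (St a**(d'**St c))"
  unfolding hassoc by (rule sw_cong2, rule sw_coassoc; (intro L)+)
 also have "... = h$$.a b v'. v'$$.c' d' d. F (St b**c'**St d) (St a**et d')"
  by (rule sw_cong3, rule sw_St_right; (intro L)+)
 also have "... = h$$.a b v'. v'$.c' d. uu$.u w. F (St b**(u**c')**St d) (St a**w)"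
  by (rule sw_cong2, rule sw_et_mid; (intro L)+)
 also have "... = h$$.a b v'. uu$.u w. v'$.c' d. F (St b**(u**(c'**St d))) (St a**w)"
  unfolding hassoc by (rule sw_cong2, rule sw_swap)
 also have "... = h$$.a b v'. uu$.u w. F (St b**(u**et v')) (St a**w)"
  by (rule sw_cong3, rule sw_antipode(2); (intro L)+)
 also have "... = h$$.a b v'. uu$.u w. F (St b**(et v'**u)) (St a**w)"
  by (rule sw_cong2, rule trans[OF sw_et(2)[symmetric] sw_et(1)]; (intro L)+)
 also have "... = h$.a v. uu$.u w. v$.b v'. F (St b**et v'**u) (St a**w)"
  unfolding hassoc by (rule sw_cong, rule sw_swap)
 also have "... = ?R" by (rule sw_cong2, rule sw_St(2); (intro L)+)
 finally show ?thesis .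
qed

text \<open>Writing h as 1 h places a flipped copy of \<Delta>(1) next to the \<Delta>(1) left over
  in \<open>sw_St_aux\<close>.\<close>

lemma sw_St_anti: assumes F: "lin2 F" shows "sw (St h) F = h$.a b. F (St b) (St a)"
proof -
 note L = lins lin2D[OF F]
 \<comment> \<open>Both sides are the coproduct of S(1) = 1: the left one by the auxiliary lemma,
   the right one by the flip.\<close>
 have *: "uu$.p q. uu$.u v. G (St q**u) (St p**v) = uu$.p q. G (St q) (St p)" if "lin2 G" for G
  using sw_St_aux[OF that, of uu] sw_uu_flip[OF that] by simp
 have "sw (St h) F = (uu**h)$.a b. uu$.u v. F (St b**u) (St a**v)" by (simp add: sw_St_aux[OF F])
 also have "... = uu$.p q. h$.a b. uu$.u v. F (St b**(St q**u)) (St a**(St p**v))"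
  unfolding hassoc[symmetric] St_mul[symmetric] by (rule sw_mul; (intro L)+)
 also have "... = h$.a b. uu$.p q. uu$.u v. F (St b**(St q**u)) (St a**(St p**v))" by (rule sw_swap)
 also have "... = h$.a b. uu$.p q. F (St b**St q) (St a**St p)" by (rule sw_cong, rule *; (intro L)+)
 also have "... = uu$.p q. h$.a b. F (St (q**b)) (St (p**a))" unfolding St_mul by (rule sw_swap)
 also have "... = (uu**h)$.a b. F (St b) (St a)" by (rule sw_mul[symmetric]; (intro L)+)
 finally show ?thesis by simp
qed

lemma ep_St [simp]: "ep (St h) = ep h"
proof -
 have "ep (St h) = h$.a b. ep (St a**et b)" by (rule sw_St(2)[symmetric]; (intro lins)+)
 also have "... = h$.a b. ep (St a**b)" by (simp only: ep_et)
 also have "... = ep (es h)" by (rule sw_antipode(1); (intro lins)+)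
 also have "... = uu$.a b. ep (h**b)*:ep a" by (rule sw_et_def(2); (intro lins)+)
 also have "... = ep (h**uu)" using sw_counit(1)[of "%b. ep (h**b)" uu] by (simp add: smul_comm lins)
 finally show ?thesis by simp
qed

text \<open>Since S reverses products and coproducts, it interchanges the two antipode
  axioms.\<close>

lemma et_St: "et (St h) = St (es h)" and es_St: "es (St h) = St (et h)"
proof -
 have "cl (et (St h)) = cl (St (es h))"
 proof (rule H_eqI)
  fix F assume F: "lin F"
  note L = lins lin_comp[OF F]
  have "F (et (St h)) = (St h)$.a b. F (a**St b)" by (rule sw_antipode(2)[OF F, symmetric])
  also have "... = h$.a b. F (St (St a**b))" unfolding St_mul by (rule sw_St_anti; (intro L)+)
  also have "... = F (St (es h))" by (rule sw_antipode(1); (intro L)+)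
  finally show "F (et (St h)) = F (St (es h))" .
 qed
 then show "et (St h) = St (es h)" by simp
 have "cl (es (St h)) = cl (St (et h))"
 proof (rule H_eqI)
  fix F assume F: "lin F"
  note L = lins lin_comp[OF F]
  have "F (es (St h)) = (St h)$.a b. F (St a**b)" by (rule sw_antipode(1)[OF F, symmetric])
  also have "... = h$.a b. F (St (a**St b))" unfolding St_mul by (rule sw_St_anti; (intro L)+)
  also have "... = F (St (et h))" by (rule sw_antipode(2); (intro L)+)
  finally show "F (es (St h)) = F (St (et h))" .
 qed
 then show "es (St h) = St (et h)" by simp
qed

lemma Si_mul: "Si (h**k) = Si k**Si h"
proof -
 have "Si (h**k) = Si (St (Si k**Si h))" by (simp add: St_mul)
 then show ?thesis by (simp only: Si_St cl_hmul)
qed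

lemma Si_uu [simp]: "Si uu = uu" using Si_St[of uu] by simp
lemma ep_Si [simp]: "ep (Si h) = ep h" using ep_St[of "Si h"] by simp
lemma et_Si: "et (Si h) = Si (es h)" using es_St[of "Si h"] Si_St[of "et (Si h)"] by simp
lemma es_Si: "es (Si h) = Si (et h)" using et_St[of "Si h"] Si_St[of "es (Si h)"] by simp

lemma sw_Si_anti: assumes F: "lin2 F" shows "sw (Si h) F = h$.a b. F (Si b) (Si a)"
proof -
 note L = lins lin2D[OF F]
 have "(St (Si h))$.a b. F (Si b) (Si a) = (Si h)$.a b. F (Si (St a)) (Si (St b))" by (rule sw_St_anti; (intro L)+)
 also have "... = sw (Si h) F" by (rule sw_cong) (simp add: lin2_cl[OF F])
 finally show ?thesis by simp
qed

text \<open>These are the antipode axioms seen through S^-1, which reverses the order of the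
  factors.\<close>

lemma sw_Si: assumes F: "lin F" shows "h$.a b. F (b**Si a) = F (Si (et h))" (is "?L = ?R") "h$.a b. F (Si b**a) = F (Si (es h))"
proof -
 note L = lins lin_comp[OF F]
 have c: "F (x**cl y) = F (x**y)" "F (cl x**y) = F (x**y)" for x y by simp_all
 have "h$.a b. F (Si (a**St b)) = ?R" by (rule sw_antipode(2); (intro L)+)
 then show "?L = ?R" by (simp add: Si_mul)
 have "h$.a b. F (Si (St a**b)) = F (Si (es h))" by (rule sw_antipode(1); (intro L)+)
 then show "h$.a b. F (Si b**a) = F (Si (es h))" by (simp add: Si_mul)
qed

subsection \<open>Separability idempotents\<close>

text \<open>A counit is inserted as for \<open>sw_et_right\<close>. As \<open>et\<close> now sits on
  the first leg, et(1_1) appears, which is S(1_1).\<close>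

lemma sw_et_left: assumes F: "lin2 F" shows "h$.a b. F (et a) b = uu$.u v. F (St u) (v**h)"
proof -
 note L = lins lin2D[OF F]
 have "uu$.u v. F (St u) (v**h) = uu$.u v. F (et u) (v**h)" by (rule sw_uu_St; (intro L)+)
 also have "... = uu$.u v. (v**h)$.p q. ep p*:F (et u) q" by (rule sw_cong, rule sw_counit(1)[symmetric]; (intro L)+)
 also have "... = uu$$.u a b. h$.c d. ep (a**c)*:F (et u) (b**d)" by (rule sw_cong, rule sw_mul; (intro L)+)
 also have "... = uu$.u w. uu$.a b. h$.c d. ep (w**a**c)*:F (et u) (b**d)" by (rule sw_one(1); (intro L)+)
 also have "... = uu$.a b. uu$.u w. h$.c d. ep (w**(a**c))*:F (et u) (b**d)" unfolding hassoc by (rule sw_swap)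
 also have "... = uu$.a b. h$.c d. uu$.u w. ep (w**(a**c))*:F (et u) (b**d)" by (rule sw_cong, rule sw_swap)
 also have "... = uu$.a b. h$.c d. F (et (a**c)) (b**d)" by (rule sw_cong2, rule sw_uu_ep(1); (intro L)+)
 also have "... = (uu**h)$.a b. F (et a) b" by (rule sw_mul[symmetric]; (intro L)+)
 finally show ?thesis by simp
qed

lemma sw_es_right: assumes F: "lin2 F" shows "h$.a b. F a (es b) = uu$.u v. F (h**u) (St v)"
proof -
 note L = lins lin2D[OF F]
 have "uu$.u v. F (h**u) (St v) = uu$.u v. F (h**u) (es v)" by (rule sw_uu_St; (intro L)+)
 also have "... = uu$.u v. (h**u)$.p q. ep q*:F p (es v)" by (rule sw_cong, rule sw_counit(2)[symmetric]; (intro L)+)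
 also have "... = uu$.u v. h$.c d. u$.a b. ep (d**b)*:F (c**a) (es v)" by (rule sw_cong, rule sw_mul; (intro L)+)
 also have "... = uu$.u v. u$.a b. h$.c d. ep (d**b)*:F (c**a) (es v)" by (rule sw_cong, rule sw_swap)
 also have "... = uu$$.a b v. h$.c d. ep (d**b)*:F (c**a) (es v)" by (rule sw_coassoc; (intro L)+)
 also have "... = uu$.a w. uu$.b v. h$.c d. ep (d**(w**b))*:F (c**a) (es v)" by (rule sw_one(1); (intro L)+)
 also have "... = uu$.a w. h$.c d. uu$.b v. ep (d**w**b)*:F (c**a) (es v)"
  unfolding hassoc by (rule sw_cong, rule sw_swap)
 also have "... = uu$.a w. h$.c d. F (c**a) (es (d**w))" by (rule sw_cong2, rule sw_uu_ep(2); (intro L)+)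
 also have "... = h$.c d. uu$.a w. F (c**a) (es (d**w))" by (rule sw_swap)
 also have "... = (h**uu)$.a b. F a (es b)" by (rule sw_mul[symmetric]; (intro L)+)
 finally show ?thesis by simp
qed

text \<open>For z in H_t both sides equal et(z_1) \<otimes> z_2. This is the Casimir property of
  S(1_1) \<otimes> 1_2, the separability idempotent of H_t.\<close>

lemma sw_uu_et_shift: assumes F: "lin2 F" shows "uu$.u v. F (et w**St u) v = uu$.u v. F (St u) (v**et w)"
proof -
 note L = lins lin2D[OF F]
 have "uu$.u v. F (St u) (v**et w) = (et w)$.a b. F (et a) b" by (rule sw_et_left[OF F, symmetric])
 also have "... = uu$.u v. F (et w**et u) v" unfolding et_et_mul[symmetric] by (rule sw_et(1); (intro L)+)
 also have "... = uu$.u v. F (et w**St u) v" by (rule sw_uu_St(1)[symmetric]; (intro L)+)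
 finally show ?thesis by (rule sym)
qed

lemma sw_uu_es_shift: assumes F: "lin2 F" shows "uu$.u v. F (es w**u) (St v) = uu$.u v. F u (St v**es w)" (is "?L = ?R")
proof -
 note L = lins lin2D[OF F]
 have "?L = (es w)$.a b. F a (es b)" by (rule sw_es_right[OF F, symmetric])
 also have "... = uu$.u v. F u (es v**es w)" unfolding es_mul_es[symmetric] by (rule sw_es(2); (intro L)+)
 also have "... = ?R" by (rule sw_uu_St(2)[symmetric]; (intro L)+)
 finally show ?thesis .
qed

text \<open>The case h = 1 is the Casimir identity of H_t read through S^-1; multiplying it by
  \<Delta>(h) from the left gives the rest. Elements of H_s thus move to the other leg at the price
  of S.\<close>

lemma sw_es_slide: assumes F: "lin2 F" shows "h$.a b. F (a**es w) b = h$.a b. F a (b**St (es w))"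
proof -
 note L = lins lin2D[OF F]
 have *: "uu$.u v. G (u**es w) v = uu$.u v. G u (v**St (es w))" if G: "lin2 G" for G
 proof -
  have "uu$.u v. G (Si (et (St w)**St u)) v = uu$.u v. G (Si (St u)) (v**et (St w))"
   by (rule sw_uu_et_shift; (intro lins lin2D[OF G])+)
  then show ?thesis by (simp add: Si_mul et_St lin2_cl[OF G])
 qed
 have "h$.a b. F (a**es w) b = (h**uu)$.a b. F (a**es w) b" by simp
 also have "... = h$.a b. uu$.u v. F (a**(u**es w)) (b**v)" unfolding hassoc[symmetric] by (rule sw_mul; (intro L)+)
 also have "... = h$.a b. uu$.u v. F (a**u) (b**(v**St (es w)))" by (rule sw_cong, rule *; (intro L)+)
 also have "... = (h**uu)$.a b. F a (b**St (es w))"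
  unfolding hassoc[symmetric] by (rule sw_mul[symmetric]; (intro L)+)
 finally show ?thesis by simp
qed

text \<open>Counterpart of \<open>sw_es_slide\<close>: the case h = 1 comes from the idempotent of
  H_s, and \<Delta>(h) is multiplied from the right.\<close>

lemma sw_et_slide: assumes F: "lin2 F" shows "h$.a b. F (St (et w)**a) b = h$.a b. F a (et w**b)"
proof -
 note L = lins lin2D[OF F]
 have *: "uu$.u v. G (St (et w)**u) v = uu$.u v. G u (et w**v)" if G: "lin2 G" for G
 proof -
  have "uu$.u v. G (es (St w)**u) (Si (St v)) = uu$.u v. G u (Si (St v**es (St w)))"
   by (rule sw_uu_es_shift; (intro lins lin2D[OF G])+)
  then show ?thesis by (simp add: Si_mul es_St lin2_cl[OF G])
 qed
 have "h$.a b. F (St (et w)**a) b = (uu**h)$.a b. F (St (et w)**a) b" by simp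
 also have "... = uu$.u v. h$.a b. F (St (et w)**u**a) (v**b)" unfolding hassoc by (rule sw_mul; (intro L)+)
 also have "... = uu$.u v. h$.a b. F (u**a) (et w**v**b)" by (rule *; (intro L)+)
 also have "... = (uu**h)$.a b. F a (et w**b)" unfolding hassoc by (rule sw_mul[symmetric]; (intro L)+)
 finally show ?thesis by simp
qed

section \<open>The structure of the double as scalar identities in H\<close>

section \<open>Functionals on the double\<close>

text \<open>
  A functional \<open>ph\<close> on the double corresponds to an endomorphism \<open>tw\<close> of \<open>H\<close> through
  \<open>ph [f \<otimes> h] = f (tw h)\<close>; the relations defining the double turn into the two twisted linearity
  conditions below.
\<close>

definition twisted :: "('h => 'h) => bool"
 where "twisted tw <-> hlin tw \<and> (\<forall>x. cl (tw x) = tw x) \<and>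
  (\<forall>w h. tw (et w**h) = et w**tw h) \<and> (\<forall>w h. tw (es w**h) = tw h**St (es w))"

text \<open>The value of the functional of \<open>tw\<close> on the product \<open>[f \<otimes> h] [g \<otimes> k]\<close>.\<close>

definition prd :: "('h => 'h) => ('h => 'a) => 'h => ('h => 'a) => 'h => 'a"
 where "prd tw f h g k = h$$.a b c. (tw (b**k))$.u v. f v*:g (St a**(u**c))"

lemma twistedD: assumes "twisted tw" shows "hlin tw" "cl (tw x) = tw x" "tw (cl x) = tw x" "tw (et w**h) = et w**tw h"
  "tw (es w**h) = tw h**St (es w)" "hlin g ==> hlin (%x. tw (g x))"
proof -
 show "hlin tw" "cl (tw x) = tw x" "tw (et w**h) = et w**tw h" "tw (es w**h) = tw h**St (es w)"
  using assms by (simp_all add: twisted_def)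
 then show "tw (cl x) = tw x" "hlin g ==> hlin (%x. tw (g x))"
  using hlinD(1)[of tw x] assms hlin_comp[of tw g] by (simp_all add: twisted_def)
qed

lemma sw_et_one: assumes F: "lin F" shows "h$.a b. F (et a**b) = F h"
proof -
 note L = lins lin_comp[OF F]
 have "h$.a b. F (et a**b) = uu$.u v. F (St u**v**h)" unfolding hassoc by (rule sw_et_left; (intro L)+)
 also have "... = F (es uu**h)" by (rule sw_antipode(1); (intro L)+)
 finally show ?thesis by (simp add: linD[OF F])
qed

text \<open>The first leg of \<Delta>(1) lies in H_s, so the second relation of \<open>tw\<close>
  applies to it. This and the next lemmas let twisted maps swallow copies of \<Delta>(1).\<close>

lemma tw_left: assumes tw: "twisted tw" and F: "lin2 F" shows "uu$.u v. F (tw (u**h)) v = uu$.u v. F (tw h**St u) v" (is "?L = ?R")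
proof -
 note T = twistedD[OF tw] and L = lins lin2D[OF F] twistedD(6)[OF tw]
 have "?L = uu$.u v. F (tw (es u**h)) v" by (rule sw_uu_es[symmetric]; (intro L)+)
 also have "... = ?R" unfolding T(5) by (rule sw_uu_es; (intro L)+)
 finally show ?thesis .
qed

lemma tw_right: assumes tw: "twisted tw" and F: "lin2 F" shows "uu$.u v. F u (tw (v**h)) = uu$.u v. F u (v**tw h)" (is "?L = ?R")
proof -
 note T = twistedD[OF tw] and L = lins lin2D[OF F] twistedD(6)[OF tw]
 have "?L = uu$.u v. F u (tw (et v**h))" by (rule sw_uu_et[symmetric]; (intro L)+)
 also have "... = ?R" unfolding T(4) by (rule sw_uu_et; (intro L)+)
 finally show ?thesis .
qed

lemma tw_left_St: assumes tw: "twisted tw" and F: "lin F" shows "uu$.u v. F (tw (u**h)**v) = F (tw h)"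
proof -
 note T = twistedD[OF tw] and L = lins lin_comp[OF F] twistedD(6)[OF tw]
 have "uu$.u v. F (tw (u**h)**v) = uu$.u v. F (tw h**(St u**v))"
  unfolding hassoc[symmetric] by (rule tw_left[OF tw]; (intro L)+)
 also have "... = F (tw h**es uu)" by (rule sw_antipode(1); (intro L)+)
 finally show ?thesis by (simp add: T)
qed

lemma tw_right_St: assumes tw: "twisted tw" and F: "lin F" shows "uu$.u v. F (St u**tw (v**h)) = F (tw h)"
proof -
 note T = twistedD[OF tw] and L = lins lin_comp[OF F] twistedD(6)[OF tw]
 have "uu$.u v. F (St u**tw (v**h)) = uu$.u v. F (St u**v**tw h)"
  unfolding hassoc by (rule tw_right[OF tw]; (intro L)+)
 also have "... = F (es uu**tw h)" by (rule sw_antipode(1); (intro L)+)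
 finally show ?thesis by (simp add: T)
qed

lemma tw_pair: assumes tw: "twisted tw" and sg: "twisted sg" and F: "lin F"
 shows "uu$.u v. F (tw (u**h)**sg (v**k)) = F (tw h**sg k)" (is "?L = ?R")
proof -
 note L = lins lin_comp[OF F] twistedD(6)[OF tw] twistedD(6)[OF sg]
 have "?L = uu$.u v. F (tw (u**h)**v**sg k)"
  unfolding hassoc by (rule tw_right[OF sg]; (intro L)+)
 also have "... = ?R" by (rule tw_left_St[OF tw]; (intro L)+)
 finally show ?thesis .
qed

text \<open>For z in H_t one has \<Delta>(x z) = x_1 z \<otimes> x_2, so 1_2 may enter the
  coproduct, where tw(1_1 h) 1_2 = tw(h).\<close>

lemma tw_absorb: assumes tw: "twisted tw" and F: "lin2 F" shows "uu$.u v. (tw (u**h))$.x y. F (x**v) y = sw (tw h) F" (is "?L = ?R")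
proof -
 note T = twistedD[OF tw] and L = lins lin2D[OF F] twistedD(6)[OF tw]
 have "?L = uu$.u v. (tw (u**h))$.x y. F (x**et v) y"
  by (rule sw_uu_et[symmetric]; (intro L)+)
 also have "... = uu$.u v. sw (tw (u**h)**et v) F" by (rule sw_cong, rule sw_et_mul(2)[symmetric]; (intro L F)+)
 also have "... = uu$.u v. sw (tw (u**h)**v) F" by (rule sw_uu_et; (intro L)+)
 also have "... = ?R" by (rule tw_left_St[OF tw]; (intro L)+)
 finally show ?thesis .
qed

text \<open>With \<epsilon> in the first place only \<Delta>^2(1) remains around \<open>tw\<close>.
  Split into two copies of \<Delta>(1), it is absorbed once on the left and once on the
  right.\<close>

lemma prd_unit_left: assumes tw: "twisted tw" and g: "lin g" shows "prd tw ep uu g k = g (tw k)"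
proof -
 note T = twistedD[OF tw] and L = lins lin_comp[OF g] twistedD(6)[OF tw]
 have "prd tw ep uu g k = uu$$.a b c. g (St a**(tw (b**k)**c))"
  unfolding prd_def by (rule sw_cong2, rule sw_counit(2); (intro L)+)
 also have "... = uu$.a b. uu$.b' c. g (St a**(tw (b**b'**k)**c))" by (rule sw_one(1); (intro L)+)
 also have "... = uu$.b' c. uu$.a b. g (St a**(tw (b**(b'**k))**c))" unfolding hassoc by (rule sw_swap)
 also have "... = uu$.b' c. uu$.a b. g (St a**tw (b**(b'**k))**c)" by (simp only: hassoc)
 also have "... = uu$.b' c. g (tw (b'**k)**c)" by (rule sw_cong, rule tw_right_St[OF tw]; (intro L)+)
 also have "... = g (tw k)" by (rule tw_left_St[OF tw g])
 finally show ?thesis .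
qed

lemma prd_unit_right: assumes tw: "twisted tw" and f: "lin f" shows "prd tw f h ep uu = f (tw h)"
proof -
 note T = twistedD[OF tw] and L = lins lin_comp[OF f] twistedD(6)[OF tw]
 \<comment> \<open>Only \<epsilon> sees the outer legs, so they may be replaced by their target
   parts. The last leg then becomes a copy of \<Delta>(1) that \<open>tw\<close> absorbs, and the
   first slides across the coproduct into the argument of f.\<close>
 have e: "ep (St a**(u**c)) = ep (St (et a)**(u**et c))" for a u c
 proof -
  have "ep (St a**(u**c)) = ep (es (St a)**(u**c))" by (simp only: ep_es)
  also have "... = ep (St (et a)**u**et c)" by (simp only: es_St hassoc[symmetric] ep_et)
  finally show ?thesis by (simp only: hassoc)
 qed
 have "prd tw f h ep uu = h$$.a b c. (tw b)$.u v. f v*:ep (St (et a)**(u**et c))"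
  by (simp only: prd_def hmul_uu T e[symmetric])
 also have "... = h$.a w. uu$.p q. (tw (p**w))$.u v. f v*:ep (St (et a)**(u**q))"
  by (rule sw_cong, rule sw_et_right; (intro L)+)
 also have "... = h$.a w. (tw w)$.u v. f v*:ep (St (et a)**u)" by (rule sw_cong, rule tw_absorb[OF tw]; (intro L)+)
 also have "... = h$.a w. (tw w)$.u v. f (et a**v)*:ep u" by (rule sw_cong, rule sw_et_slide; (intro L)+)
 also have "... = h$.a w. (tw w)$.u v. ep u*:f (et a**v)" by (simp only: smul_comm)
 also have "... = h$.a w. f (tw (et a**w))" unfolding T(4) by (rule sw_cong, rule sw_counit(1); (intro L)+)
 also have "... = f (tw h)" by (rule sw_et_one; (intro L)+)
 finally show ?thesis .
qed

lemma sw_swap2: "k$$.a b c. h$.d x. F a b c d x = h$.d x. k$$.a b c. F a b c d x" (is "?L = ?R")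
proof -
 have "?L = k$.a w. h$.d x. w$.b c. F a b c d x" by (rule sw_cong, rule sw_swap)
 also have "... = ?R" by (rule sw_swap)
 finally show ?thesis .
qed

text \<open>\<open>tw1\<close> and \<open>tw2\<close> represent multiplication by a fixed right,
  respectively left, factor followed by the functional of \<open>tw\<close>. Both sides are brought
  to one normal form \<open>?E\<close> with five legs of h, three of k and three of the value of
  \<open>tw\<close>.\<close>

lemma prd_assoc: assumes tw: "hlin tw" and f: "lin f" and g: "lin g" and p: "lin p"
  and tw1: "!!F x. lin F ==> F (tw1 x) = prd tw F x p m" and tw2: "!!F x. lin F ==> F (tw2 x) = prd tw f h F x"
 shows "prd tw1 f h g k = prd tw2 g k p m"
proof -
 note L = lins lin_comp[OF f] lin_comp[OF g] lin_comp[OF p] hlin_comp[OF tw]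
 let ?E = "%a b1 b2 b3 c. k$$.k1 k2 k3. (tw (b2**(k2**m)))$$.u s t.
  f t*:(g (St a**(s**c))*:p (St k1**(St b1**(u**(b3**k3)))))"
 have "prd tw1 f h g k = h$$.a b c. prd tw (%z. z$.u v. f v*:g (St a**(u**c))) (b**k) p m"
  unfolding prd_def[of tw1] by (rule sw_cong2, rule tw1; (intro L)+)
 also have "... = h$$.a b c. (b**k)$$.x y z. (tw (y**m))$.u v. v$.s t. f t*:(g (St a**(s**c))*:p (St x**(u**z)))"
  by (simp only: prd_def sw_smul smul_assoc)
 also have "... = h$$.a b c. b$.b1 b'. k$.k1 k'. (b'**k')$.y z. (tw (y**m))$.u v.
   v$.s t. f t*:(g (St a**(s**c))*:p (St (b1**k1)**(u**z)))" by (rule sw_cong2, rule sw_mul; (intro L)+)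
 also have "... = sw h (%a w. w$.b c. b$.b1 b'. k$.k1 k'. b'$.b2 b3. k'$.k2 k3. (tw (b2**k2**m))$.u v.
   v$.s t. f t*:(g (St a**(s**c))*:p (St (b1**k1)**(u**(b3**k3))))) " by (rule sw_cong4, rule sw_mul; (intro L)+)
 also have "... = h$$.a b c. b$$.b1 b2 b3. ?E a b1 b2 b3 c" unfolding St_mul hassoc by (rule sw_cong3, rule sw_swap)
 also have "... = h$$.a b1 w2. w2$.b' c. b'$.b2 b3. ?E a b1 b2 b3 c" by (rule sw_cong, rule sw_coassoc; (intro L)+)
 also have "... = h$$.a b1 w2. w2$$.b2 b3 c. ?E a b1 b2 b3 c" by (rule sw_cong2, rule sw_coassoc; (intro L)+)
 finally have 1: "prd tw1 f h g k = ..." .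
 let ?Q = "%k1 k3 s t. g t*:p (St k1**(s**k3))"
 have *: "sw (St a**(u**c)) (?Q k1 k3) = a$.x1 x2. u$.u1 u2. c$.c1 c2.
   g (St x1**(u2**c2))*:p (St k1**(St x2**(u1**(c1**k3))))" for a u c k1 k3 proof -
  have "sw (St a**(u**c)) (?Q k1 k3) = (St a)$.s t. (u**c)$.s' t'. ?Q k1 k3 (s**s') (t**t')"
   by (rule sw_mul; (intro L)+)
  also have "... = a$.x1 x2. (u**c)$.s' t'. ?Q k1 k3 (St x2**s') (St x1**t')" by (rule sw_St_anti; (intro L)+)
  also have "... = a$.x1 x2. u$.u1 u2. c$.c1 c2. ?Q k1 k3 (St x2**(u1**c1)) (St x1**(u2**c2))"
   by (rule sw_cong, rule sw_mul; (intro L)+)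
  finally show ?thesis by (simp only: hassoc)
 qed
 have "prd tw2 g k p m = k$$.k1 k2 k3. prd tw f h (%z. sw z (?Q k1 k3)) (k2**m)"
  unfolding prd_def[of tw2] by (rule sw_cong2, rule tw2; (intro L)+)
 also have "... = k$$.k1 k2 k3. h$$.a' b c'. (tw (b**(k2**m)))$.u v.
   a'$.x1 x2. u$.u1 u2. c'$.c1 c2. f v*:(g (St x1**(u2**c2)) *:
    p (St k1**(St x2**(u1**(c1**k3)))))" by (simp only: prd_def * sw_smul)
 also have "... = k$$.k1 k2 k3. h$$.a' b c'. a'$.x1 x2. (tw (b**(k2**m)))$.u v.
   c'$.c1 c2. u$.u1 u2. f v*:(g (St x1**(u2**c2)) *:
    p (St k1**(St x2**(u1**(c1**k3)))))" by (rule sw_cong4, rule trans[OF sw_swap], rule sw_cong2, rule sw_swap)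
 also have "... = k$$.k1 k2 k3. h$.a' w'. a'$.x1 x2. w'$$.b c1 c2.
   (tw (b**(k2**m)))$.u v. u$.u1 u2. f v*:(g (St x1**(u2**c2)) *:
    p (St k1**(St x2**(u1**(c1**k3)))))" by (rule sw_cong3, rule trans[OF sw_swap], rule sw_cong2, rule sw_swap)
 also have "... = k$$.k1 k2 k3. h$.a' w'. a'$.x1 x2. w'$$.b c1 c2.
   (tw (b**(k2**m)))$$.u s t. f t*:(g (St x1**(s**c2)) *:
    p (St k1**(St x2**(u**(c1**k3)))))" by (rule sw_cong4, rule sw_cong2, rule sw_coassoc; (intro L)+)
 also have "... = k$$.k1 k2 k3. h$$.x1 x2 w'. w'$$.b c1 c2. (tw (b**(k2**m)))$$.u s t. f t*:(g (St x1**(s**c2)) *: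
    p (St k1**(St x2**(u**(c1**k3)))))" by (rule sw_cong2, rule sw_coassoc; (intro L)+)
 also have "... = h$$.a b1 w2. w2$$.b2 b3 c. ?E a b1 b2 b3 c"
  by (rule trans[OF sw_swap2], rule sw_cong, rule trans[OF sw_swap2], rule sw_cong, rule trans[OF sw_swap2],
   rule sw_cong, rule sw_swap2)
 finally show ?thesis using 1 by simp
qed

text \<open>Multiplicativity of the comultiplication; \<open>rh\<close> is the convolution product of \<open>tw\<close> and \<open>sg\<close>.\<close>

lemma prd_conv: assumes tw: "twisted tw" and sg: "twisted sg" and f: "lin f" and g: "lin g"
  and rh: "!!F x. lin F ==> F (rh x) = x$.a b. F (tw a**sg b)"
 shows "prd rh f h g k = h$.ha hb. k$.ka kb. ha$$.a b c. (tw (b**ka))$.u v. hb$$.a' b' c'. (sg (b'**kb))$.u' v'.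
   f (v**v')*:g ((St a**(u**c))**(St a'**(u'**c')))"
proof -
 note L = lins lin_comp[OF f] lin_comp[OF g] twistedD(6)[OF tw] twistedD(6)[OF sg]
 let ?M = "%a b w'. w'$.b' c'. k$.ka kb. (tw (b**ka))$.u v. (sg (b'**kb))$.u' v'. f (v**v')*:g (St a**(u**(u'**c')))"
 have "prd rh f h g k = h$$.a b c. (b**k)$.x y. (tw x**sg y)$.u v. f v*:g (St a**(u**c))"
  unfolding prd_def by (rule sw_cong2, rule rh; (intro L)+)
 also have "... = h$$.a b c. b$.b b'. k$.ka kb. (tw (b**ka)**sg (b'**kb))$.u v. f v*:g (St a**(u**c))"
  by (rule sw_cong2, rule sw_mul; (intro L)+)
 also have "... = h$$.a b c. b$.b b'. k$.ka kb. (tw (b**ka))$.u v. (sg (b'**kb))$.u' v'.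
   f (v**v')*:g (St a**(u**u'**c))" by (rule sw_cong4, rule sw_mul; (intro L)+)
 also have "... = h$$.a b w'. ?M a b w'" unfolding hassoc by (rule sw_cong, rule sw_coassoc; (intro L)+)
 finally have 1: "prd rh f h g k = ..." .
 have "h$.ha hb. k$.ka kb. ha$$.a b c. (tw (b**ka))$.u v. hb$$.a' b' c'. (sg (b'**kb))$.u' v'.
    f (v**v')*:g ((St a**(u**c))**(St a'**(u'**c'))) =
  h$.ha hb. k$.ka kb. ha$$.a b c. hb$$.a' b' c'. (tw (b**ka))$.u v.
   (sg (b'**kb))$.u' v'. f (v**v')*:g ((St a**(u**c))**(St a'**(u'**c')))"
  by (rule sw_cong4, rule sw_swap2[symmetric])
 also have "... = h$.ha hb. ha$$.a b c. hb$$.a' b' c'. k$.ka kb. (tw (b**ka))$.u v.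
   (sg (b'**kb))$.u' v'. f (v**v')*:g ((St a**(u**c))**(St a'**(u'**c')))"
  by (rule sw_cong, rule trans[OF sw_swap], rule sw_cong, rule trans[OF sw_swap], rule sw_cong,
   rule trans[OF sw_swap], rule sw_cong, rule sw_swap)
 also have "... = h$$.a w hb. w$.b c. hb$$.a' b' c'. k$.ka kb. (tw (b**ka))$.u v.
   (sg (b'**kb))$.u' v'. f (v**v')*:g ((St a**(u**c))**(St a'**(u'**c')))" by (rule sw_coassoc; (intro L)+)
 also have "... = h$$.a b y2. y2$$.c a' w'. w'$.b' c'. k$.ka kb. (tw (b**ka))$.u v.
   (sg (b'**kb))$.u' v'. f (v**v')*:g ((St a**(u**c))**(St a'**(u'**c')))"
  by (rule sw_cong, rule sw_coassoc; (intro L)+)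
 also have "... = sw h (%a y. y$$.b c hb. hb$$.a' b' c'. k$.ka kb. (tw (b**ka))$.u v.
   (sg (b'**kb))$.u' v'. f (v**v')*:g (St a**(u**(c**St a'**(u'**c'))))) " by (simp only: hassoc)
 \<comment> \<open>The neighbouring legs c and S(a') of h contract to an element of H_t. It becomes
   a copy of \<Delta>(1) by \<open>sw_et_mid\<close>, and \<open>tw_absorb\<close> swallows that
   copy.\<close>
 also have "... = sw h (%a y. y$$.b z w'. w'$.b' c'. k$.ka kb. (tw (b**ka))$.u v.
   (sg (b'**kb))$.u' v'. f (v**v')*:g (St a**(u**(et z**(u'**c'))))) "
  by (rule sw_cong2, rule sw_St_right; (intro L)+)
 also have "... = sw h (%a y. y$.b w'. uu$.p q. w'$.b' c'. k$.ka kb. (tw (p**b**ka))$.u v.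
   (sg (b'**kb))$.u' v'. f (v**v')*:g (St a**(u**(q**(u'**c'))))) " by (rule sw_cong, rule sw_et_mid; (intro L)+)
 also have "... = h$$.a b w'. w'$.b' c'. k$.ka kb. uu$.p q. (tw (p**(b**ka)))$.u v.
   (sg (b'**kb))$.u' v'. f (v**v')*:g (St a**(u**q**(u'**c')))"
  unfolding hassoc by (rule sw_cong2, rule trans[OF sw_swap], rule sw_cong, rule sw_swap)
 also have "... = h$$.a b w'. ?M a b w'" by (rule sw_cong4, rule tw_absorb[OF tw]; (intro L)+)
 finally show ?thesis using 1 by simp
qed

subsection \<open>The counit of the double\<close>

text \<open>\<open>et\<close> represents the counit of the double. Writing et(b k) as a conjugation
  of et(k) by b lets the neighbouring legs of h contract to \<open>es\<close>.\<close>

lemma prd_et: assumes f: "lin f" and g: "lin g" shows "prd et f h g k = h$.a b. f (et b)*:g (et k**es a)" (is "?L = ?R")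
proof -
 note L = lins lin_comp[OF f] lin_comp[OF g]
 have "?L = h$$.a b c. uu$.p q. f q*:g (St a**(et (b**k)**p**c))"
  unfolding prd_def by (rule sw_cong2, rule sw_et(1); (intro L)+)
 also have "... = uu$.p q. h$$.a b c. f q*:g (St a**(et (b**k)**(p**c)))" unfolding hassoc by (rule sw_swap2)
 also have "... = uu$.p q. h$$.a b c. b$.b1 b2. f q*:g (St a**(b1**(et k**St b2)**(p**c)))"
  by (rule sw_cong3, rule sw_et_conj[symmetric]; (intro L)+)
 also have "... = uu$.p q. h$$.a b1 w2. w2$.b2 c. f q*:g (St a**(b1**(et k**St b2)**(p**c)))"
  by (rule sw_cong2, rule sw_coassoc; (intro L)+)
 also have "... = uu$.p q. h$$.a b1 w2. w2$.b2 c. f q*:g (St a**b1**(et k**(St b2**(p**c))))" by (simp only: hassoc)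
 also have "... = uu$.p q. h$$.a b2 c. f q*:g (es a**(et k**(St b2**(p**c))))"
  by (rule sw_cong, rule sw_St_left; (intro L)+)
 also have "... = uu$.p q. h$$.a b2 c. f q*:g (et k**(es a**St b2**(p**c)))" by (simp only: hassoc et_es_commute')
 also have "... = uu$.p q. h$.x c. x$.a b2. f q*:g (et k**(es a**St b2**(p**c)))"
  by (rule sw_cong, rule sw_coassoc[symmetric]; (intro L)+)
 also have "... = uu$.p q. h$.x c. f q*:g (et k**(St x**(p**c)))" by (rule sw_cong2, rule sw_St(1); (intro L)+)
 also have "... = uu$.p q. h$.x c. f q*:g (et k**(St x**(es p**c)))" by (rule sw_uu_es[symmetric]; (intro L)+)
 also have "... = uu$.p q. f q*:g (et k**es (p**h))" by (rule sw_cong, rule sw_es_conj; (intro L)+)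
 also have "... = ?R" by (rule sw_et_right[symmetric]; (intro L)+)
 finally show ?thesis .
qed

text \<open>By \<open>prd_et\<close>, the hypothesis says that \<open>tw\<close> represents the
  counit of a product whose last factor is fixed; the conclusion is the counit of a triple
  product.\<close>

lemma prd_et_triple: assumes f: "lin f" and g: "lin g" and p: "lin p"
  and tw: "!!F x. lin F ==> F (tw x) = x$.a b. F (et b)*:p (et m**es a)"
 shows "prd tw f h g k = k$.k1 k2. prd et f h g k2*:p (et m**es k1)"
proof -
 note L = lins lin_comp[OF f] lin_comp[OF g] lin_comp[OF p]
 let ?B = "%a c y. (et y)$.u v. f v*:g (St a**(u**c))"
 have "prd tw f h g k = h$$.a b c. (b**k)$.x y. ?B a c y*:p (et m**es x)"
  unfolding prd_def by (rule sw_cong2, rule tw; (intro L)+)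
 also have "... = h$$.a b c. b$.b1 b2. k$.k1 k2. ?B a c (b2**k2)*:p (et m**es (b1**k1))"
  by (rule sw_cong2, rule sw_mul; (intro L)+)
 also have "... = h$$.a b c. b$.b1 b2. k$.k1 k2. ?B a c (b2**k2)*:p (et m**es (es b1**k1))" by (simp only: es_es_mul)
 also have "... = h$$.a b1 w2. w2$.b2 c. k$.k1 k2. ?B a c (b2**k2)*:p (et m**es (es b1**k1))"
  by (rule sw_cong, rule sw_coassoc; (intro L)+)
 also have "... = h$.a w. uu$.u v. (w**v)$.b2 c. k$.k1 k2. ?B a c (b2**k2)*:p (et m**es (u**k1))"
  by (rule sw_cong, rule sw_es_left; (intro L)+)
 also have "... = h$.a w. uu$.u v. (w**et v)$.b2 c. k$.k1 k2. ?B a c (b2**k2)*:p (et m**es (u**k1))"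
  by (rule sw_cong, rule sw_uu_et[symmetric]; (intro L)+)
 also have "... = h$.a w. uu$.u v. w$.b2 c. k$.k1 k2. ?B a c (b2**et v**k2)*:p (et m**es (u**k1))"
  by (rule sw_cong2, rule sw_et_mul(2); (intro L)+)
 also have "... = h$.a w. uu$.u v. w$.b2 c. k$.k1 k2. ?B a c (b2**v**k2)*:p (et m**es (u**k1))"
  by (rule sw_cong, rule sw_uu_et; (intro L)+)
 also have "... = h$$.a b2 c. uu$.u v. k$.k1 k2. ?B a c (b2**(v**k2))*:p (et m**es (u**k1))"
  unfolding hassoc by (rule sw_cong, rule sw_swap)
 also have "... = h$$.a b2 c. (uu**k)$.k1 k2. ?B a c (b2**k2)*:p (et m**es k1)"
  by (rule sw_cong2, rule sw_mul[symmetric]; (intro L)+)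
 also have "... = (uu**k)$.k1 k2. h$$.a b2 c. ?B a c (b2**k2)*:p (et m**es k1)" by (rule sw_swap2)
 finally show ?thesis by (simp only: prd_def sw_smul hmul_uu sw_cl)
qed

lemma sw_et_et: assumes F: "lin F" shows "k$.a b. F (et a**et b) = F (et k)"
 unfolding et_et_mul[symmetric] by (rule sw_et_one; (intro lins lin_comp[OF F])+)

lemma es_et_mul: "es (et w**h) = es (St (et w)**h)"
proof -
 have "cl (es (et w**h)) = cl (es (St (et w)**h))" by (rule H_eqI) (simp add: sw_et_def(2) hassoc St_et_es ep_es)
 then show ?thesis by simp
qed

lemma sw_et_es_et: assumes F: "lin2 F" shows "k$$.a b c. F (et a**et c) (es b) = k$.a b. F (et b) (es a)" (is "?L = ?R")
proof -
 note L = lins lin2D[OF F]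
 have "?L = k$.a w. uu$.u v. F (et a**v) (es (u**w))"
  by (rule sw_cong, rule sw_et_right; (intro L)+)
 also have "... = uu$.r s. uu$.u v. F (St r**v) (es (u**(s**k)))" by (rule sw_et_left; (intro L)+)
 also have "... = uu$.r s. uu$.u v. F (St r**v) (es (u**et s**k))"
  unfolding hassoc by (rule sw_uu_et[symmetric]; (intro L)+)
 also have "... = uu$.r s. uu$.u v. F (St r**v) (es (et s**u**k))"
  by (rule sw_cong, rule trans[OF sw_et(2)[symmetric] sw_et(1)]; (intro L)+)
 also have "... = uu$.r s. uu$.u v. F (St r**v) (es (St (et s)**u**k))" by (simp only: hassoc es_et_mul)
 also have "... = uu$.r s. uu$.u v. F (St r**(et s**v)) (es (u**k))" by (rule sw_cong, rule sw_et_slide; (intro L)+)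
 also have "... = uu$.r s. uu$.u v. F (St r**(s**v)) (es (u**k))" by (rule sw_uu_et; (intro L)+)
 also have "... = uu$.u v. uu$.r s. F (St r**s**v) (es (u**k))" unfolding hassoc by (rule sw_swap)
 also have "... = uu$.u v. F (es uu**v) (es (u**k))" by (rule sw_cong, rule sw_antipode(1); (intro L)+)
 also have "... = uu$.u v. F v (es (u**k))" by (rule sw_cong) (simp add: lin2_cl[OF F])
 also have "... = ?R" by (rule sw_et_right[symmetric]; (intro L)+)
 finally show ?thesis .
qed

lemma counit_mult_double1: assumes f: "lin f" and g: "lin g" and p: "lin p"
 shows "k$.k1 k2. h$.a b. k2$.a' b'. f (et b)*:(g (et k1**es a**et b')*:p (et m**es a')) =
  k$.k1 k2. prd et f h g k2*:p (et m**es k1)"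
proof -
 note L = lins lin_comp[OF f] lin_comp[OF g] lin_comp[OF p]
 have "k$.k1 k2. h$.a b. k2$.a' b'. f (et b)*:(g (et k1**es a**et b')*:p (et m**es a')) =
  h$.a b. k$$.k1 a' b'. f (et b)*:(g (et k1**et b'**es a)*:p (et m**es a'))"
  unfolding hassoc et_es_commute[symmetric] by (rule sw_swap)
 also have "... = h$.a b. k$.k1 k2. f (et b)*:(g (et k2**es a)*:p (et m**es k1))"
  by (rule sw_cong, rule sw_et_es_et; (intro L)+)
 also have "... = k$.k1 k2. h$.a b. f (et b)*:(g (et k2**es a)*:p (et m**es k1))" by (rule sw_swap)
 finally show ?thesis by (simp only: prd_et[OF f g] sw_smul smul_assoc)
qed

lemma counit_mult_double2: assumes f: "lin f" and g: "lin g" and p: "lin p"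
 shows "k$.k1 k2. h$.a b. k1$.a' b'. f (et b)*:(g (et b'**(et k2**es a))*:p (et m**es a')) =
  k$.k1 k2. prd et f h g k2*:p (et m**es k1)"
proof -
 note L = lins lin_comp[OF f] lin_comp[OF g] lin_comp[OF p]
 have "k$.k1 k2. h$.a b. k1$.a' b'. f (et b)*:(g (et b'**(et k2**es a))*:p (et m**es a')) =
  h$.a b. k$.k1 k2. k1$.a' b'. f (et b)*:(g (et b'**et k2**es a)*:p (et m**es a'))"
  unfolding hassoc by (rule sw_swap)
 also have "... = h$.a b. k$$.a' b' k2. f (et b)*:(g (et b'**et k2**es a)*:p (et m**es a'))"
  by (rule sw_cong, rule sw_coassoc; (intro L)+)
 also have "... = h$.a b. k$.k1 k2. f (et b)*:(g (et k2**es a)*:p (et m**es k1))"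
  by (rule sw_cong2, rule sw_et_et; (intro L)+)
 also have "... = k$.k1 k2. h$.a b. f (et b)*:(g (et k2**es a)*:p (et m**es k1))" by (rule sw_swap)
 finally show ?thesis by (simp only: prd_et[OF f g] sw_smul smul_assoc)
qed

subsection \<open>The comultiplication of the unit\<close>

text \<open>Testing the unit axiom of the double by three functionals gives three sums; this one and
  the two of \<open>comult_one_double1\<close> and \<open>comult_one_double2\<close> all reduce to
  the same value at 1.\<close>

lemma comult_one_double: assumes tw: "twisted tw" and sg: "twisted sg" and rh: "twisted rh"
 shows "uu$$.a b c. ep (tw a**(sg b**rh c)) = ep (tw uu**(sg uu**rh uu))" (is "?L = ?R")
proof -
 note T = twistedD(6)[OF tw] twistedD(6)[OF sg] twistedD(6)[OF rh]
 note L = lins T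
 note U = twistedD(3)[OF tw] twistedD(3)[OF sg] twistedD(3)[OF rh]
 have "?L = uu$.a b. uu$.b' c. ep (tw a**(sg (b**b')**rh c))"
  by (rule sw_one(1); (intro L)+)
 also have "... = uu$.b' c. uu$.a b. ep (tw (a**uu)**sg (b**b')**rh c)"
  by (simp only: hmul_uu U hassoc) (rule sw_swap)
 also have "... = uu$.b' c. ep (tw uu**sg b'**rh c)" by (rule sw_cong, rule tw_pair[OF tw sg]; (intro L)+)
 also have "... = uu$.b' c. ep (tw uu**(sg (b'**uu)**rh (c**uu)))" by (simp only: hmul_uu U hassoc)
 also have "... = ?R" by (rule tw_pair[OF sg rh]; (intro L)+)
 finally show ?thesis .
qed

lemma tw_left_St_uu: assumes tw: "twisted tw" and F: "lin F" shows "uu$.u v. F (tw u**v) = F (tw uu)"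
 using tw_left_St[OF tw F, of uu] by (simp add: twistedD(3)[OF tw])

lemma tw_right_St_uu: assumes tw: "twisted tw" and F: "lin F" shows "uu$.u v. F (St u**tw v) = F (tw uu)"
 using tw_right_St[OF tw F, of uu] by (simp add: twistedD(3)[OF tw])

lemma tw_pair_uu: assumes tw: "twisted tw" and sg: "twisted sg" and F: "lin F"
 shows "uu$.u v. F (tw u**sg v) = F (tw uu**sg uu)"
 using tw_pair[OF tw sg F, of uu uu] by (simp add: twistedD(3)[OF tw] twistedD(3)[OF sg])

lemma comult_one_double1: assumes tw: "twisted tw" and sg: "twisted sg" and rh: "twisted rh"
 shows "uu$.a b. uu$.a' b'. b$$.h1 h2 h3. (sg (h2**a'))$.u v.
  ep (tw a**v)*:ep (St h1**(u**h3)**rh b') = ep (tw uu**(sg uu**rh uu))"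
proof -
 note T = twistedD(6)[OF tw] twistedD(6)[OF sg] twistedD(6)[OF rh]
 note L = lins T
 have "uu$.a b. uu$.a' b'. b$$.h1 h2 h3. (sg (h2**a'))$.u v. ep (tw a**v)*:ep (St h1**(u**h3)**rh b') =
  uu$$.a h1 w. w$.h2 h3. uu$.a' b'. (sg (h2**a'))$.u v.
   ep (tw a**v)*:ep (St h1**(u**h3)**rh b')" by (rule sw_cong, rule sw_swap2[symmetric])
 \<comment> \<open>Two applications of \<open>sw_one\<close> break the iterated coproduct of 1 into
   independent copies of \<Delta>(1), which can then be absorbed one at a time.\<close>
 also have "... = uu$.a b. uu$$.c h2 h3. uu$.a' b'. (sg (h2**a'))$.u v. ep (tw a**v)*:ep (St (b**c)**(u**h3)**rh b')"
  by (rule sw_one(1); (intro L)+)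
 also have "... = uu$.a b. uu$.c d. uu$.r s. uu$.a' b'. (sg (d**r**a'))$.u v.
   ep (tw a**v)*:ep (St (b**c)**(u**s)**rh b')" by (rule sw_cong, rule sw_one(1); (intro L)+)
 also have "... = uu$.a b. uu$.r s. uu$.a' b'. uu$.c d. (sg (d**(r**a')))$.u v.
   ep (tw a**v)*:ep (St c**(St b**(u**s**rh b')))"
  unfolding St_mul hassoc by (rule sw_cong, rule trans[OF sw_swap], rule sw_cong, rule sw_swap)
 also have "... = uu$.a b. uu$.r s. uu$.a' b'. uu$.c d. (d**sg (r**a'))$.u v.
   ep (tw a**v)*:ep (St c**(St b**(u**s**rh b')))" by (rule sw_cong3, rule tw_right[OF sg]; (intro L)+)
 also have "... = uu$.a b. uu$.r s. uu$.a' b'. uu$.c d. (et d**sg (r**a'))$.u v.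
   ep (tw a**v)*:ep (St c**(St b**(u**s**rh b')))" by (rule sw_cong3, rule sw_uu_et[symmetric]; (intro L)+)
 also have "... = uu$.a b. uu$.r s. uu$.a' b'. uu$.c d. (sg (r**a'))$.u v.
   ep (tw a**v)*:ep (St c**(St b**(et d**u**s**rh b')))" by (rule sw_cong4, rule sw_et_mul(1); (intro L)+)
 also have "... = uu$.a b. uu$.r s. uu$.a' b'. uu$.c d. (sg (r**a'))$.u v.
   ep (tw a**v)*:ep (St c**(St (et b)**(et d**u**s**rh b')))" by (rule sw_uu_et[symmetric]; (intro L)+)
 also have "... = uu$.a b. uu$.r s. uu$.a' b'. uu$.c d. (sg (r**a'))$.u v.
   ep (tw a**v)*:ep (St c**et d**(St (et b)**(u**s**rh b')))" by (simp only: hassoc St_et_es et_es_commute')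
 also have "... = uu$.a b. uu$.r s. uu$.a' b'. uu$.c d. (sg (r**a'))$.u v.
   ep (tw a**v)*:ep (St c**d**(St (et b)**(u**s**rh b')))" by (rule sw_cong3, rule sw_uu_et; (intro L)+)
 also have "... = uu$.a b. uu$.r s. uu$.a' b'. (sg (r**a'))$.u v. uu$.c d.
   ep (tw a**v)*:ep (St c**d**(St (et b)**(u**s**rh b')))" by (rule sw_cong3, rule sw_swap)
 also have "... = uu$.a b. uu$.r s. uu$.a' b'. (sg (r**a'))$.u v.
   ep (tw a**v)*:ep (es uu**(St (et b)**(u**s**rh b')))" by (rule sw_cong4, rule sw_antipode(1); (intro L)+)
 also have "... = uu$.a b. uu$.a' b'. uu$.r s. (sg (r**a'))$.u v. ep (tw a**v)*:ep (St (et b)**(u**s)**rh b')"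
  by (simp only: es_uu hmul_uu cl_hmul hassoc) (rule sw_cong, rule sw_swap)
 also have "... = uu$.a b. uu$.a' b'. (sg a')$.u v. ep (tw a**v)*:ep (St (et b)**u**rh b')"
  by (rule sw_cong2, rule tw_absorb[OF sg]; (intro L)+)
 also have "... = uu$.a b. uu$.a' b'. (sg a')$.u v. ep (tw a**(et b**v))*:ep (u**rh b')"
  by (rule sw_cong2, rule sw_et_slide; (intro L)+)
 also have "... = uu$.a b. uu$.a' b'. (sg a')$.u v. ep (tw a**(b**v))*:ep (u**rh b')" by (rule sw_uu_et; (intro L)+)
 also have "... = uu$.a' b'. uu$.a b. (sg a')$.u v. ep (tw a**b**v)*:ep (u**rh b')"
  unfolding hassoc by (rule sw_swap)
 also have "... = uu$.a' b'. (sg a')$.u v. ep (tw uu**v)*:ep (u**rh b')"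
  by (rule sw_cong, rule tw_left_St_uu[OF tw]; (intro L)+)
 also have "... = uu$.a' b'. ep (tw uu**(sg a'**rh b'))" by (simp only: ep_mul(2)[symmetric] hassoc)
 also have "... = ep (tw uu**(sg uu**rh uu))" by (rule tw_pair_uu[OF sg rh]; (intro L)+)
 finally show ?thesis .
qed

lemma comult_one_double2: assumes tw: "twisted tw" and sg: "twisted sg" and rh: "twisted rh"
 shows "uu$.a b. uu$.a' b'. a'$$.h1 h2 h3. (sg (h2**b))$.u v.
  ep (tw a**(St h1**(u**h3)))*:ep (v**rh b') = ep (tw uu**(sg uu**rh uu))"
proof -
 note T = twistedD(6)[OF tw] twistedD(6)[OF sg] twistedD(6)[OF rh]
 note L = lins T
 have "uu$.a b. uu$.a' b'. a'$$.h1 h2 h3. (sg (h2**b))$.u v. ep (tw a**(St h1**(u**h3)))*:ep (v**rh b') =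
  uu$.a b. uu$$.h1 w b'. w$.h2 h3. (sg (h2**b))$.u v.
   ep (tw a**(St h1**(u**h3)))*:ep (v**rh b')" by (rule sw_cong, rule sw_coassoc; (intro L)+)
 also have "... = uu$.a b. uu$$.h1 h2 y2. y2$.h3 b'. (sg (h2**b))$.u v. ep (tw a**(St h1**(u**h3)))*:ep (v**rh b')"
  by (rule sw_cong2, rule sw_coassoc; (intro L)+)
 \<comment> \<open>As in the previous lemma, the iterated coproduct of 1 is broken into separate
   copies of \<Delta>(1).\<close>
 also have "... = uu$.a b. uu$.h1 c. uu$$.r h3 b'. (sg (c**r**b))$.u v. ep (tw a**(St h1**(u**h3)))*:ep (v**rh b')"
  by (rule sw_cong, rule sw_one(1); (intro L)+)
 also have "... = uu$.a b. uu$.h1 c. uu$.r s. uu$.t b'. (sg (c**r**b))$.u v.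
   ep (tw a**(St h1**(u**(s**t))))*:ep (v**rh b')" by (rule sw_cong2, rule sw_one(1); (intro L)+)
 also have "... = uu$.a b. uu$.r s. uu$.t b'. uu$.h1 c. (sg (c**(r**b)))$.u v.
   ep (tw a**(St h1**(u**(s**t))))*:ep (v**rh b')"
  unfolding hassoc by (rule sw_cong, rule trans[OF sw_swap], rule sw_cong, rule sw_swap)
 also have "... = uu$.a b. uu$.r s. uu$.t b'. uu$.h1 c. (c**sg (r**b))$.u v.
   ep (tw a**(St h1**(u**(s**t))))*:ep (v**rh b')" by (rule sw_cong3, rule tw_right[OF sg]; (intro L)+)
 also have "... = uu$.a b. uu$.r s. uu$.t b'. uu$.h1 c. (et c**sg (r**b))$.u v.
   ep (tw a**(St h1**(u**(s**t))))*:ep (v**rh b')" by (rule sw_cong3, rule sw_uu_et[symmetric]; (intro L)+)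
 also have "... = uu$.a b. uu$.r s. uu$.t b'. uu$.h1 c. (sg (r**b))$.u v.
   ep (tw a**(St h1**(et c**u**(s**t))))*:ep (v**rh b')" by (rule sw_cong4, rule sw_et_mul(1); (intro L)+)
 also have "... = uu$.a b. uu$.r s. uu$.t b'. uu$.h1 c. (sg (r**b))$.u v.
   ep (tw a**(St h1**(c**u**(s**t))))*:ep (v**rh b')" by (rule sw_cong3, rule sw_uu_et; (intro L)+)
 also have "... = uu$.a b. uu$.r s. uu$.t b'. (sg (r**b))$.u v. uu$.h1 c.
   ep (tw a**(St h1**c**(u**(s**t))))*:ep (v**rh b')" unfolding hassoc by (rule sw_cong3, rule sw_swap)
 also have "... = uu$.a b. uu$.r s. uu$.t b'. (sg (r**b))$.u v. ep (tw a**(es uu**(u**(s**t))))*:ep (v**rh b')"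
  by (rule sw_cong4, rule sw_antipode(1); (intro L)+)
 also have "... = uu$.a b. uu$.t b'. uu$.r s. (sg (r**b))$.u v. ep (tw a**(u**s**t))*:ep (v**rh b')"
  by (simp only: es_uu hmul_uu cl_hmul hassoc) (rule sw_cong, rule sw_swap)
 also have "... = uu$.a b. uu$.t b'. (sg b)$.u v. ep (tw a**(u**t))*:ep (v**rh b')"
  by (rule sw_cong2, rule tw_absorb[OF sg]; (intro L)+)
 also have "... = uu$.a b. uu$.t b'. (sg b)$.u v. ep (tw a**(u**es t))*:ep (v**rh b')"
  by (rule sw_cong, rule sw_uu_es[symmetric]; (intro L)+)
 also have "... = uu$.a b. uu$.t b'. (sg b)$.u v. ep (tw a**u)*:ep (v**St (es t)**rh b')"
  by (rule sw_cong2, rule sw_es_slide; (intro L)+)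
 also have "... = uu$.a b. uu$.t b'. (sg b)$.u v. ep (tw a**u)*:ep (v**St t**rh b')"
  by (rule sw_cong, rule sw_uu_es; (intro L)+)
 also have "... = uu$.a b. (sg b)$.u v. uu$.t b'. ep (tw a**u)*:ep (v**(St t**rh b'))"
  unfolding hassoc by (rule sw_cong, rule sw_swap)
 also have "... = uu$.a b. (sg b)$.u v. ep (tw a**u)*:ep (v**rh uu)"
  by (rule sw_cong2, rule tw_right_St_uu[OF rh]; (intro L)+)
 also have "... = uu$.a b. ep (tw a**sg b**rh uu)" by (simp only: ep_mul(1))
 also have "... = ep (tw uu**sg uu**rh uu)" by (rule tw_pair_uu[OF tw sg]; (intro L)+)
 finally show ?thesis by (simp only: hassoc)
qed

subsection \<open>The antipode of the double\<close>

lemma sw_Si_right: "lin2 F ==> sw h (%a b. b$.c d. F (c**Si a) d) = h$.a b. F (Si (et a)) b"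
proof -
 assume F: "lin2 F"
 note L = lins lin2D[OF F]
 have "h$$.a c d. F (c**Si a) d = h$.a b. a$.c d. F (d**Si c) b" by (rule sw_coassoc[symmetric]; (intro L)+)
 also have "... = h$.a b. F (Si (et a)) b" by ((rule sw_Si(1) | rule sw_cong)+; (intro L)+)
 finally show ?thesis .
qed

lemma sw_Si_left: "lin2 F ==> sw h (%a b. b$.c d. F (Si c**a) d) = h$.a b. F (Si (es a)) b"
proof -
 assume F: "lin2 F"
 note L = lins lin2D[OF F]
 have "h$$.a c d. F (Si c**a) d = h$.a b. a$.c d. F (Si d**c) b" by (rule sw_coassoc[symmetric]; (intro L)+)
 also have "... = h$.a b. F (Si (es a)) b" by ((rule sw_Si(2) | rule sw_cong)+; (intro L)+)
 finally show ?thesis .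
qed

lemma sw_et_one_left: "lin2 F ==> sw h (%a b. b$.c d. F (et a**c) d) = h$.a b. F a b"
proof -
 assume F: "lin2 F"
 note L = lins lin2D[OF F]
 have "h$$.a c d. F (et a**c) d = h$.a b. a$.c d. F (et c**d) b" by (rule sw_coassoc[symmetric]; (intro L)+)
 also have "... = h$.a b. F a b" by ((rule sw_et_one | rule sw_cong)+; (intro L)+)
 finally show ?thesis .
qed

lemma sw_St_anti3: assumes F: "lin3 F" shows "(St h)$$.a b c. F a b c = h$$.s t y. F (St y) (St t) (St s)" (is "?L = ?R")
proof -
 note L = lins lin3D[OF F]
 have "?L = h$.x y. (St x)$.b c. F (St y) b c" by (rule sw_St_anti; (intro L)+)
 also have "... = h$.x y. x$.s t. F (St y) (St t) (St s)" by (rule sw_cong, rule sw_St_anti; (intro L)+)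
 also have "... = ?R" by (rule sw_coassoc; (intro L)+)
 finally show ?thesis .
qed

lemma sw_Si_anti3: assumes F: "lin3 F" shows "(Si h)$$.a b c. F a b c = h$$.s t y. F (Si y) (Si t) (Si s)" (is "?L = ?R")
proof -
 note L = lins lin3D[OF F]
 have "?L = h$.x y. (Si x)$.b c. F (Si y) b c" by (rule sw_Si_anti; (intro L)+)
 also have "... = h$.x y. x$.s t. F (Si y) (Si t) (Si s)" by (rule sw_cong, rule sw_Si_anti; (intro L)+)
 also have "... = ?R" by (rule sw_coassoc; (intro L)+)
 finally show ?thesis .
qed

text \<open>The functional of \<open>tw\<close> on \<open>x\<^sub>2 S'(x\<^sub>1)\<close>, with \<open>S'\<close> the antipode of the double.\<close>

lemma antipode_source_double: assumes tw: "twisted tw" and f: "lin f"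
 shows "h$.ha hb. ha$$.h1 h2 h3. hb$$.m1 m2 m3. (tw (m2**Si h2))$.u v.
  f (h1**(St (St m1**(u**m3))**St h3)**v) = f (et h**es (tw uu))"
proof -
 note L = lins lin_comp[OF f] twistedD(6)[OF tw]
 let ?T = "%h2 m2 m3 h1 z. (tw (m2**Si h2))$.u v. f (h1**(St m3**(St u**(z**v))))"
 have "h$.ha hb. ha$$.h1 h2 h3. hb$$.m1 m2 m3. (tw (m2**Si h2))$.u v. f (h1**(St (St m1**(u**m3))**St h3)**v) =
  h$.ha hb. ha$$.h1 h2 h3. hb$$.m1 m2 m3. ?T h2 m2 m3 h1 (St (h3**St m1))" by (simp only: St_mul hassoc)
 also have "... = h$$.h1 w hb. w$.h2 h3. hb$$.m1 m2 m3. ?T h2 m2 m3 h1 (St (h3**St m1))"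
  by (rule sw_coassoc; (intro L)+)
 also have "... = h$$.h1 h2 y2. y2$$.h3 m1 w'. w'$.m2 m3. ?T h2 m2 m3 h1 (St (h3**St m1))"
  by (rule sw_cong, rule sw_coassoc; (intro L)+)
 also have "... = h$$.h1 h2 y2. y2$$.z m2 m3. ?T h2 m2 m3 h1 (St (et z))"
  by (rule sw_cong2, rule sw_St_right; (intro L)+)
 also have "... = h$$.h1 h2 w'. uu$.p q. w'$.m2 m3. ?T (p**h2) m2 m3 h1 (St q)"
  by (rule sw_cong, rule sw_et_mid; (intro L)+)
 also have "... = uu$.p q. h$$.h1 h2 w'. w'$.m2 m3. ?T (p**h2) m2 m3 h1 (St q)" by (rule sw_swap2)
 also have "... = uu$.p q. h$$.h1 h2 w'. w'$.m2 m3. (tw (m2**Si h2**Si p))$.u v. f (h1**(St m3**(St u**(St q**v))))"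
  by (simp only: Si_mul hassoc)
 also have "... = uu$.p q. h$$.h1 z m3. (tw (Si (et z)**Si p))$.u v. f (h1**(St m3**(St u**(St q**v))))"
  by (rule sw_cong2, rule sw_Si_right; (intro L)+)
 also have "... = uu$.p q. h$.h1 m3. uu$.r s. (tw (Si s**Si p))$.u v. f (r**h1**(St m3**(St u**(St q**v))))"
  by (rule sw_cong, rule sw_et_mid; (intro L)+)
 also have "... = uu$.p q. uu$.r s. h$.h1 m3. (tw (Si s**Si p))$.u v. f (r**(h1**St m3**(St u**(St q**v))))"
  unfolding hassoc by (rule sw_cong, rule sw_swap)
 also have "... = uu$.p q. uu$.r s. (tw (Si s**Si p))$.u v. f (r**(et h**(St u**(St q**v))))"
  by (rule sw_cong2, rule sw_antipode(2); (intro L)+)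
 \<comment> \<open>Since \<Delta>(1) lies in H_s \<otimes> H_t, p and s may be replaced by es(p) and
   et(s). Then S^-1 exchanges the two subalgebras, and the two relations of \<open>tw\<close>
   release both factors, leaving tw(1).\<close>
 also have "... = uu$.p q. uu$.r s. (tw (Si (et s)**Si (es p)))$.u v. f (r**(et h**(St u**(St q**v))))"
 proof -
  have "uu$.p q. uu$.r s. (tw (Si (et s)**Si (es p)))$.u v. f (r**(et h**(St u**(St q**v)))) =
   uu$.p q. uu$.r s. (tw (Si (et s)**Si p))$.u v. f (r**(et h**(St u**(St q**v))))" by (rule sw_uu_es; (intro L)+)
  also have "... = uu$.p q. uu$.r s. (tw (Si s**Si p))$.u v. f (r**(et h**(St u**(St q**v))))"
   by (rule sw_cong, rule sw_uu_et; (intro L)+)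
  finally show ?thesis by (rule sym)
 qed
 also have "... = uu$.p q. uu$.r s. (et (Si p)**(tw uu**et s))$.u v. f (r**(et h**(St u**(St q**v))))"
 proof -
  have "tw (Si (et s)**Si (es p)) = et (Si p)**(tw uu**et s)" for s p
  proof -
   have "tw (es (Si s)**(et (Si p)**uu)) = et (Si p)**tw uu**St (es (Si s))" by (simp only: twistedD(4,5)[OF tw])
   then show ?thesis by (simp add: et_Si es_Si hassoc)
  qed
  then show ?thesis by simp
 qed
 also have "... = uu$.p q. uu$.r s. (tw uu**et s)$.u v. f (r**(et h**(St (et (Si p)**u)**(St q**v))))"
  by (rule sw_cong2, rule sw_et_mul(1); (intro L)+)
 also have "... = uu$.p q. uu$.r s. (tw uu)$.u v. f (r**(et h**(St (et (Si p)**(u**et s))**(St q**v))))"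
  by (rule sw_cong2, rule sw_et_mul(2); (intro L)+)
 also have "... = uu$.p q. uu$.r s. (tw uu)$.u v. f (r**(et h**(St (Si (es p)**(u**et s))**(St q**v))))"
  by (simp only: et_Si)
 also have "... = uu$.p q. uu$.r s. (tw uu)$.u v. f (r**(et h**(St (Si p**(u**et s))**(St q**v))))"
  by (rule sw_uu_es; (intro L)+)
 also have "... = uu$.p q. uu$.r s. (tw uu)$.u v. f (r**(et h**(St (Si p**(u**s))**(St q**v))))"
  by (rule sw_cong, rule sw_uu_et; (intro L)+)
 also have "... = uu$.p q. uu$.r s. (tw uu)$.u v. f (r**(et h**(St s**(St u**(p**St q**v)))))"
  by (simp only: St_mul hassoc St_Si cl_hmul)
 also have "... = uu$.r s. (tw uu)$.u v. uu$.p q. f (r**(et h**(St s**(St u**(p**St q**v)))))"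
  by (rule trans[OF sw_swap], rule sw_cong, rule sw_swap)
 also have "... = uu$.r s. (tw uu)$.u v. f (r**(et h**(St s**(St u**(et uu**v)))))"
  by (rule sw_cong2, rule sw_antipode(2); (intro L)+)
 also have "... = (tw uu)$.u v. uu$.r s. f (r**(et h**St s)**(St u**(et uu**v)))" unfolding hassoc by (rule sw_swap)
 also have "... = (tw uu)$.u v. f (et (uu**h)**(St u**(et uu**v)))" by (rule sw_cong, rule sw_et_conj; (intro L)+)
 also have "... = (tw uu)$.u v. f (et h**(St u**v))" by (simp only: et_uu hmul_uu et_cl cl_hmul)
 also have "... = f (et h**es (tw uu))" by (rule sw_antipode(1); (intro L)+)
 finally show ?thesis .
qed

text \<open>The sum is the source counit of the opposite double tested by \<open>tw\<close>, and
  must match \<open>antipode_source_double\<close>. The second leg of one copy of \<Delta>(1) slides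
  across the other copy to tw(1_1), which absorbs it.\<close>

lemma source_counit_double: assumes tw: "twisted tw" and f: "lin f"
 shows "uu$$.a b1 b2. ep (tw a**et b2)*:f (et h**es b1) = f (et h**es (tw uu))" (is "?L = ?R")
proof -
 note L = lins lin_comp[OF f] twistedD(6)[OF tw]
 have "?L = uu$.a b. uu$.c d. ep (tw a**et d)*:f (et h**es (c**b))"
  by (rule sw_one(2); (intro L)+)
 also have "... = uu$.a b. uu$.c d. ep (tw a**et d)*:f (et h**es (es c**b))"
  by (rule sw_cong, rule sw_uu_es[symmetric]; (intro L)+)
 also have "... = uu$.a b. uu$.c d. ep (tw a**et d)*:f (et h**es (es c**et b))"
  by (rule sw_uu_et[symmetric]; (intro L)+)
 also have "... = uu$.a b. uu$.c d. ep (tw a**et d)*:f (et h**(St (et b)**es c))"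
  by (simp only: et_es_commute[symmetric] es_mul_es St_et_es)
 also have "... = uu$.a b. uu$.c d. ep (tw a**et d)*:f (et h**(St (et b)**c))"
  by (rule sw_cong, rule sw_uu_es; (intro L)+)
 also have "... = uu$.a b. uu$.c d. ep (tw a**d)*:f (et h**(St (et b)**c))"
  by (rule sw_cong, rule sw_uu_et; (intro L)+)
 also have "... = uu$.a b. uu$.c d. ep (tw a**(et b**d))*:f (et h**c)"
  by (rule sw_cong, rule sw_et_slide; (intro L)+)
 also have "... = uu$.a b. uu$.c d. ep (tw a**(b**d))*:f (et h**c)" by (rule sw_uu_et; (intro L)+)
 also have "... = uu$.c d. uu$.a b. ep (tw a**b**d)*:f (et h**c)" unfolding hassoc by (rule sw_swap)
 also have "... = uu$.c d. ep (tw uu**d)*:f (et h**c)" by (rule sw_cong, rule tw_left_St_uu[OF tw]; (intro L)+)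
 also have "... = ?R" by (rule sw_et_def(2)[symmetric]; (intro L)+)
 finally show ?thesis .
qed

text \<open>The functional of \<open>tw\<close> on \<open>S'(x\<^sub>2) x\<^sub>1\<close>.\<close>

lemma antipode_target_double: assumes tw: "twisted tw" and f: "lin f"
 shows "h$$.ha h1 w. w$.h2 h3. (Si h2)$$.m1 m2 m3. (tw (m2**ha))$.u v.
  f (St m1**(u**m3)**(h1**(St v**St h3))) = f (et (h**tw uu))"
proof -
 note L = lins lin_comp[OF f] twistedD(6)[OF tw]
 let ?T = "%t ha y s h3. (tw (Si t**ha))$.u v. f (y**(u**(s**(St v**St h3))))"
 have "h$$.ha h1 w. w$.h2 h3. (Si h2)$$.m1 m2 m3. (tw (m2**ha))$.u v. f (St m1**(u**m3)**(h1**(St v**St h3))) =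
  h$$.ha h1 w. w$.h2 h3. h2$$.s t y. (tw (Si t**ha))$.u v.
   f (St (Si y)**(u**Si s)**(h1**(St v**St h3)))" by (rule sw_cong3, rule sw_Si_anti3; (intro L)+)
 also have "... = h$$.ha h1 w. w$.h2 h3. h2$$.s t y. ?T t ha y (Si s**h1) h3" by (simp only: hassoc St_Si cl_hmul)
 also have "... = h$$.ha h1 w. w$$.s w' h3. w'$.t y. ?T t ha y (Si s**h1) h3"
  by (rule sw_cong2, rule sw_coassoc; (intro L)+)
 also have "... = h$$.ha z w2. w2$.w' h3. w'$.t y. ?T t ha y (Si (es z)) h3"
  by (rule sw_cong, rule sw_Si_left; (intro L)+)
 also have "... = h$$.ha z w2. w2$$.t y h3. ?T t ha y (Si (es z)) h3" by (rule sw_cong2, rule sw_coassoc; (intro L)+)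
 also have "... = h$.ha w. uu$.p q. (w**q)$$.t y h3. ?T t ha y (Si p) h3"
  by (rule sw_cong, rule sw_es_left; (intro L)+)
 also have "... = h$.ha w. uu$.p q. (w**et q)$$.t y h3. ?T t ha y (Si p) h3"
  by (rule sw_cong, rule sw_uu_et[symmetric]; (intro L)+)
 also have "... = h$.ha w. uu$.p q. w$$.t y h3. ?T (t**et q) ha y (Si p) h3"
  by (rule sw_cong2, rule sw_et_mul(2); (intro L)+)
 also have "... = uu$.p q. h$$.ha t w3. w3$.y h3. ?T (t**et q) ha y (Si p) h3" by (rule sw_swap)
 also have "... = uu$.p q. h$$.ha t w3. w3$.y h3. (tw (Si (et q)**(Si t**ha)))$.u v.
   f (y**(u**(Si p**(St v**St h3))))" by (simp only: Si_mul hassoc)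
 also have "... = uu$.p q. h$$.z y h3. (tw (Si (et q)**Si (es z)))$.u v. f (y**(u**(Si p**(St v**St h3))))"
  by (rule sw_cong, rule sw_Si_left; (intro L)+)
 \<comment> \<open>S^-1(et q) lies in H_s, so \<open>tw\<close> releases it on the right, with S
   restoring et(q).\<close>
 also have "... = uu$.p q. h$$.z y h3. (tw (Si (es z))**et q)$.u v. f (y**(u**(Si p**(St v**St h3))))"
 proof -
  have "tw (Si (et q)**x) = tw x**et q" for q x using twistedD(5)[OF tw, of "Si q" x] by (simp add: es_Si)
  then show ?thesis by simp
 qed
 also have "... = uu$.p q. h$$.z y h3. (tw (Si (es z)))$.u v. f (y**(u**et q**(Si p**(St v**St h3))))"
  by (rule sw_cong3, rule sw_et_mul(2); (intro L)+)
 also have "... = uu$.p q. h$$.z y h3. (tw (Si (es z)))$.u v. f (y**(u**q**(Si p**(St v**St h3))))"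
  by (rule sw_uu_et; (intro L)+)
 also have "... = h$$.z y h3. (tw (Si (es z)))$.u v. uu$.p q. f (y**(u**(q**Si p**(St v**St h3))))"
  unfolding hassoc by (rule trans[OF sw_swap2[symmetric]], rule sw_cong2, rule sw_swap)
 also have "... = h$$.z y h3. (tw (Si (es z)))$.u v. f (y**(u**(Si (et uu)**(St v**St h3))))"
  by (rule sw_cong3, rule sw_Si(1); (intro L)+)
 also have "... = h$$.z y h3. (tw (Si (es z)))$.u v. f (y**(u**St v**St h3))"
  by (simp only: et_uu Si_uu hmul_uu cl_hmul hassoc)
 also have "... = h$$.z y h3. f (y**(et (tw (Si (es z)))**St h3))"
  by (rule sw_cong2, rule sw_antipode(2); (intro L)+)
 also have "... = uu$.p q. (h**q)$.y h3. f (y**(et (tw (Si p))**St h3))" by (rule sw_es_left; (intro L)+)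
 also have "... = uu$.p q. (h**et q)$.y h3. f (y**(et (tw (Si p))**St h3))" by (rule sw_uu_et[symmetric]; (intro L)+)
 also have "... = uu$.p q. h$.y h3. f (y**et q**(et (tw (Si p))**St h3))"
  by (rule sw_cong, rule sw_et_mul(2); (intro L)+)
 also have "... = uu$.p q. h$.y h3. f (y**q**(et (tw (Si p))**St h3))" by (rule sw_uu_et; (intro L)+)
 also have "... = uu$.p q. h$.y h3. f (y**q**(et (tw (Si (es p)))**St h3))" by (rule sw_uu_es[symmetric]; (intro L)+)
 \<comment> \<open>S^-1(es p) lies in H_t, hence passes through \<open>tw\<close> as well as through
   \<open>et\<close>.\<close>
 also have "... = uu$.p q. h$.y h3. f (y**q**(Si (es p)**et (tw uu)**St h3))"
 proof -
  have "et (tw (Si (es p))) = Si (es p)**et (tw uu)" for p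
   using twistedD(4)[OF tw, of "Si p" uu] by (simp add: et_Si[symmetric] twistedD(3)[OF tw] et_et_mul)
  then show ?thesis by simp
 qed
 also have "... = uu$.p q. h$.y h3. f (y**q**(Si p**et (tw uu)**St h3))" by (rule sw_uu_es; (intro L)+)
 also have "... = h$.y h3. uu$.p q. f (y**(q**Si p**(et (tw uu)**St h3)))" unfolding hassoc by (rule sw_swap)
 also have "... = h$.y h3. f (y**(Si (et uu)**(et (tw uu)**St h3)))" by (rule sw_cong, rule sw_Si(1); (intro L)+)
 also have "... = h$.y h3. f (y**(et (tw uu)**St h3))" by (simp only: et_uu Si_uu hmul_uu cl_hmul)
 also have "... = f (et (h**tw uu))" by (rule sw_et_conj[OF f])
 finally show ?thesis .
qed

text \<open>The target counit of the opposite double tested by \<open>tw\<close>, to be matched with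
  \<open>antipode_target_double\<close>; here \<Delta>(1) is absorbed as S(1_1) 1_2 = 1.\<close>

lemma target_counit_double: assumes tw: "twisted tw" and f: "lin f"
 shows "uu$.a b. h$.h1 h2. f (et h2)*:ep (et a**es h1**tw b) = f (et (h**tw uu))"
proof -
 note L = lins lin_comp[OF f] twistedD(6)[OF tw]
 have "uu$.a b. h$.h1 h2. f (et h2)*:ep (et a**es h1**tw b) =
  uu$.a b. h$.h1 h2. f (et h2)*:ep (St a**es h1**tw (b**uu))"
  by (simp only: hmul_uu twistedD(3)[OF tw]) (rule sw_uu_St(1)[symmetric]; (intro L)+)
 also have "... = uu$.a b. h$.h1 h2. f (et h2)*:ep (St a**es h1**(b**tw uu))" by (rule tw_right[OF tw]; (intro L)+)
 also have "... = uu$.a b. h$.h1 h2. f (et h2)*:ep (St a**es h1**(et b**tw uu))"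
  by (rule sw_uu_et[symmetric]; (intro L)+)
 also have "... = uu$.a b. h$.h1 h2. f (et h2)*:ep (St a**(et b**(es h1**tw uu)))"
  by (simp only: hassoc et_es_commute')
 also have "... = uu$.a b. h$.h1 h2. f (et h2)*:ep (St a**(b**(es h1**tw uu)))" by (rule sw_uu_et; (intro L)+)
 also have "... = h$.h1 h2. uu$.a b. f (et h2)*:ep (St a**b**(es h1**tw uu))" unfolding hassoc by (rule sw_swap)
 also have "... = h$.h1 h2. f (et h2)*:ep (es uu**(es h1**tw uu))" by (rule sw_cong, rule sw_antipode(1); (intro L)+)
 also have "... = h$.h1 h2. f (et h2)*:ep (h1**tw uu)" by (simp only: es_uu hmul_uu ep_cl ep_es)
 also have "... = uu$.u v. f v*:ep (u**h**tw uu)" by (rule sw_et_right; (intro L)+)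
 also have "... = f (et (h**tw uu))" unfolding sw_et_def(1)[OF f] hassoc by (simp only: smul_comm)
 finally show ?thesis .
qed

text \<open>The functional of \<open>tw\<close> on \<open>S'(x\<^sub>3) x\<^sub>2 S'(x\<^sub>1)\<close>.\<close>

lemma antipode_antipode_double: assumes tw: "twisted tw" and f: "lin f"
 shows "h$$.ha h1 w. w$.h2 h3. (Si h2)$$.m1 m2 m3. (tw (m2**uu))$.u v.
  f (et ha**es (St m1**(u**m3))**(h1**(St v**St h3))) =
  h$$.h1 h2 h3. f (h1**(St (tw (Si h2))**St h3))" (is "_ = ?R")
proof -
 note L = lins lin_comp[OF f] twistedD(6)[OF tw]
 let ?T = "%s t y x h3. (tw (Si t))$.u v. f (es (y**(u**Si s))**(x**(St v**St h3)))"
 let ?U = "%s t y x h3. (tw (Si t))$.u v. f (s**(es (y**u)**(x**(St v**St h3))))"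
 have "h$$.ha h1 w. w$.h2 h3. (Si h2)$$.m1 m2 m3. (tw (m2**uu))$.u v.
   f (et ha**es (St m1**(u**m3))**(h1**(St v**St h3))) =
  h$$.ha h1 w. w$.h2 h3. (Si h2)$$.m1 m2 m3. (tw m2)$.u v.
   f (es (St m1**(u**m3))**(et ha**h1**(St v**St h3)))"
  by (simp only: hmul_uu twistedD(3)[OF tw] hassoc et_es_commute')
 also have "... = h$$.h1 h2 h3. (Si h2)$$.m1 m2 m3. (tw m2)$.u v. f (es (St m1**(u**m3))**(h1**(St v**St h3)))"
  by (rule sw_et_one_left; (intro L)+)
 also have "... = h$$.h1 h2 h3. h2$$.s t y. (tw (Si t))$.u v. f (es (St (Si y)**(u**Si s))**(h1**(St v**St h3)))"
  by (rule sw_cong2, rule sw_Si_anti3; (intro L)+)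
 also have "... = h$$.h1 h2 h3. h2$$.s t y. ?T s t y h1 h3" by (simp only: St_Si cl_hmul)
 also have "... = h$$.h1 s w2. w2$.w' h3. w'$.t y. ?T s t y h1 h3" by (rule sw_cong, rule sw_coassoc; (intro L)+)
 \<comment> \<open>\<open>sw_es_conj\<close> is read backwards to free S^-1(s) from the argument of
   \<open>es\<close>; one of its legs can then meet h1 and contract by
   \<open>sw_Si_left\<close>.\<close>
 also have "... = h$$.h1 s w2. w2$.w' h3. w'$.t y. (tw (Si t))$.u v. (Si s)$.a b.
   f (St a**(es (y**u)**b)**(h1**(St v**St h3)))" unfolding hassoc[symmetric, of _ _ "Si _"]
  by (rule sw_cong4, rule sw_cong, rule sw_es_conj[symmetric]; (intro L)+)
 also have "... = h$$.h1 s w2. w2$.w' h3. w'$.t y. (tw (Si t))$.u v. s$.s1 s2.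
   f (St (Si s2)**(es (y**u)**Si s1)**(h1**(St v**St h3)))"
  by (rule sw_cong4, rule sw_cong, rule sw_Si_anti; (intro L)+)
 also have "... = h$$.h1 s w2. w2$.w' h3. w'$.t y. s$.s1 s2. ?U s2 t y (Si s1**h1) h3"
  by (simp only: St_Si cl_hmul hassoc) (rule sw_cong4, rule sw_swap)
 also have "... = h$$.h1 s w2. s$.s1 s2. w2$.w' h3. w'$.t y. ?U s2 t y (Si s1**h1) h3"
  by (rule sw_cong2, rule trans[OF _ sw_swap], rule sw_cong, rule sw_swap)
 also have "... = h$$.h1 s1 w1. w1$$.s2 w' h3. w'$.t y. ?U s2 t y (Si s1**h1) h3"
  by (rule sw_cong, rule sw_coassoc; (intro L)+)
 also have "... = h$$.z s2 w2. w2$.w' h3. w'$.t y. ?U s2 t y (Si (es z)) h3" by (rule sw_Si_left; (intro L)+)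
 also have "... = uu$.p q. (h**q)$$.s2 w' h3. w'$.t y. ?U s2 t y (Si p) h3" by (rule sw_es_left; (intro L)+)
 also have "... = uu$.p q. (h**et q)$$.s2 w' h3. w'$.t y. ?U s2 t y (Si p) h3"
  by (rule sw_uu_et[symmetric]; (intro L)+)
 also have "... = uu$.p q. h$$.s2 w' h3. w'$.t y. ?U (s2**et q) t y (Si p) h3"
  by (rule sw_cong, rule sw_et_mul(2); (intro L)+)
 also have "... = sw uu (%p q. h$$.s2 w' h3. w'$.t y. (tw (Si t))$.u v.
   f (s2**(es (y**u)**(et q**(Si p**(St v**St h3)))))) " by (simp only: hassoc et_es_commute')
 also have "... = uu$.p q. h$$.s2 w' h3. w'$.t y. (tw (Si t))$.u v. f (s2**(es (y**u)**(q**(Si p**(St v**St h3)))))"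
  by (rule sw_uu_et; (intro L)+)
 also have "... = sw h (%s2 w2. w2$.w' h3. w'$.t y. (tw (Si t))$.u v. uu$.p q.
   f (s2**(es (y**u)**(q**Si p**(St v**St h3))))) " unfolding hassoc
  by (rule trans[OF sw_swap2[symmetric]], rule sw_cong2, rule trans[OF sw_swap], rule sw_cong, rule sw_swap)
 also have "... = h$$.s2 w' h3. w'$.t y. (tw (Si t))$.u v. f (s2**(es (y**u)**(Si (et uu)**(St v**St h3))))"
  by (rule sw_cong4, rule sw_Si(1); (intro L)+)
 also have "... = h$$.s2 w' h3. w'$.t y. (tw (Si t))$.u v. f (s2**(es (y**u)**(St v**St h3)))"
  by (simp only: et_uu Si_uu hmul_uu cl_hmul)
 also have "... = h$$.s2 w' h3. w'$.t y. (tw (Si t))$.u v. u$.a b. f (s2**(St a**(es y**b)**(St v**St h3)))"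
  by (rule sw_cong4, rule sw_es_conj[symmetric]; (intro L)+)
 also have "... = h$$.s2 w' h3. w'$.t y. (tw (Si t))$$.a b c. f (s2**(St a**(es y**b)**(St c**St h3)))"
  by (rule sw_cong3, rule sw_coassoc; (intro L)+)
 also have "... = h$$.s2 w' h3. w'$.t y. (tw (Si t))$$.a b c. f (s2**(St a**(es y**(b**St c**St h3))))"
  by (simp only: hassoc)
 also have "... = h$$.s2 w' h3. w'$.t y. (tw (Si t))$.a v. f (s2**(St a**(es y**(et v**St h3))))"
  by (rule sw_cong4, rule sw_antipode(2); (intro L)+)
 also have "... = h$$.s2 w' h3. w'$.t y. (tw (Si t))$.a v. f (s2**(St a**et v**(es y**St h3)))"
  by (simp only: hassoc et_es_commute')
 also have "... = h$$.s2 w' h3. w'$.t y. f (s2**(St (tw (Si t))**(es y**St h3)))"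
  by (rule sw_cong3, rule sw_St(2); (intro L)+)
 also have "... = h$$.s2 t w'. w'$.y h3. f (s2**(St (tw (Si t))**(es y**St h3)))"
  by (rule sw_cong, rule sw_coassoc; (intro L)+)
 also have "... = ?R" by (rule sw_cong2, rule sw_St(1); (intro L)+)
 finally show ?thesis .
qed

text \<open>Both composites of the antipode of the double with its inverse become this sum once S
  and S^-1 have cancelled. The outer pairs of legs contract to elements of H_t around
  \<open>tw\<close>, which then disappear by the relations.\<close>

lemma antipode_inverse_aux: assumes tw: "twisted tw" and f: "lin f"
 shows "h$$.h1 h2 h3. h2$$.s t y. f (h1**(St s**(tw t**(y**St h3)))) = f (tw h)"
proof -
 note L = lins lin_comp[OF f] twistedD(6)[OF tw]
 have "h$$.h1 h2 h3. h2$$.s t y. f (h1**(St s**(tw t**(y**St h3)))) =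
  h$$.h1 s w2. w2$.w' h3. w'$.t y. f (h1**St s**(tw t**(y**St h3)))"
  unfolding hassoc by (rule sw_cong, rule sw_coassoc; (intro L)+)
 also have "... = h$$.a w' h3. w'$.t y. f (et a**(tw t**(y**St h3)))" by (rule sw_St_right; (intro L)+)
 also have "... = h$$.a t w3. w3$.y h3. f (et a**(tw t**(y**St h3)))" by (rule sw_cong, rule sw_coassoc; (intro L)+)
 also have "... = h$$.a t w3. f (et a**(tw t**et w3))" by (rule sw_cong2, rule sw_antipode(2); (intro L)+)
 also have "... = h$$.a t w3. f (tw (et a**t)**et w3)" by (simp only: twistedD(4)[OF tw] hassoc)
 also have "... = h$.t w3. f (tw t**et w3)" by (rule sw_et_one_left; (intro L)+)
 also have "... = uu$.u v. f (tw (u**h)**v)" by (rule sw_et_right; (intro L)+)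
 also have "... = f (tw h)" by (rule tw_left_St[OF tw f])
 finally show ?thesis .
qed

lemma antipode_inverse_double1: assumes tw: "twisted tw" and f: "lin f" shows "h$$.h1 h2 h3. (St h2)$$.k1 k2 k3.
  f (h1**(Si (k1**(St (tw (Si k2))**St k3))**St h3)) = f (tw h)"
proof -
 note L = lins lin_comp[OF f] twistedD(6)[OF tw]
 have "h$$.h1 h2 h3. (St h2)$$.k1 k2 k3. f (h1**(Si (k1**(St (tw (Si k2))**St k3))**St h3)) =
  h$$.h1 h2 h3. h2$$.s t y.
   f (h1**(Si (St y**(St (tw (Si (St t)))**St (St s)))**St h3))" by (rule sw_cong2, rule sw_St_anti3; (intro L)+)
 also have "... = f (tw h)" using antipode_inverse_aux[OF tw f, of h] by (simp add: Si_mul hassoc twistedD(3)[OF tw])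
 finally show ?thesis .
qed

lemma antipode_inverse_double2: assumes tw: "twisted tw" and f: "lin f" shows "h$$.h1 h2 h3. (Si h2)$$.k1 k2 k3.
  f (h1**(St (k1**(Si (tw (St k2))**St k3))**St h3)) = f (tw h)"
proof -
 note L = lins lin_comp[OF f] twistedD(6)[OF tw]
 have "h$$.h1 h2 h3. (Si h2)$$.k1 k2 k3. f (h1**(St (k1**(Si (tw (St k2))**St k3))**St h3)) =
  h$$.h1 h2 h3. h2$$.s t y.
   f (h1**(St (Si y**(Si (tw (St (Si t)))**St (Si s)))**St h3))" by (rule sw_cong2, rule sw_Si_anti3; (intro L)+)
 also have "... = f (tw h)" using antipode_inverse_aux[OF tw f, of h] by (simp add: St_mul hassoc twistedD(3)[OF tw])
 finally show ?thesis .
qed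

subsection \<open>Compatibility of the product with the defining relations\<close>

text \<open>\<Delta>(z h) keeps z in its first leg, where S turns it around;
  \<open>sw_et_slide\<close> then carries it across the coproduct of the value of \<open>tw\<close>
  to the argument of f.\<close>

lemma prd_left_et: assumes tw: "twisted tw" and f: "lin f" and g: "lin g"
 shows "prd tw f (et w**h) g k = prd tw (%l. f (et w**l)) h g k" (is "?L = ?R")
proof -
 note L = lins lin_comp[OF f] lin_comp[OF g] twistedD(6)[OF tw]
 have "?L = h$$.a b c. (tw (b**k))$.u v. f v*:g (St (et w**a)**(u**c))"
  unfolding prd_def by (rule sw_et_mul(1); (intro L)+)
 also have "... = h$$.a b c. (tw (b**k))$.u v. f v*:g (St a**(St (et w)**u**c))" by (simp only: St_mul hassoc)
 also have "... = ?R" unfolding prd_def by (rule sw_cong2, rule sw_et_slide; (intro L)+)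
 finally show ?thesis .
qed

lemma prd_left_es: assumes tw: "twisted tw" and f: "lin f" and g: "lin g"
 shows "prd tw f (es w**h) g k = prd tw (%l. f (l**St (es w))) h g k" (is "?L = ?R")
proof -
 note L = lins lin_comp[OF f] lin_comp[OF g] twistedD(6)[OF tw]
 have "?L = h$.a y. (es w**y)$.b c. (tw (b**k))$.u v. f v*:g (St a**(u**c))"
  unfolding prd_def by (rule sw_es_mul(1); (intro L)+)
 also have "... = h$$.a b c. (tw (b**k))$.u v. f v*:g (St a**(u**(es w**c)))"
  by (rule sw_cong, rule sw_es_mul(1); (intro L)+)
 also have "... = h$$.a b c. (tw (b**k))$.u v. f v*:g (St a**(u**es w**c))" by (simp only: hassoc)
 also have "... = ?R"
  unfolding prd_def by (rule sw_cong2, rule sw_es_slide; (intro L)+)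
 finally show ?thesis .
qed

text \<open>The factor travels across the coproduct of h, outside the argument of \<open>tw\<close>.
  So the equation holds for every linear \<open>tw\<close>, that is, in H^* \<otimes> H before
  passing to classes; this yields \<open>mult_ideal_zero\<close>.\<close>

lemma prd_right_et: assumes tw: "hlin tw" and f: "lin f" and g: "lin g"
 shows "prd tw f h g (et w**k) = prd tw f h (%l. g (et w**l)) k" (is "?L = ?R")
proof -
 note L = lins lin_comp[OF f] lin_comp[OF g] hlin_comp[OF tw]
 \<comment> \<open>\<open>sw_es_slide\<close> moves elements of the form S(y) with y in H_s, and
   every element of H_t has this form.\<close>
 have s: "St (es (Si w)) = et w" by (simp add: es_Si)
 have "?L = h$$.a b c. (tw (b**et w**k))$.u v. f v*:g (St a**(u**c))"
  by (simp only: prd_def hassoc)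
 also have "... = h$.a y. (y**et w)$.b c. (tw (b**k))$.u v. f v*:g (St a**(u**c))"
  by (rule sw_cong, rule sw_et_mul(2)[symmetric]; (intro L)+)
 also have "... = h$$.a b c. (tw (b**k))$.u v. f v*:g (St (a**es (Si w))**(u**c))"
  unfolding s[symmetric] by (rule sw_es_slide[symmetric]; (intro L)+)
 also have "... = ?R" by (simp only: prd_def St_mul s hassoc)
 finally show ?thesis .
qed

lemma prd_right_es: assumes tw: "hlin tw" and f: "lin f" and g: "lin g"
 shows "prd tw f h g (es w**k) = prd tw f h (%l. g (l**St (es w))) k" (is "?L = ?R")
proof -
 note L = lins lin_comp[OF f] lin_comp[OF g] hlin_comp[OF tw]
 have "?L = h$$.a b c. (tw (b**es w**k))$.u v. f v*:g (St a**(u**c))"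
  by (simp only: prd_def hassoc)
 also have "... = h$$.a b c. (tw (b**k))$.u v. f v*:g (St a**(u**(c**St (es w))))"
  by (rule sw_cong, rule sw_es_slide; (intro L)+)
 also have "... = ?R" by (simp only: prd_def hassoc)
 finally show ?thesis .
qed

subsection \<open>The formulas for \<open>H \<Join> H\<^sup>*\<close>\<close>

text \<open>Substituting S^-1(h) and S^-1(k) reverses coproducts and products; the right-hand side
  is the product of H \<bowtie> H^* with its factors in the opposite order, tested by
  \<open>tw\<close>.\<close>

lemma prd_Si: assumes tw: "hlin tw" and f: "lin f" and g: "lin g"
 shows "prd tw g (Si k) f (Si h) = k$$.k1 k2 k3. (tw (Si (h**k2)))$.u v. f (k3**(u**Si k1))*:g v"
proof -
 note L = lins lin_comp[OF f] lin_comp[OF g] hlin_comp[OF tw]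
 have "prd tw g (Si k) f (Si h) = k$$.s t y. (tw (Si t**Si h))$.u v. g v*:f (St (Si y)**(u**Si s))"
  unfolding prd_def by (rule sw_Si_anti3; (intro L)+)
 then show ?thesis by (simp add: Si_mul smul_comm)
qed

text \<open>\<epsilon> is invariant under S^-1 and cannot distinguish a from et(a), so the sum for
  et(S^-1(h)) turns into the counit formula of D(H).\<close>

lemma counit_Si: assumes f: "lin f" shows "f (et (Si h)) = uu$.a b. f b*:ep (h**a)"
proof -
 note L = lins lin_comp[OF f]
 have e: "ep (a**Si h) = ep (h**St a)" for a using ep_Si[of "h**St a"] by (simp add: Si_mul)
 have "f (et (Si h)) = uu$.a b. ep (h**St a)*:f b" by (simp only: sw_et_def(1)[OF f] e)
 also have "... = uu$.a b. ep (h**et a)*:f b" by (rule sw_uu_St(1); (intro L f)+)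
 finally show ?thesis by (simp add: ep_et smul_comm)
qed

lemma antipode_Si: assumes tw: "hlin tw" and f: "lin f" shows "(Si h)$$.h1 h2 h3. f (h1**(St (tw (Si h2))**St h3)) =
  h$$.h1 h2 h3. f (Si h3**(St (tw (Si (Si h2)))**h1))" (is "?L = _")
proof -
 note L = lins lin_comp[OF f] hlin_comp[OF tw]
 have "?L = h$$.s t y. f (Si y**(St (tw (Si (Si t)))**St (Si s)))"
  by (rule sw_Si_anti3; (intro L)+)
 then show ?thesis by simp
qed

end

section \<open>The dual of H and its coproduct in coordinates\<close>

section \<open>The dual module\<close>

text \<open>Tensor products see only the module part of a record. This identifies those formed over
  an algebra, its opposite, or an extension by coalgebra fields.\<close>

lemma tensor_module_cong: assumes "carrier M = carrier M'" "add M = add M'" "smult M = smult M'"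
  "carrier N = carrier N'" "add N = add N'" "smult N = smult N'"
 shows "tensor_module R M N = tensor_module R M' N'" "tens R M N = tens R M' N'"
 using assms by (simp_all add: tensor_module_def tensor_relations_def tens_def[abs_def] Let_def)

context weak_hopf_basis begin

abbreviation "Hs \<equiv> dual R H"

text \<open>\<open>tot\<close> and \<open>res\<close> pass between the extensional functionals that
  make up the dual and the total functionals of the Sweedler calculus.\<close>

definition tot :: "('h => 'a) => 'h => 'a" where "tot f = (%x. f (cl x))"
definition res :: "('h => 'a) => 'h => 'a" where "res F = restrict F (carrier H)"

lemma dual_carrier: "carrier Hs = Lin R H K \<inter> extensional (carrier H)"
 by (simp add: dual_def Let_def module.defs)
lemma dual_sel: "mult Hs = (%f g. \<lambda>h\<in>carrier H. sweedler R H K h (%h1 h2. f h1 \<otimes> g h2))"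
 "one Hs = restrict (counit H) (carrier H)" "zero Hs = (\<lambda>h\<in>carrier H. \<zero>)"
 "add Hs = (%f g. \<lambda>h\<in>carrier H. f h \<oplus> g h)" "smult Hs = (%a f. \<lambda>h\<in>carrier H. a \<otimes> f h)"
 "counit Hs = (%f. f \<one>\<^sub>H)" "antipode Hs = (%f. \<lambda>h\<in>carrier H. f (antipode H h))"
 by (simp_all add: dual_def Let_def module.defs)

lemma dual_D: assumes "f:.Hs" shows "f : Lin R H K" "f \<in> extensional (carrier H)" "h:.H ==> f h:.R"
 using assms lmD(1)[of f R H K] by (auto simp: dual_carrier)

lemma restrict_dual: "f : Lin R H K ==> restrict f (carrier H):.Hs"
 by (simp add: dual_carrier restrict_linear_map[OF mod_H])

lemma dual_eqI: assumes "f:.Hs" "g:.Hs" "!!h. h:.H ==> f h = g h" shows "f = g"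
 using assms by (auto simp: dual_carrier intro: extensionalityI)

lemma dual_module: "module R Hs"
proof -
 note D = dual_D
 have addc: "f \<oplus>\<^sub>Hs g:.Hs" if "f:.Hs" "g:.Hs" for f g
  unfolding dual_sel using lm_add[OF mod_H mod_K D(1)[OF that(1)] D(1)[OF that(2)]] by (intro restrict_dual) simp
 have smc: "a \<odot>\<^sub>Hs f:.Hs" if "a:.R" "f:.Hs" for f a
  unfolding dual_sel using lm_smult[OF mod_H mod_K D(1)[OF that(2)] that(1)] by (intro restrict_dual) simp
 have zc: "\<zero>\<^sub>Hs:.Hs" unfolding dual_sel by (intro restrict_dual lmI) auto
 have a: "(f \<oplus>\<^sub>Hs g) h = f h \<oplus> g h" if "h:.H" for f g h using that by (simp add: dual_sel)
 have s: "(a \<odot>\<^sub>Hs f) h = a \<otimes> f h" if "h:.H" for f a h using that by (simp add: dual_sel)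
 have z: "\<zero>\<^sub>Hs h = \<zero>" if "h:.H" for h using that by (simp add: dual_sel)
 show ?thesis
 proof (rule moduleI)
  show "abelian_group Hs"
  proof (rule abelian_groupI)
   fix f g k assume *: "f:.Hs" "g:.Hs" "k:.Hs"
   show "f \<oplus>\<^sub>Hs g:.Hs" by (rule addc[OF *(1,2)])
   show "f \<oplus>\<^sub>Hs g \<oplus>\<^sub>Hs k = f \<oplus>\<^sub>Hs (g \<oplus>\<^sub>Hs k)"
    by (rule dual_eqI) (use * in \<open>simp_all add: addc a D(3) R.a_assoc\<close>)
   show "f \<oplus>\<^sub>Hs g = g \<oplus>\<^sub>Hs f"
    by (rule dual_eqI) (use * in \<open>simp_all add: addc a D(3) R.a_comm\<close>)
  next
   fix f assume f: "f:.Hs"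
   show "\<zero>\<^sub>Hs \<oplus>\<^sub>Hs f = f" by (rule dual_eqI) (use f in \<open>simp_all add: addc zc a z D(3)\<close>)
   have m: "\<ominus> \<one>:.R" by simp
   have "(\<ominus> \<one>) \<odot>\<^sub>Hs f \<oplus>\<^sub>Hs f = \<zero>\<^sub>Hs"
    by (rule dual_eqI) (use f in \<open>simp_all add: addc smc zc a s z D(3) R.l_minus R.l_neg\<close>)
   then show "\<exists>g\<in>carrier Hs. g \<oplus>\<^sub>Hs f = \<zero>\<^sub>Hs" using smc[OF m f] by blast
  qed (rule zc)
  fix f assume f: "f:.Hs"
  show "\<one> \<odot>\<^sub>Hs f = f" by (rule dual_eqI) (use f in \<open>simp_all add: smc s D(3)\<close>)
 next
  fix r t f g assume r: "r:.R" and f: "f:.Hs"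
  show "r \<odot>\<^sub>Hs f:.Hs" by (rule smc[OF r f])
  show "r \<odot>\<^sub>Hs (f \<oplus>\<^sub>Hs g) = r \<odot>\<^sub>Hs f \<oplus>\<^sub>Hs r \<odot>\<^sub>Hs g" if g: "g:.Hs"
   by (rule dual_eqI) (use r f g in \<open>simp_all add: smc addc s a D(3) R.r_distr\<close>)
  show "(r \<oplus> t) \<odot>\<^sub>Hs f = r \<odot>\<^sub>Hs f \<oplus>\<^sub>Hs t \<odot>\<^sub>Hs f" if t: "t:.R"
   by (rule dual_eqI) (use r f t in \<open>simp_all add: smc addc s a D(3) R.l_distr\<close>)
  show "(r \<otimes> t) \<odot>\<^sub>Hs f = r \<odot>\<^sub>Hs (t \<odot>\<^sub>Hs f)" if t: "t:.R"
   by (rule dual_eqI) (use r f t in \<open>simp_all add: smc s D(3) R.m_assoc\<close>)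
 qed (rule R.is_cring)
qed

lemma dual_pointwise:
 "h:.H ==> (f \<oplus>\<^sub>Hs g) h = f h \<oplus> g h" "h:.H ==> (a \<odot>\<^sub>Hs f) h = a \<otimes> f h"
 by (simp_all add: dual_sel)

lemma eval_linear: "h:.H ==> (%f. f h) : Lin R Hs K" by (rule lmI) (simp_all add: dual_D(3) dual_pointwise)

lemma lin_tot: "f:.Hs ==> lin (tot f)" unfolding tot_def by (rule lin_linear_map) (rule dual_D(1))
lemma res_cl: "lin F ==> res F:.Hs" unfolding res_def by (rule restrict_dual) (rule linD(6))
lemma tot_res: "lin F ==> tot (res F) = F" by (rule ext) (simp add: tot_def res_def linD(2))
lemma res_tot: "f:.Hs ==> res (tot f) = f"
 by (rule dual_eqI) (simp_all add: res_cl lin_tot, simp add: res_def tot_def cl_id)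
lemma tot_apply: "tot f x = f (cl x)" by (simp add: tot_def)
lemma res_apply: "h:.H ==> res F h = F h" by (simp add: res_def)

definition dt :: "'i => 'h => 'a" where "dt i = tot (d i)"

lemma lin_dt: "i \<in> I ==> lin (dt i)"
 unfolding dt_def tot_def by (rule lin_linear_map[OF dual_basisD(3)[OF basis]])
lemma res_dt_closed: "i \<in> I ==> res (dt i):.Hs" by (rule res_cl[OF lin_dt])

text \<open>The expansion of f(h) in coordinates is read with the roles of \<open>e\<close> and
  \<open>d\<close> exchanged: evaluations at the \<open>e i\<close> are the coordinates on the
  dual.\<close>

lemma dual_dual_basis: "dual_basis R Hs I (%i. res (dt i)) (%i f. f (e i))" unfolding dual_basis_def
proof (intro conjI ballI)
 interpret Hs: module R Hs by (rule dual_module)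
 note D = dual_basisD[OF basis]
 show "finite I" by (rule D(1))
 show "(%i. res (dt i)) \<in> I \<rightarrow> carrier Hs" by (auto simp: res_dt_closed)
 show "(%f. f (e i)) : Lin R Hs K" if "i \<in> I" for i by (rule eval_linear[OF D(2)[OF that]])
 fix f assume f: "f:.Hs"
 have c: "f (e i) \<odot>\<^sub>Hs res (dt i):.Hs" if "i \<in> I" for i
  using that f by (intro Hs.smult_closed res_dt_closed dual_D(3)[OF f] D(2))
 show "(\<Oplus>\<^sub>Hs i\<in>I. f (e i) \<odot>\<^sub>Hs res (dt i)) = f"
 proof (rule dual_eqI[OF _ f])
  show "(\<Oplus>\<^sub>Hs i\<in>I. f (e i) \<odot>\<^sub>Hs res (dt i)):.Hs" using c by (intro Hs.M.finsum_closed) auto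
  fix h assume h: "h:.H"
  have "(\<Oplus>\<^sub>Hs i\<in>I. f (e i) \<odot>\<^sub>Hs res (dt i)) h = (\<Oplus>\<^sub>K i\<in>I. (f (e i) \<odot>\<^sub>Hs res (dt i)) h)"
   by (rule lm_sum[OF dual_module mod_K eval_linear[OF h] D(1)]) (rule c)
  also have "... = (\<Oplus>i\<in>I. d i h \<otimes> f (e i))" unfolding finsum_regular_module
   by (rule R.finsum_cong'[OF refl])
    (use h D f in \<open>auto simp: dual_pointwise res_apply dt_def tot_def cl_id dual_D(3) R.m_comm\<close>)
  also have "... = f h"
   using dual_basis_expand[OF mod_H mod_K basis dual_D(1)[OF f] h] by (simp add: finsum_regular_module)
  finally show "(\<Oplus>\<^sub>Hs i\<in>I. f (e i) \<odot>\<^sub>Hs res (dt i)) h = f h" .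
 qed
qed

text \<open>Reflexivity of H: the required element is the combination of the \<open>e i\<close>
  whose coefficients are the values of \<open>ph\<close> on the coordinate functionals.\<close>

lemma dual_functional_eval: assumes "ph : Lin R Hs K"
 shows "\<exists>x\<in>carrier H. \<forall>f\<in>carrier Hs. ph f = f x"
proof -
 note D = dual_basisD[OF basis]
 have pc: "ph (res (dt i)):.R" if "i \<in> I" for i using lmD(1)[OF assms res_dt_closed[OF that]] by simp
 let ?x = "\<Oplus>\<^sub>H i\<in>I. ph (res (dt i)) \<odot>\<^sub>H e i"
 have "ph f = f ?x" if f: "f:.Hs" for f
 proof -
  have "ph f = (\<Oplus>\<^sub>K i\<in>I. f (e i) \<odot>\<^sub>K ph (res (dt i)))"
   by (rule dual_basis_expand[OF dual_module mod_K dual_dual_basis assms f])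
  also have "... = (\<Oplus>\<^sub>K i\<in>I. f (ph (res (dt i)) \<odot>\<^sub>H e i))"
   unfolding finsum_regular_module by (rule R.finsum_cong'[OF refl])
    (use pc D f in \<open>auto simp: lmD(3)[OF dual_D(1)[OF f]] dual_D(3) R.m_comm\<close>)
  also have "... = f ?x" by (rule lm_sum[OF mod_H mod_K dual_D(1)[OF f] D(1), symmetric]) (use pc D in auto)
  finally show ?thesis .
 qed
 moreover have "?x:.H" using pc D by (intro M.finsum_closed) auto
 ultimately show ?thesis by blast
qed

subsection \<open>Comultiplication of the dual\<close>

sublocale DD: two_modules R "dual R H" "dual R H" by (rule two_modules.intro) (rule dual_module)+

text \<open>The Sweedler sum over the coproduct of F in the dual. In the tensors of coordinate
  functionals d_p \<otimes> d_q this coproduct has coefficients F(e_p e_q).\<close>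

definition swd :: "('h => 'a) => (('h => 'a) => ('h => 'a) => 'a) => 'a"
 where "swd F Ph = (\<Oplus>p\<in>I \<times> I. sc (F (e (fst p)**e (snd p))) \<otimes> sc (Ph (dt (fst p)) (dt (snd p))))"

lemma swd_closed [simp]: "swd F Ph:.R" unfolding swd_def by (rule R.finsum_closed) auto
lemma swd_sc [simp]: "sc (swd F Ph) = swd F Ph" by (simp add: sc_id)

lemma swd_sw: "swd F (%P Q. h$.a b. X P Q a b) = h$.a b. swd F (%P Q. X P Q a b)" (is "?L = ?R")
proof -
 let ?c = "%p. HH.pair_form (d (fst p)) (d (snd p)) (comult H (cl h))"
 let ?f = "%p. sc (F (e (fst p)**e (snd p)))"
 let ?X = "%p q. sc (X (dt (fst p)) (dt (snd p)) (e (fst q)) (e (snd q)))"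
 have "?L = (\<Oplus>p\<in>I \<times> I. \<Oplus>q\<in>I \<times> I. ?f p \<otimes> (?c q \<otimes> ?X p q))"
  unfolding swd_def sw_sc unfolding sw_def
  by (rule R.finsum_cong'[OF refl]) (auto simp: R.finsum_rdistr[OF finite_II] intro!: R.finsum_closed)
 also have "... = (\<Oplus>q\<in>I \<times> I. \<Oplus>p\<in>I \<times> I. ?f p \<otimes> (?c q \<otimes> ?X p q))"
  by (rule finsum_swap[OF finite_II finite_II]) auto
 also have "... = (\<Oplus>q\<in>I \<times> I. ?c q \<otimes> (\<Oplus>p\<in>I \<times> I. ?f p \<otimes> ?X p q))"
  by (rule R.finsum_cong'[OF refl])
   (auto simp: R.finsum_rdistr[OF finite_II] intro!: R.finsum_closed R.finsum_cong' R.m_lcomm)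
 also have "... = ?R" unfolding sw_def swd_sc unfolding swd_def ..
 finally show ?thesis .
qed

lemma swd_smul: "c*:swd F Ph = swd F (%P Q. c*:Ph P Q)" (is "?L = ?R") "swd F Ph*:c = swd F (%P Q. Ph P Q*:c)"
proof -
 let ?f = "%p. sc (F (e (fst p)**e (snd p)))"
 have "?L = sc c \<otimes> swd F Ph" by (simp add: smul_def)
 also have "... = (\<Oplus>p\<in>I \<times> I. sc c \<otimes> (?f p \<otimes> sc (Ph (dt (fst p)) (dt (snd p)))))"
  unfolding swd_def by (rule R.finsum_rdistr[OF finite_II]) auto
 also have "... = ?R"
  unfolding swd_def by (rule R.finsum_cong'[OF refl]) (auto simp: smul_def sc_id R.m_lcomm)
 finally show 1: "?L = ?R" .
 then show "swd F Ph*:c = swd F (%P Q. Ph P Q*:c)" by (simp add: smul_comm)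
qed

lemma swd_cong: assumes "!!P Q. [|lin P; lin Q|] ==> X P Q = Y P Q" shows "swd F X = swd F Y"
 unfolding swd_def by (rule R.finsum_cong'[OF refl]) (auto simp: assms[OF lin_dt lin_dt])

text \<open>The sum expands the bilinear form F(x y) in the product dual basis. It is the defining
  pairing of the dual coproduct, and with \<open>swd_eval'\<close> it eliminates the coproducts of
  functionals below.\<close>

lemma swd_eval: assumes F: "lin F" shows "swd F (%P Q. P x*:Q y) = F (x**y)"
proof -
 note D = dual_basisD[OF basis]
 have Fm: "bilinear R H H K (%a b. F (a**b))" by (rule lin2_bilinear) (intro lins lin_comp[OF F])
 let ?Ph = "%t. tensor_lift R K t (%a b. F (a**b))"
 have "F (x**y) = ?Ph (tens R H H (cl x) (cl y))" by (simp add: HH.tensor_lift_tens[OF mod_K Fm])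
 also have "... = (\<Oplus>\<^sub>K p\<in>I \<times> I. HH.pair_form (d (fst p)) (d (snd p)) (tens R H H (cl x) (cl y)) \<odot>\<^sub>K
   ?Ph (tens R H H (e (fst p)) (e (snd p))))"
  by (rule dual_basis_expand[OF HH.tensor_mod mod_K HH.tensor_dual_basis[OF basis basis]
   HH.tensor_lift_linear[OF mod_K Fm] HH.tens_closed]) simp_all
 also have "... = swd F (%P Q. P x*:Q y)" unfolding swd_def finsum_regular_module by (rule R.finsum_cong'[OF refl])
   (auto simp: D HH.pair_form_tens HH.tensor_lift_tens[OF mod_K Fm] smul_def dt_def tot_def sc_id
    linD(1)[OF F] linD(3)[OF F] R.m_comm R.m_assoc intro!: R.m_closed)
 finally show ?thesis by (rule sym)
qed

lemma swd_eval': assumes F: "lin F" shows "swd F (%P Q. P x*:(Q y*:r)) = F (x**y)*:r"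
  "swd F (%P Q. Q y*:P x) = F (x**y)" "swd F (%P Q. Q y*:(P x*:r)) = F (x**y)*:r"
  "swd F (%P Q. P x*:(r*:Q y)) = r*:F (x**y)" "swd F (%P Q. Q y*:(r*:P x)) = r*:F (x**y)"
 using swd_eval[OF F, of x y] swd_smul(2)[of F "%P Q. P x*:Q y" r] swd_smul(1)[of r F "%P Q. P x*:Q y"]
 by (simp_all add: smul_assoc smul_comm smul_left_comm)

text \<open>The explicit sum satisfies the pairing condition. It is the only tensor to do so,
  because functionals on the dual are evaluations and products of two evaluations separate the
  tensor square.\<close>

lemma dual_comult_mem: assumes "f:.Hs"
 shows "comult Hs f = (\<Oplus>\<^bsub>DD.T\<^esub>p\<in>I \<times> I. f (e (fst p) \<otimes>\<^sub>H e (snd p)) \<odot>\<^bsub>DD.T\<^esub>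
  tens R Hs Hs (res (dt (fst p))) (res (dt (snd p))))" (is "_ = ?t")
proof -
 interpret T: module R DD.T by (rule DD.tensor_mod)
 note D = dual_basisD[OF basis] and f = dual_D(3)[OF assms]
 have tc: "f (e (fst p) \<otimes>\<^sub>H e (snd p)) \<odot>\<^bsub>DD.T\<^esub> tens R Hs Hs (res (dt (fst p))) (res (dt (snd p))):.DD.T"
  if "p \<in> I \<times> I" for p using that by (auto intro!: T.smult_closed DD.tens_closed res_dt_closed f D m_closed)
 have t: "?t:.DD.T" using tc by (intro T.M.finsum_closed) auto
 have P: "tensor_lift R K ?t (%f1 f2. f1 h \<otimes> f2 k) = f (h \<otimes>\<^sub>H k)" (is "?M = ?N") if hk: "h:.H" "k:.H" for h k
 proof -
  have b: "bilinear R Hs Hs K (%f1 f2. f1 h \<otimes> f2 k)"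
   by (rule R.product_bilinear[OF dual_module dual_module eval_linear[OF hk(1)] eval_linear[OF hk(2)]])
  have "?M = (\<Oplus>\<^sub>K p\<in>I \<times> I. tensor_lift R K (f (e (fst p) \<otimes>\<^sub>H e (snd p)) \<odot>\<^bsub>DD.T\<^esub>
    tens R Hs Hs (res (dt (fst p))) (res (dt (snd p)))) (%f1 f2. f1 h \<otimes> f2 k))"
   by (rule lm_sum[OF DD.tensor_mod mod_K DD.tensor_lift_linear[OF mod_K b] finite_II]) (rule tc)
  also have "... = swd (tot f) (%P Q. P h*:Q k)" unfolding swd_def finsum_regular_module
   by (rule R.finsum_cong'[OF refl])
    (auto simp: lmD(3)[OF DD.tensor_lift_linear[OF mod_K b]] DD.tensor_lift_tens[OF mod_K b]
     DD.tens_closed res_dt_closed f D res_apply hk smul_def linD(1,3)[OF lin_dt] tot_def hmul_def cl_id sc_id)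
  also have "... = ?N" using swd_eval[OF lin_tot[OF assms], of h k] hk by (simp add: tot_def hmul_def cl_id)
  finally show ?thesis .
 qed
 \<comment> \<open>The bare algebra over which the definition of \<open>dual\<close> forms its
   tensor square; its tensor module coincides with that of the full record.\<close>
 let ?B = "\<lparr>carrier = Lin R H (regular_module R) \<inter> extensional (carrier H),
       mult = (%f g. \<lambda>h\<in>carrier H. sweedler R H (regular_module R) h (%h1 h2. f h1 \<otimes> g h2)),
       one = restrict (counit H) (carrier H),
       zero = (\<lambda>h\<in>carrier H. \<zero>),
       add = (%f g. \<lambda>h\<in>carrier H. f h \<oplus> g h),
       smult = (%a f. \<lambda>h\<in>carrier H. a \<otimes> f h)\<rparr>"
 have TB: "tensor_module R ?B ?B = DD.T" by (rule tensor_module_cong) (simp_all add: dual_carrier dual_sel)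
 have "comult Hs f = (THE t. t:.(tensor R ?B ?B) \<and> (\<forall>h\<in>carrier H. \<forall>k\<in>carrier H.
      tensor_lift R (regular_module R) t (%f1 f2. f1 h \<otimes> f2 k) = f (h \<otimes>\<^sub>H k)))"
  by (simp add: dual_def Let_def module.defs)
 also have "... = ?t"
 proof (rule the_equality)
  show "?t:.(tensor R ?B ?B) \<and> (\<forall>h\<in>carrier H. \<forall>k\<in>carrier H.
    tensor_lift R (regular_module R) ?t (%f1 f2. f1 h \<otimes> f2 k) = f (h \<otimes>\<^sub>H k))"
   using t P by (simp add: TB)
  fix s assume s: "s:.(tensor R ?B ?B) \<and> (\<forall>h\<in>carrier H. \<forall>k\<in>carrier H.
    tensor_lift R (regular_module R) s (%f1 f2. f1 h \<otimes> f2 k) = f (h \<otimes>\<^sub>H k))"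
  then have sT: "s:.DD.T" by (simp add: TB)
  show "s = ?t"
  proof (rule DD.tensor_separates[OF dual_dual_basis dual_dual_basis sT t])
   fix ph ps assume ph: "ph : Lin R Hs K" and ps: "ps : Lin R Hs K"
   obtain x where x: "x:.H" "!!f. f:.Hs ==> ph f = f x" using dual_functional_eval[OF ph] by blast
   obtain y where y: "y:.H" "!!f. f:.Hs ==> ps f = f y" using dual_functional_eval[OF ps] by blast
   have "DD.pair_form ph ps u = tensor_lift R K u (%f1 f2. f1 x \<otimes> f2 y)" if "u:.DD.T" for u
    unfolding DD.pair_form_def
    by (rule DD.tensor_lift_cong[OF mod_K R.product_bilinear[OF dual_module dual_module ph ps] _ that])
     (simp add: x y)
   then show "DD.pair_form ph ps s = DD.pair_form ph ps ?t" using s sT t P x(1) y(1) by simp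
  qed
 qed
 finally show ?thesis .
qed

lemma dual_comultiplication: "comultiplication R Hs"
proof -
 note D = dual_basisD[OF basis]
 have "(%f. \<Oplus>\<^bsub>DD.T\<^esub>p\<in>I \<times> I. f (e (fst p) \<otimes>\<^sub>H e (snd p)) \<odot>\<^bsub>DD.T\<^esub> tens R Hs Hs (res (dt (fst p))) (res (dt (snd p))))
   : Lin R Hs DD.T" by (intro linear_map_finsum_fun dual_module DD.tensor_mod finite_II lm_const_smult eval_linear)
   (auto intro!: DD.tens_closed res_dt_closed D m_closed)
 then have "comult Hs : Lin R Hs DD.T" by (subst lm_cong[OF dual_module dual_comult_mem]) simp_all
 then show ?thesis by (simp add: comultiplication_def comultiplication_axioms_def dual_module)
qed

sublocale CD: comultiplication R Hs by (rule dual_comultiplication)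

lemma sweedler_dual: assumes "bilinear R Hs Hs K G" "f:.Hs"
 shows "sweedler R Hs K f G = swd (tot f) (%P Q. G (res P) (res Q))" (is "?L = ?R")
proof -
 interpret T: module R DD.T by (rule DD.tensor_mod)
 note D = dual_basisD[OF basis] and f = dual_D(3)[OF assms(2)] and b = assms(1)
 have tc: "f (e (fst p) \<otimes>\<^sub>H e (snd p)) \<odot>\<^bsub>DD.T\<^esub> tens R Hs Hs (res (dt (fst p))) (res (dt (snd p))):.DD.T"
  if "p \<in> I \<times> I" for p using that by (auto intro!: T.smult_closed DD.tens_closed res_dt_closed f D m_closed)
 have "?L = (\<Oplus>\<^sub>K p\<in>I \<times> I. tensor_lift R K (f (e (fst p) \<otimes>\<^sub>H e (snd p)) \<odot>\<^bsub>DD.T\<^esub>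
    tens R Hs Hs (res (dt (fst p))) (res (dt (snd p)))) G)" unfolding sweedler_def dual_comult_mem[OF assms(2)]
  by (rule lm_sum[OF DD.tensor_mod mod_K DD.tensor_lift_linear[OF mod_K b] finite_II]) (rule tc)
 also have "... = ?R" unfolding swd_def finsum_regular_module
  by (rule R.finsum_cong'[OF refl])
   (auto simp: lmD(3)[OF DD.tensor_lift_linear[OF mod_K b]] DD.tensor_lift_tens[OF mod_K b]
    DD.tens_closed res_dt_closed f D tot_def hmul_def cl_id sc_id bilD(3)[OF b, simplified])
 finally show ?thesis .
qed

subsection \<open>Algebra structure, antipode and actions\<close>

lemma dual_one: "one Hs = res ep" by (auto simp: dual_sel res_def ep_def cl_id intro!: restrict_ext)

lemma lin_conv: "lin F ==> lin G ==> lin (%x. x$.a b. F a*:G b)" by (intro lins)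

lemma dual_mult: assumes "f:.Hs" "g:.Hs" shows "f \<otimes>\<^sub>Hs g = res (%x. x$.a b. tot f a*:tot g b)"
proof -
 have L: "lin2 (%a b. tot f a*:tot g b)" by (intro lins lin_tot assms)
 have "sweedler R H K h (%a b. f a \<otimes> g b) = h$.a b. tot f a*:tot g b" if "h:.H" for h
  unfolding sw_sweedler[OF L] cl_id[OF that]
  by (rule CH.sweedler_cong[OF mod_K lin2_bilinear[OF L] that, symmetric])
   (simp add: tot_def cl_id smul_def sc_id dual_D(3) assms)
 then show ?thesis by (auto simp: dual_sel res_def intro!: restrict_ext)
qed

lemma dual_mult_closed: assumes "f:.Hs" "g:.Hs" shows "f \<otimes>\<^sub>Hs g:.Hs"
 unfolding dual_mult[OF assms] by (intro res_cl lin_conv lin_tot assms)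

lemma act_left_res: assumes "f:.Hs" "h:.H" shows "act_left H h f = res (%l. tot f (l**h))"
 using assms by (auto simp: act_left_def res_def tot_def hmul_def cl_id intro!: restrict_ext)

lemma act_right_res: assumes "f:.Hs" "h:.H" shows "act_right H f h = res (%l. tot f (h**l))"
 using assms by (auto simp: act_right_def res_def tot_def hmul_def cl_id intro!: restrict_ext)

lemma act_closed: assumes "f:.Hs" "h:.H" shows "act_left H h f:.Hs" "act_right H f h:.Hs"
 unfolding act_left_res[OF assms] act_right_res[OF assms] by (intro res_cl lin_comp[OF lin_tot[OF assms(1)]] lins)+

lemma dual_antipode: assumes "f:.Hs" shows "antipode Hs f = res (%x. tot f (St x))"
 using assms by (auto simp: dual_sel res_def tot_def St_def cl_id lmD(1)[OF antipode_linear] intro!: restrict_ext)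

lemma dual_antipode_closed: "f:.Hs ==> antipode Hs f:.Hs"
 unfolding dual_antipode by (intro res_cl lin_comp[OF lin_tot] lins)

text \<open>The transpose of S^-1 supplies a preimage, and the transpose of S is injective because S
  is onto.\<close>

lemma dual_antipode_inv: assumes f: "f:.Hs" shows "antipode_inv Hs f = res (%x. tot f (Si x))"
proof (rule inv_into_f_eq)
 let ?g = "res (%x. tot f (Si x))"
 have L: "lin (%x. tot f (Si x))" by (intro lin_comp[OF lin_tot[OF f]] lins)
 show g: "?g:.Hs" by (rule res_cl[OF L])
 show "antipode Hs ?g = f"
  unfolding dual_antipode[OF g] tot_res[OF L] by (simp add: tot_apply) (use res_tot[OF f] in \<open>simp add: tot_def\<close>)
 show "inj_on (antipode Hs) (carrier Hs)"
 proof (rule inj_onI)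
  fix f g assume f: "f:.Hs" and g: "g:.Hs" and eq: "antipode Hs f = antipode Hs g"
  have LL: "lin (%x. tot f (St x))" "lin (%x. tot g (St x))"
   by (intro lin_comp[OF lin_tot[OF f]] lin_comp[OF lin_tot[OF g]] lins)+
  have e: "(%x. tot f (St x)) = (%x. tot g (St x))"
   using arg_cong[OF eq, of tot] unfolding dual_antipode[OF f] dual_antipode[OF g] tot_res[OF LL(1)] tot_res[OF LL(2)] .
  have "tot f x = tot g x" for x using fun_cong[OF e, of "Si x"] by (simp add: tot_def)
  then have "tot f = tot g" by (rule ext)
  then have "res (tot f) = res (tot g)" by (rule arg_cong)
  then show "f = g" unfolding res_tot[OF f] res_tot[OF g] .
 qed
qed

lemma dual_antipode_inv_closed: "f:.Hs ==> antipode_inv Hs f:.Hs"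
 unfolding dual_antipode_inv by (intro res_cl lin_comp[OF lin_tot] lins)

end

text \<open>The second relation is \<open>sw_es_slide\<close> at h = 1. As a twisted map,
  \<open>et\<close> is available to represent the counit of the double.\<close>

lemma (in weak_hopf_basis) twisted_et: "twisted et"
proof -
 have "et (es w**h) = et h**St (es w)" for w h
 proof -
  have "cl (et (es w**h)) = cl (et h**St (es w))"
  proof (rule H_eqI)
   fix F assume F: "lin F"
   note L = lins lin_comp[OF F]
   have "F (et h**St (es w)) = uu$.a b. ep (a**h)*:F (b**St (es w))" by (rule sw_et_def(1); (intro L)+)
   also have "... = uu$.a b. ep (a**es w**h)*:F b" by (rule sw_es_slide[symmetric]; (intro L F)+)
   finally show "F (et (es w**h)) = F (et h**St (es w))" by (simp only: sw_et_def(1)[OF F] hassoc)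
  qed
  then show ?thesis by simp
 qed
 moreover have "hlin et" using hlin_et[OF hlin_id] by simp
 ultimately show ?thesis by (simp add: twisted_def et_et_mul)
qed

section \<open>Weak Hopf axioms from the values of functionals on classes\<close>

section \<open>Weak Hopf algebras presented by classes \<open>c f h\<close>\<close>

text \<open>
  Both the opposite of \<open>D'(H)\<close> and \<open>D(H)\<close> are spanned by classes \<open>c f h\<close> with
  \<open>f \<in> H\<^sup>*\<close>, \<open>h \<in> H\<close>, whose functionals are the twisted endomorphisms and whose operations have
  the values computed above; for \<open>D(H)\<close> the class \<open>c f h\<close> is \<open>[S h \<Join> f]\<close>.
\<close>

locale double_presentation = weak_hopf_basis R H I e d
 for R :: "('a, 'r) ring_scheme" and H :: "('a, 'h, 'x) hopf_scheme"
  and I :: "'i set" and e :: "'i => 'h" and d :: "'i => 'h => 'a" +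
 fixes V :: "('a, 'v, 'w) hopf_scheme" (structure) and c :: "('h => 'a) => 'h => 'v"
  and J :: "'j set" and b :: "'j => 'v" and \<beta> :: "'j => 'v => 'a" assumes mod_V: "module R V"
  and mult_V: "bilinear R V V V (mult V)" and c_bilinear: "bilinear R Hs H V c"
  and basis_V: "dual_basis R V J b \<beta>"
  and base_V: "j \<in> J ==> \<exists>f\<in>carrier Hs. \<exists>h\<in>carrier H. b j = c f h"
  and functional_V: "ph : Lin R V (regular_module R) ==>
   \<exists>tw. twisted tw \<and> (\<forall>F h. lin F --> ph (c (res F) (cl h)) = F (tw h))"
  and one_V: "one V = c (one Hs) (one H)" and product_V: "[|ph : Lin R V (regular_module R); twisted tw;
   !!F h. lin F ==> ph (c (res F) (cl h)) = F (tw h); lin F; lin G|] ==>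
   ph (c (res G) (cl k) \<otimes> c (res F) (cl h)) = prd tw F h G k"
  and comult_V: "comult V : Lin R V (tensor R V V)"
  and comult_c: "[|bilinear R V V (regular_module R) B; lin F|] ==>
   tensor_lift R (regular_module R) (comult V (c (res F) (cl h))) B =
   swd F (%P Q. h$.s t. B (c (res P) (cl s)) (c (res Q) (cl t)))"
  and counit_V: "counit V : Lin R V (regular_module R)"
  and counit_c: "lin F ==> counit V (c (res F) (cl h)) = F (et h)" and antipode_V: "antipode V : Lin R V V"
  and antipode_c: "[|ph : Lin R V (regular_module R); twisted tw;
   !!F h. lin F ==> ph (c (res F) (cl h)) = F (tw h); lin F|] ==>
   ph (antipode V (c (res F) (cl h))) = h$$.h1 h2 h3. F (h1**(St (tw (Si h2))**St h3))"
begin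

sublocale VV: two_modules R V V by (rule two_modules.intro) (rule mod_V)+

sublocale VVa: two_algebras R V V by unfold_locales (rule mult_V)+

definition cc :: "('h => 'a) => 'h => 'v" where "cc F h = c (res F) (cl h)"

definition corr :: "('v => 'a) => ('h => 'h) => bool"
 where "corr ph tw <-> ph : Lin R V K \<and> twisted tw \<and> (\<forall>F h. lin F --> ph (cc F h) = F (tw h))"

lemma corrD: assumes "corr ph tw" shows "ph : Lin R V K" "twisted tw" "lin F ==> ph (cc F h) = F (tw h)"
  "x:.V ==> ph x:.R" using assms lmD(1)[of ph R V K] by (auto simp: corr_def)

lemma corr_ex: "ph : Lin R V K ==> \<exists>tw. corr ph tw" using functional_V[of ph] by (auto simp: corr_def cc_def)

lemma cc_closed: "lin F ==> cc F h:.V" unfolding cc_def by (rule bilD(3)[OF c_bilinear res_cl]) simp_all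

lemma cc_prod: assumes "corr ph tw" "lin F" "lin G" shows "ph (cc G k \<otimes> cc F h) = prd tw F h G k"
 unfolding cc_def using assms by (intro product_V) (auto simp: corr_def cc_def)

lemma cc_antipode: assumes "corr ph tw" "lin F"
 shows "ph (antipode V (cc F h)) = h$$.h1 h2 h3. F (h1**(St (tw (Si h2))**St h3))"
 unfolding cc_def using assms by (intro antipode_c) (auto simp: corr_def cc_def)

lemma one_cc: "one V = cc ep uu" by (simp add: one_V cc_def dual_one uu_def cl_id)

lemma corr_counit: "corr (counit V) et" unfolding corr_def using counit_V twisted_et counit_c by (simp add: cc_def)

lemma mult_closed: "x:.V ==> y:.V ==> x \<otimes> y:.V" by (rule bilD(3)[OF mult_V])

lemma mult_right_linear: "x:.V ==> (%y. x \<otimes> y) : Lin R V V" by (rule bilD(1)[OF mult_V])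

lemma mult_left_linear: "y:.V ==> (%x. x \<otimes> y) : Lin R V V" by (rule bilD(2)[OF mult_V])

lemma V_sep: assumes "x:.V" "y:.V" "!!ph tw. corr ph tw ==> ph x = ph y" shows "x = y"
 by (rule dual_basis_separates[OF mod_V basis_V assms(1,2)]) (use assms(3) corr_ex in blast)

text \<open>The vectors of the dual basis are classes by \<open>base_V\<close>, and a linear map is
  determined by its values on them.\<close>

lemma V_ext: assumes "module R P" "f : Lin R V P" "g : Lin R V P" "!!F h. lin F ==> f (cc F h) = g (cc F h)" "x:.V"
 shows "f x = g x"
proof -
 interpret P: module R P by (rule assms(1))
 have eq: "f (b j) = g (b j)" if j: "j \<in> J" for j
 proof -
  obtain k h where "k:.Hs" "h:.H" "b j = c k h" using base_V[OF j] by blast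
  then show ?thesis using assms(4)[OF lin_tot[of k], of h] by (simp add: cc_def res_tot cl_id)
 qed
 have "(\<Oplus>\<^sub>P j\<in>J. \<beta> j x \<odot>\<^sub>P f (b j)) = (\<Oplus>\<^sub>P j\<in>J. \<beta> j x \<odot>\<^sub>P g (b j))"
  by (rule P.M.finsum_cong'[OF refl])
   (use dual_basisD(2,5)[OF basis_V] lmD(1)[OF assms(3)] assms(5) in \<open>auto simp: eq intro!: P.smult_closed\<close>)
 then show ?thesis
  using dual_basis_expand[OF mod_V assms(1) basis_V assms(2,5)] dual_basis_expand[OF mod_V assms(1) basis_V assms(3,5)] by simp
qed

lemma VV_sep: assumes "s:.VV.T" "t:.VV.T"
  "!!ph tw ps sg. corr ph tw ==> corr ps sg ==> VV.pair_form ph ps s = VV.pair_form ph ps t" shows "s = t"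
 by (rule VV.tensor_separates[OF basis_V basis_V assms(1,2)]) (use assms(3) corr_ex in blast)

lemma mod_VV: "module R (tensor R V V)" by (rule VV.tensor_module')

sublocale V3: two_modules R V "tensor R V V" by (rule two_modules.intro[OF mod_V mod_VV])

lemma mod_VVV: "module R (tensor3 R V)" by (rule V3.tensor_module')

abbreviation "form3 ph ps ch \<equiv> V3.pair_form ph (VV.pair_form ps ch)"

lemma form3_linear: assumes "corr ph tw" "corr ps sg" "corr ch rh" shows "form3 ph ps ch : Lin R (tensor3 R V) K"
proof -
 have "VV.pair_form ps ch : Lin R (tensor R V V) K"
  using VV.pair_form_linear[OF corrD(1)[OF assms(2)] corrD(1)[OF assms(3)]] by simp
 from V3.pair_form_linear[OF corrD(1)[OF assms(1)] this] show ?thesis by simp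
qed

lemma form3_tens: assumes "corr ph tw" "corr ps sg" "corr ch rh" "x:.V" "t:.VV.T"
 shows "form3 ph ps ch (tens R V (tensor R V V) x t) = ph x \<otimes>\<^sub>R VV.pair_form ps ch t"
proof -
 have "VV.pair_form ps ch : Lin R (tensor R V V) K"
  using VV.pair_form_linear[OF corrD(1)[OF assms(2)] corrD(1)[OF assms(3)]] by simp
 from V3.pair_form_tens[OF corrD(1)[OF assms(1)] this assms(4)] assms(5) show ?thesis by simp
qed

lemma form3_tens3: assumes "corr ph tw" "corr ps sg" "corr ch rh" "x:.V" "y:.V" "z:.V"
 shows "form3 ph ps ch (tens3 R V x y z) = ph x \<otimes>\<^sub>R (ps y \<otimes>\<^sub>R ch z)"
 using form3_tens[OF assms(1-4) VV.tens_closed[OF assms(5,6)]]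
  VV.pair_form_tens[OF corrD(1)[OF assms(2)] corrD(1)[OF assms(3)] assms(5,6)] by simp

lemma VVV_sep: assumes "s:.V3.T" "t:.V3.T"
  "!!ph tw ps sg ch rh. corr ph tw ==> corr ps sg ==> corr ch rh ==> form3 ph ps ch s = form3 ph ps ch t"
 shows "s = t"
proof -
 have bVV: "dual_basis R (tensor R V V) (J \<times> J) (%p. tens R V V (b (fst p)) (b (snd p)))
   (%p. VV.pair_form (\<beta> (fst p)) (\<beta> (snd p)))" using VV.tensor_dual_basis[OF basis_V basis_V]
  by (simp add: dual_basis_def finsum_cong_record[of "tensor R V V" VV.T])
 note TD = V3.tensor_dual_basis[OF basis_V bVV]
 interpret T: module R V3.T by (rule V3.tensor_mod)
 have eq: "V3.pair_form (\<beta> i) (VV.pair_form (\<beta> j) (\<beta> k)) s = V3.pair_form (\<beta> i) (VV.pair_form (\<beta> j) (\<beta> k)) t"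
  if "i \<in> J" "j \<in> J" "k \<in> J" for i j k using assms(3) corr_ex dual_basisD(3)[OF basis_V] that by meson
 have "(\<Oplus>\<^bsub>V3.T\<^esub>p\<in>J \<times> J \<times> J. V3.pair_form (\<beta> (fst p)) (VV.pair_form (\<beta> (fst (snd p))) (\<beta> (snd (snd p)))) s \<odot>\<^bsub>V3.T\<^esub>
   tens R V (tensor R V V) (b (fst p)) (tens R V V (b (fst (snd p))) (b (snd (snd p))))) =
  (\<Oplus>\<^bsub>V3.T\<^esub>p\<in>J \<times> J \<times> J. V3.pair_form (\<beta> (fst p)) (VV.pair_form (\<beta> (fst (snd p))) (\<beta> (snd (snd p)))) t \<odot>\<^bsub>V3.T\<^esub>
   tens R V (tensor R V V) (b (fst p)) (tens R V V (b (fst (snd p))) (b (snd (snd p)))))"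
  by (rule T.M.finsum_cong'[OF refl])
   (use dual_basisD(2,5)[OF TD] assms(1,2) in \<open>auto simp: eq intro!: T.smult_closed\<close>)
 then show ?thesis using dual_basisD(4)[OF TD] assms(1,2) by simp
qed

lemma comultiplication_V: "comultiplication R V"
 using comult_V by (simp add: comultiplication_def comultiplication_axioms_def mod_V)

sublocale CV: comultiplication R V by (rule comultiplication_V)

lemma sweedler_cc: assumes "bilinear R V V K B" "lin F"
 shows "sweedler R V K (cc F h) B = swd F (%P Q. h$.s t. B (cc P s) (cc Q t))"
 unfolding sweedler_def cc_def by (rule comult_c[OF assms])

lemma smul_id: "x:.R ==> y:.R ==> x \<otimes>\<^sub>R y = x*:y" by (simp add: smul_def sc_id)

lemma corr_mult: assumes "corr ph tw"
 shows "y:.V ==> \<exists>tw'. corr (%x. ph (x \<otimes> y)) tw'" "y:.V ==> \<exists>tw'. corr (%x. ph (y \<otimes> x)) tw'"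
 using corr_ex[OF lm_comp[OF mult_left_linear corrD(1)[OF assms]]]
  corr_ex[OF lm_comp[OF mult_right_linear corrD(1)[OF assms]]] by auto

subsection \<open>The algebra structure\<close>

lemma mult_assoc_V: assumes "x:.V" "y:.V" "z:.V" shows "x \<otimes> y \<otimes> z = x \<otimes> (y \<otimes> z)"
proof -
 note ml = mult_left_linear and mr = mult_right_linear and comp = lm_comp
 have gen: "cc P m \<otimes> cc G k \<otimes> cc F h = cc P m \<otimes> (cc G k \<otimes> cc F h)"
  if F: "lin F" and G: "lin G" and P: "lin P" for F G P h k m
 proof (rule V_sep)
  fix ph tw assume ph: "corr ph tw"
  \<comment> \<open>Multiplication by a fixed class followed by \<open>ph\<close> is again a
    functional on V, hence represented by an endomorphism; these two are the inputs of
    \<open>prd_assoc\<close>.\<close>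
  obtain tw1 where tw1: "corr (%x. ph (cc P m \<otimes> x)) tw1" using corr_mult(2)[OF ph cc_closed[OF P]] by blast
  obtain tw2 where tw2: "corr (%x. ph (x \<otimes> cc F h)) tw2" using corr_mult(1)[OF ph cc_closed[OF F]] by blast
  have "ph (cc P m \<otimes> cc G k \<otimes> cc F h) = prd tw2 G k P m" by (rule cc_prod[OF tw2 G P])
  also have "... = prd tw1 F h G k"
  proof (rule prd_assoc[OF twistedD(1)[OF corrD(2)[OF ph]] F G P, symmetric])
   show "F' (tw1 x) = prd tw F' x P m" if "lin F'" for F' x
    using corrD(3)[OF tw1 that, of x] cc_prod[OF ph that P] by simp
   show "F' (tw2 x) = prd tw F h F' x" if "lin F'" for F' x
    using corrD(3)[OF tw2 that, of x] cc_prod[OF ph F that] by simp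
  qed
  also have "... = ph (cc P m \<otimes> (cc G k \<otimes> cc F h))" by (rule cc_prod[OF tw1 F G, symmetric])
  finally show "ph (cc P m \<otimes> cc G k \<otimes> cc F h) = ph (cc P m \<otimes> (cc G k \<otimes> cc F h))" .
 qed (intro mult_closed cc_closed F G P)+
 \<comment> \<open>The identity on classes is extended to arbitrary elements by linearity, one
   factor at a time.\<close>
 have 1: "cc P m \<otimes> cc G k \<otimes> z = cc P m \<otimes> (cc G k \<otimes> z)" if G: "lin G" and P: "lin P" for G P k m
  by (rule V_ext[where f="%z. cc P m \<otimes> cc G k \<otimes> z" and g="%z. cc P m \<otimes> (cc G k \<otimes> z)", OF mod_V _ _ gen[OF _ G P] assms(3)])
   (intro mr comp[OF mr mr] mult_closed cc_closed G P)+
 have 2: "cc P m \<otimes> y \<otimes> z = cc P m \<otimes> (y \<otimes> z)" if P: "lin P" for P m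
  by (rule V_ext[where f="%y. cc P m \<otimes> y \<otimes> z" and g="%y. cc P m \<otimes> (y \<otimes> z)", OF mod_V _ _ 1[OF _ P] assms(2)])
   (intro comp[OF mr ml] comp[OF ml mr] cc_closed P assms)+
 show ?thesis
  by (rule V_ext[where f="%x. x \<otimes> y \<otimes> z" and g="%x. x \<otimes> (y \<otimes> z)", OF mod_V _ _ 2 assms(1)])
   (intro comp[OF ml ml] ml mult_closed assms)+
qed

lemma one_closed_V: "\<one>:.V" unfolding one_cc by (rule cc_closed) (intro lins)

text \<open>The factors of \<open>prd\<close> appear in reverse order in V, so
  \<open>prd_unit_right\<close> yields the left unit law and \<open>prd_unit_left\<close> the right
  one.\<close>

lemma unit_V: assumes "x:.V" shows "\<one> \<otimes> x = x" "x \<otimes> \<one> = x"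
proof -
 have ep: "lin ep" by (intro lins)
 have "\<one> \<otimes> cc F h = cc F h" if F: "lin F" for F h
  by (rule V_sep[OF mult_closed[OF one_closed_V cc_closed[OF F]] cc_closed[OF F]])
   (simp add: one_cc cc_prod[OF _ F ep] prd_unit_right[OF corrD(2) F] corrD(3)[OF _ F])
 from V_ext[OF mod_V mult_right_linear[OF one_closed_V] lm_id this assms] show "\<one> \<otimes> x = x" .
 have "cc F h \<otimes> \<one> = cc F h" if F: "lin F" for F h
  by (rule V_sep[OF mult_closed[OF cc_closed[OF F] one_closed_V] cc_closed[OF F]])
   (simp add: one_cc cc_prod[OF _ ep F] prd_unit_left[OF corrD(2) F] corrD(3)[OF _ F])
 from V_ext[OF mod_V mult_left_linear[OF one_closed_V] lm_id this assms] show "x \<otimes> \<one> = x" .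
qed

lemma unital_algebra_V: "unital_algebra R V"
proof -
 interpret V: module R V by (rule mod_V)
 have "ring V"
 proof (rule ringI)
  show "monoid V" by (rule monoidI) (simp_all add: mult_closed one_closed_V mult_assoc_V unit_V)
 qed (simp_all add: module.axioms(2)[OF mod_V] lmD(2)[OF mult_left_linear] lmD(2)[OF mult_right_linear])
 then show ?thesis by (intro unital_algebra.intro mod_V unital_algebra_axioms.intro)
   (simp_all add: lmD(3)[OF mult_left_linear] lmD(3)[OF mult_right_linear])
qed

subsection \<open>The coalgebra structure\<close>

lemma pair_bilinear: assumes "corr ph tw" "corr ps sg" shows "bilinear R V V K (%x y. ph x \<otimes>\<^sub>R ps y)"
 by (rule R.product_bilinear[OF mod_V mod_V corrD(1)[OF assms(1)] corrD(1)[OF assms(2)]])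

text \<open>Dually to the coproduct, functionals multiply by convolution of the endomorphisms that
  represent them.\<close>

lemma pair_form_comult: assumes ph: "corr ph tw" and ps: "corr ps sg" and F: "lin F"
 shows "VV.pair_form ph ps (comult V (cc F h)) = h$.s t. F (tw s**sg t)" (is "?L = _")
proof -
 have "?L = swd F (%P Q. h$.s t. ph (cc P s) \<otimes>\<^sub>R ps (cc Q t))"
  using sweedler_cc[OF pair_bilinear[OF ph ps] F] by (simp add: sweedler_def VV.pair_form_def)
 also have "... = swd F (%P Q. h$.s t. P (tw s)*:Q (sg t))"
  by (rule swd_cong) (simp add: corrD(3)[OF ph] corrD(3)[OF ps] smul_id linD(1))
 finally show ?thesis by (simp only: swd_sw swd_eval[OF F])
qed

lemma comult_closed_V: "x:.V ==> comult V x:.VV.T" using lmD(1)[OF comult_V] by simp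

lemma coalgebra_tens_bilinear: "bilinear R V V (tensor3 R V) (%x y. tens R V (tensor R V V) x (comult V y))"
proof (rule bilI)
 note B = V3.tens_bilinear
 show "(%y. tens R V (tensor R V V) x (comult V y)) : Lin R V (tensor3 R V)" if "x:.V" for x
  using lm_comp[OF comult_V bilD(1)[OF B that]] by simp
 show "(%x. tens R V (tensor R V V) x (comult V y)) : Lin R V (tensor3 R V)" if "y:.V" for y
  using bilD(2)[OF B, of "comult V y"] comult_closed_V[OF that] by simp
qed

lemma tens3_linear_V: assumes "x:.V" "y:.V" "z:.V" shows "(%x. tens3 R V x y z) : Lin R V (tensor3 R V)" (is ?A)
  "(%y. tens3 R V x y z) : Lin R V (tensor3 R V)" (is ?B) "(%z. tens3 R V x y z) : Lin R V (tensor3 R V)" (is ?C)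
proof -
 note B = V3.tens_bilinear and B' = VV.tens_bilinear
 show ?A
  using bilD(2)[OF B, of "tens R V V y z"] assms by (simp add: VV.tens_closed)
 have s: "(%s. tens R V (tensor R V V) x s) : Lin R VV.T (tensor3 R V)" using bilD(1)[OF B, of x] assms by simp
 show ?B by (rule lm_comp[OF bilD(2)[OF B' assms(3)] s])
 show ?C by (rule lm_comp[OF bilD(1)[OF B' assms(2)] s])
qed

lemma tens3_sweedler_props: "!!z. z:.V ==> bilinear R V V (tensor3 R V) (%x y. tens3 R V x y z)"
 "!!x y. [|x:.V; y:.V|] ==> (%z. tens3 R V x y z) : Lin R V (tensor3 R V)"
 by (rule bilI; rule tens3_linear_V[of _ _ _] tens3_linear_V(2); assumption?)
  (rule tens3_linear_V(3)[OF _ _ one_closed_V]; assumption)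

lemma form3_bilinear: assumes "corr ph tw" "corr ps sg" "corr ch rh" "z:.V"
 shows "bilinear R V V K (%x y. ph x \<otimes>\<^sub>R (ps y \<otimes>\<^sub>R ch z))"
proof (rule R.product_bilinear[OF mod_V mod_V corrD(1)[OF assms(1)]])
 show "(%y. ps y \<otimes>\<^sub>R ch z) : Lin R V K"
  using lm_const_smult[OF mod_V mod_K corrD(1)[OF assms(2)], of "ch z"] corrD(4)[OF assms(3,4)] by simp
qed

lemma form3_linear_last: assumes "corr ph tw" "corr ps sg" "corr ch rh" "x:.V" "y:.V"
 shows "(%z. ph x \<otimes>\<^sub>R (ps y \<otimes>\<^sub>R ch z)) : Lin R V K"
 using lm_smult[OF mod_V mod_K lm_smult[OF mod_V mod_K corrD(1)[OF assms(3)]], of "ps y" "ph x"]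
  corrD(4)[OF assms(1,4)] corrD(4)[OF assms(2,5)] by simp

lemma form3_sweedler3: assumes ph: "corr ph tw" and ps: "corr ps sg" and ch: "corr ch rh" and F: "lin F"
 shows "form3 ph ps ch (sweedler3 R V (tensor3 R V) (cc F h) (%x y z. tens3 R V x y z)) =
  h$$.s t u. F (tw s**(sg t**rh u))"
proof -
 note T = twistedD(6)[OF corrD(2)[OF ph]] twistedD(6)[OF corrD(2)[OF ps]] twistedD(6)[OF corrD(2)[OF ch]]
 note L = lins T lin_comp[OF F] and cl = cc_closed[OF F]
 note B = form3_bilinear[OF ph ps ch] and B3 = form3_linear_last[OF ph ps ch]
 have "form3 ph ps ch (sweedler3 R V (tensor3 R V) (cc F h) (%x y z. tens3 R V x y z)) =
   sweedler3 R V K (cc F h) (%x y z. form3 ph ps ch (tens3 R V x y z))"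
  by (rule CV.sweedler3_comp[OF mod_VVV mod_K tens3_sweedler_props form3_linear[OF ph ps ch] cl])
 also have "... = sweedler3 R V K (cc F h) (%x y z. ph x \<otimes>\<^sub>R (ps y \<otimes>\<^sub>R ch z))"
  by (rule CV.sweedler3_cong[OF mod_K B B3 cl, symmetric]) (simp_all add: form3_tens3[OF ph ps ch])
 also have "... = swd F (%P Q. h$.s t. sweedler R V K (cc P s) (%x y. ph x \<otimes>\<^sub>R (ps y \<otimes>\<^sub>R ch (cc Q t))))"
  unfolding sweedler3_def by (rule sweedler_cc[OF CV.sweedler3_inner_bilinear[OF mod_K B B3] F])
 also have "... = swd F (%P Q. h$.s t. swd P (%P1 P2. s$.s1 s2. P1 (tw s1)*:(P2 (sg s2)*:Q (rh t))))"
 proof (rule swd_cong)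
  fix P Q assume P: "lin P" and Q: "lin Q"
  have "sweedler R V K (cc P s) (%x y. ph x \<otimes>\<^sub>R (ps y \<otimes>\<^sub>R ch (cc Q t))) =
   swd P (%P1 P2. s$.s1 s2. P1 (tw s1)*:(P2 (sg s2)*:Q (rh t)))" for s t
   unfolding sweedler_cc[OF B[OF cc_closed[OF Q]] P]
   by (rule swd_cong) (simp add: corrD(3)[OF ph] corrD(3)[OF ps] corrD(3)[OF ch] Q smul_id linD(1))
  then show "h$.s t. sweedler R V K (cc P s) (%x y. ph x \<otimes>\<^sub>R (ps y \<otimes>\<^sub>R ch (cc Q t))) =
   h$.s t. swd P (%P1 P2. s$.s1 s2. P1 (tw s1)*:(P2 (sg s2)*:Q (rh t)))" by simp qed
 also have "... = swd F (%P Q. h$.s t. s$.s1 s2. P (tw s1**sg s2)*:Q (rh t))"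
  by (rule swd_cong) (simp add: swd_sw swd_eval')
 also have "... = h$.s t. s$.s1 s2. F (tw s1**(sg s2**rh t))" by (simp only: swd_sw swd_eval[OF F] hassoc)
 also have "... = h$$.s t u. F (tw s**(sg t**rh u))" by (rule sw_coassoc; (intro L)+)
 finally show ?thesis .
qed

lemma coassoc_V: assumes "x:.V" shows "sweedler3 R V (tensor3 R V) x (%x y z. tens3 R V x y z) =
  sweedler R V (tensor3 R V) x (%x y. tens R V (tensor R V V) x (comult V y))"
proof (rule V_ext[OF mod_VVV _ _ _ assms])
 show l1: "(%x. sweedler3 R V (tensor3 R V) x (%x y z. tens3 R V x y z)) : Lin R V (tensor3 R V)"
  by (rule CV.sweedler3_linear[OF mod_VVV tens3_sweedler_props])
 show l2: "(%x. sweedler R V (tensor3 R V) x (%x y. tens R V (tensor R V V) x (comult V y))) : Lin R V (tensor3 R V)"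
  by (rule CV.sweedler_linear[OF mod_VVV coalgebra_tens_bilinear])
 fix F h assume F: "lin F"
 show "sweedler3 R V (tensor3 R V) (cc F h) (%x y z. tens3 R V x y z) =
  sweedler R V (tensor3 R V) (cc F h) (%x y. tens R V (tensor R V V) x (comult V y))" proof (rule VVV_sep)
  show "sweedler3 R V (tensor3 R V) (cc F h) (%x y z. tens3 R V x y z):.V3.T"
   "sweedler R V (tensor3 R V) (cc F h) (%x y. tens R V (tensor R V V) x (comult V y)):.V3.T"
   using lmD(1)[OF l1 cc_closed[OF F]] lmD(1)[OF l2 cc_closed[OF F]] by simp_all
  fix ph tw ps sg ch rh assume ph: "corr ph tw" and ps: "corr ps sg" and ch: "corr ch rh"
  have pl: "(%y. VV.pair_form ps ch (comult V y)) : Lin R V K"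
   using lm_comp[OF comult_V[simplified] VV.pair_form_linear[OF corrD(1)[OF ps] corrD(1)[OF ch]]] .
  have B: "bilinear R V V K (%x y. ph x \<otimes>\<^sub>R VV.pair_form ps ch (comult V y))"
   by (rule R.product_bilinear[OF mod_V mod_V corrD(1)[OF ph] pl])
  have "form3 ph ps ch (sweedler R V (tensor3 R V) (cc F h) (%x y. tens R V (tensor R V V) x (comult V y))) =
   sweedler R V K (cc F h) (%x y. form3 ph ps ch (tens R V (tensor R V V) x (comult V y)))"
   by (rule CV.sweedler_comp[OF mod_VVV mod_K coalgebra_tens_bilinear form3_linear[OF ph ps ch] cc_closed[OF F]])
  also have "... = sweedler R V K (cc F h) (%x y. ph x \<otimes>\<^sub>R VV.pair_form ps ch (comult V y))"
   by (rule CV.sweedler_cong[OF mod_K B cc_closed[OF F], symmetric])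
    (simp add: form3_tens[OF ph ps ch] comult_closed_V)
  also have "... = swd F (%P Q. h$.s t. ph (cc P s) \<otimes>\<^sub>R VV.pair_form ps ch (comult V (cc Q t)))"
   by (rule sweedler_cc[OF B F])
  also have "... = swd F (%P Q. h$$.s t1 t2. P (tw s)*:Q (sg t1**rh t2))"
   by (rule swd_cong) (simp add: corrD(3)[OF ph] pair_form_comult[OF ps ch] smul_id linD(1) sw_smul)
  also have "... = h$$.s t u. F (tw s**(sg t**rh u))" by (simp only: swd_sw swd_eval[OF F])
  finally show "form3 ph ps ch (sweedler3 R V (tensor3 R V) (cc F h) (%x y z. tens3 R V x y z)) =
   form3 ph ps ch (sweedler R V (tensor3 R V) (cc F h) (%x y. tens R V (tensor R V V) x (comult V y)))"
   using form3_sweedler3[OF ph ps ch F] by simp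
 qed
qed

lemma scaled_bilinear: assumes "f : Lin R V K"
 shows "bilinear R V V V (%x y. f x \<odot> y)" (is ?A) "bilinear R V V V (%x y. f y \<odot> x)"
proof -
 note f = lmD(1)[OF assms, simplified]
 show ?A "bilinear R V V V (%x y. f y \<odot> x)" by (rule bilI;
   rule lm_smult[OF mod_V mod_V lm_id f] lm_const_smult[OF mod_V mod_V assms]; assumption)+
qed

lemma counit_V_laws: assumes "x:.V"
 shows "sweedler R V V x (%x y. counit V x \<odot> y) = x" (is "?L = _") "sweedler R V V x (%x y. counit V y \<odot> x) = x" (is ?A)
proof -
 note sb = scaled_bilinear[OF counit_V] and ec = corrD(4)[OF corr_counit]
 have "sweedler R V V (cc F h) (%x y. counit V x \<odot> y) = cc F h" if F: "lin F" for F h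
 proof (rule V_sep[OF CV.sweedler_closed[OF mod_V sb(1) cc_closed[OF F]] cc_closed[OF F]])
  fix ph tw assume ph: "corr ph tw"
  note L = lins lin_comp[OF F] twistedD(6)[OF corrD(2)[OF ph]]
  have "ph (sweedler R V V (cc F h) (%x y. counit V x \<odot> y)) = sweedler R V K (cc F h) (%x y. ph (counit V x \<odot> y))"
   by (rule CV.sweedler_comp[OF mod_V mod_K sb(1) corrD(1)[OF ph] cc_closed[OF F]])
  also have "... = sweedler R V K (cc F h) (%x y. counit V x \<otimes>\<^sub>R ph y)"
   by (rule CV.sweedler_cong[OF mod_K pair_bilinear[OF corr_counit ph] cc_closed[OF F], symmetric])
    (simp add: lmD(3)[OF corrD(1)[OF ph]] ec)
  also have "... = h$.s t. F (et s**tw t)"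
   using pair_form_comult[OF corr_counit ph F] by (simp add: sweedler_def VV.pair_form_def)
  also have "... = h$.s t. F (tw (et s**t))" by (simp only: twistedD(4)[OF corrD(2)[OF ph]])
  also have "... = F (tw h)" by (rule sw_et_one; (intro L)+)
  finally show "ph (sweedler R V V (cc F h) (%x y. counit V x \<odot> y)) = ph (cc F h)" by (simp add: corrD(3)[OF ph F])
 qed
 from V_ext[OF mod_V CV.sweedler_linear[OF mod_V sb(1)] lm_id this assms]
 show "?L = x" .
 have "sweedler R V V (cc F h) (%x y. counit V y \<odot> x) = cc F h" if F: "lin F" for F h
 proof (rule V_sep[OF CV.sweedler_closed[OF mod_V sb(2) cc_closed[OF F]] cc_closed[OF F]])
  fix ph tw assume ph: "corr ph tw"
  note L = lins lin_comp[OF F] twistedD(6)[OF corrD(2)[OF ph]]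
  have "ph (sweedler R V V (cc F h) (%x y. counit V y \<odot> x)) = sweedler R V K (cc F h) (%x y. ph (counit V y \<odot> x))"
   by (rule CV.sweedler_comp[OF mod_V mod_K sb(2) corrD(1)[OF ph] cc_closed[OF F]])
  also have "... = sweedler R V K (cc F h) (%x y. ph x \<otimes>\<^sub>R counit V y)"
   by (rule CV.sweedler_cong[OF mod_K pair_bilinear[OF ph corr_counit] cc_closed[OF F], symmetric])
    (simp add: lmD(3)[OF corrD(1)[OF ph]] ec corrD(4)[OF ph] R.m_comm)
  also have "... = h$.s t. F (tw s**et t)"
   using pair_form_comult[OF ph corr_counit F] by (simp add: sweedler_def VV.pair_form_def)
  also have "... = uu$.u v. F (tw (u**h)**v)" by (rule sw_et_right; (intro L)+)
  also have "... = F (tw h)" by (rule tw_left_St[OF corrD(2)[OF ph] F])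
  finally show "ph (sweedler R V V (cc F h) (%x y. counit V y \<odot> x)) = ph (cc F h)" by (simp add: corrD(3)[OF ph F])
 qed
 from V_ext[OF mod_V CV.sweedler_linear[OF mod_V sb(2)] lm_id this assms]
 show ?A .
qed

lemma coalgebra_V: "coalgebra R V"
 by (intro coalgebra.intro mod_V coalgebra_axioms.intro comult_V counit_V coassoc_V counit_V_laws)

subsection \<open>The compatibility of product and coproduct\<close>

lemma one_linear: "lin ep" "cc ep uu = \<one>" by (intro lins) (simp add: one_cc)

lemma comult_mult_cc: assumes F: "lin F" and G: "lin G"
 shows "comult V (cc G k \<otimes> cc F h) = comult V (cc G k) \<otimes>\<^bsub>tensor R V V\<^esub> comult V (cc F h)"
proof (rule VV_sep)
 note cl = comult_closed_V[OF cc_closed]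
 let ?s = "comult V (cc G k)" and ?t = "comult V (cc F h)"
 show "comult V (cc G k \<otimes> cc F h):.VV.T" by (intro comult_closed_V mult_closed cc_closed F G)
 show "?s \<otimes>\<^bsub>tensor R V V\<^esub> ?t:.VV.T" by (intro VVa.tensor_mult_closed cl F G)
 fix ph tw ps sg assume ph: "corr ph tw" and ps: "corr ps sg"
 let ?pf = "VV.pair_form ph ps"
 have pl: "?pf : Lin R VV.T K" by (rule VV.pair_form_linear[OF corrD(1)[OF ph] corrD(1)[OF ps]])
 \<comment> \<open>\<open>rh\<close> represents the coproduct tested by \<open>ph\<close> and
   \<open>ps\<close>. By \<open>pair_form_comult\<close> it is the convolution of \<open>tw\<close>
   and \<open>sg\<close>, which is the hypothesis of \<open>prd_conv\<close>.\<close>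
 obtain rh where rh: "corr (%x. ?pf (comult V x)) rh" using corr_ex[OF lm_comp[OF comult_V[simplified] pl]] by blast
 have rhv: "F' (rh x) = x$.a b. F' (tw a**sg b)" if "lin F'" for F' x
  using corrD(3)[OF rh that, of x] pair_form_comult[OF ph ps that] by simp
 have B: "bilinear R V V K (%m n. ?pf (tensor_lift R VV.T ?t (%m' n'. tens R V V (m \<otimes> m') (n \<otimes> n'))))"
  by (rule VV.bilinear_comp[OF VVa.mult_tens_bilinear'[OF cl[OF F]] pl])
 have B': "bilinear R V V K (%m' n'. ph (m \<otimes> m') \<otimes>\<^sub>R ps (n \<otimes> n'))" if "m:.V" "n:.V" for m n
  by (rule R.product_bilinear[OF mod_V mod_V lm_comp[OF mult_right_linear[OF that(1)] corrD(1)[OF ph]]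
   lm_comp[OF mult_right_linear[OF that(2)] corrD(1)[OF ps]]])
 have inner: "?pf (tensor_lift R VV.T ?t (%m' n'. tens R V V (m \<otimes> m') (n \<otimes> n'))) =
   swd F (%P Q. h$.s t. ph (m \<otimes> cc P s) \<otimes>\<^sub>R ps (n \<otimes> cc Q t))" if mn: "m:.V" "n:.V" for m n
 proof -
  have "?pf (tensor_lift R VV.T ?t (%m' n'. tens R V V (m \<otimes> m') (n \<otimes> n'))) =
   sweedler R V K (cc F h) (%m' n'. ?pf (tens R V V (m \<otimes> m') (n \<otimes> n')))" unfolding sweedler_def
   by (rule VV.tensor_lift_comp[OF VV.tensor_mod mod_K VVa.mult_tens_bilinear(1)[OF mn] pl cl[OF F]])
  also have "... = sweedler R V K (cc F h) (%m' n'. ph (m \<otimes> m') \<otimes>\<^sub>R ps (n \<otimes> n'))"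
   by (rule CV.sweedler_cong[OF mod_K B'[OF mn] cc_closed[OF F], symmetric])
    (simp add: VV.pair_form_tens[OF corrD(1)[OF ph] corrD(1)[OF ps]] mult_closed mn)
  finally show ?thesis unfolding sweedler_cc[OF B'[OF mn] F] .
 qed
 have "?pf (comult V (cc G k \<otimes> cc F h)) = prd rh F h G k" by (rule cc_prod[OF rh F G])
 also have "... = h$.ha hb. k$.ka kb. ha$$.a b c. (tw (b**ka))$.u v. hb$$.a' b' c'. (sg (b'**kb))$.u' v'.
   F (v**v')*:G ((St a**(u**c))**(St a'**(u'**c')))" by (rule prd_conv[OF corrD(2)[OF ph] corrD(2)[OF ps] F G rhv])
 \<comment> \<open>The coproducts of F and G are reintroduced by reading \<open>swd_eval\<close>
   backwards, so that one product in V appears for each tensor leg.\<close>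
 also have "... = swd G (%P' Q'. k$.ka kb. swd F (%P Q. h$.ha hb. prd tw P ha P' ka*:prd sg Q hb Q' kb))"
 proof -
  have "swd G (%P' Q'. k$.ka kb. swd F (%P Q. h$.ha hb. prd tw P ha P' ka*:prd sg Q hb Q' kb)) =
   swd G (%P' Q'. k$.ka kb. swd F (%P Q. h$.ha hb.
    ha$$.a b c. (tw (b**ka))$.u v. hb$$.a' b' c'. (sg (b'**kb))$.u' v'.
     P v*:(Q v'*:(P' (St a**(u**c))*:Q' (St a'**(u'**c'))))))"
   by (simp only: prd_def sw_smul(2), simp only: sw_smul(1), simp only: smul_assoc smul_left_comm smul_comm)
  also have "... = sw k (%ka kb. h$.ha hb. ha$$.a b c. (tw (b**ka))$.u v. hb$$.a' b' c'. (sg (b'**kb))$.u' v'.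
     F (v**v')*:G ((St a**(u**c))**(St a'**(u'**c')))) "
   by (simp only: swd_sw swd_eval'(1)[OF F] swd_smul(1)[symmetric] swd_eval[OF G])
  finally show ?thesis by (simp only: sw_swap[of k])
 qed
 also have "... = swd G (%P' Q'. k$.ka kb. swd F (%P Q. h$.s t.
   ph (cc P' ka \<otimes> cc P s) \<otimes>\<^sub>R ps (cc Q' kb \<otimes> cc Q t)))" proof (rule swd_cong)
  fix P' Q' assume P': "lin P'" and Q': "lin Q'"
  have "swd F (%P Q. h$.ha hb. prd tw P ha P' ka*:prd sg Q hb Q' kb) =
   swd F (%P Q. h$.s t. ph (cc P' ka \<otimes> cc P s) \<otimes>\<^sub>R ps (cc Q' kb \<otimes> cc Q t))" for ka kb
   by (rule swd_cong) (simp add: cc_prod[OF ph _ P'] cc_prod[OF ps _ Q'] prd_def smul_id)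
  then show "k$.ka kb. swd F (%P Q. h$.ha hb. prd tw P ha P' ka*:prd sg Q hb Q' kb) =
   k$.ka kb. swd F (%P Q. h$.s t. ph (cc P' ka \<otimes> cc P s) \<otimes>\<^sub>R ps (cc Q' kb \<otimes> cc Q t))" by simp
 qed
 also have "... = sweedler R V K (cc G k) (%m n. ?pf (tensor_lift R VV.T ?t (%m' n'. tens R V V (m \<otimes> m') (n \<otimes> n'))))"
  unfolding sweedler_cc[OF B G] by (rule swd_cong) (simp add: inner[OF cc_closed cc_closed])
 also have "... = ?pf (?s \<otimes>\<^bsub>tensor R V V\<^esub> ?t)" unfolding sweedler_def VVa.tensor_mult
  by (rule VV.tensor_lift_comp[OF VV.tensor_mod mod_K VVa.mult_tens_bilinear'[OF cl[OF F]] pl cl[OF G], symmetric])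
 finally show "?pf (comult V (cc G k \<otimes> cc F h)) = ?pf (?s \<otimes>\<^bsub>tensor R V V\<^esub> ?t)" .
qed

lemma comult_mult_V: assumes "x:.V" "y:.V"
 shows "comult V (x \<otimes> y) = comult V x \<otimes>\<^bsub>tensor R V V\<^esub> comult V y"
proof -
 note cm = comult_V[simplified] and mod = VV.tensor_mod and B = VVa.tensor_mult_bilinear
 note ml = mult_left_linear and mr = mult_right_linear and cl = comult_closed_V
 have 1: "comult V (cc G k \<otimes> y) = comult V (cc G k) \<otimes>\<^bsub>tensor R V V\<^esub> comult V y" if G: "lin G" for G k
  by (rule V_ext[where f="%y. comult V (cc G k \<otimes> y)" and g="%y. comult V (cc G k) \<otimes>\<^bsub>tensor R V V\<^esub> comult V y",
    OF mod lm_comp[OF mr[OF cc_closed[OF G]] cm] lm_comp[OF cm bilD(1)[OF B cl[OF cc_closed[OF G]]]]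
     comult_mult_cc[OF _ G] assms(2)])
 show ?thesis
  by (rule V_ext[where f="%x. comult V (x \<otimes> y)" and g="%x. comult V x \<otimes>\<^bsub>tensor R V V\<^esub> comult V y",
    OF mod lm_comp[OF ml[OF assms(2)] cm] lm_comp[OF cm bilD(2)[OF B cl[OF assms(2)]]] 1 assms(1)])
qed

subsection \<open>The unit and the counit\<close>

text \<open>\<open>op\<close> is the product or its opposite, so the right-hand sides of both halves
  of the unit axiom are evaluated together.\<close>

lemma comult_one_form:
 assumes op: "bilinear R V V V op" and ph: "corr ph tw" and ps: "corr ps sg" and ch: "corr ch rh"
 shows "sweedler R V (tensor3 R V) \<one> (%a b. sweedler R V (tensor3 R V) \<one> (%a' b'. tens3 R V a (op b a') b')):.V3.T"
  "form3 ph ps ch (sweedler R V (tensor3 R V) \<one> (%a b. sweedler R V (tensor3 R V) \<one> (%a' b'. tens3 R V a (op b a') b'))) =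
   swd ep (%P Q. uu$.a b. swd ep (%P' Q'. uu$.a' b'.
    P (tw a)*:(ps (op (cc Q b) (cc P' a'))*:Q' (rh b'))))"
proof -
 note o = bilD[OF op] and one = one_closed_V
 let ?E = "%a b. sweedler R V (tensor3 R V) \<one> (%a' b'. tens3 R V a (op b a') b')"
 have b1: "bilinear R V V (tensor3 R V) (%a' b'. tens3 R V a (op b a') b')" if "a:.V" "b:.V" for a b
  by (rule bilI; (rule tens3_linear_V(3)[OF that(1) o(3)[OF that(2)] one] |
   rule lm_comp[OF o(1)[OF that(2)] tens3_linear_V(2)[OF that(1) one]]); assumption)
 have b2: "bilinear R V V (tensor3 R V) ?E"
 proof (rule bilI)
  fix a assume a: "a:.V"
  show "(%b. ?E a b) : Lin R V (tensor3 R V)" by (rule CV.sweedler_fun_linear[OF mod_VVV mod_V b1[OF a] _ one])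
    (assumption | rule lm_comp[OF o(2) tens3_linear_V(2)[OF a one]])+
  show "(%b. ?E b a) : Lin R V (tensor3 R V)" by (rule CV.sweedler_fun_linear[OF mod_VVV mod_V b1[OF _ a] _ one])
    (assumption | rule tens3_linear_V(1)[OF one o(3)[OF a]])+
 qed
 show "sweedler R V (tensor3 R V) \<one> ?E:.V3.T" using CV.sweedler_closed[OF mod_VVV b2 one] by simp
 note f3 = form3_linear[OF ph ps ch]
 have b3: "bilinear R V V K (%a' b'. ph a \<otimes>\<^sub>R (ps (op b a') \<otimes>\<^sub>R ch b'))" if "a:.V" "b:.V" for a b
  by (rule VV.bilinear_smult[OF mod_K R.product_bilinear[OF mod_V mod_V lm_comp[OF o(1)[OF that(2)] corrD(1)[OF ps]] corrD(1)[OF ch]]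
   corrD(4)[OF ph that(1)], simplified])
 have inner: "form3 ph ps ch (?E a b) = swd ep (%P' Q'. uu$.a' b'. ph a \<otimes>\<^sub>R (ps (op b (cc P' a')) \<otimes>\<^sub>R ch (cc Q' b')))"
  if ab: "a:.V" "b:.V" for a b
 proof -
  have "form3 ph ps ch (?E a b) = sweedler R V K \<one> (%a' b'. form3 ph ps ch (tens3 R V a (op b a') b'))"
   by (rule CV.sweedler_comp[OF mod_VVV mod_K b1[OF ab] f3 one])
  also have "... = sweedler R V K \<one> (%a' b'. ph a \<otimes>\<^sub>R (ps (op b a') \<otimes>\<^sub>R ch b'))"
   by (rule CV.sweedler_cong[OF mod_K b3[OF ab] one, symmetric]) (simp add: form3_tens3[OF ph ps ch] ab o(3))
  finally show ?thesis unfolding one_cc sweedler_cc[OF b3[OF ab] one_linear(1)] .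
 qed
 have "form3 ph ps ch (sweedler R V (tensor3 R V) \<one> ?E) = sweedler R V K \<one> (%a b. form3 ph ps ch (?E a b))"
  by (rule CV.sweedler_comp[OF mod_VVV mod_K b2 f3 one])
 also have "... = swd ep (%P Q. uu$.a b. form3 ph ps ch (?E (cc P a) (cc Q b)))"
  unfolding one_cc by (rule sweedler_cc[OF VV.bilinear_comp[OF b2[unfolded one_cc] f3] one_linear(1)])
 also have "... = swd ep (%P Q. uu$.a b. swd ep (%P' Q'. uu$.a' b'.
    P (tw a)*:(ps (op (cc Q b) (cc P' a'))*:Q' (rh b'))))" proof (rule swd_cong)
  fix P Q assume P: "lin P" and Q: "lin Q"
  have "form3 ph ps ch (?E (cc P a) (cc Q b)) = swd ep (%P' Q'. uu$.a' b'.
    P (tw a)*:(ps (op (cc Q b) (cc P' a'))*:Q' (rh b')))" for a b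
   unfolding inner[OF cc_closed[OF P] cc_closed[OF Q]] by (rule swd_cong)
    (simp add: corrD(3)[OF ph P] corrD(3)[OF ch] smul_id linD(1)[OF P] linD(1) corrD(4)[OF ps] o(3) cc_closed Q)
  then show "uu$.a b. form3 ph ps ch (?E (cc P a) (cc Q b)) = uu$.a b. swd ep (%P' Q'. uu$.a' b'.
    P (tw a)*:(ps (op (cc Q b) (cc P' a'))*:Q' (rh b')))" by simp qed
 finally show "form3 ph ps ch (sweedler R V (tensor3 R V) \<one> ?E) = ..." .
qed

lemma comult_one_V: "sweedler3 R V (tensor3 R V) \<one> (%a b c. tens3 R V a b c) =
  sweedler R V (tensor3 R V) \<one> (%a b. sweedler R V (tensor3 R V) \<one> (%a' b'. tens3 R V a (b \<otimes> a') b'))" (is "?L = ?M1")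
 "sweedler3 R V (tensor3 R V) \<one> (%a b c. tens3 R V a b c) =
  sweedler R V (tensor3 R V) \<one> (%a b. sweedler R V (tensor3 R V) \<one> (%a' b'. tens3 R V a (a' \<otimes> b) b'))" (is "_ = ?M2")
proof -
 have opp: "bilinear R V V V (%x y. y \<otimes> x)"
  by (rule bilI) (intro mult_left_linear mult_right_linear; assumption)+
 have lhs: "?L:.V3.T"
  using lmD(1)[OF CV.sweedler3_linear[OF mod_VVV tens3_sweedler_props] one_closed_V] by simp
 note ep = one_linear(1)
 have l: "form3 ph ps ch ?L = ep (tw uu**(sg uu**rh uu))"
  if "corr ph tw" "corr ps sg" "corr ch rh" for ph tw ps sg ch rh unfolding one_cc form3_sweedler3[OF that ep]
  by (rule comult_one_double[OF corrD(2)[OF that(1)] corrD(2)[OF that(2)] corrD(2)[OF that(3)]])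
 \<comment> \<open>Both halves have this shape: \<open>m\<close> is the product of the middle legs
   in one of the two orders, and \<open>N\<close> is the value of a functional on it.\<close>
 have main: "?L = sweedler R V (tensor3 R V) \<one> (%a b. sweedler R V (tensor3 R V) \<one> (%a' b'. tens3 R V a (m b a') b'))"
  if m: "bilinear R V V V m"
   and e: "!!ps sg P b Q a. [|corr ps sg; lin P; lin Q|] ==> ps (m (cc P b) (cc Q a)) = N sg P b Q a"
   and v: "!!tw sg rh. [|twisted tw; twisted sg; twisted rh|] ==> swd ep (%P Q. uu$.a b. swd ep (%P' Q'. uu$.a' b'.
    P (tw a)*:(N sg Q b P' a'*:Q' (rh b')))) = ep (tw uu**(sg uu**rh uu))" for m N
 proof (rule VVV_sep[OF lhs comult_one_form(1)[OF m corr_counit corr_counit corr_counit]])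
  fix ph tw ps sg ch rh assume c: "corr ph tw" "corr ps sg" "corr ch rh"
  have "swd ep (%P' Q'. uu$.a' b'. P (tw a)*:(ps (m (cc Q b) (cc P' a'))*:Q' (rh b'))) =
    swd ep (%P' Q'. uu$.a' b'. P (tw a)*:(N sg Q b P' a'*:Q' (rh b')))" if "lin Q" for P Q a b
   by (rule swd_cong) (simp add: e[OF c(2) that])
  then have "swd ep (%P Q. uu$.a b. swd ep (%P' Q'. uu$.a' b'. P (tw a)*:(ps (m (cc Q b) (cc P' a'))*:Q' (rh b')))) =
   ep (tw uu**(sg uu**rh uu))"
   unfolding v[OF corrD(2)[OF c(1)] corrD(2)[OF c(2)] corrD(2)[OF c(3)], symmetric] by (intro swd_cong) simp
  then show "form3 ph ps ch ?L = form3 ph ps ch (sweedler R V (tensor3 R V) \<one>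
    (%a b. sweedler R V (tensor3 R V) \<one> (%a' b'. tens3 R V a (m b a') b')))"
   by (simp only: l[OF c] comult_one_form(2)[OF m c])
 qed
 note ev = swd_sw swd_smul(1)[symmetric] swd_eval[OF ep] swd_eval'(1)[OF ep]
 show "?L = ?M1"
 proof (rule main[OF mult_V])
  fix tw sg rh assume t: "twisted tw" "twisted sg" "twisted rh"
  have "swd ep (%P Q. uu$.a b. swd ep (%P' Q'. uu$.a' b'. P (tw a)*:(prd sg P' a' Q b*:Q' (rh b')))) =
   swd ep (%P Q. uu$.a b. swd ep (%P' Q'. uu$.a' b'. a'$$.h1 h2 h3. (sg (h2**b))$.u v.
    P (tw a)*:(Q (St h1**(u**h3))*:(P' v*:Q' (rh b')))))"
   by (simp only: prd_def sw_smul smul_assoc smul_left_comm smul_comm)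
  also have "... = uu$.a b. uu$.a' b'. a'$$.h1 h2 h3. (sg (h2**b))$.u v. ep (tw a**(St h1**(u**h3)))*:ep (v**rh b')"
   by (simp only: ev)
  finally show "swd ep (%P Q. uu$.a b. swd ep (%P' Q'. uu$.a' b'. P (tw a)*:(prd sg P' a' Q b*:Q' (rh b')))) =
   ep (tw uu**(sg uu**rh uu))" unfolding comult_one_double2[OF t] .
 qed (rule cc_prod)
 show "?L = ?M2"
 proof (rule main[OF opp])
  fix tw sg rh assume t: "twisted tw" "twisted sg" "twisted rh"
  have "swd ep (%P Q. uu$.a b. swd ep (%P' Q'. uu$.a' b'. P (tw a)*:(prd sg Q b P' a'*:Q' (rh b')))) =
   swd ep (%P Q. uu$.a b. swd ep (%P' Q'. uu$.a' b'. b$$.h1 h2 h3. (sg (h2**a'))$.u v.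
    P (tw a)*:(Q v*:(P' (St h1**(u**h3))*:Q' (rh b')))))" by (simp only: prd_def sw_smul smul_assoc)
  also have "... = uu$.a b. uu$.a' b'. b$$.h1 h2 h3. (sg (h2**a'))$.u v. ep (tw a**v)*:ep (St h1**(u**h3)**rh b')"
   by (simp only: ev)
  finally show "swd ep (%P Q. uu$.a b. swd ep (%P' Q'. uu$.a' b'. P (tw a)*:(prd sg Q b P' a'*:Q' (rh b')))) =
   ep (tw uu**(sg uu**rh uu))" unfolding comult_one_double1[OF t] .
 qed (rule cc_prod)
qed

lemma counit_mult_functional: assumes "x:.V"
 shows "(%y. counit V (x \<otimes> y)) : Lin R V K" "(%y. counit V (y \<otimes> x)) : Lin R V K"
 by (rule lm_comp[OF mult_right_linear[OF assms] counit_V] lm_comp[OF mult_left_linear[OF assms] counit_V])+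

lemma counit_mult_bilinear: assumes "x:.V" "z:.V"
 shows "bilinear R V V K (%k1 k2. counit V (x \<otimes> k1) \<otimes>\<^sub>R counit V (k2 \<otimes> z))" (is ?A)
  "bilinear R V V K (%k1 k2. counit V (x \<otimes> k2) \<otimes>\<^sub>R counit V (k1 \<otimes> z))" (is ?B)
proof -
 note pb = R.product_bilinear[OF mod_V mod_V counit_mult_functional(1)[OF assms(1)] counit_mult_functional(2)[OF assms(2)]]
 show ?A by (rule pb)
 show ?B
  using pb by (simp add: bilinear_def)
qed

lemma counit_mult_cc: assumes F: "lin F" and G: "lin G" and P: "lin P"
 shows "counit V (cc P m \<otimes> cc G k \<otimes> cc F h) =
   sweedler R V K (cc G k) (%k1 k2. counit V (cc P m \<otimes> k1) \<otimes>\<^sub>R counit V (k2 \<otimes> cc F h))" (is ?A)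
  "counit V (cc P m \<otimes> cc G k \<otimes> cc F h) =
   sweedler R V K (cc G k) (%k1 k2. counit V (cc P m \<otimes> k2) \<otimes>\<^sub>R counit V (k1 \<otimes> cc F h))" (is ?B)
proof -
 note cnt = corr_counit and B = counit_mult_bilinear[OF cc_closed[OF P] cc_closed[OF F]]
 \<comment> \<open>The counit of a product with its left factor fixed. By \<open>prd_et\<close> its
   representing map has the form that \<open>prd_et_triple\<close> requires.\<close>
 obtain tw where tw: "corr (%x. counit V (cc P m \<otimes> x)) tw" using corr_mult(2)[OF cnt cc_closed[OF P]] by blast
 have twv: "F' (tw x) = x$.a b. F' (et b)*:P (et m**es a)" if "lin F'" for F' x
  using corrD(3)[OF tw that, of x] cc_prod[OF cnt that P] prd_et[OF that P] by simp
 have e: "counit V (cc P m \<otimes> cc G k \<otimes> cc F h) = k$.k1 k2. prd et F h G k2*:P (et m**es k1)"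
  unfolding mult_assoc_V[OF cc_closed[OF P] cc_closed[OF G] cc_closed[OF F]] cc_prod[OF tw F G]
  by (rule prd_et_triple[OF F G P twv])
 have "sweedler R V K (cc G k) (%k1 k2. counit V (cc P m \<otimes> k1) \<otimes>\<^sub>R counit V (k2 \<otimes> cc F h)) =
  swd G (%G1 G2. k$.k1 k2. h$.a b. k1$.a' b'. (F (et b)*:P (et m**es a'))*:(G1 (et b')*:G2 (et k2**es a)))"
  unfolding sweedler_cc[OF B(1) G]
 proof (rule swd_cong)
  fix G1 G2 assume g: "lin G1" "lin G2"
  show "k$.k1 k2. counit V (cc P m \<otimes> cc G1 k1) \<otimes>\<^sub>R counit V (cc G2 k2 \<otimes> cc F h) =
   k$.k1 k2. h$.a b. k1$.a' b'. (F (et b)*:P (et m**es a'))*:(G1 (et b')*:G2 (et k2**es a))"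
   unfolding cc_prod[OF cnt g(1) P] cc_prod[OF cnt F g(2)] prd_et[OF g(1) P] prd_et[OF F g(2)]
   by (simp only: smul_id[OF sw_closed sw_closed] sw_smul smul_assoc smul_comm smul_left_comm)
 qed
 also have "... = k$.k1 k2. h$.a b. k1$.a' b'. F (et b)*:(G (et b'**(et k2**es a))*:P (et m**es a'))"
  by (simp only: swd_sw swd_smul(1)[symmetric] swd_eval[OF G]) (simp only: smul_assoc smul_comm smul_left_comm)
 also have "... = k$.k1 k2. prd et F h G k2*:P (et m**es k1)" by (rule counit_mult_double2[OF F G P])
 finally show ?A by (simp add: e)
 have "sweedler R V K (cc G k) (%k1 k2. counit V (cc P m \<otimes> k2) \<otimes>\<^sub>R counit V (k1 \<otimes> cc F h)) =
  swd G (%G1 G2. k$.k1 k2. h$.a b. k2$.a' b'. (F (et b)*:P (et m**es a'))*:(G1 (et k1**es a)*:G2 (et b')))"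
  unfolding sweedler_cc[OF B(2) G]
 proof (rule swd_cong)
  fix G1 G2 assume g: "lin G1" "lin G2"
  show "k$.k1 k2. counit V (cc P m \<otimes> cc G2 k2) \<otimes>\<^sub>R counit V (cc G1 k1 \<otimes> cc F h) =
   k$.k1 k2. h$.a b. k2$.a' b'. (F (et b)*:P (et m**es a'))*:(G1 (et k1**es a)*:G2 (et b'))"
   unfolding cc_prod[OF cnt g(2) P] cc_prod[OF cnt F g(1)] prd_et[OF g(2) P] prd_et[OF F g(1)]
   by (simp only: smul_id[OF sw_closed sw_closed] sw_smul smul_assoc smul_comm smul_left_comm)
 qed
 also have "... = k$.k1 k2. h$.a b. k2$.a' b'. F (et b)*:(G (et k1**es a**et b')*:P (et m**es a'))"
  by (simp only: swd_sw swd_smul(1)[symmetric] swd_eval[OF G]) (simp only: smul_assoc smul_comm smul_left_comm)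
 also have "... = k$.k1 k2. prd et F h G k2*:P (et m**es k1)" by (rule counit_mult_double1[OF F G P])
 finally show ?B by (simp add: e)
qed

lemma counit_mult_linear: assumes "y:.V"
 shows "z:.V ==> (%x. sweedler R V K y (%k1 k2. counit V (x \<otimes> k1) \<otimes>\<^sub>R counit V (k2 \<otimes> z))) : Lin R V K"
  "x:.V ==> (%z. sweedler R V K y (%k1 k2. counit V (x \<otimes> k1) \<otimes>\<^sub>R counit V (k2 \<otimes> z))) : Lin R V K"
  "z:.V ==> (%x. sweedler R V K y (%k1 k2. counit V (x \<otimes> k2) \<otimes>\<^sub>R counit V (k1 \<otimes> z))) : Lin R V K"
  "x:.V ==> (%z. sweedler R V K y (%k1 k2. counit V (x \<otimes> k2) \<otimes>\<^sub>R counit V (k1 \<otimes> z))) : Lin R V K"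
proof -
 note B = counit_mult_bilinear
 note sl = CV.sweedler_fun_linear[OF mod_K mod_V _ _ assms]
 note f = counit_mult_functional and cl = lmD(1)[OF counit_V mult_closed, simplified]
 have l: "(%x. counit V (x \<otimes> k1) \<otimes>\<^sub>R counit V (k2 \<otimes> z)) : Lin R V K"
  if "k1:.V" "k2:.V" "z:.V" for k1 k2 z
  using lm_const_smult[OF mod_V mod_K f(2)[OF that(1)], of "counit V (k2 \<otimes> z)"] cl[OF that(2,3)] by simp
 have r: "(%z. counit V (x \<otimes> k1) \<otimes>\<^sub>R counit V (k2 \<otimes> z)) : Lin R V K"
  if "x:.V" "k1:.V" "k2:.V" for k1 k2 x
  using lm_smult[OF mod_V mod_K f(1)[OF that(3)] cl[OF that(1,2)]] by simp
 show "(%x. sweedler R V K y (%k1 k2. counit V (x \<otimes> k1) \<otimes>\<^sub>R counit V (k2 \<otimes> z))) : Lin R V K" if "z:.V"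
  by (rule sl) (intro B(1) l that; assumption)+
 show "(%z. sweedler R V K y (%k1 k2. counit V (x \<otimes> k1) \<otimes>\<^sub>R counit V (k2 \<otimes> z))) : Lin R V K" if "x:.V"
  by (rule sl) (intro B(1) r that; assumption)+
 show "(%x. sweedler R V K y (%k1 k2. counit V (x \<otimes> k2) \<otimes>\<^sub>R counit V (k1 \<otimes> z))) : Lin R V K" if "z:.V"
  by (rule sl) (intro B(2) l that; assumption)+
 show "(%z. sweedler R V K y (%k1 k2. counit V (x \<otimes> k2) \<otimes>\<^sub>R counit V (k1 \<otimes> z))) : Lin R V K" if "x:.V"
  by (rule sl) (intro B(2) r that; assumption)+
qed

lemma trilinear_ext: assumes f: "!!y z. [|y:.V; z:.V|] ==> (%x. f x y z) : Lin R V K"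
   "!!x z. [|x:.V; z:.V|] ==> (%y. f x y z) : Lin R V K"
   "!!x y. [|x:.V; y:.V|] ==> (%z. f x y z) : Lin R V K"
  and g: "!!y z. [|y:.V; z:.V|] ==> (%x. g x y z) : Lin R V K"
   "!!x z. [|x:.V; z:.V|] ==> (%y. g x y z) : Lin R V K"
   "!!x y. [|x:.V; y:.V|] ==> (%z. g x y z) : Lin R V K"
  and eq: "!!F G P h k m. [|lin F; lin G; lin P|] ==> f (cc P m) (cc G k) (cc F h) = g (cc P m) (cc G k) (cc F h)"
  and mem: "x:.V" "y:.V" "z:.V" shows "f x y z = g x y z"
proof -
 have 1: "f (cc P m) (cc G k) z = g (cc P m) (cc G k) z" if "lin G" "lin P" for G P k m
  by (rule V_ext[where f="%z. f (cc P m) (cc G k) z" and g="%z. g (cc P m) (cc G k) z", OF mod_K])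
   (intro f g cc_closed that eq mem; assumption)+
 have 2: "f (cc P m) y z = g (cc P m) y z" if "lin P" for P m
  by (rule V_ext[where f="%y. f (cc P m) y z" and g="%y. g (cc P m) y z", OF mod_K])
   (intro f g cc_closed that 1 mem; assumption)+
 show ?thesis by (rule V_ext[where f="%x. f x y z" and g="%x. g x y z", OF mod_K])
   (intro f g cc_closed 2 mem; assumption)+
qed

lemma counit_mult_V: assumes "x:.V" "y:.V" "z:.V"
 shows "counit V (x \<otimes> y \<otimes> z) = sweedler R V K y (%k1 k2. counit V (x \<otimes> k1) \<otimes>\<^sub>R counit V (k2 \<otimes> z))" (is "?L = ?R")
  "counit V (x \<otimes> y \<otimes> z) = sweedler R V K y (%k1 k2. counit V (x \<otimes> k2) \<otimes>\<^sub>R counit V (k1 \<otimes> z))"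
proof -
 note ml = mult_left_linear and mr = mult_right_linear and comp = lm_comp and cm = lm_comp[OF _ counit_V]
 note cl = counit_mult_linear and sl = CV.sweedler_linear[OF mod_K]
 show "?L = ?R"
  by (rule trilinear_ext[where f="%x y z. counit V (x \<otimes> y \<otimes> z)"
   and g="%x y z. sweedler R V K y (%k1 k2. counit V (x \<otimes> k1) \<otimes>\<^sub>R counit V (k2 \<otimes> z))", OF _ _ _ _ _ _ _ assms])
   (rule cm[OF comp[OF ml ml]] cm[OF comp[OF mr ml]] cm[OF mr[OF mult_closed]] cl(1,2) sl[OF counit_mult_bilinear(1)] counit_mult_cc(1); assumption)+
 show "?L = sweedler R V K y (%k1 k2. counit V (x \<otimes> k2) \<otimes>\<^sub>R counit V (k1 \<otimes> z))"
  by (rule trilinear_ext[where f="%x y z. counit V (x \<otimes> y \<otimes> z)"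
   and g="%x y z. sweedler R V K y (%k1 k2. counit V (x \<otimes> k2) \<otimes>\<^sub>R counit V (k1 \<otimes> z))", OF _ _ _ _ _ _ _ assms])
   (rule cm[OF comp[OF ml ml]] cm[OF comp[OF mr ml]] cm[OF mr[OF mult_closed]] cl(3,4) sl[OF counit_mult_bilinear(2)] counit_mult_cc(2); assumption)+
qed

lemma weak_bialgebra_V: "weak_bialgebra R V"
 by (intro weak_bialgebra.intro weak_bialgebra_axioms.intro unital_algebra_V coalgebra_V comult_mult_V comult_one_V counit_mult_V)

subsection \<open>The antipode\<close>

lemma counit_scaled_bilinear: assumes "x:.V"
 shows "bilinear R V V V (%a b. counit V (a \<otimes> x) \<odot> b)" "bilinear R V V V (%a b. counit V (x \<otimes> b) \<odot> a)"
 by (rule scaled_bilinear[OF counit_mult_functional(2)[OF assms]] scaled_bilinear[OF counit_mult_functional(1)[OF assms]])+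

lemma target_source_counit_linear: "target_counit R V : Lin R V V" "source_counit R V : Lin R V V"
proof -
 note sl = CV.sweedler_fun_linear[OF mod_V mod_V _ _ one_closed_V]
 note f = counit_mult_functional
 show "target_counit R V : Lin R V V" unfolding target_counit_def[abs_def]
  by (rule sl) (intro counit_scaled_bilinear lm_const_smult[OF mod_V mod_V f(1)]; assumption)+
 show "source_counit R V : Lin R V V" unfolding source_counit_def[abs_def]
  by (rule sl) (intro counit_scaled_bilinear lm_const_smult[OF mod_V mod_V f(2)]; assumption)+
qed

text \<open>The unit is the class of \<epsilon> and 1, so the sum over its coproduct runs over
  \<Delta>(1) in H, and \<open>prd_et\<close> turns it into the sum of
  \<open>source_counit_double\<close>.\<close>

lemma source_counit_value: assumes ph: "corr ph tw" and F: "lin F"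
 shows "ph (source_counit R V (cc F h)) = F (et h**es (tw uu))" (is "?L = ?R")
proof -
 note B = counit_scaled_bilinear(2)[OF cc_closed[OF F]]
 have "?L = sweedler R V K (cc ep uu) (%a b. ph (counit V (cc F h \<otimes> b) \<odot> a))"
  unfolding source_counit_def one_cc
  by (rule CV.sweedler_comp[OF mod_V mod_K B corrD(1)[OF ph] cc_closed[OF one_linear(1)]])
 also have "... = swd ep (%P Q. uu$.a b. ph (counit V (cc F h \<otimes> cc Q b) \<odot> cc P a))"
  by (rule sweedler_cc[OF VV.bilinear_comp[OF B corrD(1)[OF ph]] one_linear(1)])
 also have "... = swd ep (%P Q. uu$$.a b1 b2. P (tw a)*:(Q (et b2)*:F (et h**es b1)))"
 proof (rule swd_cong)
  fix P Q assume P: "lin P" and Q: "lin Q"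
  have "ph (counit V (cc F h \<otimes> cc Q b) \<odot> cc P a) = b$.b1 b2. P (tw a)*:(Q (et b2)*:F (et h**es b1))" for a b
   by (simp add: cc_prod[OF corr_counit Q F] prd_et[OF Q F] lmD(3)[OF corrD(1)[OF ph]] cc_closed P
    corrD(3)[OF ph P] smul_id linD(1)[OF P] sw_smul smul_comm smul_left_comm)
  then show "uu$.a b. ph (counit V (cc F h \<otimes> cc Q b) \<odot> cc P a) =
   uu$$.a b1 b2. P (tw a)*:(Q (et b2)*:F (et h**es b1))" by simp qed
 also have "... = uu$$.a b1 b2. ep (tw a**et b2)*:F (et h**es b1)"
  by (simp only: swd_sw swd_eval'(1)[OF one_linear(1)])
 also have "... = ?R" by (rule source_counit_double[OF corrD(2)[OF ph] F])
 finally show ?thesis .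
qed

lemma target_counit_value: assumes ph: "corr ph tw" and F: "lin F"
 shows "ph (target_counit R V (cc F h)) = F (et (h**tw uu))" (is "?L = ?R")
proof -
 note B = counit_scaled_bilinear(1)[OF cc_closed[OF F]]
 have "?L = sweedler R V K (cc ep uu) (%a b. ph (counit V (a \<otimes> cc F h) \<odot> b))"
  unfolding target_counit_def one_cc
  by (rule CV.sweedler_comp[OF mod_V mod_K B corrD(1)[OF ph] cc_closed[OF one_linear(1)]])
 also have "... = swd ep (%P Q. uu$.a b. ph (counit V (cc P a \<otimes> cc F h) \<odot> cc Q b))"
  by (rule sweedler_cc[OF VV.bilinear_comp[OF B corrD(1)[OF ph]] one_linear(1)])
 also have "... = swd ep (%P Q. uu$.a b. h$.h1 h2. F (et h2)*:(P (et a**es h1)*:Q (tw b)))"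
 proof (rule swd_cong)
  fix P Q assume P: "lin P" and Q: "lin Q"
  have "ph (counit V (cc P a \<otimes> cc F h) \<odot> cc Q b) = h$.h1 h2. F (et h2)*:(P (et a**es h1)*:Q (tw b))" for a b
   by (simp add: cc_prod[OF corr_counit F P] prd_et[OF F P] lmD(3)[OF corrD(1)[OF ph]] cc_closed Q
    corrD(3)[OF ph Q] smul_id linD(1)[OF Q] sw_smul smul_assoc)
  then show "uu$.a b. ph (counit V (cc P a \<otimes> cc F h) \<odot> cc Q b) =
   uu$.a b. h$.h1 h2. F (et h2)*:(P (et a**es h1)*:Q (tw b))" by simp qed
 also have "... = uu$.a b. h$.h1 h2. F (et h2)*:ep (et a**es h1**tw b)"
  by (simp only: swd_sw swd_smul(1)[symmetric] swd_eval[OF one_linear(1)])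
 also have "... = ?R" by (rule target_counit_double[OF corrD(2)[OF ph] F])
 finally show ?thesis .
qed

lemma antipode_bilinear:
 "bilinear R V V V (%x y. antipode V x \<otimes> y)" (is ?A) "bilinear R V V V (%x y. x \<otimes> antipode V y)" (is ?B)
 "bilinear R V V V (%x y. source_counit R V x \<otimes> antipode V y)" (is ?C)
proof -
 note S = lmD(1)[OF antipode_V] and s = lmD(1)[OF target_source_counit_linear(2)]
 note ml = lm_comp[OF _ mult_left_linear] and mr = lm_comp[OF _ mult_right_linear]
 show ?A
  by (rule bilI) (intro mult_right_linear S ml[OF antipode_V]; assumption)+
 show ?B
  by (rule bilI) (intro mr[OF antipode_V] mult_left_linear S; assumption)+
 show ?C
  by (rule bilI) (intro mr[OF antipode_V] s ml[OF target_source_counit_linear(2)] S; assumption)+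
qed

lemma antipode_closed: "x:.V ==> antipode V x:.V" by (rule lmD(1)[OF antipode_V])

lemma V_sweedler_value: assumes ph: "corr ph tw" and F: "lin F" and B: "bilinear R V V V B"
 shows "ph (sweedler R V V (cc F h) B) = swd F (%P Q. h$.a b. ph (B (cc P a) (cc Q b)))"
 unfolding CV.sweedler_comp[OF mod_V mod_K B corrD(1)[OF ph] cc_closed[OF F]]
 by (rule sweedler_cc[OF VV.bilinear_comp[OF B corrD(1)[OF ph]] F])

lemma antipode_source_V: assumes "x:.V"
 shows "sweedler R V V x (%h1 h2. antipode V h1 \<otimes> h2) = source_counit R V x"
proof (rule V_ext[OF mod_V CV.sweedler_linear[OF mod_V antipode_bilinear(1)] target_source_counit_linear(2) _ assms])
 fix F h assume F: "lin F"
 show "sweedler R V V (cc F h) (%h1 h2. antipode V h1 \<otimes> h2) = source_counit R V (cc F h)"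
 proof (rule V_sep[OF CV.sweedler_closed[OF mod_V antipode_bilinear(1) cc_closed[OF F]]
   lmD(1)[OF target_source_counit_linear(2) cc_closed[OF F]]])
  fix ph tw assume ph: "corr ph tw"
  have v: "ph (antipode V (cc P ha) \<otimes> cc Q hb) = ha$$.h1 h2 h3. hb$$.m1 m2 m3. (tw (m2**Si h2))$.u v.
    Q v*:P (h1**(St (St m1**(u**m3))**St h3))" (is "?M = _") if P: "lin P" and Q: "lin Q" for P Q ha hb proof -
   \<comment> \<open>Multiplication by the second class is absorbed into the functional; thus the
     antipode is evaluated first, and the product afterwards inside its formula.\<close>
   obtain sg where sg: "corr (%x. ph (x \<otimes> cc Q hb)) sg" using corr_mult(1)[OF ph cc_closed[OF Q]] by blast
   have sgv: "F' (sg x) = prd tw Q hb F' x" if "lin F'" for F' x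
    using corrD(3)[OF sg that, of x] cc_prod[OF ph Q that] by simp
   have "?M = ha$$.h1 h2 h3. P (h1**(St (sg (Si h2))**St h3))"
    by (rule cc_antipode[OF sg P])
   also have "... = ha$$.h1 h2 h3. prd tw Q hb (%y. P (h1**(St y**St h3))) (Si h2)"
    by (rule sw_cong2, rule sgv; (intro lins lin_comp[OF P])+)
   finally show ?thesis by (simp only: prd_def)
  qed
  have "ph (sweedler R V V (cc F h) (%h1 h2. antipode V h1 \<otimes> h2)) =
   swd F (%P Q. h$.ha hb. ph (antipode V (cc P ha) \<otimes> cc Q hb))"
   by (rule V_sweedler_value[OF ph F antipode_bilinear(1)])
  also have "... = swd F (%P Q. h$.ha hb. ha$$.h1 h2 h3. hb$$.m1 m2 m3. (tw (m2**Si h2))$.u v.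
    Q v*:P (h1**(St (St m1**(u**m3))**St h3)))" by (rule swd_cong) (simp only: v)
  also have "... = h$.ha hb. ha$$.h1 h2 h3. hb$$.m1 m2 m3. (tw (m2**Si h2))$.u v.
    F (h1**(St (St m1**(u**m3))**St h3)**v)" by (simp only: swd_sw swd_eval'(2)[OF F])
  also have "... = F (et h**es (tw uu))" by (rule antipode_source_double[OF corrD(2)[OF ph] F])
  finally show "ph (sweedler R V V (cc F h) (%h1 h2. antipode V h1 \<otimes> h2)) = ph (source_counit R V (cc F h))"
   by (simp only: source_counit_value[OF ph F])
 qed
qed

lemma product_antipode_value: assumes ph: "corr ph tw" and P: "lin P" and Q: "lin Q"
 shows "ph (cc P ha \<otimes> antipode V (cc Q hb)) = hb$$.h1 h2 h3. (Si h2)$$.m1 m2 m3. (tw (m2**ha))$.u v.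
   Q (h1**(St v**St h3))*:P (St m1**(u**m3))" (is "?L = _")
proof -
 obtain sg where sg: "corr (%x. ph (cc P ha \<otimes> x)) sg" using corr_mult(2)[OF ph cc_closed[OF P]] by blast
 have sgv: "F' (sg x) = prd tw F' x P ha" if "lin F'" for F' x
  using corrD(3)[OF sg that, of x] cc_prod[OF ph that P] by simp
 have "?L = hb$$.h1 h2 h3. Q (h1**(St (sg (Si h2))**St h3))"
  by (rule cc_antipode[OF sg Q])
 also have "... = hb$$.h1 h2 h3. prd tw (%y. Q (h1**(St y**St h3))) (Si h2) P ha"
  by (rule sw_cong2, rule sgv; (intro lins lin_comp[OF Q])+)
 finally show ?thesis by (simp only: prd_def)
qed

lemma antipode_target_V: assumes "x:.V"
 shows "sweedler R V V x (%h1 h2. h1 \<otimes> antipode V h2) = target_counit R V x"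
proof (rule V_ext[OF mod_V CV.sweedler_linear[OF mod_V antipode_bilinear(2)] target_source_counit_linear(1) _ assms])
 fix F h assume F: "lin F"
 show "sweedler R V V (cc F h) (%h1 h2. h1 \<otimes> antipode V h2) = target_counit R V (cc F h)"
 proof (rule V_sep[OF CV.sweedler_closed[OF mod_V antipode_bilinear(2) cc_closed[OF F]]
   lmD(1)[OF target_source_counit_linear(1) cc_closed[OF F]]])
  fix ph tw assume ph: "corr ph tw"
  have "ph (sweedler R V V (cc F h) (%h1 h2. h1 \<otimes> antipode V h2)) =
   swd F (%P Q. h$.ha hb. ph (cc P ha \<otimes> antipode V (cc Q hb)))"
   by (rule V_sweedler_value[OF ph F antipode_bilinear(2)])
  also have "... = swd F (%P Q. h$$.ha h1 w. w$.h2 h3. (Si h2)$$.m1 m2 m3. (tw (m2**ha))$.u v.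
    Q (h1**(St v**St h3))*:P (St m1**(u**m3)))" by (rule swd_cong) (simp only: product_antipode_value[OF ph])
  also have "... = h$$.ha h1 w. w$.h2 h3. (Si h2)$$.m1 m2 m3. (tw (m2**ha))$.u v.
    F (St m1**(u**m3)**(h1**(St v**St h3)))" by (simp only: swd_sw swd_eval'(2)[OF F])
  also have "... = F (et (h**tw uu))" by (rule antipode_target_double[OF corrD(2)[OF ph] F])
  finally show "ph (sweedler R V V (cc F h) (%h1 h2. h1 \<otimes> antipode V h2)) = ph (target_counit R V (cc F h))"
   by (simp only: target_counit_value[OF ph F])
 qed
qed

text \<open>The last antipode axiom in the form it takes once S(x_1) x_2 has been replaced by the
  source counit.\<close>

lemma antipode_source_antipode: assumes "x:.V"
 shows "sweedler R V V x (%h1 h2. source_counit R V h1 \<otimes> antipode V h2) = antipode V x"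
proof (rule V_ext[OF mod_V CV.sweedler_linear[OF mod_V antipode_bilinear(3)] antipode_V _ assms])
 fix F h assume F: "lin F"
 show "sweedler R V V (cc F h) (%h1 h2. source_counit R V h1 \<otimes> antipode V h2) = antipode V (cc F h)"
 proof (rule V_sep[OF CV.sweedler_closed[OF mod_V antipode_bilinear(3) cc_closed[OF F]]
   antipode_closed[OF cc_closed[OF F]]])
  fix ph tw assume ph: "corr ph tw"
  have v: "ph (source_counit R V (cc P ha) \<otimes> antipode V (cc Q hb)) =
   hb$$.h1 h2 h3. (Si h2)$$.m1 m2 m3. (tw (m2**uu))$.u v.
    Q (h1**(St v**St h3))*:P (et ha**es (St m1**(u**m3)))" (is "?M = ?N") if P: "lin P" and Q: "lin Q" for P Q ha hb proof -
   obtain sg where sg: "corr (%x. ph (x \<otimes> antipode V (cc Q hb))) sg"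
    using corr_mult(1)[OF ph antipode_closed[OF cc_closed[OF Q]]] by blast
   have "?M = P (et ha**es (sg uu))"
    by (rule source_counit_value[OF sg P])
   \<comment> \<open>The element \<open>sg uu\<close> is known only through functionals, so its
     occurrence under P and \<open>es\<close> is read as the value on a class at 1. The product with
     the antipode can then be evaluated.\<close>
   also have "... = ph (cc (%y. P (et ha**es y)) uu \<otimes> antipode V (cc Q hb))"
    by (rule corrD(3)[OF sg, symmetric]) (intro lins lin_comp[OF P])
   also have "... = ?N"
    by (rule product_antipode_value[OF ph _ Q]) (intro lins lin_comp[OF P])
   finally show ?thesis .
  qed
  have "ph (sweedler R V V (cc F h) (%h1 h2. source_counit R V h1 \<otimes> antipode V h2)) =
   swd F (%P Q. h$.ha hb. ph (source_counit R V (cc P ha) \<otimes> antipode V (cc Q hb)))"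
   by (rule V_sweedler_value[OF ph F antipode_bilinear(3)])
  also have "... = swd F (%P Q. h$$.ha h1 w. w$.h2 h3. (Si h2)$$.m1 m2 m3. (tw (m2**uu))$.u v.
    Q (h1**(St v**St h3))*:P (et ha**es (St m1**(u**m3))))" by (rule swd_cong) (simp only: v)
  also have "... = h$$.ha h1 w. w$.h2 h3. (Si h2)$$.m1 m2 m3. (tw (m2**uu))$.u v.
    F (et ha**es (St m1**(u**m3))**(h1**(St v**St h3)))" by (simp only: swd_sw swd_eval'(2)[OF F])
  also have "... = h$$.h1 h2 h3. F (h1**(St (tw (Si h2))**St h3))"
   by (rule antipode_antipode_double[OF corrD(2)[OF ph] F])
  finally show "ph (sweedler R V V (cc F h) (%h1 h2. source_counit R V h1 \<otimes> antipode V h2)) = ph (antipode V (cc F h))"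
   by (simp only: cc_antipode[OF ph F])
 qed
qed

lemma antipode_antipode_V: assumes x: "x:.V"
 shows "sweedler3 R V V x (%h1 h2 h3. antipode V h1 \<otimes> h2 \<otimes> antipode V h3) = antipode V x"
proof -
 note S = antipode_closed
 have "sweedler R V V x (%y c. sweedler R V V y (%a b. antipode V a \<otimes> b \<otimes> antipode V c)) =
  sweedler R V V x (%y c. source_counit R V y \<otimes> antipode V c)"
 proof (rule CV.sweedler_cong[OF mod_V antipode_bilinear(3) x, symmetric])
  fix y c assume y: "y:.V" and c: "c:.V"
  have "source_counit R V y \<otimes> antipode V c = sweedler R V V y (%a b. antipode V a \<otimes> b) \<otimes> antipode V c"
   by (simp only: antipode_source_V[OF y])
  also have "... = sweedler R V V y (%a b. antipode V a \<otimes> b \<otimes> antipode V c)"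
   by (rule CV.sweedler_comp[OF mod_V mod_V antipode_bilinear(1) mult_left_linear[OF S[OF c]] y])
  finally show "source_counit R V y \<otimes> antipode V c = sweedler R V V y (%a b. antipode V a \<otimes> b \<otimes> antipode V c)" .
 qed
 then show ?thesis unfolding sweedler3_def antipode_source_antipode[OF x] .
qed

theorem weak_hopf_algebra_V: "weak_hopf_algebra R V"
 by (intro weak_hopf_algebra.intro weak_hopf_algebra_axioms.intro weak_bialgebra_V antipode_V
  antipode_source_V antipode_target_V antipode_antipode_V)

end

lemma (in comultiplication) sweedler3_fun_linear:
 assumes "module R P" "module R X" "!!x c. [|x:.X; c:.C|] ==> bilinear R C C P (%a b. F x a b c)"
  "!!x a b. [|x:.X; a:.C; b:.C|] ==> F x a b : Lin R C P"
  "!!a b c. [|a:.C; b:.C; c:.C|] ==> (%x. F x a b c) : Lin R X P" "h:.C"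
 shows "(%x. sweedler3 R C P h (F x)) : Lin R X P" unfolding sweedler3_def
proof (rule sweedler_fun_linear[OF assms(1,2) sweedler3_inner_bilinear[OF assms(1)] _ assms(6)])
 fix y c assume "y:.C" "c:.C"
 then show "(%x. sweedler R C P y (%a b. F x a b c)) : Lin R X P"
  by (intro sweedler_fun_linear[OF assms(1,2)] assms(3,5))
qed (rule assms(3,4); assumption)+

section \<open>Construction of D'(H) and its structure maps\<close>

section \<open>The algebra \<open>H\<^sup>* \<otimes> H\<close> and its quotient\<close>

context weak_hopf_basis begin

lemma dual_linearI: assumes "!!x. x:.X ==> m x:.Hs" "!!h. h:.H ==> (%x. m x h) : Lin R X K" and X: "module R X"
 shows "m : Lin R X Hs"
proof (rule lmI[OF assms(1)])
 interpret X: module R X by (rule X)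
 interpret Hs: module R Hs by (rule dual_module)
 show "m (x \<oplus>\<^sub>X y) = m x \<oplus>\<^sub>Hs m y" if "x:.X" "y:.X" for x y
  by (rule dual_eqI) (use that in \<open>simp_all add: assms(1) dual_pointwise lmD(2)[OF assms(2)]\<close>)
 show "m (a \<odot>\<^sub>X x) = a \<odot>\<^sub>Hs m x" if "a:.R" "x:.X" for a x
  by (rule dual_eqI) (use that in \<open>simp_all add: assms(1) dual_pointwise lmD(3)[OF assms(2)]\<close>)
qed

lemma dual_mult_bilinear: "bilinear R Hs Hs Hs (mult Hs)"
proof (rule bilI)
 note sl = CH.sweedler_fun_linear[OF mod_K dual_module]
 note pb = R.product_bilinear[OF mod_H mod_H dual_D(1) dual_D(1)]
 show "(%g. f \<otimes>\<^sub>Hs g) : Lin R Hs Hs" if f: "f:.Hs" for f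
 proof (rule dual_linearI[OF dual_mult_closed[OF f] _ dual_module])
  fix h assume h: "h:.H"
  have "(%g. sweedler R H K h (%h1 h2. f h1 \<otimes> g h2)) : Lin R Hs K"
   by (rule sl[OF pb[OF f] _ h]) (assumption | use lm_smult[OF dual_module mod_K eval_linear dual_D(3)[OF f]] in simp)+
  then show "(%g. (f \<otimes>\<^sub>Hs g) h) : Lin R Hs K" using h by (simp add: dual_sel)
 qed
 show "(%f. f \<otimes>\<^sub>Hs g) : Lin R Hs Hs" if g: "g:.Hs" for g
 proof (rule dual_linearI[OF dual_mult_closed[OF _ g] _ dual_module])
  fix h assume h: "h:.H"
  have "(%f. sweedler R H K h (%h1 h2. f h1 \<otimes> g h2)) : Lin R Hs K"
  proof (rule sl[OF pb[OF _ g] _ h])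
   fix a b assume "a:.H" "b:.H"
   then show "(%f. f a \<otimes> g b) : Lin R Hs K"
    using lm_const_smult[OF dual_module mod_K eval_linear, of a "g b"] dual_D(3)[OF g] by simp
  qed
  then show "(%f. (f \<otimes>\<^sub>Hs g) h) : Lin R Hs K" using h by (simp add: dual_sel)
 qed
qed

lemma act_left_bilinear: "bilinear R H Hs Hs (act_left H)"
proof (rule bilI)
 show "act_left H h : Lin R Hs Hs" if "h:.H" for h
 proof (rule dual_linearI[OF act_closed(1)[OF _ that] _ dual_module])
  fix l assume "l:.H"
  then show "(%f. act_left H h f l) : Lin R Hs K"
   using eval_linear[of "l \<otimes>\<^sub>H h"] that by (simp add: act_left_def)
 qed
 show "(%h. act_left H h f) : Lin R H Hs" if "f:.Hs" for f
 proof (rule dual_linearI[OF act_closed(1)[OF that] _ mod_H])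
  fix l assume "l:.H"
  then show "(%h. act_left H h f l) : Lin R H K"
   using lm_comp[OF bilD(1)[OF mult_bilinear] dual_D(1)[OF that], of l] by (simp add: act_left_def)
 qed
qed

lemma act_right_bilinear: "bilinear R Hs H Hs (act_right H)"
proof (rule bilI)
 show "(%f. act_right H f h) : Lin R Hs Hs" if "h:.H" for h
 proof (rule dual_linearI[OF act_closed(2)[OF _ that] _ dual_module])
  fix l assume "l:.H"
  then show "(%f. act_right H f h l) : Lin R Hs K"
   using eval_linear[of "h \<otimes>\<^sub>H l"] that by (simp add: act_right_def)
 qed
 show "act_right H f : Lin R H Hs" if "f:.Hs" for f
 proof (rule dual_linearI[OF act_closed(2)[OF that] _ mod_H])
  fix l assume "l:.H"
  then show "(%h. act_right H f h l) : Lin R H K"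
   using lm_comp[OF bilD(2)[OF mult_bilinear] dual_D(1)[OF that], of l] by (simp add: act_right_def)
 qed
qed

sublocale SH: two_modules R "dual R H" H by (rule two_modules.intro[OF dual_module mod_H])

abbreviation "A \<equiv> double'_product R H"
abbreviation "HsH \<equiv> tensor R (dual R H) H"

definition tt :: "('h => 'a) => 'h => (('h => 'a) \<times> 'h => 'a) set" where "tt F h = tens R Hs H (res F) (cl h)"

definition prod_term where
 "prod_term f g k a b c = tens R Hs H (act_right H (act_left H c g) (antipode H a) \<otimes>\<^sub>Hs f) (b \<otimes>\<^sub>H k)"

lemma A_sel: "carrier A = carrier SH.T" "add A = add SH.T" "zero A = zero SH.T" "smult A = smult SH.T"
 "one A = tens R Hs H \<one>\<^sub>Hs \<one>\<^sub>H"
 "x \<otimes>\<^sub>A y = tensor_lift R HsH x (%f h. tensor_lift R HsH y (%g k. sweedler3 R H HsH h (prod_term f g k)))"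
 by (simp_all add: double'_product_def Let_def prod_term_def[abs_def])

lemma mod_HsH: "module R HsH" by (rule SH.tensor_module')
lemma mod_A: "module R A" by (rule module_cong[OF SH.tensor_mod]) (simp_all add: A_sel)

lemma linear_map_A: "Lin R A P = Lin R SH.T P" "Lin R P A = Lin R P SH.T" by (simp_all add: linear_map_def A_sel)

lemma prod_term_linear: assumes "f:.Hs" "g:.Hs" "k:.H" "a:.H" "b:.H" "c:.H"
 shows "(%f. prod_term f g k a b c) : Lin R Hs HsH" (is ?A) "(%g. prod_term f g k a b c) : Lin R Hs HsH" (is ?B)
  "(%k. prod_term f g k a b c) : Lin R H HsH" (is ?C) "(%a. prod_term f g k a b c) : Lin R H HsH" (is ?D)
  "(%b. prod_term f g k a b c) : Lin R H HsH" (is ?E) "(%c. prod_term f g k a b c) : Lin R H HsH" (is ?F)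
proof -
 have S: "antipode H a:.H" by (rule lmD(1)[OF antipode_linear assms(4)])
 have ac: "act_right H (act_left H c g) (antipode H a):.Hs" by (intro act_closed S assms)
 have mc: "act_right H (act_left H c g) (antipode H a) \<otimes>\<^sub>Hs f:.Hs" by (intro dual_mult_closed ac assms)
 have bk: "b \<otimes>\<^sub>H k:.H" using assms by simp
 have l: "(%f. tens R Hs H f (b \<otimes>\<^sub>H k)) : Lin R Hs HsH" using bilD(2)[OF SH.tens_bilinear bk] by simp
 have r: "(%h. tens R Hs H (act_right H (act_left H c g) (antipode H a) \<otimes>\<^sub>Hs f) h) : Lin R H HsH"
  using bilD(1)[OF SH.tens_bilinear mc] by simp
 note ml = lm_comp[OF _ lm_comp[OF bilD(2)[OF dual_mult_bilinear assms(1)] l]]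
 show ?A unfolding prod_term_def
  by (rule lm_comp[OF bilD(1)[OF dual_mult_bilinear ac] l])
 show ?B unfolding prod_term_def
  by (rule ml[OF lm_comp[OF bilD(1)[OF act_left_bilinear assms(6)] bilD(2)[OF act_right_bilinear S]]])
 show ?F unfolding prod_term_def
  by (rule ml[OF lm_comp[OF bilD(2)[OF act_left_bilinear assms(2)] bilD(2)[OF act_right_bilinear S]]])
 show ?D unfolding prod_term_def
  by (rule ml[OF lm_comp[OF antipode_linear bilD(1)[OF act_right_bilinear act_closed(1)[OF assms(2,6)]]]])
 show ?C unfolding prod_term_def
  by (rule lm_comp[OF bilD(1)[OF mult_bilinear assms(5)] r])
 show ?E unfolding prod_term_def
  by (rule lm_comp[OF bilD(2)[OF mult_bilinear assms(3)] r])
qed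

lemma prod_term_trilinear: assumes "f:.Hs" "g:.Hs" "k:.H" shows "trilinear HsH (prod_term f g k)"
 by (rule trilinearI; (rule prod_term_linear(4)[OF assms one_closed] | rule prod_term_linear(5)[OF assms _ one_closed] |
  rule prod_term_linear(6)[OF assms _ _ one_closed]); assumption)

lemma prod_sum_linear: assumes "f:.Hs" "g:.Hs" "k:.H" "h:.H"
 shows "(%f. sweedler3 R H HsH h (prod_term f g k)) : Lin R Hs HsH" (is ?A)
  "(%g. sweedler3 R H HsH h (prod_term f g k)) : Lin R Hs HsH" (is ?B)
  "(%k. sweedler3 R H HsH h (prod_term f g k)) : Lin R H HsH" (is ?C)
  "(%h. sweedler3 R H HsH h (prod_term f g k)) : Lin R H HsH" (is ?D)
proof -
 note T = trilinearD(2,3)[OF prod_term_trilinear] and P = prod_term_linear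
 show ?A
  by (rule CH.sweedler3_fun_linear[OF mod_HsH dual_module _ _ _ assms(4)]; rule T P(1); (assumption | rule assms))
 show ?B
  by (rule CH.sweedler3_fun_linear[OF mod_HsH dual_module _ _ _ assms(4)]; rule T P(2); (assumption | rule assms))
 show ?C
  by (rule CH.sweedler3_fun_linear[OF mod_HsH mod_H _ _ _ assms(4)]; rule T P(3); (assumption | rule assms))
 show ?D
  by (rule CH.sweedler3_linear[OF mod_HsH T(1)[OF assms(1-3)] T(2)[OF assms(1-3)]])
qed

lemma prod_sum_bilinear: "[|f:.Hs; h:.H|] ==> bilinear R Hs H HsH (%g k. sweedler3 R H HsH h (prod_term f g k))"
 "[|g:.Hs; k:.H|] ==> bilinear R Hs H HsH (%f h. sweedler3 R H HsH h (prod_term f g k))"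
proof -
 note P = prod_sum_linear
 show "bilinear R Hs H HsH (%g k. sweedler3 R H HsH h (prod_term f g k))" if f: "f:.Hs" "h:.H"
  by (rule bilI; (rule P(2)[OF f(1,1) _ f(2)] | rule P(3)[OF f(1) _ f(2,2)]); assumption)
 show "bilinear R Hs H HsH (%f h. sweedler3 R H HsH h (prod_term f g k))" if g: "g:.Hs" "k:.H"
  by (rule bilI; (rule P(1)[OF g(1,1,2)] | rule P(4)[OF _ g one_closed]); assumption)
qed

lemma mult_A_bilinear: "bilinear R A A A (mult A)"
 using SH.tensor_product_bilinear(2)[OF mod_HsH prod_sum_bilinear] by (simp add: bilinear_def linear_map_A A_sel)

lemma mult_A_tens: assumes "f:.Hs" "g:.Hs" "k:.H" "h:.H"
 shows "tens R Hs H f h \<otimes>\<^sub>A tens R Hs H g k = sweedler3 R H HsH h (prod_term f g k)"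
 unfolding A_sel(6) by (rule SH.tensor_product_bilinear(3)[OF mod_HsH prod_sum_bilinear]) (simp_all add: assms)

lemma tt_closed: "lin F ==> tt F h:.A" unfolding tt_def A_sel by (rule SH.tens_closed[OF res_cl cl_closed])

lemma A_ext: assumes "module R P" "f : Lin R A P" "g : Lin R A P" "!!F h. lin F ==> f (tt F h) = g (tt F h)" "x:.A"
 shows "f x = g x"
proof (rule SH.tensor_eqI[OF assms(1)])
 show "f : Lin R SH.T P" "g : Lin R SH.T P" "x:.SH.T" using assms(2,3,5) by (simp_all add: linear_map_A A_sel)
 show "f (tens R Hs H m n) = g (tens R Hs H m n)" if "m:.Hs" "n:.H" for m n
  using assms(4)[OF lin_tot[OF that(1)], of n] that by (simp add: tt_def res_tot cl_id)
qed

definition rep :: "((('h => 'a) \<times> 'h => 'a) set => 'a) => ('h => 'h) => bool"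
 where "rep ph tw <-> ph : Lin R A K \<and> hlin tw \<and> (\<forall>x. cl (tw x) = tw x) \<and> (\<forall>F h. lin F --> ph (tt F h) = F (tw h))"

lemma repD: assumes "rep ph tw" shows "ph : Lin R A K" "hlin tw" "cl (tw x) = tw x" "lin F ==> ph (tt F h) = F (tw h)"
 using assms by (auto simp: rep_def)

text \<open>For fixed h the functional \<open>ph\<close> is an evaluation on the dual, by
  reflexivity. The chosen elements depend linearly on h because functionals separate points of
  H.\<close>

lemma rep_ex: assumes ph: "ph : Lin R A K" shows "\<exists>tw. rep ph tw"
proof -
 have ph': "ph : Lin R SH.T K" using ph by (simp add: linear_map_A)
 have "\<exists>x\<in>carrier H. \<forall>f\<in>carrier Hs. ph (tens R Hs H f (cl h)) = f x" for h
  by (rule dual_functional_eval[OF lm_comp[OF bilD(2)[OF SH.tens_bilinear cl_closed] ph']])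
 then obtain tw where tw: "!!h. tw h:.H" "!!h f. f:.Hs ==> ph (tens R Hs H f (cl h)) = f (tw h)" by metis
 have v: "ph (tt F h) = F (tw h)" if "lin F" for F h
  using tw(2)[OF res_cl[OF that], of h] tw(1)[of h] by (simp add: tt_def res_apply)
 have lt: "(%h. ph (tens R Hs H (res F) h)) : Lin R H K" if "lin F" for F
  by (rule lm_comp[OF bilD(1)[OF SH.tens_bilinear res_cl[OF that]] ph'])
 note cl = cl_id[OF tw(1)]
 have "hlin tw"
 proof (rule hlinI)
  show "cl (tw (cl x)) = cl (tw x)" for x by (rule H_eqI) (simp add: v[symmetric] tt_def)
  show "cl (tw (x \<oplus>\<^sub>H y)) = cl (tw x) \<oplus>\<^sub>H cl (tw y)" if "x:.H" "y:.H" for x y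
  proof -
   have "cl (tw (x \<oplus>\<^sub>H y)) = cl (tw x \<oplus>\<^sub>H tw y)"
    by (rule H_eqI) (use that tw(1) in \<open>simp add: linD(4) v[symmetric] tt_def cl_id lmD(2)[OF lt]\<close>)
   then show ?thesis by (simp add: cl cl_id tw(1))
  qed
  show "cl (tw (a \<odot>\<^sub>H x)) = a \<odot>\<^sub>H cl (tw x)" if "a:.R" "x:.H" for a x
  proof -
   have "cl (tw (a \<odot>\<^sub>H x)) = cl (a \<odot>\<^sub>H tw x)"
    by (rule H_eqI) (use that tw(1) in \<open>simp add: linD(5) v[symmetric] tt_def cl_id lmD(3)[OF lt]\<close>)
   then show ?thesis by (simp add: cl cl_id tw(1) that)
  qed
 qed
 then show ?thesis using ph v cl unfolding rep_def by blast
qed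

definition base_A where "base_A p = tens R Hs H (res (dt (fst p))) (e (snd p))"
definition form_A where "form_A p = SH.pair_form (%f. f (e (fst p))) (d (snd p))"

lemma basis_A: "dual_basis R A (I \<times> I) base_A form_A"
proof -
 have "dual_basis R SH.T (I \<times> I) base_A form_A"
  using SH.tensor_dual_basis[OF dual_dual_basis basis] by (simp add: base_A_def[abs_def] form_A_def[abs_def])
 then show ?thesis by (simp add: dual_basis_def A_sel linear_map_A finsum_cong_record[of A SH.T])
qed

lemma A_sep: assumes "x:.A" "y:.A" "!!ph tw. rep ph tw ==> ph x = ph y" shows "x = y"
 by (rule dual_basis_separates[OF mod_A basis_A assms(1,2)]) (use assms(3) rep_ex in blast)

lemma prod_term_res: assumes F: "lin F" and G: "lin G" and abc: "a:.H" "b:.H" "c:.H"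
 shows "prod_term (res F) (res G) (cl k) a b c = tt (%x. x$.u v. G (St a**(u**c))*:F v) (b**k)"
proof -
 note f = res_cl[OF F] and g = res_cl[OF G] and L = lins lin_comp[OF G]
 have S: "antipode H a = St a" using abc by (simp add: St_def cl_id)
 have bk: "b \<otimes>\<^sub>H cl k = cl (b**k)" using abc by (simp add: hmul_def cl_id)
 have gl: "lin (%l. G (l**c))" "lin (%l. G (St a**l**c))" by (intro L)+
 have "act_right H (act_left H c (res G)) (antipode H a) = res (%l. G (St a**l**c))"
  using abc by (simp add: act_left_res g tot_res[OF G] act_right_res res_cl[OF gl(1)] S tot_res[OF gl(1)])
 then have "act_right H (act_left H c (res G)) (antipode H a) \<otimes>\<^sub>Hs res F = res (%x. x$.u v. G (St a**u**c)*:F v)"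
  by (simp add: dual_mult res_cl gl f tot_res F)
 then show ?thesis by (simp add: prod_term_def bk tt_def hassoc)
qed

lemma mult_A_value: assumes ph: "rep ph tw" and F: "lin F" and G: "lin G"
 shows "ph (tt F h \<otimes>\<^sub>A tt G k) = prd tw F h G k" (is "?L = ?R")
proof -
 note f = res_cl[OF F] and g = res_cl[OF G] and tw = repD(2)[OF ph]
 have ph': "ph : Lin R HsH K" using repD(1)[OF ph] by (simp add: linear_map_A)
 note L = lins hlin_comp[OF tw] lin_comp[OF F] lin_comp[OF G]
 have v: "ph (prod_term (res F) (res G) (cl k) a b c) = (tw (b**k))$.u v. F v*:G (St a**(u**c))"
  if abc: "a:.H" "b:.H" "c:.H" for a b c
  unfolding prod_term_res[OF F G abc] by (subst repD(4)[OF ph]) ((intro L)+, simp only: smul_comm)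
 note T = prod_term_trilinear[OF f g cl_closed, of k]
 have l3: "lin3 (%a b c. (tw (b**k))$.u v. F v*:G (St a**(u**c)))" by (intro L)
 have "?L = ph (sweedler3 R H HsH (cl h) (prod_term (res F) (res G) (cl k)))"
  unfolding tt_def by (simp add: mult_A_tens f g)
 also have "... = sweedler3 R H K (cl h) (%a b c. ph (prod_term (res F) (res G) (cl k) a b c))"
  by (rule CH.sweedler3_comp[OF mod_HsH mod_K trilinearD(2,3)[OF T] ph' cl_closed])
 also have "... = sweedler3 R H K (cl h) (%a b c. (tw (b**k))$.u v. F v*:G (St a**(u**c)))"
  by (rule CH.sweedler3_cong[OF mod_K trilinearD(2,3)[OF lin3_trilinear[OF l3]] cl_closed, symmetric])
   (simp_all add: v)
 also have "... = ?R" unfolding prd_def sweedler3_sw'[OF l3 cl_closed] by simp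
 finally show ?thesis .
qed

abbreviation "DI \<equiv> double'_ideal R H"

text \<open>The generators of the ideal after evaluation of the convolutions with translates of
  \<epsilon>: for z in H_t these give l -> F(z l), and for y in H_s they give l -> F(l
  S(y)).\<close>

definition relators where
 "relators = {tt F (et w**h) \<ominus>\<^sub>A tt (%l. F (et w**l)) h | F w h. lin F} \<union>
  {tt F (es w**h) \<ominus>\<^sub>A tt (%l. F (l**St (es w))) h | F w h. lin F}"

lemma relation_functionals: assumes F: "lin F"
 shows "act_right H \<one>\<^sub>Hs (et w) \<otimes>\<^sub>Hs res F = res (%l. F (et w**l))" (is "?L = ?R")
  "act_left H (es w) \<one>\<^sub>Hs \<otimes>\<^sub>Hs res F = res (%l. F (l**St (es w)))" (is ?A)
proof -
 note L = lins lin_comp[OF F]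
 have ep: "lin ep" by (intro lins)
 have l: "lin (%l. ep (et w**l))" "lin (%l. ep (l**es w))" by (intro L)+
 have "x$.a b. ep (et w**a)*:F b = F (et w**x)" for x
  using sw_et_mul(1)[of "%a b. ep a*:F b" w x] sw_counit(1)[OF F, of "et w**x"] F by (simp add: lin2I lins)
 then show "?L = ?R"
  by (simp add: dual_one act_right_res res_cl ep tot_res dual_mult l F)
 have "x$.a b. ep (a**es w)*:F b = F (x**St (es w))" for x
  using sw_es_slide[of "%a b. ep a*:F b" x w] sw_counit(1)[of "%b. F (b**St (es w))" x] F L by (simp add: lin2I lins)
 then show ?A
  by (simp add: dual_one act_left_res res_cl ep tot_res dual_mult l F)
qed

lemma relators_mem: assumes "lin F" shows "tt F (et w**h) \<ominus>\<^sub>A tt (%l. F (et w**l)) h \<in> relators"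
  "tt F (es w**h) \<ominus>\<^sub>A tt (%l. F (l**St (es w))) h \<in> relators"
 using assms unfolding relators_def by blast+

text \<open>The definition of the ideal ranges over carriers and images, \<open>relators\<close>
  over all arguments of the total operations; both describe the same set of generators.\<close>

lemma ideal_span: "DI = module_span R A relators"
proof -
 have et: "z \<in> target_counit R H ` carrier H <-> (\<exists>w. z = et w)" for z
  by (auto simp: et_def) (metis cl_id)
 have es: "z \<in> source_counit R H ` carrier H <-> (\<exists>w. z = es w)" for z
  by (auto simp: es_def) (metis cl_id)
 have 1: "tens R Hs H f (et w \<otimes>\<^sub>H h) \<ominus>\<^sub>A tens R Hs H (act_right H \<one>\<^sub>Hs (et w) \<otimes>\<^sub>Hs f) h =
   tt (tot f) (et w**h) \<ominus>\<^sub>A tt (%l. tot f (et w**l)) h"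
  "tens R Hs H f (es w \<otimes>\<^sub>H h) \<ominus>\<^sub>A tens R Hs H (act_left H (es w) \<one>\<^sub>Hs \<otimes>\<^sub>Hs f) h =
   tt (tot f) (es w**h) \<ominus>\<^sub>A tt (%l. tot f (l**St (es w))) h" if "f:.Hs" "h:.H" for f h w
  using relation_functionals[OF lin_tot[OF that(1)], of w] that by (simp_all add: tt_def res_tot hmul_def cl_id)
 have 2: "tt F h = tt (tot (res F)) (cl h)" if "lin F" for F h using that by (simp add: tt_def tot_res)
 have "{tens R Hs H f (z \<otimes>\<^sub>H h) \<ominus>\<^sub>A tens R Hs H (act_right H \<one>\<^sub>Hs z \<otimes>\<^sub>Hs f) h | f h z.
     f:.Hs \<and> h:.H \<and> z \<in> target_counit R H ` carrier H} =
   {tt F (et w**h) \<ominus>\<^sub>A tt (%l. F (et w**l)) h | F w h. lin F}" (is "?X = ?Y") proof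
  show "?X \<subseteq> ?Y" unfolding et using 1(1) lin_tot by blast
  show "?Y \<subseteq> ?X"
  proof
   fix x assume "x \<in> ?Y"
   then obtain F w h where F: "lin F" and x: "x = tt F (et w**h) \<ominus>\<^sub>A tt (%l. F (et w**l)) h" by blast
   have "x = tens R Hs H (res F) (et w \<otimes>\<^sub>H cl h) \<ominus>\<^sub>A tens R Hs H (act_right H \<one>\<^sub>Hs (et w) \<otimes>\<^sub>Hs res F) (cl h)"
    using 1(1)[OF res_cl[OF F] cl_closed] by (simp add: x tot_res[OF F]) (simp add: tt_def)
   then show "x \<in> ?X" unfolding et using res_cl[OF F] cl_closed by blast
  qed
 qed
 moreover have "{tens R Hs H f (y \<otimes>\<^sub>H h) \<ominus>\<^sub>A tens R Hs H (act_left H y \<one>\<^sub>Hs \<otimes>\<^sub>Hs f) h | f h y.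
     f:.Hs \<and> h:.H \<and> y \<in> source_counit R H ` carrier H} =
   {tt F (es w**h) \<ominus>\<^sub>A tt (%l. F (l**St (es w))) h | F w h. lin F}" (is "?X = ?Y") proof
  show "?X \<subseteq> ?Y" unfolding es using 1(2) lin_tot by blast
  show "?Y \<subseteq> ?X"
  proof
   fix x assume "x \<in> ?Y"
   then obtain F w h where F: "lin F" and x: "x = tt F (es w**h) \<ominus>\<^sub>A tt (%l. F (l**St (es w))) h" by blast
   have "x = tens R Hs H (res F) (es w \<otimes>\<^sub>H cl h) \<ominus>\<^sub>A tens R Hs H (act_left H (es w) \<one>\<^sub>Hs \<otimes>\<^sub>Hs res F) (cl h)"
    using 1(2)[OF res_cl[OF F] cl_closed] by (simp add: x tot_res[OF F]) (simp add: tt_def)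
   then show "x \<in> ?X" unfolding es using res_cl[OF F] cl_closed by blast
  qed
 qed
 ultimately show ?thesis by (simp add: double'_ideal_def Let_def relators_def)
qed

lemma relators_closed: "relators \<subseteq> carrier A"
proof -
 interpret A: module R A by (rule mod_A)
 show ?thesis by (auto simp: relators_def intro!: A.M.minus_closed tt_closed lin_comp lins)
qed

sublocale QA: quotient_by R "double'_product R H" "double'_ideal R H" unfolding quotient_by_def quotient_by_axioms_def
 using mod_A module_span_submodule[OF mod_A relators_closed] by (simp add: ideal_span)

abbreviation "Q \<equiv> quotient_algebra A DI"

lemma mod_Q: "module R Q" by (rule QA.quotient_module)

lemma ideal_zero: assumes "module R P" "f : Lin R A P" "x \<in> DI"
  "!!F w h. lin F ==> f (tt F (et w**h)) = f (tt (%l. F (et w**l)) h)"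
  "!!F w h. lin F ==> f (tt F (es w**h)) = f (tt (%l. F (l**St (es w))) h)" shows "f x = \<zero>\<^sub>P"
proof (rule linear_map_span_zero[OF mod_A assms(1,2) relators_closed])
 interpret P: module R P by (rule assms(1))
 note m = linear_map_minus[OF mod_A assms(1,2) tt_closed tt_closed]
 show "x \<in> module_span R A relators" using assms(3) by (simp add: ideal_span)
 fix r assume "r \<in> relators"
 then consider F w h where "lin F" "r = tt F (et w**h) \<ominus>\<^sub>A tt (%l. F (et w**l)) h"
  | F w h where "lin F" "r = tt F (es w**h) \<ominus>\<^sub>A tt (%l. F (l**St (es w))) h"
  unfolding relators_def by blast
 then show "f r = \<zero>\<^sub>P"
 proof cases
  case 1
  have "f r = f (tt F (et w**h)) \<ominus>\<^sub>P f (tt (%l. F (et w**l)) h)"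
   unfolding 1(2) by (rule m[OF 1(1)]) (intro lin_comp[OF 1(1)] lins)
  then show ?thesis by (simp add: assms(4)[OF 1(1)] P.M.minus_eq_zero_iff lmD(1)[OF assms(2)] tt_closed lin_comp[OF 1(1)] lins)
 next
  case 2
  have "f r = f (tt F (es w**h)) \<ominus>\<^sub>P f (tt (%l. F (l**St (es w))) h)"
   unfolding 2(2) by (rule m[OF 2(1)]) (intro lin_comp[OF 2(1)] lins)
  then show ?thesis by (simp add: assms(5)[OF 2(1)] P.M.minus_eq_zero_iff lmD(1)[OF assms(2)] tt_closed lin_comp[OF 2(1)] lins)
 qed
qed

lemma cls_tt: assumes F: "lin F" shows "QA.cls (tt F (et w**h)) = QA.cls (tt (%l. F (et w**l)) h)" (is "?L = ?R")
  "QA.cls (tt F (es w**h)) = QA.cls (tt (%l. F (l**St (es w))) h)"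
proof -
 have l: "lin (%l. F (et w**l))" "lin (%l. F (l**St (es w)))" by (intro lin_comp[OF F] lins)+
 have "relators \<subseteq> DI" unfolding ideal_span by (rule module_span_incl)
 then show "?L = ?R"
  "QA.cls (tt F (es w**h)) = QA.cls (tt (%l. F (l**St (es w))) h)"
  using relators_mem[OF F] by (auto simp: QA.cls_eq_iff tt_closed F l)
qed

text \<open>Each family of relators, killed by \<open>ph\<close> for all F, gives one of the two
  relations because functionals separate points of H.\<close>

lemma rep_twisted: assumes ph: "rep ph tw" and "!!x. x \<in> DI ==> ph x = \<zero>" shows "twisted tw"
proof -
 interpret KK: module R K by (rule mod_K)
 have l: "lin (%l. F (et w**l))" "lin (%l. F (l**St (es w)))" if "lin F" for F w by (intro lin_comp[OF that] lins)+
 have inD: "relators \<subseteq> DI" unfolding ideal_span by (rule module_span_incl)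
 have eq: "ph x = ph y" if "x \<ominus>\<^sub>A y \<in> relators" "x:.A" "y:.A" for x y
 proof -
  have "ph x \<ominus>\<^sub>K ph y = \<zero>\<^sub>K"
   using assms(2)[of "x \<ominus>\<^sub>A y"] inD that linear_map_minus[OF mod_A mod_K repD(1)[OF ph] that(2,3)] by auto
  then show ?thesis using KK.M.minus_eq_zero_iff lmD(1)[OF repD(1)[OF ph]] that by blast
 qed
 have "tw (et w**h) = et w**tw h" for w h
 proof -
  have "cl (tw (et w**h)) = cl (et w**tw h)"
  proof (rule H_eqI)
   fix F assume F: "lin F"
   have "ph (tt F (et w**h)) = ph (tt (%l. F (et w**l)) h)"
    by (rule eq[OF relators_mem(1)[OF F]]) (intro tt_closed F l)+
   then show "F (tw (et w**h)) = F (et w**tw h)" by (simp add: repD(4)[OF ph] F l)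
  qed
  then show ?thesis by (simp add: repD(3)[OF ph])
 qed
 moreover have "tw (es w**h) = tw h**St (es w)" for w h
 proof -
  have "cl (tw (es w**h)) = cl (tw h**St (es w))"
  proof (rule H_eqI)
   fix F assume F: "lin F"
   have "ph (tt F (es w**h)) = ph (tt (%l. F (l**St (es w))) h)"
    by (rule eq[OF relators_mem(2)[OF F]]) (intro tt_closed F l)+
   then show "F (tw (es w**h)) = F (tw h**St (es w))" by (simp add: repD(4)[OF ph] F l)
  qed
  then show ?thesis by (simp add: repD(3)[OF ph])
 qed
 ultimately show ?thesis using repD(2,3)[OF ph] by (simp add: twisted_def)
qed

subsection \<open>The projection \<open>x \<mapsto> [\<epsilon> \<otimes> 1] x\<close>\<close>

lemma one_A: "\<one>\<^sub>A = tt ep uu" by (simp add: A_sel tt_def dual_one uu_def cl_id)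

lemma one_A_closed: "\<one>\<^sub>A:.A" unfolding one_A by (rule tt_closed) (intro lins)

text \<open>The relations hold in the right factor for every functional on H^* \<otimes> H, so a
  relator on the right gives zero itself and not merely an element of the ideal.\<close>

lemma mult_ideal_zero: assumes x: "x:.A" and i: "i \<in> DI" shows "x \<otimes>\<^sub>A i = \<zero>\<^sub>A"
proof (rule ideal_zero[OF mod_A bilD(1)[OF mult_A_bilinear x] i])
 fix F w h assume F: "lin F"
 note B = mult_A_bilinear
 have l: "lin (%l. F (et w**l))" "lin (%l. F (l**St (es w)))" by (intro lin_comp[OF F] lins)+
 have 1: "tt P m \<otimes>\<^sub>A tt F (et w**h) = tt P m \<otimes>\<^sub>A tt (%l. F (et w**l)) h"
  "tt P m \<otimes>\<^sub>A tt F (es w**h) = tt P m \<otimes>\<^sub>A tt (%l. F (l**St (es w))) h" if P: "lin P" for P m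
  by (rule A_sep; (intro bilD(3)[OF B] tt_closed F P l)?;
   simp add: mult_A_value P F l prd_right_et[OF repD(2) P F] prd_right_es[OF repD(2) P F])+
 show "x \<otimes>\<^sub>A tt F (et w**h) = x \<otimes>\<^sub>A tt (%l. F (et w**l)) h"
  by (rule A_ext[where f="%x. x \<otimes>\<^sub>A tt F (et w**h)" and g="%x. x \<otimes>\<^sub>A tt (%l. F (et w**l)) h",
    OF mod_A bilD(2)[OF B tt_closed[OF F]] bilD(2)[OF B tt_closed[OF l(1)]] 1(1) x])
 show "x \<otimes>\<^sub>A tt F (es w**h) = x \<otimes>\<^sub>A tt (%l. F (l**St (es w))) h"
  by (rule A_ext[where f="%x. x \<otimes>\<^sub>A tt F (es w**h)" and g="%x. x \<otimes>\<^sub>A tt (%l. F (l**St (es w))) h",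
    OF mod_A bilD(2)[OF B tt_closed[OF F]] bilD(2)[OF B tt_closed[OF l(2)]] 1(2) x])
qed

text \<open>Scalar forms do not suffice, since the target will be the quotient, whose functionals
  are not yet known to separate points. The identity \<Delta>(1) = es(1_1) \<otimes> et(1_2) is
  therefore proved in H \<otimes> H and then lifted.\<close>

lemma sweedler_one_es_et: assumes "module R P" "bilinear R H H P B"
 shows "sweedler R H P \<one>\<^sub>H B = sweedler R H P \<one>\<^sub>H (%a b. B (es a) (et b))" (is "?L = ?R")
proof -
 note ts = target_source_linear
 have one: "\<one>\<^sub>H:.H" by simp
 have eq: "es a = source_counit R H a" "et a = target_counit R H a" if "a:.H" for a
  using that by (simp_all add: es_def et_def cl_id)
 have b: "bilinear R H H P' (%a b. B' (es a) (et b))" if "bilinear R H H P' B'" for P' :: "('a, 'p', 'z') module_scheme" and B'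
 proof -
  have "bilinear R H H P' (%a b. B' (source_counit R H a) (target_counit R H b))"
   by (rule bilI; (rule lm_comp[OF ts(1) bilD(1)[OF that lmD(1)[OF ts(2)]]] |
    rule lm_comp[OF ts(2) bilD(2)[OF that lmD(1)[OF ts(1)]]]); assumption)
  then show ?thesis by (rule iffD1[OF bilinear_cong[OF mod_H mod_H], rotated]) (simp add: eq)
 qed
 note tb = b[OF HH.tens_bilinear]
 have "comult H \<one>\<^sub>H = sweedler R H HH.T \<one>\<^sub>H (%a b. tens R H H (es a) (et b))"
 proof (rule HH.tensor_separates[OF basis basis])
  show "comult H \<one>\<^sub>H:.HH.T" using lmD(1)[OF comult_linear one] by simp
  show "sweedler R H HH.T \<one>\<^sub>H (%a b. tens R H H (es a) (et b)):.HH.T"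
   by (rule CH.sweedler_closed[OF HH.tensor_mod tb one])
  fix f g assume fg: "f : Lin R H K" "g : Lin R H K"
  note pl = HH.pair_form_linear[OF fg]
  let ?B = "%a b. f (cl a)*:g (cl b)"
  have L: "lin2 ?B" by (intro lins lin_linear_map fg)
  have L': "lin2 (%a b. ?B (es a) (et b))" "lin2 (%a b. ?B a (et b))" by (intro lins lin2D[OF L])+
  have v: "f a \<otimes> g b = ?B a b" if "a:.H" "b:.H" for a b
   using that lmD(1)[OF fg(1)] lmD(1)[OF fg(2)] by (simp add: cl_id smul_def sc_id)
  have "HH.pair_form f g (comult H \<one>\<^sub>H) = sweedler R H K \<one>\<^sub>H (%a b. f a \<otimes> g b)"
   by (simp add: HH.pair_form_def sweedler_def)
  also have "... = sw \<one>\<^sub>H ?B" by (rule sweedler_sw[OF L one v])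
  also have "... = uu$.a b. ?B a (et b)" unfolding uu_def[symmetric] by (rule sw_uu_et[OF L, symmetric])
  also have "... = sw \<one>\<^sub>H (%a b. ?B (es a) (et b))" unfolding uu_def[symmetric] by (rule sw_uu_es[OF L'(2), symmetric])
  also have "... = sweedler R H K \<one>\<^sub>H (%a b. HH.pair_form f g (tens R H H (es a) (et b)))"
   by (rule sweedler_sw[OF L'(1) one, symmetric]) (simp add: HH.pair_form_tens[OF fg] v)
  also have "... = HH.pair_form f g (sweedler R H HH.T \<one>\<^sub>H (%a b. tens R H H (es a) (et b)))"
   by (rule CH.sweedler_comp[OF HH.tensor_mod mod_K tb pl one, symmetric])
  finally show "HH.pair_form f g (comult H \<one>\<^sub>H) = HH.pair_form f g (sweedler R H HH.T \<one>\<^sub>H (%a b. tens R H H (es a) (et b)))" .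
 qed
 then have "?L = tensor_lift R P (sweedler R H HH.T \<one>\<^sub>H (%a b. tens R H H (es a) (et b))) B"
  by (simp add: sweedler_def)
 also have "... = sweedler R H P \<one>\<^sub>H (%a b. tensor_lift R P (tens R H H (es a) (et b)) B)"
  by (rule CH.sweedler_comp[OF HH.tensor_mod assms(1) tb HH.tensor_lift_linear[OF assms] one])
 also have "... = ?R" by (simp add: HH.tensor_lift_tens[OF assms])
 finally show ?thesis .
qed

lemma cls_linear': "QA.cls : Lin R HsH Q" using QA.cls_linear by (simp add: linear_map_A)

text \<open>
  Since \<open>\<Delta>(1) \<in> H\<^sub>s \<otimes> H\<^sub>t\<close>, the middle leg of \<open>\<Delta>\<^sup>2(1)\<close> in \<open>[\<epsilon> \<otimes> 1] [g \<otimes> k]\<close> can be moved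
  through the relations, where it recombines with the outer legs to \<open>S(1\<^sub>1) 1\<^sub>2 = 1\<close>.
\<close>

lemma cls_one_mult: assumes x: "x:.A" shows "QA.cls (\<one>\<^sub>A \<otimes>\<^sub>A x) = QA.cls x"
proof (rule A_ext[OF mod_Q lm_comp[OF bilD(1)[OF mult_A_bilinear one_A_closed] QA.cls_linear] QA.cls_linear _ x])
 fix G k assume G: "lin G"
 have one: "\<one>\<^sub>H:.H" by simp
 have ep: "lin ep" by (intro lins)
 note f = res_cl[OF ep] and g = res_cl[OF G] and k = cl_closed[of k]
 have gl: "lin (%l. G (x**(l**y)))" for x y by (intro lins lin_comp[OF G])
 define Ph where "Ph = (%x y. QA.cls (tt (%l. G (x**(l**y))) k))"
 define Fx where "Fx = (%a b c. QA.cls (prod_term (res ep) (res G) (cl k) a b c))"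
 have Ph_lin: "bilinear R H H Q Ph"
 proof (rule bilI)
  have c: "(%f. QA.cls (tens R Hs H f (cl k))) : Lin R Hs Q"
   using lm_comp[OF bilD(2)[OF SH.tens_bilinear k] cls_linear'[unfolded lm_tensor]] .
  have l: "(%l. G (x**(l**y))) : Lin R H K" "(%x. G (x**(l**y))) : Lin R H K"
   "(%y. G (x**(l**y))) : Lin R H K" for x y l by (rule linD(6); intro lins lin_comp[OF G])+
  have r: "res (%l. G (x**(l**y))):.Hs" for x y by (rule res_cl[OF gl])
  have "(%y. res (%l. G (x**(l**y)))) : Lin R H Hs" for x
   by (rule dual_linearI[OF r _ mod_H]) (simp add: res_apply l)
  from lm_comp[OF this c] show "Ph x : Lin R H Q" for x by (simp add: Ph_def tt_def)
  have "(%x. res (%l. G (x**(l**y)))) : Lin R H Hs" for y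
   by (rule dual_linearI[OF r _ mod_H]) (simp add: res_apply l)
  from lm_comp[OF this c] show "(%x. Ph x y) : Lin R H Q" for y by (simp add: Ph_def tt_def)
 qed
 have Fx_tri: "trilinear Q Fx"
 proof (rule trilinearI)
  note T = trilinearD[OF prod_term_trilinear[OF f g k]]
  show "(%c. Fx a b c) : Lin R H Q" if "a:.H" "b:.H" for a b
   unfolding Fx_def by (rule lm_comp[OF T(3)[OF that] cls_linear'])
  show "(%b. Fx a b c) : Lin R H Q" if "a:.H" "c:.H" for a c
   unfolding Fx_def by (rule lm_comp[OF T(4)[OF that] cls_linear'])
  show "(%a. Fx a b c) : Lin R H Q" if "b:.H" "c:.H" for b c
   unfolding Fx_def by (rule lm_comp[OF T(5)[OF that] cls_linear'])
 qed
 note T = trilinearD[OF Fx_tri]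
 have Fx: "Fx a b c = QA.cls (tt (%l. G (St a**(l**c))) (b**k))" if "a:.H" "b:.H" "c:.H" for a b c
 proof -
  have "x$.u v. G (St a**(u**c))*:ep v = G (St a**(x**c))" for x
   using sw_counit(2)[OF gl[of "St a" c], of x] by (simp add: smul_comm)
  then show ?thesis unfolding Fx_def prod_term_res[OF ep G that] by simp
 qed
 \<comment> \<open>The factor from H_s leaves the second tensor component through one relation and
   the factor from H_t through the other; both end up in the functional.\<close>
 have slide: "Fx (es a) (es c \<otimes>\<^sub>H et b) (et d) = Ph (St (es a)**et b) (St (es c)**et d)" (is "?M = ?N") for a b c d
 proof -
  have l: "lin (%l. G (St (es a)**(l**(St (es c)**et d))))" by (rule gl)
  have "?M = QA.cls (tt (%l. G (St (es a)**(l**et d))) (es c**(et b**k)))"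
   by (subst Fx) (simp_all add: hmul_def cl_id m_assoc)
  also have "... = QA.cls (tt (%l. G (St (es a)**(l**(St (es c)**et d)))) (et b**k))"
   unfolding cls_tt(2)[OF gl] hassoc ..
  also have "... = ?N" unfolding cls_tt(1)[OF l] Ph_def hassoc ..
  finally show ?thesis .
 qed
 have Fb: "bilinear R H H Q (%c d. Fx a (c \<otimes>\<^sub>H b) d)" if "a:.H" "b:.H" for a b
  by (rule bilI; (rule T(3)[OF that(1) bilD(3)[OF mult_bilinear _ that(2)]] |
   rule lm_comp[OF bilD(2)[OF mult_bilinear that(2)] T(4)[OF that(1)]]); assumption)
 have Fb2: "bilinear R H H Q (%a b. sweedler R H Q \<one>\<^sub>H (%c d. Fx a (c \<otimes>\<^sub>H b) d))"
 proof (rule bilI; rule CH.sweedler_fun_linear[OF mod_Q mod_H Fb _ one])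
  fix a b c d assume *: "b:.H" "c:.H" "d:.H" "a:.H"
  show "(%a. Fx a (c \<otimes>\<^sub>H b) d) : Lin R H Q" by (rule T(5)[OF bilD(3)[OF mult_bilinear *(2,1)] *(3)])
  show "(%b. Fx a (c \<otimes>\<^sub>H b) d) : Lin R H Q"
   by (rule lm_comp[OF bilD(1)[OF mult_bilinear *(2)] T(4)[OF *(4,3)]])
 qed
 have S: "antipode H c \<otimes>\<^sub>H d = St c**d" if "c:.H" "d:.H" for c d
  using that by (simp add: St_def hmul_def cl_id lmD(1)[OF antipode_linear])
 have Sb: "bilinear R H H H (%c d. St c**d)"
 proof -
  have "bilinear R H H H (%c d. antipode H c \<otimes>\<^sub>H d)"
   by (rule bilI; (rule bilD(1)[OF mult_bilinear lmD(1)[OF antipode_linear]] |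
    rule lm_comp[OF antipode_linear bilD(2)[OF mult_bilinear]]); assumption)
  moreover have "bilinear R H H H (%c d. antipode H c \<otimes>\<^sub>H d) <-> bilinear R H H H (%c d. St c**d)"
   by (rule bilinear_cong[OF mod_H mod_H S])
  ultimately show ?thesis by (rule iffD1[rotated])
 qed
 have S1: "sweedler R H H \<one>\<^sub>H (%c d. St c**d) = uu"
  using CH.sweedler_cong[OF mod_H Sb one S[symmetric]] antipode_source[OF one] es_uu
  by (simp add: es_def uu_def cl_id)
 have Phb: "bilinear R H H Q (%c d. Ph z (St c**d))" "bilinear R H H Q (%c d. Ph (St c**d) z)" if "z:.H" for z
  by (rule HH.bilinear_comp[OF Sb bilD(1)[OF Ph_lin that]] HH.bilinear_comp[OF Sb bilD(2)[OF Ph_lin that]])+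
 have "QA.cls (\<one>\<^sub>A \<otimes>\<^sub>A tt G k) = QA.cls (sweedler3 R H HsH \<one>\<^sub>H (prod_term (res ep) (res G) (cl k)))"
  unfolding one_A tt_def by (simp add: mult_A_tens f g, simp add: uu_def)
 also have "... = sweedler3 R H Q \<one>\<^sub>H Fx" unfolding Fx_def
  by (rule CH.sweedler3_comp[OF mod_HsH mod_Q trilinearD(2,3)[OF prod_term_trilinear[OF f g k]] cls_linear' one])
 also have "... = sweedler R H Q \<one>\<^sub>H (%a b. sweedler R H Q \<one>\<^sub>H (%c d. Fx a (c \<otimes>\<^sub>H b) d))"
  by (rule sweedler3_one(2)[OF mod_Q Fx_tri])
 \<comment> \<open>Each copy of \<Delta>(1) is moved into H_s \<otimes> H_t so that
   \<open>slide\<close> applies, and is released afterwards so that S(1_1) 1_2 = 1 removes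
   it.\<close>
 also have "... = sweedler R H Q \<one>\<^sub>H (%a b. sweedler R H Q \<one>\<^sub>H (%c d. Fx (es a) (c \<otimes>\<^sub>H et b) d))"
  by (rule sweedler_one_es_et[OF mod_Q Fb2])
 also have "... = sweedler R H Q \<one>\<^sub>H (%a b. Ph (St (es a)**et b) uu)"
 proof -
  have "sweedler R H Q \<one>\<^sub>H (%c d. Fx (es a) (c \<otimes>\<^sub>H et b) d) = Ph (St (es a)**et b) uu" (is "?M = ?N") for a b
  proof -
   have "?M = sweedler R H Q \<one>\<^sub>H (%c d. Fx (es a) (es c \<otimes>\<^sub>H et b) (et d))"
    by (rule sweedler_one_es_et[OF mod_Q Fb]) simp_all
   also have "... = sweedler R H Q \<one>\<^sub>H (%c d. Ph (St (es a)**et b) (St (es c)**et d))" by (simp only: slide)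
   also have "... = sweedler R H Q \<one>\<^sub>H (%c d. Ph (St (es a)**et b) (St c**d))"
    by (rule sweedler_one_es_et[OF mod_Q Phb(1), symmetric]) simp
   also have "... = ?N" unfolding S1[symmetric]
    by (rule CH.sweedler_comp[OF mod_H mod_Q Sb bilD(1)[OF Ph_lin] one, symmetric]) simp
   finally show ?thesis .
  qed
  then show ?thesis by simp
 qed
 also have "... = sweedler R H Q \<one>\<^sub>H (%a b. Ph (St a**b) uu)"
  by (rule sweedler_one_es_et[OF mod_Q Phb(2), symmetric]) simp
 also have "... = Ph (sweedler R H H \<one>\<^sub>H (%a b. St a**b)) uu"
  by (rule CH.sweedler_comp[OF mod_H mod_Q Sb bilD(2)[OF Ph_lin] one, symmetric]) simp
 also have "... = QA.cls (tt G k)" unfolding S1 Ph_def by (simp add: linD(2)[OF G])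
 finally show "QA.cls (\<one>\<^sub>A \<otimes>\<^sub>A tt G k) = QA.cls (tt G k)" .
qed

lemma one_mult_zero_mem: assumes x: "x:.A" and "\<one>\<^sub>A \<otimes>\<^sub>A x = \<zero>\<^sub>A"
 shows "x \<in> DI"
 using QA.a_rcos_self[OF x] cls_one_mult[OF x] QA.M.a_coset_add_zero[OF QA.I_subset] assms(2) by simp

text \<open>Composing an arbitrary functional with left multiplication by the preunit makes it
  vanish on the ideal, hence twisted. So if all twisted functionals vanish at \<open>x\<close>, its
  product with the preunit is zero.\<close>

lemma ideal_memI: assumes x: "x:.A" and "!!ph tw. [|rep ph tw; twisted tw|] ==> ph x = \<zero>" shows "x \<in> DI"
proof -
 note m1 = bilD(1)[OF mult_A_bilinear one_A_closed]
 have "\<one>\<^sub>A \<otimes>\<^sub>A x = \<zero>\<^sub>A"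
 proof (rule A_sep)
  show "\<one>\<^sub>A \<otimes>\<^sub>A x:.A" by (rule lmD(1)[OF m1 x])
  fix ph tw assume ph: "rep ph tw"
  note c = lm_comp[OF m1 repD(1)[OF ph]] and z = lm_zero[OF mod_A mod_K repD(1)[OF ph]]
  obtain sg where sg: "rep (%x. ph (\<one>\<^sub>A \<otimes>\<^sub>A x)) sg" using rep_ex[OF c] by blast
  have "twisted sg" by (rule rep_twisted[OF sg]) (simp add: mult_ideal_zero[OF one_A_closed] z)
  from assms(2)[OF sg this] show "ph (\<one>\<^sub>A \<otimes>\<^sub>A x) = ph \<zero>\<^sub>A" using z by simp
 qed simp
 then show ?thesis by (rule one_mult_zero_mem[OF x])
qed

lemma ideal_iff: assumes x: "x:.A"
 shows "x \<in> DI <-> \<one>\<^sub>A \<otimes>\<^sub>A x = \<zero>\<^sub>A"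
 using mult_ideal_zero[OF one_A_closed] one_mult_zero_mem[OF x] by blast

text \<open>Membership is tested by twisted functionals; for these, a relator as left factor
  contributes nothing by \<open>prd_left_et\<close> and \<open>prd_left_es\<close>.\<close>

lemma ideal_mult: assumes i: "i \<in> DI" and y: "y:.A" shows "i \<otimes>\<^sub>A y \<in> DI"
proof (rule ideal_memI)
 note B = mult_A_bilinear
 show "i \<otimes>\<^sub>A y:.A" using i y QA.I_subset bilD(3)[OF B] by blast
 fix ph tw assume ph: "rep ph tw" and tw: "twisted tw"
 note f = repD(1)[OF ph] and c = lm_comp[OF bilD(2)[OF B] repD(1)[OF ph]]
  and c' = lm_comp[OF bilD(1)[OF B tt_closed] repD(1)[OF ph]]
 have "ph (i \<otimes>\<^sub>A y) = \<zero>\<^sub>K"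
 proof (rule ideal_zero[OF mod_K c[OF y] i])
  fix F w h assume F: "lin F"
  have l: "lin (%l. F (et w**l))" "lin (%l. F (l**St (es w)))" by (intro lin_comp[OF F] lins)+
  show "ph (tt F (et w**h) \<otimes>\<^sub>A y) = ph (tt (%l. F (et w**l)) h \<otimes>\<^sub>A y)"
   by (rule A_ext[where f="%y. ph (tt F (et w**h) \<otimes>\<^sub>A y)" and g="%y. ph (tt (%l. F (et w**l)) h \<otimes>\<^sub>A y)",
     OF mod_K c'[OF F] c'[OF l(1)] _ y]) (simp add: mult_A_value[OF ph] F l prd_left_et[OF tw])
  show "ph (tt F (es w**h) \<otimes>\<^sub>A y) = ph (tt (%l. F (l**St (es w))) h \<otimes>\<^sub>A y)"
   by (rule A_ext[where f="%y. ph (tt F (es w**h) \<otimes>\<^sub>A y)" and g="%y. ph (tt (%l. F (l**St (es w))) h \<otimes>\<^sub>A y)",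
     OF mod_K c'[OF F] c'[OF l(2)] _ y]) (simp add: mult_A_value[OF ph] F l prd_left_es[OF tw])
 qed
 then show "ph (i \<otimes>\<^sub>A y) = \<zero>" by simp
qed

subsection \<open>The quotient algebra\<close>

text \<open>The product of cosets is a union over representatives. Changing the left one alters the
  product by an element of the ideal, changing the right one does not alter it at all.\<close>

lemma cls_mult: assumes x: "x:.A" and y: "y:.A"
 shows "QA.cls x \<otimes>\<^sub>Q QA.cls y = QA.cls (x \<otimes>\<^sub>A y)" (is "?L = ?R")
proof -
 note B = mult_A_bilinear
 have eq: "QA.cls (a \<otimes>\<^sub>A b) = ?R" if a: "a \<in> QA.cls x" and b: "b \<in> QA.cls y" for a b
 proof -
  have a: "a:.A" "a \<ominus>\<^sub>A x \<in> DI" and b: "b:.A" "b \<ominus>\<^sub>A y \<in> DI"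
   using a b QA.mem_cls x y by auto
  have xy: "a \<otimes>\<^sub>A b:.A" "x \<otimes>\<^sub>A b:.A" "x \<otimes>\<^sub>A y:.A"
   using bilD(3)[OF B] a b x y by auto
  have "a \<otimes>\<^sub>A b \<ominus>\<^sub>A x \<otimes>\<^sub>A b \<in> DI"
   using ideal_mult[OF a(2) b(1)] linear_map_minus[OF mod_A mod_A bilD(2)[OF B b(1)] a(1) x] by simp
  then have "QA.cls (a \<otimes>\<^sub>A b) = QA.cls (x \<otimes>\<^sub>A b)" using xy by (simp add: QA.cls_eq_iff)
  moreover have "x \<otimes>\<^sub>A b \<ominus>\<^sub>A x \<otimes>\<^sub>A y = \<zero>\<^sub>A"
   using mult_ideal_zero[OF x b(2)] linear_map_minus[OF mod_A mod_A bilD(1)[OF B x] b(1) y] by simp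
  then have "x \<otimes>\<^sub>A b = x \<otimes>\<^sub>A y" using xy by (simp add: QA.M.minus_eq_zero_iff)
  ultimately show ?thesis by simp
 qed
 have "?L = (\<Union>a\<in>QA.cls x. \<Union>b\<in>QA.cls y. QA.cls (a \<otimes>\<^sub>A b))"
  by (simp add: QA.quotient_sel rcoset_mult_def)
 also have "... = (\<Union>a\<in>QA.cls x. \<Union>b\<in>QA.cls y. QA.cls (x \<otimes>\<^sub>A y))"
  by (intro SUP_cong refl eq)
 also have "... = ?R" using QA.a_rcos_self x y by blast
 finally show ?thesis .
qed

lemma mult_Q_bilinear: "bilinear R Q Q Q (mult Q)"
proof (rule bilI; rule lmI)
 note B = bilD(3)[OF mult_A_bilinear]
 note l = lmD[OF bilD(1)[OF mult_A_bilinear]] and r = lmD[OF bilD(2)[OF mult_A_bilinear]]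
 note simps = cls_mult QA.cls_add[symmetric] QA.cls_smult[symmetric] QA.cls_closed B l r
 fix X Y Z assume "X:.Q" "Y:.Q"
 then obtain x y where x: "x:.A" "X = QA.cls x" "y:.A" "Y = QA.cls y" using QA.quotient_cases by meson
 show "X \<otimes>\<^sub>Q Y:.Q" using x by (simp add: simps)
 show "Y \<otimes>\<^sub>Q X:.Q" using x by (simp add: simps)
 show "X \<otimes>\<^sub>Q (a \<odot>\<^sub>Q Y) = a \<odot>\<^sub>Q (X \<otimes>\<^sub>Q Y)" "(a \<odot>\<^sub>Q Y) \<otimes>\<^sub>Q X = a \<odot>\<^sub>Q (Y \<otimes>\<^sub>Q X)" if "a:.R" for a
  using x that by (simp_all add: simps)
 assume "Z:.Q"
 then obtain z where z: "z:.A" "Z = QA.cls z" using QA.quotient_cases by meson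
 show "X \<otimes>\<^sub>Q (Y \<oplus>\<^sub>Q Z) = X \<otimes>\<^sub>Q Y \<oplus>\<^sub>Q X \<otimes>\<^sub>Q Z" "(Y \<oplus>\<^sub>Q Z) \<otimes>\<^sub>Q X = Y \<otimes>\<^sub>Q X \<oplus>\<^sub>Q Z \<otimes>\<^sub>Q X"
  using x z by (simp_all add: simps)
qed

definition base_Q where "base_Q p = QA.cls (base_A p)"
text \<open>Multiplication by the preunit annihilates the ideal, so the composite with a coordinate
  form is constant on classes.\<close>

definition form_Q where "form_Q p = on_class (%x. form_A p (\<one>\<^sub>A \<otimes>\<^sub>A x))"

text \<open>Multiplication by the preunit induces the identity on classes and so splits the
  projection: expanding the product of the preunit with x and projecting recovers the class of
  x.\<close>

lemma basis_Q: "dual_basis R Q (I \<times> I) base_Q form_Q"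
proof -
 note D = dual_basisD[OF basis_A] and m1 = bilD(1)[OF mult_A_bilinear one_A_closed]
 have l: "(%x. form_A p (\<one>\<^sub>A \<otimes>\<^sub>A x)) : Lin R A K" if "p \<in> I \<times> I" for p
  by (rule lm_comp[OF m1 D(3)[OF that]])
 have z: "form_A p (\<one>\<^sub>A \<otimes>\<^sub>A i) = \<zero>\<^sub>K" if "p \<in> I \<times> I" "i \<in> DI" for p i
  using lm_zero[OF mod_A mod_K D(3)[OF that(1)]] by (simp add: mult_ideal_zero[OF one_A_closed that(2)])
 have ol: "form_Q p : Lin R Q K" if "p \<in> I \<times> I" for p
  unfolding form_Q_def by (rule QA.on_class_linear[OF mod_K l[OF that] z[OF that]])
 have oc: "form_Q p (QA.cls x) = form_A p (\<one>\<^sub>A \<otimes>\<^sub>A x)" if "p \<in> I \<times> I" "x:.A" for p x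
  unfolding form_Q_def by (rule QA.on_class_cls[OF mod_K l[OF that(1)] z[OF that(1)] that(2)])
 interpret Q: module R Q by (rule mod_Q)
 show ?thesis unfolding dual_basis_def
 proof (intro conjI ballI)
  show "finite (I \<times> I)" by (rule D(1))
  show "base_Q \<in> I \<times> I \<rightarrow> carrier Q" unfolding base_Q_def using QA.cls_closed[OF D(2)] by blast
  show "form_Q p : Lin R Q K" if "p \<in> I \<times> I" for p by (rule ol[OF that])
  fix X assume "X:.Q"
  then obtain x where x: "x:.A" "X = QA.cls x" using QA.quotient_cases by meson
  have c: "\<one>\<^sub>A \<otimes>\<^sub>A x:.A" by (rule lmD(1)[OF m1 x(1)])
  have "(\<Oplus>\<^sub>Q p\<in>I \<times> I. form_Q p X \<odot>\<^sub>Q base_Q p) = (\<Oplus>\<^sub>Q p\<in>I \<times> I. form_A p (\<one>\<^sub>A \<otimes>\<^sub>A x) \<odot>\<^sub>Q QA.cls (base_A p))"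
   by (rule Q.M.finsum_cong'[OF refl])
    (use D(2,5) c x in \<open>auto simp: oc base_Q_def intro!: Q.smult_closed QA.cls_closed\<close>)
  also have "... = QA.cls (\<one>\<^sub>A \<otimes>\<^sub>A x)"
   by (rule dual_basis_expand[OF mod_A mod_Q basis_A QA.cls_linear c, symmetric])
  finally show "(\<Oplus>\<^sub>Q p\<in>I \<times> I. form_Q p X \<odot>\<^sub>Q base_Q p) = X" by (simp add: cls_one_mult x)
 qed
qed

end

lemma (in quotient_by) cls_zero: "x \<in> I ==> cls x = \<zero>\<^sub>Q"
 by (simp add: quotient_sel abelian_subgroup.a_rcos_const[OF abelian_subgroup])

section \<open>The coalgebra structure and the antipode of the quotient\<close>

context weak_hopf_basis begin

abbreviation "cQ \<equiv> double'_class R H"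

lemma cQ_def: "cQ f h = QA.cls (tens R Hs H f h)" by (simp add: double'_class_def)

lemma cQ_tt: "cQ (res F) (cl h) = QA.cls (tt F h)" by (simp add: cQ_def tt_def)

lemma cQ_bilinear: "bilinear R Hs H Q cQ"
 unfolding cQ_def using SH.bilinear_comp[OF SH.tens_bilinear cls_linear'[unfolded lm_tensor]] .

definition qrep :: "((('h => 'a) \<times> 'h => 'a) set set => 'a) => ('h => 'h) => bool"
 where "qrep ph tw <-> ph : Lin R Q K \<and> twisted tw \<and> (\<forall>F h. lin F --> ph (cQ (res F) (cl h)) = F (tw h))"

lemma qrepD: assumes "qrep ph tw" shows "ph : Lin R Q K" "twisted tw" "lin F ==> ph (cQ (res F) (cl h)) = F (tw h)"
 using assms by (auto simp: qrep_def)

lemma qrep_ex: assumes ph: "ph : Lin R Q K" shows "\<exists>tw. qrep ph tw"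
proof -
 obtain tw where tw: "rep (%x. ph (QA.cls x)) tw" using rep_ex[OF lm_comp[OF QA.cls_linear ph]] by blast
 have "ph (QA.cls x) = \<zero>" if x: "x \<in> DI" for x
 proof -
  show ?thesis using lm_zero[OF mod_Q mod_K ph] by (simp add: QA.cls_zero[OF x])
 qed
 then have "twisted tw" by (rule rep_twisted[OF tw])
 then show ?thesis using ph repD(4)[OF tw] by (auto simp: qrep_def cQ_tt)
qed

lemma Q_sep: assumes "x:.Q" "y:.Q" "!!ph tw. qrep ph tw ==> ph x = ph y" shows "x = y"
 by (rule dual_basis_separates[OF mod_Q basis_Q assms(1,2)]) (use assms(3) qrep_ex in blast)

sublocale QQ: two_modules R Q Q by (rule two_modules.intro) (rule mod_Q)+

abbreviation "Q2 \<equiv> tensor R Q Q"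

lemma mod_Q2: "module R Q2" by (rule QQ.tensor_module')

lemma tensor_lift_linear_Q: assumes "module R P" "bilinear R Hs H P G" shows "(%t. tensor_lift R P t G) : Lin R A P"
 using SH.tensor_lift_linear[OF assms] by (simp add: linear_map_A)

lemma tensor_lift_tt: assumes "module R P" "bilinear R Hs H P G" "lin F"
 shows "tensor_lift R P (tt F h) G = G (res F) (cl h)"
 unfolding tt_def by (rule SH.tensor_lift_tens[OF assms(1,2) res_cl[OF assms(3)] cl_closed])

subsection \<open>The comultiplication\<close>

definition comult_sum where
 "comult_sum f h = sweedler R Hs Q2 f (%f1 f2. sweedler R H Q2 h (%h1 h2. tens R Q Q (cQ f1 h1) (cQ f2 h2)))"

lemma comult_term_bilinear: assumes "f1:.Hs" "f2:.Hs"
 shows "bilinear R H H Q2 (%h1 h2. tens R Q Q (cQ f1 h1) (cQ f2 h2))"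
proof -
 note B = bilD[OF cQ_bilinear] and T = bilD[OF QQ.tens_bilinear]
 show ?thesis by (rule bilI; unfold lm_tensor; (rule lm_comp[OF B(1)[OF assms(2)] T(1)[OF B(3)[OF assms(1)]]] |
   rule lm_comp[OF B(1)[OF assms(1)] T(2)[OF B(3)[OF assms(2)]]]); assumption)
qed

lemma comult_inner_bilinear: assumes "h:.H"
 shows "bilinear R Hs Hs Q2 (%f1 f2. sweedler R H Q2 h (%h1 h2. tens R Q Q (cQ f1 h1) (cQ f2 h2)))"
proof -
 note B = bilD[OF cQ_bilinear] and T = bilD[OF QQ.tens_bilinear]
 note sl = CH.sweedler_fun_linear[OF mod_Q2 dual_module _ _ assms]
 show ?thesis
 proof (rule bilI)
  fix f assume f: "f:.Hs"
  have l: "(%f2. tens R Q Q (cQ f a) (cQ f2 b)) : Lin R Hs Q2"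
   "(%f1. tens R Q Q (cQ f1 a) (cQ f b)) : Lin R Hs Q2" if "a:.H" "b:.H" for a b
   using lm_comp[OF B(2)[OF that(2)] T(1)[OF B(3)[OF f that(1)]]]
    lm_comp[OF B(2)[OF that(1)] T(2)[OF B(3)[OF f that(2)]]] by simp_all
  show "(%f2. sweedler R H Q2 h (%h1 h2. tens R Q Q (cQ f h1) (cQ f2 h2))) : Lin R Hs Q2"
   by (rule sl; rule comult_term_bilinear[OF f] l; assumption)
  show "(%f1. sweedler R H Q2 h (%h1 h2. tens R Q Q (cQ f1 h1) (cQ f h2))) : Lin R Hs Q2"
   by (rule sl; rule comult_term_bilinear[OF _ f] l; assumption)
 qed
qed

lemma comult_sum_bilinear: "bilinear R Hs H Q2 comult_sum"
proof (rule bilI)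
 show "(%h. comult_sum f h) : Lin R H Q2" if f: "f:.Hs" for f unfolding comult_sum_def
  by (rule CD.sweedler_fun_linear[OF mod_Q2 mod_H comult_inner_bilinear _ f])
   (assumption | rule CH.sweedler_linear[OF mod_Q2 comult_term_bilinear])+
 show "(%f. comult_sum f h) : Lin R Hs Q2" if "h:.H" for h unfolding comult_sum_def
  by (rule CD.sweedler_linear[OF mod_Q2 comult_inner_bilinear[OF that]])
qed

lemma comult_sum_value: assumes B: "bilinear R Q Q K B" and F: "lin F"
 shows "tensor_lift R K (comult_sum (res F) (cl h)) B =
  swd F (%P P'. h$.s t. B (cQ (res P) (cl s)) (cQ (res P') (cl t)))" (is "_ = ?R")
proof -
 note ci = comult_inner_bilinear[OF cl_closed, of h] and c = bilD[OF cQ_bilinear]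
 have l: "(%t. tensor_lift R K t B) : Lin R Q2 K" using QQ.tensor_lift_linear[OF mod_K B] by simp
 have b: "bilinear R Hs Hs K (%f1 f2. tensor_lift R K (sweedler R H Q2 (cl h) (%h1 h2. tens R Q Q (cQ f1 h1) (cQ f2 h2))) B)"
  by (rule DD.bilinear_comp[OF ci l])
 have "tensor_lift R K (comult_sum (res F) (cl h)) B =
  sweedler R Hs K (res F) (%f1 f2. tensor_lift R K (sweedler R H Q2 (cl h) (%h1 h2. tens R Q Q (cQ f1 h1) (cQ f2 h2))) B)"
  unfolding comult_sum_def by (rule CD.sweedler_comp[OF mod_Q2 mod_K ci l res_cl[OF F]])
 also have "... = swd F (%P P'. tensor_lift R K (sweedler R H Q2 (cl h) (%h1 h2. tens R Q Q (cQ (res P) h1) (cQ (res P') h2))) B)"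
  using sweedler_dual[OF b res_cl[OF F]] by (simp add: tot_res[OF F])
 also have "... = ?R"
 proof (rule swd_cong)
  fix P P' assume P: "lin P" and P': "lin P'"
  note p = res_cl[OF P] res_cl[OF P']
  have L: "lin2 (%s t. B (cQ (res P) (cl s)) (cQ (res P') (cl t)))" by (rule lin2I; rule lin_linear_map)
    (rule lm_comp[OF c(1)[OF p(1)] bilD(2)[OF B c(3)[OF p(2) cl_closed]]]
     lm_comp[OF c(1)[OF p(2)] bilD(1)[OF B c(3)[OF p(1) cl_closed]]])+
  have "tensor_lift R K (sweedler R H Q2 (cl h) (%h1 h2. tens R Q Q (cQ (res P) h1) (cQ (res P') h2))) B =
   sweedler R H K (cl h) (%h1 h2. tensor_lift R K (tens R Q Q (cQ (res P) h1) (cQ (res P') h2)) B)"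
   by (rule CH.sweedler_comp[OF mod_Q2 mod_K comult_term_bilinear[OF p] l cl_closed])
  also have "... = (cl h)$.s t. B (cQ (res P) (cl s)) (cQ (res P') (cl t))"
   by (rule sweedler_sw[OF L cl_closed]) (simp add: QQ.tensor_lift_tens[OF mod_K B c(3)[OF p(1)] c(3)[OF p(2)]] cl_id)
  finally show "tensor_lift R K (sweedler R H Q2 (cl h) (%h1 h2. tens R Q Q (cQ (res P) h1) (cQ (res P') h2))) B =
   h$.s t. B (cQ (res P) (cl s)) (cQ (res P') (cl t))" by simp qed finally show ?thesis .
qed

lemma comult_sum_pair: assumes ph: "qrep ph tw" and ps: "qrep ps sg" and F: "lin F"
 shows "QQ.pair_form ph ps (comult_sum (res F) (cl h)) = h$.s t. F (tw s**sg t)"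
proof -
 have b: "bilinear R Q Q K (%x y. ph x \<otimes> ps y)"
  by (rule R.product_bilinear[OF mod_Q mod_Q qrepD(1)[OF ph] qrepD(1)[OF ps]])
 have "QQ.pair_form ph ps (comult_sum (res F) (cl h)) =
   swd F (%P P'. h$.s t. ph (cQ (res P) (cl s)) \<otimes> ps (cQ (res P') (cl t)))"
  using comult_sum_value[OF b F] by (simp add: QQ.pair_form_def)
 also have "... = swd F (%P P'. h$.s t. P (tw s)*:P' (sg t))"
  by (rule swd_cong) (simp add: qrepD(3)[OF ph] qrepD(3)[OF ps] smul_def linD(3))
 finally show ?thesis by (simp only: swd_sw swd_eval[OF F])
qed

text \<open>Tested by two twisted maps, a factor from H_t stays in the first leg and leaves
  \<open>tw\<close> on the left; a factor from H_s stays in the second leg and leaves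
  \<open>sg\<close> on the right through S.\<close>

lemma comult_sum_ideal: assumes "x \<in> DI" shows "tensor_lift R Q2 x comult_sum = \<zero>\<^bsub>Q2\<^esub>"
proof (rule ideal_zero[OF mod_Q2 tensor_lift_linear_Q[OF mod_Q2 comult_sum_bilinear] assms])
 fix F w h assume F: "lin F"
 note tl = tensor_lift_tt[OF mod_Q2 comult_sum_bilinear] and cb = bilD(3)[OF comult_sum_bilinear, simplified]
 have l: "lin (%l. F (et w**l))" "lin (%l. F (l**St (es w)))" by (intro lin_comp[OF F] lins)+
 have sep: "x = y" if "x:.QQ.T" "y:.QQ.T"
  "!!ph tw ps sg. qrep ph tw ==> qrep ps sg ==> QQ.pair_form ph ps x = QQ.pair_form ph ps y" for x y
  by (rule QQ.tensor_separates[OF basis_Q basis_Q that(1,2)]) (use that(3) qrep_ex in blast)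
 show "tensor_lift R Q2 (tt F (et w**h)) comult_sum = tensor_lift R Q2 (tt (%l. F (et w**l)) h) comult_sum"
  unfolding tl[OF F] tl[OF l(1)]
 proof (rule sep)
  fix ph tw ps sg assume r: "qrep ph tw" "qrep ps sg"
  note tw = qrepD(2)[OF r(1)] and sg = qrepD(2)[OF r(2)]
  have "(et w**h)$.s t. F (tw s**sg t) = h$.s t. F (et w**(tw s**sg t))"
   unfolding hassoc[symmetric] twistedD(4)[OF tw, symmetric]
   by (rule sw_et_mul(1)) (intro lins lin_comp[OF F] twistedD(6)[OF tw] twistedD(6)[OF sg])
  then show "QQ.pair_form ph ps (comult_sum (res F) (cl (et w**h))) = QQ.pair_form ph ps (comult_sum (res (%l. F (et w**l))) (cl h))"
   by (simp only: comult_sum_pair[OF r] F l)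
 qed (intro cb res_cl F l cl_closed)+
 show "tensor_lift R Q2 (tt F (es w**h)) comult_sum = tensor_lift R Q2 (tt (%l. F (l**St (es w))) h) comult_sum"
  unfolding tl[OF F] tl[OF l(2)]
 proof (rule sep)
  fix ph tw ps sg assume r: "qrep ph tw" "qrep ps sg"
  note tw = qrepD(2)[OF r(1)] and sg = qrepD(2)[OF r(2)]
  have "(es w**h)$.s t. F (tw s**sg t) = h$.s t. F (tw s**sg t**St (es w))"
   unfolding hassoc twistedD(5)[OF sg, symmetric]
   by (rule sw_es_mul(1)) (intro lins lin_comp[OF F] twistedD(6)[OF tw] twistedD(6)[OF sg])
  then show "QQ.pair_form ph ps (comult_sum (res F) (cl (es w**h))) = QQ.pair_form ph ps (comult_sum (res (%l. F (l**St (es w)))) (cl h))"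
   by (simp only: comult_sum_pair[OF r] F l)
 qed (intro cb res_cl F l cl_closed)+
qed

lemma comult_Q: "on_class (%t. tensor_lift R Q2 t comult_sum) : Lin R Q Q2" (is ?A)
 "lin F ==> on_class (%t. tensor_lift R Q2 t comult_sum) (cQ (res F) (cl h)) = comult_sum (res F) (cl h)"
proof -
 note tl = tensor_lift_linear_Q[OF mod_Q2 comult_sum_bilinear]
 show ?A
  by (rule QA.on_class_linear[OF mod_Q2 tl comult_sum_ideal])
 show "on_class (%t. tensor_lift R Q2 t comult_sum) (cQ (res F) (cl h)) = comult_sum (res F) (cl h)" if "lin F"
  using QA.on_class_cls[OF mod_Q2 tl _ tt_closed[OF that], of h] comult_sum_ideal
  by (simp add: cQ_tt tensor_lift_tt[OF mod_Q2 comult_sum_bilinear that])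
qed

subsection \<open>The counit\<close>

lemma counit_bilinear: "bilinear R Hs H K (%f h. f (target_counit R H h))"
 by (rule bilI) (rule lm_comp[OF target_source_linear(1) dual_D(1)]
  eval_linear[OF lmD(1)[OF target_source_linear(1)]]; assumption)+

lemma counit_tt: assumes "lin F" shows "tensor_lift R K (tt F h) (%f h. f (target_counit R H h)) = F (et h)"
 by (simp add: tensor_lift_tt[OF mod_K counit_bilinear assms] res_apply et_def lmD(1)[OF target_source_linear(1)])

lemma counit_ideal: assumes "x \<in> DI" shows "tensor_lift R K x (%f h. f (target_counit R H h)) = \<zero>\<^sub>K"
proof (rule ideal_zero[OF mod_K tensor_lift_linear_Q[OF mod_K counit_bilinear] assms])
 fix F w h assume F: "lin F"
 have l: "lin (%l. F (et w**l))" "lin (%l. F (l**St (es w)))" by (intro lin_comp[OF F] lins)+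
 show "tensor_lift R K (tt F (et w**h)) (%f h. f (target_counit R H h)) =
  tensor_lift R K (tt (%l. F (et w**l)) h) (%f h. f (target_counit R H h))"
  by (simp only: counit_tt F l twistedD(4)[OF twisted_et])
 show "tensor_lift R K (tt F (es w**h)) (%f h. f (target_counit R H h)) =
  tensor_lift R K (tt (%l. F (l**St (es w))) h) (%f h. f (target_counit R H h))"
  by (simp only: counit_tt F l twistedD(5)[OF twisted_et])
qed

lemma counit_Q: "on_class (%t. tensor_lift R K t (%f h. f (target_counit R H h))) : Lin R Q K" (is ?A)
 "lin F ==> on_class (%t. tensor_lift R K t (%f h. f (target_counit R H h))) (cQ (res F) (cl h)) = F (et h)"
proof -
 note tl = tensor_lift_linear_Q[OF mod_K counit_bilinear]
 show ?A
  by (rule QA.on_class_linear[OF mod_K tl counit_ideal])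
 show "on_class (%t. tensor_lift R K t (%f h. f (target_counit R H h))) (cQ (res F) (cl h)) = F (et h)" if "lin F"
  using QA.on_class_cls[OF mod_K tl _ tt_closed[OF that], of h] counit_ideal by (simp add: cQ_tt counit_tt[OF that])
qed

subsection \<open>The antipode and its inverse\<close>

lemma sweedler3_dual: assumes Gb: "!!f3. f3:.Hs ==> bilinear R Hs Hs K (%f1 f2. G f1 f2 f3)"
  and Gl: "!!f1 f2. [|f1:.Hs; f2:.Hs|] ==> (%f3. G f1 f2 f3) : Lin R Hs K" and F: "lin F"
 shows "sweedler3 R Hs K (res F) G = swd F (%P P3. swd P (%P1 P2. G (res P1) (res P2) (res P3)))" (is "?L = ?R")
proof -
 have "?L = swd F (%P P3. sweedler R Hs K (res P) (%f1 f2. G f1 f2 (res P3)))"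
  using sweedler_dual[OF CD.sweedler3_inner_bilinear[OF mod_K Gb Gl] res_cl[OF F]]
  by (simp add: sweedler3_def tot_res[OF F])
 also have "... = ?R"
  by (rule swd_cong) (simp add: sweedler_dual[OF Gb[OF res_cl] res_cl] tot_res)
 finally show ?thesis .
qed

text \<open>
  The antipode of \<open>D'(H)\<close> and its inverse are both of the following form, with \<open>a\<close>, \<open>b\<close>
  the inverse antipode of \<open>H\<^sup>*\<close> and the antipode of \<open>H\<close>, or vice versa.
\<close>

definition anti_term where
 "anti_term a b f1 f2 f3 h1 h2 h3 = (f1 h1 \<otimes> f3 (antipode H h3)) \<odot>\<^sub>Q cQ (a f2) (b h2)"

definition anti_sum where
 "anti_sum a b f h = sweedler3 R Hs Q f (%f1 f2 f3. sweedler3 R H Q h (anti_term a b f1 f2 f3))"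

text \<open>The map \<open>a\<close> is the transpose of \<alpha>, and \<beta> is the total version
  of \<open>b\<close>. Keeping them abstract treats the antipode and its inverse by the same
  computation.\<close>

context
 fixes a :: "('h => 'a) => ('h => 'a)" and b :: "'h => 'h" and \<alpha> \<beta> :: "'h => 'h"
 assumes a_lin: "a : Lin R Hs Hs" and b_lin: "b : Lin R H H"
  and \<alpha>: "hlin \<alpha>" and \<beta>: "hlin \<beta>"
  and a_res: "!!F. lin F ==> a (res F) = res (%x. F (\<alpha> x))" and b_cl: "!!x. b (cl x) = cl (\<beta> x)"
begin

lemma anti_term_linear: assumes "f1:.Hs" "f2:.Hs" "f3:.Hs" "h1:.H" "h2:.H" "h3:.H"
 shows "(%f1. anti_term a b f1 f2 f3 h1 h2 h3) : Lin R Hs Q" (is ?A) "(%f2. anti_term a b f1 f2 f3 h1 h2 h3) : Lin R Hs Q" (is ?B)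
  "(%f3. anti_term a b f1 f2 f3 h1 h2 h3) : Lin R Hs Q" "(%h1. anti_term a b f1 f2 f3 h1 h2 h3) : Lin R H Q"
  "(%h2. anti_term a b f1 f2 f3 h1 h2 h3) : Lin R H Q" (is ?C) "(%h3. anti_term a b f1 f2 f3 h1 h2 h3) : Lin R H Q"
proof -
 note c = bilD[OF cQ_bilinear] and aD = lmD(1)[OF a_lin assms(2)] and bD = lmD(1)[OF b_lin assms(5)]
 note SD = lmD(1)[OF antipode_linear assms(6)]
 have q: "cQ (a f2) (b h2):.Q" by (rule c(3)[OF aD bD])
 note r1 = dual_D(3)[OF assms(1,4)] and r3 = dual_D(3)[OF assms(3) SD]
 have p: "(%f1. f1 h1 \<otimes> f3 (antipode H h3)) : Lin R Hs K"
  "(%f3. f1 h1 \<otimes> f3 (antipode H h3)) : Lin R Hs K" "(%h1. f1 h1 \<otimes> f3 (antipode H h3)) : Lin R H K"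
  "(%h3. f1 h1 \<otimes> f3 (antipode H h3)) : Lin R H K"
  using lm_const_smult[OF dual_module mod_K eval_linear[OF assms(4)], of "f3 (antipode H h3)"]
   lm_smult[OF dual_module mod_K eval_linear[OF SD] r1]
   lm_const_smult[OF mod_H mod_K dual_D(1)[OF assms(1)], of "f3 (antipode H h3)"]
   lm_smult[OF mod_H mod_K lm_comp[OF antipode_linear dual_D(1)[OF assms(3)]] r1] r3 by simp_all
 show ?A "(%f3. anti_term a b f1 f2 f3 h1 h2 h3) : Lin R Hs Q"
  "(%h1. anti_term a b f1 f2 f3 h1 h2 h3) : Lin R H Q" "(%h3. anti_term a b f1 f2 f3 h1 h2 h3) : Lin R H Q"
  unfolding anti_term_def
  by (rule lm_const_smult[OF dual_module mod_Q p(1) q] lm_const_smult[OF dual_module mod_Q p(2) q]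
   lm_const_smult[OF mod_H mod_Q p(3) q] lm_const_smult[OF mod_H mod_Q p(4) q])+
 have m: "f1 h1 \<otimes> f3 (antipode H h3):.R" using r1 r3 by simp
 show ?B unfolding anti_term_def
  by (rule lm_smult[OF dual_module mod_Q lm_comp[OF a_lin c(2)[OF bD]] m])
 show ?C unfolding anti_term_def
  by (rule lm_smult[OF mod_H mod_Q lm_comp[OF b_lin c(1)[OF aD]] m])
qed

lemma anti_term_trilinear: assumes "f1:.Hs" "f2:.Hs" "f3:.Hs" shows "trilinear Q (anti_term a b f1 f2 f3)"
 by (rule trilinearI; (rule anti_term_linear(4)[OF assms one_closed] | rule anti_term_linear(5)[OF assms _ one_closed] |
  rule anti_term_linear(6)[OF assms _ _ one_closed]); assumption)

lemma anti_inner_linear: assumes "f1:.Hs" "f2:.Hs" "f3:.Hs" "h:.H"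
 shows "(%f1. sweedler3 R H Q h (anti_term a b f1 f2 f3)) : Lin R Hs Q" (is ?A)
  "(%f2. sweedler3 R H Q h (anti_term a b f1 f2 f3)) : Lin R Hs Q" (is ?B)
  "(%f3. sweedler3 R H Q h (anti_term a b f1 f2 f3)) : Lin R Hs Q" (is ?C)
  "(%h. sweedler3 R H Q h (anti_term a b f1 f2 f3)) : Lin R H Q" (is ?D)
proof -
 note T = trilinearD(2,3)[OF anti_term_trilinear] and P = anti_term_linear
 note sl = CH.sweedler3_fun_linear[OF mod_Q dual_module _ _ _ assms(4)]
 show ?A
  by (rule sl; rule T P(1); (assumption | rule assms))
 show ?B
  by (rule sl; rule T P(2); (assumption | rule assms))
 show ?C
  by (rule sl; rule T P(3); (assumption | rule assms))
 show ?D
  by (rule CH.sweedler3_linear[OF mod_Q T(1)[OF assms(1-3)] T(2)[OF assms(1-3)]])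
qed

lemma anti_inner_bilinear: assumes "f3:.Hs" "h:.H"
 shows "bilinear R Hs Hs Q (%f1 f2. sweedler3 R H Q h (anti_term a b f1 f2 f3))"
 by (rule bilI; (rule anti_inner_linear(1)[OF assms(1) _ assms] | rule anti_inner_linear(2)[OF _ assms(1) assms]); assumption)

lemma anti_sum_bilinear: "bilinear R Hs H Q (anti_sum a b)"
proof (rule bilI)
 show "(%h. anti_sum a b f h) : Lin R H Q" if "f:.Hs" for f unfolding anti_sum_def
  by (rule CD.sweedler3_fun_linear[OF mod_Q mod_H _ _ _ that];
   (rule anti_inner_bilinear | rule anti_inner_linear(3)[OF _ _ that] | rule anti_inner_linear(4)[OF _ _ _ one_closed]); assumption)
 show "(%f. anti_sum a b f h) : Lin R Hs Q" if "h:.H" for h unfolding anti_sum_def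
 proof (rule CD.sweedler3_linear[OF mod_Q anti_inner_bilinear[OF _ that]])
  fix f1 f2 assume f: "f1:.Hs" "f2:.Hs"
  show "(%f3. sweedler3 R H Q h (anti_term a b f1 f2 f3)) : Lin R Hs Q"
   by (rule anti_inner_linear(3)[OF f f(1) that])
 qed
qed

lemma anti_sum_value: assumes ph: "qrep ph tw" and F: "lin F"
 shows "ph (anti_sum a b (res F) (cl h)) = h$$.h1 h2 h3. F (h1**(\<alpha> (tw (\<beta> h2))**St h3))" (is "?L = ?R")
proof -
 note C = comultiplication_H and f = qrepD(1)[OF ph] and tw = twistedD(6)[OF qrepD(2)[OF ph]]
 let ?G = "%f1 f2 f3. ph (sweedler3 R H Q (cl h) (anti_term a b f1 f2 f3))"
 have Gb: "bilinear R Hs Hs K (%f1 f2. ?G f1 f2 f3)" if "f3:.Hs" for f3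
  by (rule DD.bilinear_comp[OF anti_inner_bilinear[OF that cl_closed] f])
 have Gl: "(%f3. ?G f1 f2 f3) : Lin R Hs K" if "f1:.Hs" "f2:.Hs" for f1 f2
  by (rule lm_comp[OF anti_inner_linear(3)[OF that that(1) cl_closed] f])
 have v: "?G (res P1) (res P2) (res P3) = h$$.h1 h2 h3. P1 h1*:(P2 (\<alpha> (tw (\<beta> h2)))*:P3 (St h3))"
  if P: "lin P1" "lin P2" "lin P3" for P1 P2 P3
 proof -
  note p = res_cl[OF P(1)] res_cl[OF P(2)] res_cl[OF P(3)]
  note T = trilinearD(2,3)[OF anti_term_trilinear[OF p]]
  have L: "lin3 (%h1 h2 h3. P1 h1*:(P2 (\<alpha> (tw (\<beta> h2)))*:P3 (St h3)))"
   by (intro lins P(1) lin_comp[OF P(2)] lin_comp[OF P(3)] hlin_comp[OF \<alpha>] tw \<beta>)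
  have l2: "lin (%x. P2 (\<alpha> x))" by (rule lin_comp[OF P(2) \<alpha>])
  have t: "ph (anti_term a b (res P1) (res P2) (res P3) x y z) = P1 x*:(P2 (\<alpha> (tw (\<beta> y)))*:P3 (St z))"
   if "x:.H" "y:.H" "z:.H" for x y z
  proof -
   have 1: "ph (cQ (a (res P2)) (b y)) = P2 (\<alpha> (tw (\<beta> y)))"
    using qrepD(3)[OF ph l2, of "\<beta> y"] b_cl[of y] that(2) twistedD(3)[OF qrepD(2)[OF ph]]
    by (simp add: a_res[OF P(2)] cl_id)
   have 2: "antipode H z = St z" using that(3) by (simp add: St_def cl_id)
   show ?thesis unfolding anti_term_def
    using lmD(3)[OF f, of "P1 x \<otimes> P3 (St z)" "cQ (a (res P2)) (b y)"] that
     bilD(3)[OF cQ_bilinear lmD(1)[OF a_lin p(2)] lmD(1)[OF b_lin that(2)]]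
    by (simp add: 1 2 res_apply linD(1) P smul_def linD(3) sc_id R.m_ac)
  qed
  have "?G (res P1) (res P2) (res P3) = sweedler3 R H K (cl h) (%x y z. ph (anti_term a b (res P1) (res P2) (res P3) x y z))"
   by (rule comultiplication.sweedler3_comp[OF C mod_Q mod_K T f cl_closed])
  also have "... = sweedler3 R H K (cl h) (%h1 h2 h3. P1 h1*:(P2 (\<alpha> (tw (\<beta> h2)))*:P3 (St h3)))"
   by (rule comultiplication.sweedler3_cong[OF C mod_K trilinearD(2,3)[OF lin3_trilinear[OF L]] cl_closed, symmetric]) (simp_all add: t)
  finally show ?thesis by (simp add: sweedler3_sw'[OF L cl_closed])
 qed
 have "?L = sweedler3 R Hs K (res F) ?G" unfolding anti_sum_def
  by (rule CD.sweedler3_comp[OF mod_Q mod_K anti_inner_bilinear[OF _ cl_closed] _ f res_cl[OF F]])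
   (assumption, rule anti_inner_linear(3)[OF _ _ res_cl[OF F] cl_closed])
 also have "... = swd F (%P P3. swd P (%P1 P2. ?G (res P1) (res P2) (res P3)))" by (rule sweedler3_dual[OF Gb Gl F])
 also have "... = swd F (%P P3. swd P (%P1 P2. h$$.h1 h2 h3. P1 h1*:(P2 (\<alpha> (tw (\<beta> h2)))*:P3 (St h3))))"
  by (rule swd_cong, rule swd_cong) (rule v)
 also have "... = swd F (%P P3. h$$.h1 h2 h3. P (h1**\<alpha> (tw (\<beta> h2)))*:P3 (St h3))"
  by (rule swd_cong) (simp only: swd_sw swd_eval'(1))
 also have "... = ?R"
  by (simp only: swd_sw swd_eval[OF F] hassoc)
 finally show ?thesis .
qed

text \<open>In the triple coproduct a factor from H_t remains on the first leg, which stands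
  leftmost in the value; one from H_s remains on the last leg, which stands rightmost under
  S.\<close>

lemma anti_sum_ideal: assumes "x \<in> DI" shows "tensor_lift R Q x (anti_sum a b) = \<zero>\<^sub>Q"
proof (rule ideal_zero[OF mod_Q tensor_lift_linear_Q[OF mod_Q anti_sum_bilinear] assms])
 fix F w h assume F: "lin F"
 note tl = tensor_lift_tt[OF mod_Q anti_sum_bilinear] and cb = bilD(3)[OF anti_sum_bilinear]
 have l: "lin (%l. F (et w**l))" "lin (%l. F (l**St (es w)))" by (intro lin_comp[OF F] lins)+
 show "tensor_lift R Q (tt F (et w**h)) (anti_sum a b) = tensor_lift R Q (tt (%l. F (et w**l)) h) (anti_sum a b)"
  unfolding tl[OF F] tl[OF l(1)]
 proof (rule Q_sep)
  fix ph tw assume r: "qrep ph tw"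
  note L = lins lin_comp[OF F] hlin_comp[OF \<alpha>] twistedD(6)[OF qrepD(2)[OF r]] hlin_comp[OF \<beta>]
  have "(et w**h)$$.h1 h2 h3. F (h1**(\<alpha> (tw (\<beta> h2))**St h3)) =
   h$$.h1 h2 h3. F ((et w**h1)**(\<alpha> (tw (\<beta> h2))**St h3))" by (rule sw_et_mul(1)) (intro L)+
  then show "ph (anti_sum a b (res F) (cl (et w**h))) = ph (anti_sum a b (res (%l. F (et w**l))) (cl h))"
   by (simp only: anti_sum_value[OF r] F l hassoc)
 qed (intro cb res_cl F l cl_closed)+
 show "tensor_lift R Q (tt F (es w**h)) (anti_sum a b) = tensor_lift R Q (tt (%l. F (l**St (es w))) h) (anti_sum a b)"
  unfolding tl[OF F] tl[OF l(2)]
 proof (rule Q_sep)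
  fix ph tw assume r: "qrep ph tw"
  note L = lins lin_comp[OF F] hlin_comp[OF \<alpha>] twistedD(6)[OF qrepD(2)[OF r]] hlin_comp[OF \<beta>]
  have "(es w**h)$$.h1 h2 h3. F (h1**(\<alpha> (tw (\<beta> h2))**St h3)) =
   h$.h1 w'. (es w**w')$.h2 h3. F (h1**(\<alpha> (tw (\<beta> h2))**St h3))" by (rule sw_es_mul(1)) (intro L)+
  also have "... = h$$.h1 h2 h3. F (h1**(\<alpha> (tw (\<beta> h2))**St (es w**h3)))"
   by (rule sw_cong, rule sw_es_mul(1)) (intro L)+
  finally show "ph (anti_sum a b (res F) (cl (es w**h))) = ph (anti_sum a b (res (%l. F (l**St (es w)))) (cl h))"
   by (simp only: anti_sum_value[OF r] F l hassoc St_mul)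
 qed (intro cb res_cl F l cl_closed)+
qed

lemma anti_Q: "on_class (%t. tensor_lift R Q t (anti_sum a b)) : Lin R Q Q" (is ?A)
 "lin F ==> on_class (%t. tensor_lift R Q t (anti_sum a b)) (cQ (res F) (cl h)) = anti_sum a b (res F) (cl h)"
proof -
 note tl = tensor_lift_linear_Q[OF mod_Q anti_sum_bilinear]
 show ?A
  by (rule QA.on_class_linear[OF mod_Q tl anti_sum_ideal])
 show "on_class (%t. tensor_lift R Q t (anti_sum a b)) (cQ (res F) (cl h)) = anti_sum a b (res F) (cl h)" if "lin F"
  using QA.on_class_cls[OF mod_Q tl _ tt_closed[OF that], of h] anti_sum_ideal
  by (simp add: cQ_tt tensor_lift_tt[OF mod_Q anti_sum_bilinear that])
qed

lemma anti_Q_value: assumes "qrep ph tw" "lin F"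
 shows "ph (on_class (%t. tensor_lift R Q t (anti_sum a b)) (cQ (res F) (cl h))) =
  h$$.h1 h2 h3. F (h1**(\<alpha> (tw (\<beta> h2))**St h3))"
 by (simp only: anti_Q(2)[OF assms(2)] anti_sum_value[OF assms])

end

abbreviation "Dd \<equiv> drinfeld_double' R H"

lemma Dd_sel:
 "carrier Dd = carrier Q" "mult Dd = mult Q" "one Dd = one Q" "zero Dd = zero Q" "add Dd = add Q" "smult Dd = smult Q"
 "comult Dd = on_class (%t. tensor_lift R Q2 t comult_sum)"
 "counit Dd = on_class (%t. tensor_lift R K t (%f h. f (target_counit R H h)))"
 "antipode Dd = on_class (%t. tensor_lift R Q t (anti_sum (antipode_inv Hs) (antipode H)))"
 unfolding comult_sum_def[abs_def] anti_sum_def[abs_def] anti_term_def[abs_def]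
 by (simp_all add: drinfeld_double'_def Let_def module.defs)

lemma Q_ext: assumes "module R P" "f : Lin R Q P" "g : Lin R Q P"
  "!!F h. lin F ==> f (cQ (res F) (cl h)) = g (cQ (res F) (cl h))" "X:.Q" shows "f X = g X"
proof -
 obtain x where x: "x:.A" "X = QA.cls x" using QA.quotient_cases assms(5) by meson
 note c = lm_comp[OF QA.cls_linear]
 show ?thesis unfolding x(2)
  by (rule A_ext[where f="%x. f (QA.cls x)" and g="%x. g (QA.cls x)", OF assms(1) c[OF assms(2)] c[OF assms(3)] _ x(1)])
   (rule assms(4)[unfolded cQ_tt])
qed

lemma dual_antipode_linear: "antipode Hs : Lin R Hs Hs" "antipode_inv Hs : Lin R Hs Hs"
proof -
 show "antipode Hs : Lin R Hs Hs"
 proof (rule dual_linearI[OF dual_antipode_closed _ dual_module])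
  fix h assume h: "h:.H"
  then show "(%f. antipode Hs f h) : Lin R Hs K"
   using eval_linear[OF lmD(1)[OF antipode_linear h]] by (simp add: dual_sel)
 qed
 show "antipode_inv Hs : Lin R Hs Hs"
 proof (rule dual_linearI[OF dual_antipode_inv_closed _ dual_module])
  fix h assume h: "h:.H"
  have "(%f. f (Si h)) : Lin R Hs K" by (rule eval_linear) simp
  then show "(%f. antipode_inv Hs f h) : Lin R Hs K"
   by (rule iffD2[OF lm_cong[OF dual_module], rotated]) (simp add: dual_antipode_inv res_apply h tot_def)
 qed
qed

lemma dual_antipode_res: assumes "lin F"
 shows "antipode Hs (res F) = res (%x. F (St x))" "antipode_inv Hs (res F) = res (%x. F (Si x))"
 by (simp_all add: dual_antipode dual_antipode_inv res_cl tot_res assms)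

lemma antipode_cl: "antipode H (cl x) = cl (St x)" "antipode_inv H (cl x) = cl (Si x)"
 by (simp_all add: cl_id) (simp_all add: St_def Si_def)

lemma hlin_antipode: "hlin St" "hlin Si" using hlin_St[OF hlin_id] hlin_Si[OF hlin_id] by simp_all

definition "antipode_Q = on_class (%t. tensor_lift R Q t (anti_sum (antipode_inv Hs) (antipode H)))"
text \<open>The inverse of the antipode of D'(H), with S and S^-1 exchanged in the middle; it
  becomes the antipode of the opposite algebra.\<close>

definition "antipode_op = on_class (%t. tensor_lift R Q t (anti_sum (antipode Hs) (antipode_inv H)))"

lemmas antipode_Q_args = dual_antipode_linear(2) antipode_linear hlin_antipode(2,1) dual_antipode_res(2) antipode_cl(1)
lemmas antipode_op_args = dual_antipode_linear(1) linear_map_St_inv hlin_antipode dual_antipode_res(1) antipode_cl(2)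

lemma antipode_Q_linear: "antipode_Q : Lin R Q Q" "antipode_op : Lin R Q Q"
 unfolding antipode_Q_def antipode_op_def by (rule anti_Q(1)[OF antipode_Q_args] anti_Q(1)[OF antipode_op_args]; assumption)+

lemma antipode_Q_value: assumes "qrep ph tw" "lin F"
 shows "ph (antipode_Q (cQ (res F) (cl h))) = h$$.h1 h2 h3. F (h1**(Si (tw (St h2))**St h3))"
  "ph (antipode_op (cQ (res F) (cl h))) = h$$.h1 h2 h3. F (h1**(St (tw (Si h2))**St h3))"
 unfolding antipode_Q_def antipode_op_def
 by (rule anti_Q_value[OF antipode_Q_args assms] anti_Q_value[OF antipode_op_args assms]; assumption)+

lemma cQ_closed: "lin F ==> cQ (res F) (cl h):.Q" by (rule bilD(3)[OF cQ_bilinear res_cl cl_closed])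

lemma antipode_Q_inverse: assumes X: "X:.Q" shows "antipode_op (antipode_Q X) = X" "antipode_Q (antipode_op X) = X"
proof -
 have main: "g (f X) = X" if f: "f : Lin R Q Q" and g: "g : Lin R Q Q"
  and s: "!!ph tw F h. qrep ph tw ==> lin F ==> ph (g (f (cQ (res F) (cl h)))) = F (tw h)" for f g
 proof (rule Q_ext[OF mod_Q lm_comp[OF f g] lm_id _ X])
  fix F h assume F: "lin F"
  show "g (f (cQ (res F) (cl h))) = cQ (res F) (cl h)"
   by (rule Q_sep[OF lmD(1)[OF g lmD(1)[OF f cQ_closed[OF F]]] cQ_closed[OF F]]) (simp add: s F qrepD(3)[OF _ F])
 qed
 note S = antipode_Q_linear
 show "antipode_op (antipode_Q X) = X"
 proof (rule main[OF S])
  fix ph tw F h assume ph: "qrep ph tw" and F: "lin F"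
  obtain sg where sg: "qrep (%x. ph (antipode_op x)) sg" using qrep_ex[OF lm_comp[OF S(2) qrepD(1)[OF ph]]] by blast
  have sgv: "F' (sg x) = x$$.k1 k2 k3. F' (k1**(St (tw (Si k2))**St k3))" if "lin F'" for F' x
   using qrepD(3)[OF sg that, of x] antipode_Q_value(2)[OF ph that, of x] by simp
  show "ph (antipode_op (antipode_Q (cQ (res F) (cl h)))) = F (tw h)"
   unfolding antipode_inverse_double1[OF qrepD(2)[OF ph] F, symmetric]
   by (rule trans, rule antipode_Q_value(1)[OF sg F], (rule sw_cong2, rule sgv; (intro lins lin_comp[OF F])+))
 qed
 show "antipode_Q (antipode_op X) = X"
 proof (rule main[OF S(2,1)])
  fix ph tw F h assume ph: "qrep ph tw" and F: "lin F"
  obtain sg where sg: "qrep (%x. ph (antipode_Q x)) sg" using qrep_ex[OF lm_comp[OF S(1) qrepD(1)[OF ph]]] by blast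
  have sgv: "F' (sg x) = x$$.k1 k2 k3. F' (k1**(Si (tw (St k2))**St k3))" if "lin F'" for F' x
   using qrepD(3)[OF sg that, of x] antipode_Q_value(1)[OF ph that, of x] by simp
  show "ph (antipode_Q (antipode_op (cQ (res F) (cl h)))) = F (tw h)"
   unfolding antipode_inverse_double2[OF qrepD(2)[OF ph] F, symmetric]
   by (rule trans, rule antipode_Q_value(2)[OF sg F], (rule sw_cong2, rule sgv; (intro lins lin_comp[OF F])+))
 qed
qed

text \<open>The antipode of \<open>hopf_op\<close> is given as a set-theoretic inverse; identifying
  it with an explicit formula makes its values computable.\<close>

lemma antipode_inv_Dd: assumes X: "X:.Q" shows "antipode_inv Dd X = antipode_op X"
proof (rule inv_into_f_eq)
 note D = lmD(1)[OF antipode_Q_linear(1)] lmD(1)[OF antipode_Q_linear(2)]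
 have e: "antipode Dd = antipode_Q" by (simp add: Dd_sel antipode_Q_def)
 show "inj_on (antipode Dd) (carrier Dd)" unfolding e Dd_sel by (rule inj_onI) (metis antipode_Q_inverse(1))
 show "antipode_op X:.Dd" using D(2)[OF X] by (simp add: Dd_sel)
 show "antipode Dd (antipode_op X) = X" unfolding e by (rule antipode_Q_inverse(2)[OF X])
qed

abbreviation "Vop \<equiv> hopf_op Dd"

lemma Vop_sel:
 "carrier Vop = carrier Q" "x \<otimes>\<^bsub>Vop\<^esub> y = y \<otimes>\<^sub>Q x" "one Vop = one Q" "zero Vop = zero Q" "add Vop = add Q"
 "smult Vop = smult Q" "comult Vop = comult Dd" "counit Vop = counit Dd" "antipode Vop = antipode_inv Dd"
 by (simp_all add: hopf_op_def Dd_sel(1-6))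

lemma linear_map_Vop: "Lin R Vop P = Lin R Q P" "Lin R P Vop = Lin R P Q" by (simp_all add: linear_map_def Vop_sel)

lemma tensor_Vop: "tensor_module R Vop Vop = tensor_module R Q Q" "tens R Vop Vop = tens R Q Q"
 by (rule tensor_module_cong; simp add: Vop_sel)+

lemma qrep_rep: assumes "qrep ph tw" shows "rep (%x. ph (QA.cls x)) tw"
 using lm_comp[OF QA.cls_linear qrepD(1)[OF assms]] twistedD(1,2)[OF qrepD(2)[OF assms]] qrepD(3)[OF assms]
 by (simp add: rep_def cQ_tt)

text \<open>Passing to the opposite product accounts for the reversed factors in
  \<open>product_V\<close>, since \<open>mult_A_value\<close> has them in the order of
  \<open>prd\<close>.\<close>

lemma double_presentation_op: "double_presentation R H I e d Vop cQ (I \<times> I) base_Q form_Q"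
proof (intro double_presentation.intro double_presentation_axioms.intro weak_hopf_basis_axioms)
 show "module R Vop" by (rule module_cong[OF mod_Q]) (simp_all add: Vop_sel)
 show "bilinear R Vop Vop Vop (mult Vop)" using mult_Q_bilinear by (simp add: bilinear_def linear_map_Vop Vop_sel)
 show "bilinear R Hs H Vop cQ" using cQ_bilinear by (simp add: bilinear_def linear_map_Vop)
 show "dual_basis R Vop (I \<times> I) base_Q form_Q"
  using basis_Q by (simp add: dual_basis_def linear_map_Vop Vop_sel finsum_cong_record[of Vop Q])
 show "\<exists>f\<in>carrier Hs. \<exists>h\<in>carrier H. base_Q j = cQ f h" if "j \<in> I \<times> I" for j
  unfolding base_Q_def base_A_def cQ_def by (intro bexI[of _ "res (dt (fst j))"] bexI[of _ "e (snd j)"] refl)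
   (use res_dt_closed dual_basisD(2)[OF basis] that in auto)
 show "\<exists>tw. twisted tw \<and> (\<forall>F h. lin F --> ph (cQ (res F) (cl h)) = F (tw h))" if "ph : Lin R Vop K" for ph
  using qrep_ex that unfolding linear_map_Vop qrep_def by blast
 show "one Vop = cQ (one Hs) (one H)" by (simp add: Vop_sel QA.quotient_sel cQ_def A_sel)
 show "ph (cQ (res G) (cl k) \<otimes>\<^bsub>Vop\<^esub> cQ (res F) (cl h)) = prd tw F h G k"
  if ph: "ph : Lin R Vop K" "twisted tw" "!!F h. lin F ==> ph (cQ (res F) (cl h)) = F (tw h)" and F: "lin F" and G: "lin G"
  for ph tw F G k h
 proof -
  have q: "qrep ph tw" using ph by (simp add: qrep_def linear_map_Vop)
  show ?thesis using mult_A_value[OF qrep_rep[OF q] F G] by (simp add: Vop_sel cQ_tt cls_mult tt_closed F G)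
 qed
 show "comult Vop : Lin R Vop (tensor R Vop Vop)"
  using comult_Q(1) by (simp add: linear_map_Vop Vop_sel Dd_sel tensor_Vop)
 show "tensor_lift R K (comult Vop (cQ (res F) (cl h))) B = swd F (%P Q. h$.s t. B (cQ (res P) (cl s)) (cQ (res Q) (cl t)))"
  if B: "bilinear R Vop Vop K B" and F: "lin F" for B F h
 proof -
  have "bilinear R Q Q K B" using B by (simp add: bilinear_def linear_map_Vop Vop_sel)
  from comult_sum_value[OF this F] show ?thesis by (simp add: Vop_sel Dd_sel comult_Q(2)[OF F])
 qed
 show "counit Vop : Lin R Vop K" using counit_Q(1) by (simp add: linear_map_Vop Vop_sel Dd_sel)
 show "counit Vop (cQ (res F) (cl h)) = F (et h)" if "lin F" for F h
  using counit_Q(2)[OF that] by (simp add: Vop_sel Dd_sel)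
 show "antipode Vop : Lin R Vop Vop" unfolding linear_map_Vop Vop_sel
  by (rule iffD2[OF lm_cong[OF mod_Q] antipode_Q_linear(2)]) (rule antipode_inv_Dd)
 show "ph (antipode Vop (cQ (res F) (cl h))) = h$$.h1 h2 h3. F (h1**(St (tw (Si h2))**St h3))"
  if ph: "ph : Lin R Vop K" "twisted tw" "!!F h. lin F ==> ph (cQ (res F) (cl h)) = F (tw h)" and F: "lin F" for ph tw F h
 proof -
  have q: "qrep ph tw" using ph by (simp add: qrep_def linear_map_Vop)
  show ?thesis by (simp add: Vop_sel antipode_inv_Dd cQ_closed F antipode_Q_value(2)[OF q F])
 qed
qed

end

section \<open>Transport of structure\<close>

section \<open>Transport along an isomorphism of algebras\<close>

text \<open>The coalgebra and antipode of V pulled back along \<open>Ph\<close> with inverse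
  \<open>Ps\<close>; the lift in the coproduct plays the part of Ps \<otimes> Ps.\<close>

definition hopf_transport ::
 "('a, 'r) ring_scheme => ('a, 'v, 'w) hopf_scheme => ('a, 'u) module => ('u => 'v) => ('v => 'u) => ('a, 'u) hopf"
 where "hopf_transport R V U Ph Ps = module.extend U
  \<lparr>comult = (%x. tensor_lift R (tensor R U U) (comult V (Ph x)) (%v w. tens R U U (Ps v) (Ps w))),
  counit = (%x. counit V (Ph x)), antipode = (%x. Ps (antipode V (Ph x)))\<rparr>"

lemma hopf_transport_sel:
 "carrier (hopf_transport R V U Ph Ps) = carrier U" "mult (hopf_transport R V U Ph Ps) = mult U"
 "one (hopf_transport R V U Ph Ps) = one U" "zero (hopf_transport R V U Ph Ps) = zero U"
 "add (hopf_transport R V U Ph Ps) = add U" "smult (hopf_transport R V U Ph Ps) = smult U"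
 "comult (hopf_transport R V U Ph Ps) = (%x. tensor_lift R (tensor R U U) (comult V (Ph x)) (%v w. tens R U U (Ps v) (Ps w)))"
 "counit (hopf_transport R V U Ph Ps) = (%x. counit V (Ph x))"
 "antipode (hopf_transport R V U Ph Ps) = (%x. Ps (antipode V (Ph x)))"
 "module.truncate (hopf_transport R V U Ph Ps) = U" by (simp_all add: hopf_transport_def module.defs)

locale hopf_transport_along = double_presentation R H I e d V c J b \<beta>
 for R :: "('a, 'r) ring_scheme" and H :: "('a, 'h, 'x) hopf_scheme"
  and I :: "'i set" and e :: "'i => 'h" and d :: "'i => 'h => 'a"
  and V :: "('a, 'v, 'w) hopf_scheme" (structure) and c :: "('h => 'a) => 'h => 'v"
  and J :: "'j set" and b :: "'j => 'v" and \<beta> :: "'j => 'v => 'a" +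
 fixes U :: "('a, 'u) module" and Ph :: "'u => 'v" and Ps :: "'v => 'u"
 assumes mod_U: "module R U" and Ph: "Ph : Lin R U V" and Ps: "Ps : Lin R V U"
  and PhPs: "v:.V ==> Ph (Ps v) = v" and PsPh: "x:.U ==> Ps (Ph x) = x"
  and Ph_one: "Ph \<one>\<^sub>U = \<one>" and one_U: "\<one>\<^sub>U:.U"
  and Ph_mult: "[|x:.U; y:.U|] ==> Ph (x \<otimes>\<^sub>U y) = Ph x \<otimes> Ph y"
  and U_mult: "[|x:.U; y:.U|] ==> x \<otimes>\<^sub>U y:.U"
begin

abbreviation "D \<equiv> hopf_transport R V U Ph Ps"

lemmas D_sel = hopf_transport_sel[of R V U Ph Ps]

lemma linear_map_D: "Lin R D P = Lin R U P" "Lin R P D = Lin R P U" by (simp_all add: linear_map_def D_sel)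

lemma tensor_D: "tensor_module R D D = tensor_module R U U" "tens R D D = tens R U U"
 by (rule tensor_module_cong; simp add: D_sel)+

sublocale UU: two_modules R U U by (rule two_modules.intro) (rule mod_U)+

lemma Ps_mult: assumes "v:.V" "w:.V" shows "Ps (v \<otimes> w) = Ps v \<otimes>\<^sub>U Ps w"
proof -
 note D = lmD(1)[OF Ps]
 have "Ps (v \<otimes> w) = Ps (Ph (Ps v \<otimes>\<^sub>U Ps w))" using assms D by (simp add: Ph_mult PhPs)
 then show ?thesis using PsPh U_mult assms D by simp
qed

lemma PsPs_bilinear: "bilinear R V V UU.T (%v w. tens R U U (Ps v) (Ps w))"
proof (rule bilI)
 note D = lmD(1)[OF Ps] and T = bilD[OF UU.tens_bilinear]
 show "(%w. tens R U U (Ps v) (Ps w)) : Lin R V UU.T" if "v:.V" for v by (rule lm_comp[OF Ps T(1)[OF D[OF that]]])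
 show "(%v. tens R U U (Ps v) (Ps w)) : Lin R V UU.T" if "w:.V" for w by (rule lm_comp[OF Ps T(2)[OF D[OF that]]])
qed

lemma comult_D_lift: assumes P: "module R P" and B: "bilinear R U U P B" and x: "x:.U"
 shows "tensor_lift R P (comult D x) B = tensor_lift R P (comult V (Ph x)) (%v w. B (Ps v) (Ps w))" (is "_ = ?R")
proof -
 note D = lmD(1)[OF Ps]
 have l: "(%t. tensor_lift R P t B) : Lin R UU.T P" by (rule UU.tensor_lift_linear[OF P B])
 have cv: "comult V (Ph x):.VV.T" by (rule comult_closed_V[OF lmD(1)[OF Ph x]])
 have "tensor_lift R P (comult D x) B =
  tensor_lift R P (comult V (Ph x)) (%v w. tensor_lift R P (tens R U U (Ps v) (Ps w)) B)"
  unfolding D_sel UU.tensor_lift_codomain by (rule VV.tensor_lift_comp[OF UU.tensor_mod P PsPs_bilinear l cv])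
 also have "... = ?R"
  by (rule VV.tensor_lift_cong[OF P VV.bilinear_comp[OF PsPs_bilinear l] _ cv])
   (simp add: UU.tensor_lift_tens[OF P B] D)
 finally show ?thesis .
qed

lemma comult_D_linear: "comult D : Lin R D (tensor R D D)"
 using lm_comp[OF lm_comp[OF Ph comult_V[simplified]] VV.tensor_lift_linear[OF UU.tensor_mod PsPs_bilinear]]
 by (simp add: linear_map_D tensor_D D_sel UU.tensor_lift_codomain)

text \<open>The data of the presentation are transported instead of the axioms. The general theorem
  then gives the weak Hopf structure on the new algebra, and the formulas for classes become
  available there too.\<close>

lemma double_presentation_D: "double_presentation R H I e d D (%f h. Ps (c f h)) J (%j. Ps (b j)) (%j x. \<beta> j (Ph x))"
proof (intro double_presentation.intro double_presentation_axioms.intro weak_hopf_basis_axioms)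
 note PsD = lmD(1)[OF Ps] and PhD = lmD(1)[OF Ph]
 note cD = cc_closed[unfolded cc_def]
 have U: "x = Ps (Ph x)" "Ph x:.V" if "x:.U" for x using PsPh[OF that] PhD[OF that] by simp_all
 show "module R D" by (rule module_cong[OF mod_U]) (simp_all add: D_sel)
 show "bilinear R D D D (mult D)"
 proof (rule bilI; unfold linear_map_D)
  fix x assume "x:.D"
  then have x: "x:.U" by (simp add: D_sel)
  have l: "(%y. Ps (Ph x \<otimes> Ph y)) : Lin R U U" "(%y. Ps (Ph y \<otimes> Ph x)) : Lin R U U"
   by (rule lm_comp[OF lm_comp[OF Ph mult_right_linear[OF PhD[OF x]]] Ps]
    lm_comp[OF lm_comp[OF Ph mult_left_linear[OF PhD[OF x]]] Ps])+
  show "(%y. x \<otimes>\<^sub>D y) : Lin R U U"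
   by (rule iffD1[OF lm_cong[OF mod_U] l(1)]) (simp add: D_sel Ps_mult PhD PsPh x)
  show "(%y. y \<otimes>\<^sub>D x) : Lin R U U"
   by (rule iffD1[OF lm_cong[OF mod_U] l(2)]) (simp add: D_sel Ps_mult PhD PsPh x)
 qed
 show "bilinear R Hs H D (%f h. Ps (c f h))"
  using two_modules.bilinear_comp[OF SH.two_modules_axioms c_bilinear Ps] by (simp add: bilinear_def linear_map_D)
 show "dual_basis R D J (%j. Ps (b j)) (%j x. \<beta> j (Ph x))" unfolding dual_basis_def linear_map_D D_sel(1)
 proof (intro conjI ballI)
  note B = dual_basisD[OF basis_V]
  show "finite J" by (rule B(1))
  show "(%j. Ps (b j)) \<in> J \<rightarrow> carrier U" using PsD B(2) by blast
  show "(%x. \<beta> j (Ph x)) : Lin R U K" if "j \<in> J" for j by (rule lm_comp[OF Ph B(3)[OF that]])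
  fix x assume x: "x:.U"
  show "(\<Oplus>\<^sub>D j\<in>J. \<beta> j (Ph x) \<odot>\<^sub>D Ps (b j)) = x"
   using dual_basis_expand[OF mod_V mod_U basis_V Ps PhD[OF x]] PsPh[OF x]
   by (simp add: D_sel finsum_cong_record[of D U])
 qed
 show "\<exists>f\<in>carrier Hs. \<exists>h\<in>carrier H. Ps (b j) = Ps (c f h)" if "j \<in> J" for j using base_V[OF that] by metis
 have fun_V: "(%v. ph (Ps v)) : Lin R V K" if "ph : Lin R D K" for ph
  using lm_comp[OF Ps] that by (simp add: linear_map_D)
 show "\<exists>tw. twisted tw \<and> (\<forall>F h. lin F --> ph (Ps (c (res F) (cl h))) = F (tw h))" if "ph : Lin R D K" for ph
  using functional_V[OF fun_V[OF that]] .
 show "one D = Ps (c (one Hs) (one H))" using PsPh[OF one_U] by (simp add: D_sel Ph_one one_V)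
 show "ph (Ps (c (res G) (cl k)) \<otimes>\<^sub>D Ps (c (res F) (cl h))) = prd tw F h G k"
  if "ph : Lin R D K" "twisted tw" "!!F h. lin F ==> ph (Ps (c (res F) (cl h))) = F (tw h)" "lin F" "lin G" for ph tw F G k h
  using product_V[OF fun_V[OF that(1)] that(2-5)] by (simp add: D_sel Ps_mult cD that(4,5))
 show "comult D : Lin R D (tensor R D D)" by (rule comult_D_linear)
 show "tensor_lift R K (comult D (Ps (c (res F) (cl h)))) B =
   swd F (%P Q. h$.s t. B (Ps (c (res P) (cl s))) (Ps (c (res Q) (cl t))))"
  if B: "bilinear R D D K B" and F: "lin F" for B F h
 proof -
  have BU: "bilinear R U U K B" using B by (simp add: bilinear_def linear_map_D D_sel)
  have "bilinear R V V K (%v w. B (Ps v) (Ps w))"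
   by (rule bilI; (rule lm_comp[OF Ps bilD(1)[OF BU PsD]] | rule lm_comp[OF Ps bilD(2)[OF BU PsD]]); assumption)
  from comult_c[OF this F] show ?thesis using comult_D_lift[OF mod_K BU PsD[OF cD[OF F]]] by (simp add: PhPs cD F)
 qed
 show "counit D : Lin R D K" using lm_comp[OF Ph counit_V] by (simp add: linear_map_D D_sel)
 show "counit D (Ps (c (res F) (cl h))) = F (et h)" if "lin F" for F h
  using counit_c[OF that] by (simp add: D_sel PhPs cD that)
 show "antipode D : Lin R D D" using lm_comp[OF lm_comp[OF Ph antipode_V] Ps] by (simp add: linear_map_D D_sel)
 show "ph (antipode D (Ps (c (res F) (cl h)))) = h$$.h1 h2 h3. F (h1**(St (tw (Si h2))**St h3))"
  if "ph : Lin R D K" "twisted tw" "!!F h. lin F ==> ph (Ps (c (res F) (cl h))) = F (tw h)" "lin F" for ph tw F h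
  using antipode_c[OF fun_V[OF that(1)] that(2-4)] by (simp add: D_sel PhPs cD that(4))
qed

lemma weak_hopf_algebra_D: "weak_hopf_algebra R D"
 by (rule double_presentation.weak_hopf_algebra_V[OF double_presentation_D])

lemma iso_D: "Ph \<in> weak_hopf_iso R D V"
proof -
 note PsD = lmD(1)[OF Ps] and PhD = lmD(1)[OF Ph]
 have "Ph \<in> ring_iso D V"
 proof (rule ring_iso_memI)
  show "bij_betw Ph (carrier D) (carrier V)"
   unfolding D_sel by (rule bij_betw_byWitness[of _ Ps]) (use PsD PhD PhPs PsPh in auto)
 qed (simp_all add: D_sel PhD Ph_mult lmD(2)[OF Ph] Ph_one)
 moreover have "Ph : Lin R D V" using Ph by (simp add: linear_map_D)
 moreover have "comult V (Ph x) = sweedler R D (tensor R V V) x (%x y. tens R V V (Ph x) (Ph y))" if "x:.D" for x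
 proof -
  have x: "x:.U" using that by (simp add: D_sel)
  have cv: "comult V (Ph x):.VV.T" by (rule comult_closed_V[OF PhD[OF x]])
  have B: "bilinear R U U VV.T (%x y. tens R V V (Ph x) (Ph y))"
   by (rule bilI; (rule lm_comp[OF Ph bilD(1)[OF VV.tens_bilinear PhD]] | rule lm_comp[OF Ph bilD(2)[OF VV.tens_bilinear PhD]]); assumption)
  have "sweedler R D (tensor R V V) x (%x y. tens R V V (Ph x) (Ph y)) =
   tensor_lift R VV.T (comult V (Ph x)) (%v w. tens R V V (Ph (Ps v)) (Ph (Ps w)))"
   unfolding sweedler_def VV.tensor_lift_codomain by (rule comult_D_lift[OF VV.tensor_mod B x])
  also have "... = tensor_lift R VV.T (comult V (Ph x)) (tens R V V)"
   by (rule VV.tensor_lift_cong[OF VV.tensor_mod VV.tens_bilinear _ cv, symmetric]) (simp add: PhPs)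
  also have "... = comult V (Ph x)"
   by (rule VV.tensor_eqI[where f="%t. tensor_lift R VV.T t (tens R V V)" and g="%t. t", OF VV.tensor_mod
    VV.tensor_lift_linear[OF VV.tensor_mod VV.tens_bilinear] lm_id _ cv])
    (rule VV.tensor_lift_tens[OF VV.tensor_mod VV.tens_bilinear])
  finally show ?thesis by (rule sym)
 qed
 moreover have "counit V (Ph x) = counit D x" "antipode V (Ph x) = Ph (antipode D x)" if "x:.D" for x
  using that PhD lmD(1)[OF antipode_V] by (simp_all add: D_sel PhPs)
 ultimately show ?thesis using weak_hopf_algebra_D weak_hopf_algebra_V by (simp add: weak_hopf_iso_def)
qed

end

section \<open>Formulas on the classes of H \<bowtie> H^* and the comparison of the two
  doubles\<close>

section \<open>The Drinfeld double\<close>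

context double_presentation begin

text \<open>\<open>dc h f\<close> is to become the class [h \<bowtie> f], while the presentation is
  indexed by c f h = [S(h) \<bowtie> f]. The formulas of the theorem result from this change of
  indexing.\<close>

context
 fixes dc :: "'h => ('h => 'a) => 'v" assumes dc: "[|h:.H; f:.Hs|] ==> dc h f = c f (antipode_inv H h)"
begin

lemma dc_cc: "lin F ==> dc (cl h) (res F) = cc F (Si h)" by (simp add: dc res_cl cc_def antipode_cl)

lemma dc_bilinear: "bilinear R H Hs V dc"
proof -
 note cb = bilD[OF c_bilinear] and Si = lmD(1)[OF linear_map_St_inv]
 have "bilinear R H Hs V (%h f. c f (antipode_inv H h))"
  by (rule bilI; (rule cb(2)[OF Si] | rule lm_comp[OF linear_map_St_inv cb(1)]); assumption)
 moreover have "bilinear R H Hs V (%h f. c f (antipode_inv H h)) <-> bilinear R H Hs V dc"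
  by (rule bilinear_cong[OF mod_H dual_module]) (simp add: dc)
 ultimately show ?thesis by simp
qed

lemma dc_value: assumes "corr ph tw" "h:.H" "lin F" shows "ph (dc h (res F)) = F (tw (Si h))"
 using dc_cc[OF assms(3), of h] corrD(3)[OF assms(1,3)] assms(2) by (simp add: cl_id)

abbreviation "V2 \<equiv> tensor R V V"

lemma dc_comult_term: assumes "x:.H" "y:.H" "f1:.Hs" "f2:.Hs"
 shows "(%f1. tens R V V (dc y f1) (dc x f2)) : Lin R Hs V2" (is ?A) "(%f2. tens R V V (dc y f1) (dc x f2)) : Lin R Hs V2"
  "(%x. tens R V V (dc y f1) (dc x f2)) : Lin R H V2" "(%y. tens R V V (dc y f1) (dc x f2)) : Lin R H V2"
proof -
 note D = bilD[OF dc_bilinear] and T = bilD[OF VV.tens_bilinear]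
 show ?A "(%f2. tens R V V (dc y f1) (dc x f2)) : Lin R Hs V2"
  "(%x. tens R V V (dc y f1) (dc x f2)) : Lin R H V2" "(%y. tens R V V (dc y f1) (dc x f2)) : Lin R H V2"
  using lm_comp[OF D(1)[OF assms(2)] T(2)[OF D(3)[OF assms(1,4)]]] lm_comp[OF D(1)[OF assms(1)] T(1)[OF D(3)[OF assms(2,3)]]]
   lm_comp[OF D(2)[OF assms(4)] T(1)[OF D(3)[OF assms(2,3)]]] lm_comp[OF D(2)[OF assms(3)] T(2)[OF D(3)[OF assms(1,4)]]]
  by simp_all
qed

text \<open>S^-1 reverses the coproduct of h; this is the origin of the exchanged legs h_2, h_1 in
  the formula.\<close>

lemma comult_dc: assumes h: "h:.H" and f: "f:.Hs"
 shows "comult V (dc h f) = sweedler R H V2 h (%h1 h2. sweedler R Hs V2 f (%f1 f2. tens R V V (dc h2 f1) (dc h1 f2)))"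
proof -
 note C = comultiplication_H and t = dc_comult_term
 have b1: "bilinear R Hs Hs V2 (%f1 f2. tens R V V (dc b f1) (dc a f2))" if "a:.H" "b:.H" for a b
  by (rule bilI; (rule t(1)[OF that f] | rule t(2)[OF that _ f]); assumption)
 have b2: "bilinear R H H V2 (%h1 h2. sweedler R Hs V2 f (%f1 f2. tens R V V (dc h2 f1) (dc h1 f2)))"
 proof (rule bilI)
  show "(%h2. sweedler R Hs V2 f (%f1 f2. tens R V V (dc h2 f1) (dc h1 f2))) : Lin R H V2" if "h1:.H" for h1
   by (rule CD.sweedler_fun_linear[OF mod_VV mod_H _ _ f]; rule b1[OF that] t(4)[OF that that]; assumption)
  show "(%h1. sweedler R Hs V2 f (%f1 f2. tens R V V (dc h2 f1) (dc h1 f2))) : Lin R H V2" if "h2:.H" for h2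
   by (rule CD.sweedler_fun_linear[OF mod_VV mod_H _ _ f]; rule b1[OF _ that] t(3)[OF that that]; assumption)
 qed
 define F where "F = tot f"
 have F: "lin F" and fF: "f = res F" unfolding F_def using lin_tot[OF f] res_tot[OF f] by auto
 show ?thesis
 proof (rule VV_sep)
  show "comult V (dc h f):.VV.T" by (rule comult_closed_V[OF bilD(3)[OF dc_bilinear h f]])
  show "sweedler R H V2 h (%h1 h2. sweedler R Hs V2 f (%f1 f2. tens R V V (dc h2 f1) (dc h1 f2))):.VV.T"
   using comultiplication.sweedler_closed[OF C mod_VV b2 h] by simp
  fix ph tw ps sg assume ph: "corr ph tw" and ps: "corr ps sg"
  note L = lins lin_comp[OF F] twistedD(6)[OF corrD(2)[OF ph]] twistedD(6)[OF corrD(2)[OF ps]]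
  have pl: "VV.pair_form ph ps : Lin R V2 K" using VV.pair_form_linear[OF corrD(1)[OF ph] corrD(1)[OF ps]] by simp
  have inner: "VV.pair_form ph ps (sweedler R Hs V2 f (%f1 f2. tens R V V (dc b f1) (dc a f2))) = F (tw (Si b)**sg (Si a))"
   if ab: "a:.H" "b:.H" for a b
  proof -
   have "VV.pair_form ph ps (sweedler R Hs V2 f (%f1 f2. tens R V V (dc b f1) (dc a f2))) =
    sweedler R Hs K f (%f1 f2. VV.pair_form ph ps (tens R V V (dc b f1) (dc a f2)))"
    by (rule CD.sweedler_comp[OF mod_VV mod_K b1[OF ab] pl f])
   also have "... = swd F (%P P'. VV.pair_form ph ps (tens R V V (dc b (res P)) (dc a (res P'))))"
    unfolding F_def by (rule sweedler_dual[OF DD.bilinear_comp[OF b1[OF ab] pl] f])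
   also have "... = swd F (%P P'. P (tw (Si b))*:P' (sg (Si a)))" by (rule swd_cong)
     (simp add: VV.pair_form_tens[OF corrD(1)[OF ph] corrD(1)[OF ps]] bilD(3)[OF dc_bilinear] res_cl ab
      dc_value[OF ph] dc_value[OF ps] smul_id linD(1))
   also have "... = F (tw (Si b)**sg (Si a))" by (rule swd_eval[OF F])
   finally show ?thesis .
  qed
  have "VV.pair_form ph ps (sweedler R H V2 h (%h1 h2. sweedler R Hs V2 f (%f1 f2. tens R V V (dc h2 f1) (dc h1 f2)))) =
   sweedler R H K h (%h1 h2. VV.pair_form ph ps (sweedler R Hs V2 f (%f1 f2. tens R V V (dc h2 f1) (dc h1 f2))))"
   by (rule comultiplication.sweedler_comp[OF C mod_VV mod_K b2 pl h])
  also have "... = h$.a b. F (tw (Si b)**sg (Si a))" by (rule sweedler_sw[OF _ h inner]) (intro L)+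
  also have "... = (Si h)$.s t. F (tw s**sg t)" by (rule sw_Si_anti[symmetric]) (intro L)+
  also have "... = VV.pair_form ph ps (comult V (dc h f))"
   using dc_cc[OF F, of h] h by (simp add: fF cl_id pair_form_comult[OF ph ps F])
  finally show "VV.pair_form ph ps (comult V (dc h f)) =
   VV.pair_form ph ps (sweedler R H V2 h (%h1 h2. sweedler R Hs V2 f (%f1 f2. tens R V V (dc h2 f1) (dc h1 f2))))" by (rule sym)
 qed
qed

lemma counit_dc: assumes h: "h:.H" and f: "f:.Hs"
 shows "counit V (dc h f) = sweedler R H K \<one>\<^sub>H (%a b. f b \<otimes>\<^sub>R counit H (h \<otimes>\<^sub>H a))" (is "?L = ?R")
proof -
 note F = lin_tot[OF f]
 have "?L = tot f (et (Si h))"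
  using dc_cc[OF F, of h] corrD(3)[OF corr_counit F] h by (simp add: res_tot[OF f] cl_id)
 also have "... = sw \<one>\<^sub>H (%a b. tot f b*:ep (h**a))" unfolding counit_Si[OF F] uu_def ..
 also have "... = ?R"
 proof (rule sweedler_sw[symmetric])
  show "lin2 (%a b. tot f b*:ep (h**a))" by (intro lins F)
  show "f b \<otimes>\<^sub>R counit H (h \<otimes>\<^sub>H a) = tot f b*:ep (h**a)" if "a:.H" "b:.H" for a b
   using that h lmD(1)[OF counit_linear] by (simp add: tot_def cl_id ep_def hmul_def smul_def sc_id dual_D(3)[OF f])
 qed simp
 finally show ?thesis .
qed

abbreviation anti_dc where
 "anti_dc h1 h2 h3 f1 f2 f3 \<equiv> (f1 (antipode_inv H h3) \<otimes>\<^sub>R f3 h1) \<odot> dc (antipode_inv H h2) (antipode Hs f2)"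

lemma anti_dc_linear: assumes "h1:.H" "h2:.H" "h3:.H" "f1:.Hs" "f2:.Hs" "f3:.Hs"
 shows "(%h1. anti_dc h1 h2 h3 f1 f2 f3) : Lin R H V" (is ?A) "(%h2. anti_dc h1 h2 h3 f1 f2 f3) : Lin R H V" (is ?B)
  "(%h3. anti_dc h1 h2 h3 f1 f2 f3) : Lin R H V" "(%f1. anti_dc h1 h2 h3 f1 f2 f3) : Lin R Hs V"
  "(%f2. anti_dc h1 h2 h3 f1 f2 f3) : Lin R Hs V" (is ?C) "(%f3. anti_dc h1 h2 h3 f1 f2 f3) : Lin R Hs V"
proof -
 note D = bilD[OF dc_bilinear] and Si = lmD(1)[OF linear_map_St_inv]
 note aD = dual_antipode_closed[OF assms(5)] and r1 = dual_D(3)[OF assms(4) Si[OF assms(3)]] and r3 = dual_D(3)[OF assms(6,1)]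
 have q: "dc (antipode_inv H h2) (antipode Hs f2):.V" by (rule D(3)[OF Si[OF assms(2)] aD])
 have p: "(%f1. f1 (antipode_inv H h3) \<otimes>\<^sub>R f3 h1) : Lin R Hs K"
  "(%f3. f1 (antipode_inv H h3) \<otimes>\<^sub>R f3 h1) : Lin R Hs K"
  "(%h3. f1 (antipode_inv H h3) \<otimes>\<^sub>R f3 h1) : Lin R H K"
  "(%h1. f1 (antipode_inv H h3) \<otimes>\<^sub>R f3 h1) : Lin R H K"
  using lm_const_smult[OF dual_module mod_K eval_linear[OF Si[OF assms(3)]], of "f3 h1"]
   lm_smult[OF dual_module mod_K eval_linear[OF assms(1)] r1]
   lm_const_smult[OF mod_H mod_K lm_comp[OF linear_map_St_inv dual_D(1)[OF assms(4)]], of "f3 h1"]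
   lm_smult[OF mod_H mod_K dual_D(1)[OF assms(6)] r1] r3 by simp_all
 have m: "f1 (antipode_inv H h3) \<otimes>\<^sub>R f3 h1:.R" using r1 r3 by simp
 show ?A "(%h3. anti_dc h1 h2 h3 f1 f2 f3) : Lin R H V"
  "(%f1. anti_dc h1 h2 h3 f1 f2 f3) : Lin R Hs V" "(%f3. anti_dc h1 h2 h3 f1 f2 f3) : Lin R Hs V"
 
  by (rule lm_const_smult[OF dual_module mod_V p(1) q] lm_const_smult[OF dual_module mod_V p(2) q]
   lm_const_smult[OF mod_H mod_V p(3) q] lm_const_smult[OF mod_H mod_V p(4) q])+
 show ?C
  by (rule lm_smult[OF dual_module mod_V lm_comp[OF dual_antipode_linear(1) D(1)[OF Si[OF assms(2)]]] m])
 show ?B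
  by (rule lm_smult[OF mod_H mod_V lm_comp[OF linear_map_St_inv D(2)[OF aD]] m])
qed

text \<open>At S^-1(h) the antipode formula has its legs in reverse order by
  \<open>antipode_Si\<close>, which pairs f_1 with S^-1(h_3) and f_3 with h_1.\<close>

lemma antipode_dc: assumes h: "h:.H" and f: "f:.Hs"
 shows "antipode V (dc h f) = sweedler3 R H V h (%h1 h2 h3. sweedler3 R Hs V f (anti_dc h1 h2 h3))"
proof -
 note C = comultiplication_H and t = anti_dc_linear
 have fb: "bilinear R Hs Hs V (%f1 f2. anti_dc h1 h2 h3 f1 f2 f3)"
  if "h1:.H" "h2:.H" "h3:.H" "f3:.Hs" for h1 h2 h3 f3
  by (rule bilI; (rule t(4)[OF that(1-3) f _ that(4)] | rule t(5)[OF that(1-3) _ f that(4)]); assumption)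
 have fl: "(%f3. anti_dc h1 h2 h3 f1 f2 f3) : Lin R Hs V"
  if "h1:.H" "h2:.H" "h3:.H" "f1:.Hs" "f2:.Hs" for h1 h2 h3 f1 f2 by (rule t(6)[OF that f])
 note sl = CD.sweedler3_fun_linear[OF mod_V mod_H _ _ _ f]
 let ?W = "%h1 h2 h3. sweedler3 R Hs V f (anti_dc h1 h2 h3)"
 have T: "trilinear V ?W"
 proof (rule trilinearI)
  fix x y assume xy: "x:.H" "y:.H"
  show "(%h3. ?W x y h3) : Lin R H V" by (rule sl; rule fb[OF xy] fl[OF xy] t(3)[OF xy h]; assumption)
  show "(%h2. ?W x h2 y) : Lin R H V"
   by (rule sl; (rule fb[OF xy(1) _ xy(2)] | rule fl[OF xy(1) _ xy(2)] | rule t(2)[OF xy(1) h xy(2)]); assumption)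
  show "(%h1. ?W h1 x y) : Lin R H V"
   by (rule sl; (rule fb[OF _ xy] | rule fl[OF _ xy] | rule t(1)[OF h xy]); assumption)
 qed
 define F where "F = tot f"
 have F: "lin F" and fF: "f = res F" unfolding F_def using lin_tot[OF f] res_tot[OF f] by auto
 note Tl = comultiplication.sweedler3_linear[OF C mod_V trilinearD(2,3)[OF T]]
 show ?thesis
 proof (rule V_sep[OF antipode_closed[OF bilD(3)[OF dc_bilinear h f]] lmD(1)[OF Tl h]])
  fix ph tw assume ph: "corr ph tw"
  note phl = corrD(1)[OF ph]
  have L: "lin3 (%h1 h2 h3. F (Si h3**(St (tw (Si (Si h2)))**h1)))"
   by (intro lins lin_comp[OF F] twistedD(6)[OF corrD(2)[OF ph]])
  have inner: "ph (?W x y z) = F (Si z**(St (tw (Si (Si y)))**x))" (is "?M = ?N") if xyz: "x:.H" "y:.H" "z:.H" for x y z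
  proof -
   have v: "ph (anti_dc x y z (res P1) (res P2) (res P3)) = P1 (Si z)*:(P2 (St (tw (Si (Si y))))*:P3 x)"
    if P: "lin P1" "lin P2" "lin P3" for P1 P2 P3
   proof -
    have l2: "lin (%x. P2 (St x))" by (intro lin_comp[OF P(2)] lins)
    have Sz: "antipode_inv H z = Si z" "antipode_inv H y = Si y" using xyz by (simp_all add: Si_def cl_id)
    show ?thesis by (simp add: Sz dual_antipode_res P res_apply lmD(3)[OF phl] linD(1) xyz
      bilD(3)[OF dc_bilinear] res_cl l2 dc_value[OF ph _ l2] smul_def linD(3) sc_id R.m_ac)
   qed
   have "?M = sweedler3 R Hs K f (%f1 f2 f3. ph (anti_dc x y z f1 f2 f3))"
    by (rule CD.sweedler3_comp[where F="anti_dc x y z" and f=ph, OF mod_V mod_K _ _ phl f])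
     (rule fb[OF xyz] fl[OF xyz]; assumption)+
   also have "... = swd F (%P P3. swd P (%P1 P2. ph (anti_dc x y z (res P1) (res P2) (res P3))))"
    unfolding fF by (rule sweedler3_dual[where G="%f1 f2 f3. ph (anti_dc x y z f1 f2 f3)", OF _ _ F])
     (rule DD.bilinear_comp[OF fb[OF xyz] phl] lm_comp[OF fl[OF xyz] phl]; assumption)+
   also have "... = swd F (%P P3. swd P (%P1 P2. P1 (Si z)*:(P2 (St (tw (Si (Si y))))*:P3 x)))"
    by (rule swd_cong, rule swd_cong) (rule v)
   also have "... = swd F (%P P3. P (Si z**St (tw (Si (Si y))))*:P3 x)"
    by (rule swd_cong) (simp only: swd_eval'(1))
   also have "... = ?N" by (simp only: swd_eval[OF F] hassoc)
   finally show ?thesis .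
  qed
  have "ph (sweedler3 R H V h ?W) = sweedler3 R H K h (%x y z. ph (?W x y z))"
   by (rule comultiplication.sweedler3_comp[OF C mod_V mod_K trilinearD(2,3)[OF T] phl h])
  also have "... = sweedler3 R H K h (%h1 h2 h3. F (Si h3**(St (tw (Si (Si h2)))**h1)))"
   by (rule comultiplication.sweedler3_cong[OF C mod_K trilinearD(2,3)[OF lin3_trilinear[OF L]] h, symmetric]) (simp_all add: inner)
  also have "... = h$$.h1 h2 h3. F (Si h3**(St (tw (Si (Si h2)))**h1))" by (rule sweedler3_sw'[OF L h])
  also have "... = ph (antipode V (dc h f))"
   using dc_cc[OF F, of h] h cc_antipode[OF ph F, of "Si h"] antipode_Si[OF twistedD(1)[OF corrD(2)[OF ph]] F, of h]
   by (simp add: fF cl_id)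
  finally show "ph (antipode V (dc h f)) = ph (sweedler3 R H V h ?W)" by (rule sym)
 qed
qed

end

end

context weak_hopf_basis begin

subsection \<open>The isomorphism \<open>h \<Join> f \<mapsto> f \<otimes> S\<^sup>-\<^sup>1(h)\<close>\<close>

sublocale HS: two_modules R H "dual R H" by (rule two_modules.intro[OF mod_H dual_module])

abbreviation "B \<equiv> double_product R H"
abbreviation "HHs \<equiv> tensor R H (dual R H)"

definition double_term where
 "double_term h f g k1 k2 k3 = tens R H Hs (h \<otimes>\<^sub>H k2) (act_right H (act_left H (antipode_inv H k1) f) k3 \<otimes>\<^sub>Hs g)"

lemma B_sel: "carrier B = carrier HS.T" "add B = add HS.T" "zero B = zero HS.T" "smult B = smult HS.T"
 "one B = tens R H Hs \<one>\<^sub>H \<one>\<^sub>Hs"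
 "x \<otimes>\<^sub>B y = tensor_lift R HHs x (%h f. tensor_lift R HHs y (%k g. sweedler3 R H HHs k (double_term h f g)))"
 by (simp_all add: double_product_def Let_def double_term_def[abs_def])

lemma mod_HHs: "module R HHs" by (rule HS.tensor_module')
lemma mod_B: "module R B" by (rule module_cong[OF HS.tensor_mod]) (simp_all add: B_sel)

lemma linear_map_B: "Lin R B P = Lin R HS.T P" "Lin R P B = Lin R P HS.T" by (simp_all add: linear_map_def B_sel)

lemma double_term_linear: assumes "h:.H" "f:.Hs" "g:.Hs" "k1:.H" "k2:.H" "k3:.H"
 shows "(%h. double_term h f g k1 k2 k3) : Lin R H HHs" (is ?A) "(%f. double_term h f g k1 k2 k3) : Lin R Hs HHs" (is ?B)
  "(%g. double_term h f g k1 k2 k3) : Lin R Hs HHs" (is ?C) "(%k1. double_term h f g k1 k2 k3) : Lin R H HHs" (is ?D)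
  "(%k2. double_term h f g k1 k2 k3) : Lin R H HHs" (is ?E) "(%k3. double_term h f g k1 k2 k3) : Lin R H HHs" (is ?F)
proof -
 have S: "antipode_inv H k1:.H" by (rule lmD(1)[OF linear_map_St_inv assms(4)])
 have ac: "act_right H (act_left H (antipode_inv H k1) f) k3:.Hs" by (intro act_closed S assms)
 have mc: "act_right H (act_left H (antipode_inv H k1) f) k3 \<otimes>\<^sub>Hs g:.Hs" by (intro dual_mult_closed ac assms)
 have hk: "h \<otimes>\<^sub>H k2:.H" using assms by simp
 have l: "(%h. tens R H Hs h (act_right H (act_left H (antipode_inv H k1) f) k3 \<otimes>\<^sub>Hs g)) : Lin R H HHs"
  using bilD(2)[OF HS.tens_bilinear mc] by simp
 have r: "(%f. tens R H Hs (h \<otimes>\<^sub>H k2) f) : Lin R Hs HHs" using bilD(1)[OF HS.tens_bilinear hk] by simp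
 note mr = lm_comp[OF _ lm_comp[OF bilD(2)[OF dual_mult_bilinear assms(3)] r]]
 show ?A unfolding double_term_def
  by (rule lm_comp[OF bilD(2)[OF mult_bilinear assms(5)] l])
 show ?E unfolding double_term_def
  by (rule lm_comp[OF bilD(1)[OF mult_bilinear assms(1)] l])
 show ?C unfolding double_term_def
  by (rule lm_comp[OF bilD(1)[OF dual_mult_bilinear ac] r])
 show ?B unfolding double_term_def
  by (rule mr[OF lm_comp[OF bilD(1)[OF act_left_bilinear S] bilD(2)[OF act_right_bilinear assms(6)]]])
 show ?D unfolding double_term_def
  by (rule mr[OF lm_comp[OF lm_comp[OF linear_map_St_inv bilD(2)[OF act_left_bilinear assms(2)]]
   bilD(2)[OF act_right_bilinear assms(6)]]])
 show ?F unfolding double_term_def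
  by (rule mr[OF bilD(1)[OF act_right_bilinear act_closed(1)[OF assms(2) S]]])
qed

lemma double_term_trilinear: assumes "h:.H" "f:.Hs" "g:.Hs" shows "trilinear HHs (double_term h f g)"
 by (rule trilinearI; (rule double_term_linear(4)[OF assms one_closed] | rule double_term_linear(5)[OF assms _ one_closed] |
  rule double_term_linear(6)[OF assms _ _ one_closed]); assumption)

lemma double_sum_linear: assumes "h:.H" "f:.Hs" "g:.Hs" "k:.H"
 shows "(%h. sweedler3 R H HHs k (double_term h f g)) : Lin R H HHs" (is ?A)
  "(%f. sweedler3 R H HHs k (double_term h f g)) : Lin R Hs HHs" (is ?B)
  "(%g. sweedler3 R H HHs k (double_term h f g)) : Lin R Hs HHs" (is ?C)
  "(%k. sweedler3 R H HHs k (double_term h f g)) : Lin R H HHs" (is ?D)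
proof -
 note T = trilinearD(2,3)[OF double_term_trilinear] and P = double_term_linear
 note sl = CH.sweedler3_fun_linear[OF mod_HHs _ _ _ _ assms(4)]
 show ?A
  by (rule sl[OF mod_H]; rule T P(1); (assumption | rule assms))
 show ?B
  by (rule sl[OF dual_module]; rule T P(2); (assumption | rule assms))
 show ?C
  by (rule sl[OF dual_module]; rule T P(3); (assumption | rule assms))
 show ?D
  by (rule CH.sweedler3_linear[OF mod_HHs T(1)[OF assms(1-3)] T(2)[OF assms(1-3)]])
qed

lemma double_sum_bilinear:
 "[|h:.H; f:.Hs|] ==> bilinear R H Hs HHs (%k g. sweedler3 R H HHs k (double_term h f g))"
 "[|k:.H; g:.Hs|] ==> bilinear R H Hs HHs (%h f. sweedler3 R H HHs k (double_term h f g))"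
proof -
 note P = double_sum_linear
 show "bilinear R H Hs HHs (%k g. sweedler3 R H HHs k (double_term h f g))" if f: "h:.H" "f:.Hs"
  by (rule bilI; (rule P(3)[OF f f(2)] | rule P(4)[OF f _ f(1)]); assumption)
 show "bilinear R H Hs HHs (%h f. sweedler3 R H HHs k (double_term h f g))" if g: "k:.H" "g:.Hs"
  by (rule bilI; (rule P(1)[OF g(1) _ g(2,1)] | rule P(2)[OF _ g(2,2,1)]); assumption)
qed

lemma mult_B_bilinear: "bilinear R B B B (mult B)"
 using HS.tensor_product_bilinear(2)[OF mod_HHs double_sum_bilinear] by (simp add: bilinear_def linear_map_B B_sel)

lemma mult_B_tens: assumes "h:.H" "f:.Hs" "k:.H" "g:.Hs"
 shows "tens R H Hs h f \<otimes>\<^sub>B tens R H Hs k g = sweedler3 R H HHs k (double_term h f g)"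
 unfolding B_sel(6) by (rule HS.tensor_product_bilinear(3)[OF mod_HHs double_sum_bilinear]) (simp_all add: assms)

text \<open>S^-1 makes the map reverse products; with plain h in place of S^-1(h) the legs S^-1(k_1)
  and k_3 of one product would not match h_3 and S(h_1) of the other.\<close>

definition flip where "flip x = tensor_lift R SH.T x (%h f. tens R Hs H f (antipode_inv H h))"
definition unflip where "unflip y = tensor_lift R HS.T y (%f h. tens R H Hs (antipode H h) f)"

lemma flip_bilinear: "bilinear R H Hs SH.T (%h f. tens R Hs H f (antipode_inv H h))" (is ?A)
  "bilinear R Hs H HS.T (%f h. tens R H Hs (antipode H h) f)" (is ?B)
proof -
 note T = bilD[OF SH.tens_bilinear] and T' = bilD[OF HS.tens_bilinear]
 show ?A
  by (rule bilI; (rule T(2)[OF lmD(1)[OF linear_map_St_inv]] | rule lm_comp[OF linear_map_St_inv T(1)]); assumption)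
 show ?B
  by (rule bilI; (rule T'(1)[OF lmD(1)[OF antipode_linear]] | rule lm_comp[OF antipode_linear T'(2)]); assumption)
qed

lemma flip_linear: "flip : Lin R B A" "unflip : Lin R A B"
 unfolding flip_def[abs_def] unflip_def[abs_def] linear_map_A linear_map_B
 by (rule HS.tensor_lift_linear[OF SH.tensor_mod flip_bilinear(1)]
  SH.tensor_lift_linear[OF HS.tensor_mod flip_bilinear(2)])+

lemma flip_tens: "[|h:.H; f:.Hs|] ==> flip (tens R H Hs h f) = tens R Hs H f (antipode_inv H h)"
 "[|h:.H; f:.Hs|] ==> unflip (tens R Hs H f h) = tens R H Hs (antipode H h) f" unfolding flip_def unflip_def
 by (rule HS.tensor_lift_tens[OF SH.tensor_mod flip_bilinear(1)]
  SH.tensor_lift_tens[OF HS.tensor_mod flip_bilinear(2)]; assumption)+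

lemma antipode_inv_inverse: assumes "h:.H"
 shows "antipode H (antipode_inv H h) = h" "antipode_inv H (antipode H h) = h"
  "antipode H h:.H" "antipode_inv H h:.H"
 using St_Si[of h] Si_St[of h] assms lmD(1)[OF antipode_linear] lmD(1)[OF linear_map_St_inv]
 by (simp_all add: St_def Si_def cl_id)

lemma unflip_flip: "x:.B ==> unflip (flip x) = x"
 by (rule HS.tensor_eqI[where f="%x. unflip (flip x)" and g="%x. x", OF HS.tensor_mod
   lm_comp[OF flip_linear[unfolded linear_map_A linear_map_B]] lm_id])
  (simp_all add: flip_tens antipode_inv_inverse B_sel)

lemma flip_unflip: "y:.A ==> flip (unflip y) = y"
 by (rule SH.tensor_eqI[where f="%x. flip (unflip x)" and g="%x. x", OF SH.tensor_mod
   lm_comp[OF flip_linear(2,1)[unfolded linear_map_A linear_map_B]] lm_id])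
  (simp_all add: flip_tens antipode_inv_inverse A_sel)

lemma flip_one: "flip \<one>\<^sub>B = \<one>\<^sub>A"
proof -
 have "antipode_inv H \<one>\<^sub>H = \<one>\<^sub>H" using Si_uu by (simp add: uu_def Si_def cl_id)
 then show ?thesis using res_cl[OF lin_ep[OF hlin_id]] by (simp add: B_sel A_sel flip_tens dual_one)
qed

text \<open>A functional represented by \<open>tw\<close> turns the left side into the sum of
  \<open>prd_Si\<close> and the right side into the corresponding value of
  \<open>prd\<close>.\<close>

lemma flip_mult_tens: assumes h: "h:.H" and f: "f:.Hs" and k: "k:.H" and g: "g:.Hs"
 shows "flip (tens R H Hs h f \<otimes>\<^sub>B tens R H Hs k g) = flip (tens R H Hs k g) \<otimes>\<^sub>A flip (tens R H Hs h f)"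
proof -
 define F G where "F = tot f" and "G = tot g"
 have F: "lin F" "res F = f" and G: "lin G" "res G = g" unfolding F_def G_def using lin_tot res_tot f g by auto
 have tt: "tens R Hs H f (antipode_inv H h) = tt F (Si h)" "tens R Hs H g (antipode_inv H k) = tt G (Si k)"
  using h k by (simp_all add: tt_def F G Si_def cl_id antipode_inv_inverse)
 have fl: "flip : Lin R HHs A" using flip_linear(1) by (simp add: linear_map_B)
 note T = trilinearD(2,3)[OF double_term_trilinear[OF h f g]]
 have v: "flip (double_term h f g a b c) = tt (%x. x$.u v. F (c**(u**Si a))*:G v) (Si (h**b))"
  if abc: "a:.H" "b:.H" "c:.H" for a b c
 proof -
  have S: "antipode_inv H a = Si a" "antipode_inv H (h \<otimes>\<^sub>H b) = cl (Si (h**b))" "h \<otimes>\<^sub>H b:.H"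
   using abc h by (simp_all add: Si_def hmul_def cl_id antipode_inv_inverse)
  have l: "lin (%l. F (l**Si a))" "lin (%l. F (c**l**Si a))" by (intro lins lin_comp[OF F(1)])+
  have "act_right H (act_left H (antipode_inv H a) f) c = res (%l. F (c**l**Si a))"
   using abc f by (simp add: S F(2)[symmetric] act_left_res res_cl F(1) tot_res act_right_res l)
  then have "act_right H (act_left H (antipode_inv H a) f) c \<otimes>\<^sub>Hs g = res (%x. x$.u v. F (c**u**Si a)*:G v)"
   by (simp add: G(2)[symmetric] dual_mult res_cl l G(1) tot_res)
  moreover have "res (%x. x$.u v. F (c**u**Si a)*:G v):.Hs" by (rule res_cl[OF lin_conv[OF l(2) G(1)]])
  ultimately show ?thesis by (simp add: double_term_def flip_tens S tt_def hassoc)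
 qed
 show ?thesis
 proof (rule A_sep)
  show "flip (tens R H Hs h f \<otimes>\<^sub>B tens R H Hs k g):.A"
   by (intro lmD(1)[OF flip_linear(1)] bilD(3)[OF mult_B_bilinear]) (simp_all add: B_sel HS.tens_closed assms)
  show "flip (tens R H Hs k g) \<otimes>\<^sub>A flip (tens R H Hs h f):.A"
   by (intro lmD(1)[OF flip_linear(1)] bilD(3)[OF mult_A_bilinear]) (simp_all add: B_sel HS.tens_closed assms)
  fix ph tw assume ph: "rep ph tw"
  note L = lins lin_comp[OF F(1)] lin_comp[OF G(1)] hlin_comp[OF repD(2)[OF ph]]
  have fph: "(%x. ph (flip x)) : Lin R HHs K" by (rule lm_comp[OF fl repD(1)[OF ph]])
  have L3: "lin3 (%a b c. (tw (Si (h**b)))$.u v. F (c**(u**Si a))*:G v)" by (intro L F G)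
  have "ph (flip (tens R H Hs h f \<otimes>\<^sub>B tens R H Hs k g)) = sweedler3 R H K k (%a b c. ph (flip (double_term h f g a b c)))"
   unfolding mult_B_tens[OF assms] by (rule CH.sweedler3_comp[OF mod_HHs mod_K T fph k])
  also have "... = sweedler3 R H K k (%a b c. (tw (Si (h**b)))$.u v. F (c**(u**Si a))*:G v)"
  proof (rule CH.sweedler3_cong[OF mod_K trilinearD(2,3)[OF lin3_trilinear[OF L3]] k, symmetric])
   fix a b c assume abc: "a:.H" "b:.H" "c:.H"
   show "(tw (Si (h**b)))$.u v. F (c**(u**Si a))*:G v = ph (flip (double_term h f g a b c))"
    unfolding v[OF abc] by (rule repD(4)[OF ph, symmetric]) (intro L G)
  qed
  also have "... = k$$.a b c. (tw (Si (h**b)))$.u v. F (c**(u**Si a))*:G v" by (rule sweedler3_sw'[OF L3 k])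
  also have "... = prd tw G (Si k) F (Si h)" by (rule prd_Si[OF repD(2)[OF ph] F(1) G(1), symmetric])
  also have "... = ph (flip (tens R H Hs k g) \<otimes>\<^sub>A flip (tens R H Hs h f))"
   by (simp add: flip_tens assms tt mult_A_value[OF ph G(1) F(1)])
  finally show "ph (flip (tens R H Hs h f \<otimes>\<^sub>B tens R H Hs k g)) = ph (flip (tens R H Hs k g) \<otimes>\<^sub>A flip (tens R H Hs h f))" .
 qed
qed

lemma flip_mult: assumes x: "x:.B" and y: "y:.B"
 shows "flip (x \<otimes>\<^sub>B y) = flip y \<otimes>\<^sub>A flip x"
proof -
 note Bl = bilD[OF mult_B_bilinear] and Al = bilD[OF mult_A_bilinear] and fl = flip_linear(1) and fD = lmD(1)[OF flip_linear(1)]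
 have t: "tens R H Hs h f:.B" if "h:.H" "f:.Hs" for h f using HS.tens_closed[OF that] by (simp add: B_sel)
 have 1: "flip (tens R H Hs h f \<otimes>\<^sub>B y) = flip y \<otimes>\<^sub>A flip (tens R H Hs h f)" if hf: "h:.H" "f:.Hs" for h f
  by (rule HS.tensor_eqI[where f="%y. flip (tens R H Hs h f \<otimes>\<^sub>B y)" and g="%y. flip y \<otimes>\<^sub>A flip (tens R H Hs h f)", OF mod_A
   lm_comp[OF Bl(1)[OF t[OF hf]] fl, unfolded linear_map_B] lm_comp[OF fl Al(2)[OF fD[OF t[OF hf]]], unfolded linear_map_B]
   flip_mult_tens[OF hf] y[unfolded B_sel]])
 show ?thesis
  by (rule HS.tensor_eqI[where f="%x. flip (x \<otimes>\<^sub>B y)" and g="%x. flip y \<otimes>\<^sub>A flip x", OF mod_A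
   lm_comp[OF Bl(2)[OF y] fl, unfolded linear_map_B] lm_comp[OF fl Al(1)[OF fD[OF y]], unfolded linear_map_B]
   1 x[unfolded B_sel]])
qed

abbreviation "ker \<equiv> double_kernel R H"
abbreviation "DH \<equiv> drinfeld_double R H"

lemma one_B_closed: "\<one>\<^sub>B:.B"
 using HS.tens_closed[OF one_closed res_cl[OF lin_ep[OF hlin_id]]] by (simp add: B_sel dual_one)

lemma ker_eq: "ker = {x \<in> carrier B. x \<otimes>\<^sub>B \<one>\<^sub>B = \<zero>\<^sub>B}"
 by (simp add: double_kernel_def a_kernel_def')

text \<open>\<open>flip\<close> turns right multiplication by one preunit into left multiplication
  by the other, and the ideal is the annihilator of the latter by \<open>ideal_iff\<close>.\<close>

lemma ker_iff: assumes x: "x:.B" shows "x \<in> ker <-> flip x \<in> DI"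
proof -
 have "flip (x \<otimes>\<^sub>B \<one>\<^sub>B) = \<one>\<^sub>A \<otimes>\<^sub>A flip x" by (simp add: flip_mult[OF x one_B_closed] flip_one)
 moreover have "flip (x \<otimes>\<^sub>B \<one>\<^sub>B) = \<zero>\<^sub>A <-> x \<otimes>\<^sub>B \<one>\<^sub>B = \<zero>\<^sub>B"
  using unflip_flip[OF bilD(3)[OF mult_B_bilinear x one_B_closed]] lm_zero[OF mod_A mod_B flip_linear(2)]
   lm_zero[OF mod_B mod_A flip_linear(1)] by metis
 ultimately show ?thesis using ideal_iff[OF lmD(1)[OF flip_linear(1) x]] x by (simp add: ker_eq)
qed

sublocale QB: quotient_by R "double_product R H" "double_kernel R H"
 unfolding quotient_by_def quotient_by_axioms_def ker_eq
 using mod_B linear_map_kernel_submodule[OF mod_B mod_B bilD(2)[OF mult_B_bilinear one_B_closed]] by simp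

lemma DH_def: "DH = quotient_algebra B ker" by (simp add: drinfeld_double_def)

definition "to_op = on_class (%x. QA.cls (flip x))"
definition "from_op = on_class (%y. QB.cls (unflip y))"

lemma to_op: "to_op : Lin R DH Q" "x:.B ==> to_op (QB.cls x) = QA.cls (flip x)"
 "from_op : Lin R Q DH" "y:.A ==> from_op (QA.cls y) = QB.cls (unflip y)"
proof -
 note l = lm_comp[OF flip_linear(1) QA.cls_linear] and l' = lm_comp[OF flip_linear(2) QB.cls_linear]
 have z: "QA.cls (flip i) = \<zero>\<^sub>Q" if "i \<in> ker" for i
  using that QB.I_subset ker_iff by (intro QA.cls_zero) auto
 have z': "QB.cls (unflip i) = \<zero>\<^bsub>quotient_algebra B ker\<^esub>" if "i \<in> DI" for i
 proof -
  have i: "i:.A" using that QA.I_subset by auto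
  show ?thesis using that by (intro QB.cls_zero) (simp add: ker_iff lmD(1)[OF flip_linear(2) i] flip_unflip[OF i])
 qed
 show "to_op : Lin R DH Q" unfolding to_op_def DH_def by (rule QB.on_class_linear[OF mod_Q l z])
 show "to_op (QB.cls x) = QA.cls (flip x)" if "x:.B"
  unfolding to_op_def by (rule QB.on_class_cls[OF mod_Q l _ that]) (rule z)
 show "from_op : Lin R Q DH" unfolding from_op_def DH_def by (rule QA.on_class_linear[OF QB.quotient_module l' z'])
 show "from_op (QA.cls y) = QB.cls (unflip y)" if "y:.A"
  unfolding from_op_def by (rule QA.on_class_cls[OF QB.quotient_module l' _ that]) (rule z')
qed

lemma from_to_op: "X:.DH ==> from_op (to_op X) = X" "Y:.Q ==> to_op (from_op Y) = Y"
proof -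
 show "from_op (to_op X) = X" if X: "X:.DH"
 proof -
  obtain x where "x:.B" "X = QB.cls x" using QB.quotient_cases X unfolding DH_def by meson
  then show ?thesis by (simp add: to_op(2,4) lmD(1)[OF flip_linear(1)] unflip_flip)
 qed
 show "to_op (from_op Y) = Y" if Y: "Y:.Q"
 proof -
  obtain y where "y:.A" "Y = QA.cls y" using QA.quotient_cases Y by meson
  then show ?thesis by (simp add: to_op(2,4) lmD(1)[OF flip_linear(2)] flip_unflip)
 qed
qed

text \<open>Independence of representatives is inherited from the quotient \<open>Q\<close>, where
  it is known, because \<open>to_op\<close> is injective.\<close>

lemma cls_mult_DH: assumes x: "x:.B" and y: "y:.B"
 shows "QB.cls x \<otimes>\<^bsub>DH\<^esub> QB.cls y = QB.cls (x \<otimes>\<^sub>B y)" (is "?L = ?R")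
proof -
 note Bl = bilD(3)[OF mult_B_bilinear] and fD = lmD(1)[OF flip_linear(1)]
 have c: "QB.cls z:.DH" if "z:.B" for z using QB.cls_closed[OF that] by (simp add: DH_def)
 have eq: "QB.cls (a \<otimes>\<^sub>B b) = ?R" if a: "a \<in> QB.cls x" and b: "b \<in> QB.cls y" for a b
 proof -
  have ab: "a:.B" "b:.B" using a b QB.mem_cls x y by auto
  have "QB.cls a = QB.cls x" "QB.cls b = QB.cls y" using a b ab QB.mem_cls x y by (simp_all add: QB.cls_eq_iff)
  then have "QA.cls (flip a) = QA.cls (flip x)" "QA.cls (flip b) = QA.cls (flip y)" using to_op(2) ab x y by metis+
  then have "to_op (QB.cls (a \<otimes>\<^sub>B b)) = to_op (QB.cls (x \<otimes>\<^sub>B y))"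
   by (simp add: to_op(2) Bl ab x y flip_mult cls_mult[symmetric] fD)
  then show ?thesis using from_to_op(1) c Bl ab x y by metis
 qed
 have "?L = (\<Union>a\<in>QB.cls x. \<Union>b\<in>QB.cls y. QB.cls (a \<otimes>\<^sub>B b))"
  by (simp add: DH_def QB.quotient_sel rcoset_mult_def)
 also have "... = (\<Union>a\<in>QB.cls x. \<Union>b\<in>QB.cls y. QB.cls (x \<otimes>\<^sub>B y))"
  by (intro SUP_cong refl eq)
 also have "... = ?R" using QB.a_rcos_self x y by blast
 finally show ?thesis .
qed

lemma hopf_transport_double: "hopf_transport_along R H I e d Vop cQ (I \<times> I) base_Q form_Q DH to_op from_op"
proof (intro hopf_transport_along.intro hopf_transport_along_axioms.intro double_presentation_op)
 note fD = lmD(1)[OF flip_linear(1)] and Bl = bilD(3)[OF mult_B_bilinear]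
 show "module R DH" unfolding DH_def by (rule QB.quotient_module)
 show "to_op : Lin R DH Vop" "from_op : Lin R Vop DH" using to_op(1,3) by (simp_all add: linear_map_Vop)
 show "to_op (from_op v) = v" if "v:.Vop" for v using from_to_op(2) that by (simp add: Vop_sel)
 show "from_op (to_op x) = x" if "x:.DH" for x by (rule from_to_op(1)[OF that])
 have one: "\<one>\<^bsub>DH\<^esub> = QB.cls \<one>\<^sub>B" by (simp add: DH_def QB.quotient_sel)
 show "to_op \<one>\<^bsub>DH\<^esub> = \<one>\<^bsub>Vop\<^esub>"
  unfolding one by (simp add: to_op(2)[OF one_B_closed] flip_one Vop_sel QA.quotient_sel)
 show "\<one>\<^bsub>DH\<^esub>:.DH" unfolding one unfolding DH_def by (rule QB.cls_closed[OF one_B_closed])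
 fix X Y assume "X:.DH" "Y:.DH"
 then obtain x y where x: "x:.B" "X = QB.cls x" "y:.B" "Y = QB.cls y"
  using QB.quotient_cases unfolding DH_def by meson
 show "X \<otimes>\<^bsub>DH\<^esub> Y:.DH"
  unfolding x cls_mult_DH[OF x(1,3)] unfolding DH_def by (rule QB.cls_closed[OF Bl[OF x(1,3)]])
 show "to_op (X \<otimes>\<^bsub>DH\<^esub> Y) = to_op X \<otimes>\<^bsub>Vop\<^esub> to_op Y"
  unfolding x cls_mult_DH[OF x(1,3)] by (simp add: to_op(2) x Bl flip_mult cls_mult fD Vop_sel)
qed

theorem double_weak_hopf: "\<exists>D :: ('a, ('h \<times> ('h => 'a) => 'a) set set) hopf.
  module.truncate D = drinfeld_double R H \<and>
  weak_hopf_algebra R D \<and> (\<forall>h\<in>carrier H. \<forall>f\<in>carrier (dual R H).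
   comult D (double_class R H h f) =
    sweedler R H (tensor R D D) h (%h1 h2.
    sweedler R (dual R H) (tensor R D D) f (%f1 f2.
     tens R D D (double_class R H h2 f1) (double_class R H h1 f2))) \<and>
   counit D (double_class R H h f) =
    sweedler R H (regular_module R) \<one>\<^sub>H (%a b. f b \<otimes> counit H (h \<otimes>\<^sub>H a)) \<and>
   antipode D (double_class R H h f) =
    sweedler3 R H D h (%h1 h2 h3.
    sweedler3 R (dual R H) D f (%f1 f2 f3. (f1 (antipode_inv H h3) \<otimes> f3 h1) \<odot>\<^sub>D
      double_class R H (antipode_inv H h2) (antipode (dual R H) f2)))) \<and>
  weak_hopf_iso R D (hopf_op (drinfeld_double' R H)) ~= {}"
proof -
 \<comment> \<open>The operations are defined by transport; the formulas of the theorem are then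
   derived for them on classes.\<close>
 let ?D = "hopf_transport R Vop DH to_op from_op"
 note along = hopf_transport_double
 note pres = hopf_transport_along.double_presentation_D[OF along]
 have dc: "double_class R H h f = from_op (cQ f (antipode_inv H h))" if "h:.H" "f:.Hs" for h f
  using that SH.tens_closed[of f "antipode_inv H h"]
  by (simp add: double_class_def cQ_def to_op(4) A_sel flip_tens antipode_inv_inverse)
 have formulas: "comult ?D (double_class R H h f) =
    sweedler R H (tensor R ?D ?D) h (%h1 h2. sweedler R Hs (tensor R ?D ?D) f (%f1 f2.
     tens R ?D ?D (double_class R H h2 f1) (double_class R H h1 f2)))"
  "counit ?D (double_class R H h f) = sweedler R H K \<one>\<^sub>H (%a b. f b \<otimes> counit H (h \<otimes>\<^sub>H a))"
  "antipode ?D (double_class R H h f) = sweedler3 R H ?D h (%h1 h2 h3. sweedler3 R Hs ?D f (%f1 f2 f3.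
     (f1 (antipode_inv H h3) \<otimes> f3 h1) \<odot>\<^bsub>?D\<^esub> double_class R H (antipode_inv H h2) (antipode Hs f2)))"
  if h: "h:.H" and f: "f:.Hs" for h f
  by (rule double_presentation.comult_dc[OF pres, where dc="double_class R H", OF _ h f]
   double_presentation.counit_dc[OF pres, where dc="double_class R H", OF _ h f]
   double_presentation.antipode_dc[OF pres, where dc="double_class R H", OF _ h f]; rule dc; assumption)+
 have "to_op \<in> weak_hopf_iso R ?D Vop" by (rule hopf_transport_along.iso_D[OF along])
 then show ?thesis
  by (intro exI[of _ ?D] conjI ballI) (rule hopf_transport_sel hopf_transport_along.weak_hopf_algebra_D[OF along] formulas | assumption | blast)+
qed

end

theorem proposition4p5:
  fixes R :: "('a, 'r) ring_scheme" and H :: "('a, 'h) hopf"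
  assumes "weak_hopf_algebra R H"
    and "bij_betw (antipode H) (carrier H) (carrier H)"
    and "finitely_generated_module R H"
    and "projective_module R H"
  shows "\<exists>D :: ('a, ('h \<times> ('h \<Rightarrow> 'a) \<Rightarrow> 'a) set set) hopf.
    module.truncate D = drinfeld_double R H \<and>
    weak_hopf_algebra R D \<and>
    (\<forall>h\<in>carrier H. \<forall>f\<in>carrier (dual R H).
       comult D (double_class R H h f) =
         sweedler R H (tensor R D D) h (\<lambda>h1 h2.
         sweedler R (dual R H) (tensor R D D) f (\<lambda>f1 f2.
           tens R D D (double_class R H h2 f1) (double_class R H h1 f2))) \<and>
       counit D (double_class R H h f) =
         sweedler R H (regular_module R) \<one>\<^bsub>H\<^esub> (\<lambda>a b. f b \<otimes>\<^bsub>R\<^esub> counit H (h \<otimes>\<^bsub>H\<^esub> a)) \<and>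
       antipode D (double_class R H h f) =
         sweedler3 R H D h (\<lambda>h1 h2 h3.
         sweedler3 R (dual R H) D f (\<lambda>f1 f2 f3.
           (f1 (antipode_inv H h3) \<otimes>\<^bsub>R\<^esub> f3 h1) \<odot>\<^bsub>D\<^esub>
             double_class R H (antipode_inv H h2) (antipode (dual R H) f2)))) \<and>
    weak_hopf_iso R D (hopf_op (drinfeld_double' R H)) \<noteq> {}"
proof -
  interpret H: weak_hopf_algebra R H by (rule assms(1))
  \<comment> \<open>Finite generation and projectivity enter the argument through this dual
    basis.\<close>
  obtain I :: "'h set" and e d where "dual_basis R H I e d"
    using projective_dual_basis[OF H.module_axioms assms(3,4)] by blast
  then have "weak_hopf_basis R H I e d"
    using assms(1,2) by (simp add: weak_hopf_basis_def weak_hopf_basis_axioms_def)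
  then show ?thesis by (rule weak_hopf_basis.double_weak_hopf)
qed

end
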